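(* Let $\mathcal{E}$ be an idempotent splitting exact category. The category $\mathrm{C}(\mathcal{E})$ of complexes in $\mathcal{E}$ carries the structure of a saturated additive uni-fractionable category, where $$\mathrm{Den}\,\mathrm{C}(\mathcal{E})=\{f\in\mathrm{Mor}\,\mathrm{C}(\mathcal{E})\mid f\text{ is a quasi-isomorphism}\},$$ $$\mathrm{SDen}\,\mathrm{C}(\mathcal{E})=\{i\in\mathrm{Den}\,\mathrm{C}(\mathcal{E})\mid i\text{ is a pure monomorphism}\}=\{i\in\mathrm{Mor}\,\mathrm{C}(\mathcal{E})\mid i\text{ is a pure monomorphism with }\mathrm{Coker}\,i\text{ purely acyclic}\},$$ $$\mathrm{TDen}\,\mathrm{C}(\mathcal{E})=\{p\in\mathrm{Den}\,\mathrm{C}(\mathcal{E})\mid p\text{ is a pure epimorphism}\}=\{p\in\mathrm{Mor}\,\mathrm{C}(\mathcal{E})\mid p\text{ is a pure epimorphism with }\mathrm{Ker}\,p\text{ purely acyclic}\}.$$ In particular, the derived category $\mathrm{D}(\mathcal{E})$ is isomorphic to $\mathrm{Frac}\,\mathrm{C}(\mathcal{E})$.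
   Context: Exact categories are in the sense of Quillen; the distinguished short exact sequences are called pure short exact sequences, and the monomorphisms/epimorphisms occurring in them are the pure monomorphisms/pure epimorphisms. $\mathcal{E}$ is idempotent splitting if every morphism $e$ in $\mathcal{E}$ with $e^2=e$ splits. $\mathrm{C}(\mathcal{E})$ is an exact category with the degreewise pure short exact sequences as pure short exact sequences. A complex $X$ is purely acyclic if each differential factors as a pure epimorphism $X^n\to Z^{n+1}$ followed by a pure monomorphism $Z^{n+1}\to X^{n+1}$ such that each $Z^n\to X^n\to Z^{n+1}$ is a pure short exact sequence. A morphism of complexes is a quasi-isomorphism if its mapping cone is homotopy equivalent to a purely acyclic complex (for idempotent splitting $\mathcal{E}$: if its mapping cone is purely acyclic). $\mathrm{D}(\mathcal{E})$ is the localisation of the homotopy category of complexes $\mathrm{K}(\mathcal{E})$ at the quasi-isomorphisms. Composition is written diagrammatically: for $f\colon X\to Y$, $g\colon Y\to Z$ the composite is $fg\colon X\to Z$. A category with denominators is a category $\mathcal{C}$ together with a subset $\mathrm{Den}\,\mathcal{C}\subseteq\mathrm{Mor}\,\mathcal{C}$ of denominators. A subset $D\subseteq\mathrm{Mor}\,\mathcal{C}$ is multiplicative if it contains all identities and is closed under composition; it is semi-saturated if it is multiplicative and, for composable $f,g$, whenever two of $f,g,fg$ are in $D$, so is the third. A uni-fractionable category is a category with denominators $\mathcal{C}$ with $\mathrm{Den}\,\mathcal{C}$ semi-saturated, together with multiplicative subsets $\mathrm{SDen}\,\mathcal{C},\mathrm{TDen}\,\mathcal{C}\subseteq\mathrm{Den}\,\mathcal{C}$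 (S-denominators, T-denominators) such that: (WU) for $i\in\mathrm{SDen}\,\mathcal{C}$ and a morphism $f$ with the same source as $i$ there is a weak pushout square $if'=fi'$ of $i$ and $f$ with $i'\in\mathrm{SDen}\,\mathcal{C}$; dually, for $p\in\mathrm{TDen}\,\mathcal{C}$ and a morphism $f$ with the same target as $p$ there is a weak pullback square $f'p=p'f$ of $f$ and $p$ with $p'\in\mathrm{TDen}\,\mathcal{C}$; (Fac) for every $d\in\mathrm{Den}\,\mathcal{C}$ there are $i\in\mathrm{SDen}\,\mathcal{C}$, $p\in\mathrm{TDen}\,\mathcal{C}$ with $d=ip$. (Weak pushout/pullback: universal property without uniqueness.) It is additive if the underlying category is additive and $\mathrm{Den}\,\mathcal{C}$ is closed under finite (direct) sums of morphisms. A $3$-arrow $(b,f,a)\colon X\leftarrow\tilde X\to\tilde Y\leftarrow Y$ in $\mathcal{C}$ consists of denominators $b\colon\tilde X\to X$, $a\colon Y\to\tilde Y$ and a morphism $f\colon\tilde X\to\tilde Y$; its source is $X$, its target is $Y$. Fraction equality is the equivalence relation on $3$-arrows generated by $(b,f,a)\equiv(b,fc,ac)$ for $ac\in\mathrm{Den}\,\mathcal{C}$ and $(b,f,a)\equiv(cb,cf,a)$ for $cb\in\mathrm{Den}\,\mathcal{C}$; the class of $(b,f,a)$ is the double fraction $b\backslash f/a$. The fraction category $\mathrm{Frac}\,\mathcal{C}$ has the objects of $\mathcal{C}$, double fractions as morphisms, identities $1\backslash1/1$, and composition (independent of choices): choose an S-denominator $j$ and a T-denominator $q$ with $b_2a_1=jq$,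 a T-denominator $q'$ and $f_1'$ with $f_1'q=q'f_1$, an S-denominator $j'$ and $f_2'$ with $jf_2'=f_2j'$; then $(b_1\backslash f_1/a_1)(b_2\backslash f_2/a_2)=q'b_1\backslash f_1'f_2'/a_2j'$. It is a localisation of $\mathcal{C}$ with respect to $\mathrm{Den}\,\mathcal{C}$ via $\mathrm{loc}(X)=X$, $\mathrm{loc}(f)=1\backslash f/1$. $\mathcal{C}$ is saturated if every morphism $f$ of $\mathcal{C}$ with $\mathrm{loc}(f)$ invertible is a denominator. *)

theory Defs
  imports "HOL-Algebra.Group"
begin

section \<open>Categories\<close>

text \<open>Composition is diagrammatic: \<open>f \<cdot>\<^bsub>C\<^esub> g\<close> is \<open>f\<close> followed by \<open>g\<close>.  It is only meaningful for
  composable arrows, so every condition below that mentions a composite also asserts composability.\<close>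

record ('o, 'm) cat =
  Obj :: "'o set"
  Arr :: "'m set"
  Dom :: "'m \<Rightarrow> 'o"
  Cod :: "'m \<Rightarrow> 'o"
  Ident :: "'o \<Rightarrow> 'm"
  Comp :: "'m \<Rightarrow> 'm \<Rightarrow> 'm" (infixl "\<cdot>\<index>" 70)

definition Hom :: "('o, 'm, 'z) cat_scheme \<Rightarrow> 'o \<Rightarrow> 'o \<Rightarrow> 'm set" where
  "Hom C X Y = {f \<in> Arr C. Dom C f = X \<and> Cod C f = Y}"

definition composable :: "('o, 'm, 'z) cat_scheme \<Rightarrow> 'm \<Rightarrow> 'm \<Rightarrow> bool" where
  "composable C f g \<longleftrightarrow> f \<in> Arr C \<and> g \<in> Arr C \<and> Cod C f = Dom C g"

definition category :: "('o, 'm, 'z) cat_scheme \<Rightarrow> bool" where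
  "category C \<longleftrightarrow>
     (\<forall>f\<in>Arr C. Dom C f \<in> Obj C \<and> Cod C f \<in> Obj C) \<and>
     (\<forall>X\<in>Obj C. Ident C X \<in> Hom C X X) \<and>
     (\<forall>f g. composable C f g \<longrightarrow> f \<cdot>\<^bsub>C\<^esub> g \<in> Hom C (Dom C f) (Cod C g)) \<and>
     (\<forall>f\<in>Arr C. Ident C (Dom C f) \<cdot>\<^bsub>C\<^esub> f = f \<and> f \<cdot>\<^bsub>C\<^esub> Ident C (Cod C f) = f) \<and>
     (\<forall>f g h. composable C f g \<and> composable C g h \<longrightarrow>
        (f \<cdot>\<^bsub>C\<^esub> g) \<cdot>\<^bsub>C\<^esub> h = f \<cdot>\<^bsub>C\<^esub> (g \<cdot>\<^bsub>C\<^esub> h))"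

definition is_iso :: "('o, 'm, 'z) cat_scheme \<Rightarrow> 'm \<Rightarrow> bool" where
  "is_iso C f \<longleftrightarrow> f \<in> Arr C \<and>
     (\<exists>g\<in>Hom C (Cod C f) (Dom C f). f \<cdot>\<^bsub>C\<^esub> g = Ident C (Dom C f) \<and> g \<cdot>\<^bsub>C\<^esub> f = Ident C (Cod C f))"

definition is_functor ::
  "('o, 'm, 'z) cat_scheme \<Rightarrow> ('p, 'n, 'w) cat_scheme \<Rightarrow> ('o \<Rightarrow> 'p) \<Rightarrow> ('m \<Rightarrow> 'n) \<Rightarrow> bool" where
  "is_functor C D Fo Fm \<longleftrightarrow> category C \<and> category D \<and>
     (\<forall>X\<in>Obj C. Fo X \<in> Obj D \<and> Fm (Ident C X) = Ident D (Fo X)) \<and>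
     (\<forall>f\<in>Arr C. Fm f \<in> Hom D (Fo (Dom C f)) (Fo (Cod C f))) \<and>
     (\<forall>f g. composable C f g \<longrightarrow> Fm (f \<cdot>\<^bsub>C\<^esub> g) = Fm f \<cdot>\<^bsub>D\<^esub> Fm g)"

definition isomorphic_categories ::
  "('o, 'm, 'z) cat_scheme \<Rightarrow> ('p, 'n, 'w) cat_scheme \<Rightarrow> bool" where
  "isomorphic_categories C D \<longleftrightarrow>
     (\<exists>Fo Fm. is_functor C D Fo Fm \<and> bij_betw Fo (Obj C) (Obj D) \<and> bij_betw Fm (Arr C) (Arr D))"

definition commutes :: "('o, 'm, 'z) cat_scheme \<Rightarrow> 'm \<Rightarrow> 'm \<Rightarrow> 'm \<Rightarrow> 'm \<Rightarrow> bool" where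
  "commutes C f g h k \<longleftrightarrow> composable C f g \<and> composable C h k \<and> f \<cdot>\<^bsub>C\<^esub> g = h \<cdot>\<^bsub>C\<^esub> k"

text \<open>In the following four definitions the first two arrows are the given (co)span \<open>i, f\<close>
  (respectively \<open>f, p\<close>); the last two complete it to the square \<open>i f' = f i'\<close> (respectively
  \<open>f' p = p' f\<close>).\<close>

definition weak_pushout :: "('o, 'm, 'z) cat_scheme \<Rightarrow> 'm \<Rightarrow> 'm \<Rightarrow> 'm \<Rightarrow> 'm \<Rightarrow> bool" where
  "weak_pushout C i f f' i' \<longleftrightarrow> commutes C i f' f i' \<and>
     (\<forall>g h. commutes C i g f h \<longrightarrow>
        (\<exists>k\<in>Hom C (Cod C f') (Cod C g). f' \<cdot>\<^bsub>C\<^esub> k = g \<and> i' \<cdot>\<^bsub>C\<^esub> k = h))"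

definition weak_pullback :: "('o, 'm, 'z) cat_scheme \<Rightarrow> 'm \<Rightarrow> 'm \<Rightarrow> 'm \<Rightarrow> 'm \<Rightarrow> bool" where
  "weak_pullback C f p f' p' \<longleftrightarrow> commutes C f' p p' f \<and>
     (\<forall>g h. commutes C g p h f \<longrightarrow>
        (\<exists>k\<in>Hom C (Dom C g) (Dom C f'). k \<cdot>\<^bsub>C\<^esub> f' = g \<and> k \<cdot>\<^bsub>C\<^esub> p' = h))"

definition pushout :: "('o, 'm, 'z) cat_scheme \<Rightarrow> 'm \<Rightarrow> 'm \<Rightarrow> 'm \<Rightarrow> 'm \<Rightarrow> bool" where
  "pushout C i f f' i' \<longleftrightarrow> commutes C i f' f i' \<and>
     (\<forall>g h. commutes C i g f h \<longrightarrow>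
        (\<exists>!k. k \<in> Hom C (Cod C f') (Cod C g) \<and> f' \<cdot>\<^bsub>C\<^esub> k = g \<and> i' \<cdot>\<^bsub>C\<^esub> k = h))"

definition pullback :: "('o, 'm, 'z) cat_scheme \<Rightarrow> 'm \<Rightarrow> 'm \<Rightarrow> 'm \<Rightarrow> 'm \<Rightarrow> bool" where
  "pullback C f p f' p' \<longleftrightarrow> commutes C f' p p' f \<and>
     (\<forall>g h. commutes C g p h f \<longrightarrow>
        (\<exists>!k. k \<in> Hom C (Dom C g) (Dom C f') \<and> k \<cdot>\<^bsub>C\<^esub> f' = g \<and> k \<cdot>\<^bsub>C\<^esub> p' = h))"

definition idempotent_splitting :: "('o, 'm, 'z) cat_scheme \<Rightarrow> bool" where
  "idempotent_splitting C \<longleftrightarrow>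
     (\<forall>X\<in>Obj C. \<forall>e\<in>Hom C X X. e \<cdot>\<^bsub>C\<^esub> e = e \<longrightarrow>
        (\<exists>Y\<in>Obj C. \<exists>r\<in>Hom C X Y. \<exists>s\<in>Hom C Y X. r \<cdot>\<^bsub>C\<^esub> s = e \<and> s \<cdot>\<^bsub>C\<^esub> r = Ident C Y))"

section \<open>Quotient categories and localisation\<close>

definition quot_cat :: "('o, 'm, 'z) cat_scheme \<Rightarrow> ('m \<times> 'm) set \<Rightarrow> ('o, 'm set) cat" where
  "quot_cat C R =
    \<lparr> Obj = Obj C,
      Arr = Arr C // R,
      Dom = (\<lambda>A. THE X. \<exists>f\<in>A. X = Dom C f),
      Cod = (\<lambda>A. THE X. \<exists>f\<in>A. X = Cod C f),
      Ident = (\<lambda>X. R `` {Ident C X}),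
      Comp = (\<lambda>A B. THE F. \<exists>f\<in>A. \<exists>g\<in>B. F = R `` {f \<cdot>\<^bsub>C\<^esub> g}) \<rparr>"

text \<open>The localisation of \<open>C\<close> at \<open>W\<close> is the Gabriel--Zisman category of zigzags: words of arrows of
  \<open>C\<close> (\<open>Fwd\<close>) and formal inverses of arrows in \<open>W\<close> (\<open>Bwd\<close>), modulo the congruence generated by the
  composition of \<open>C\<close>, its identities, and cancellation of arrows in \<open>W\<close> against their formal
  inverses.  End points are recorded because the empty word exists at every object.\<close>

datatype 'm step = Fwd 'm | Bwd 'm

fun zigzag :: "('o, 'm, 'z) cat_scheme \<Rightarrow> 'm set \<Rightarrow> 'o \<Rightarrow> 'm step list \<Rightarrow> 'o \<Rightarrow> bool" where
  "zigzag C W X [] Y \<longleftrightarrow> X \<in> Obj C \<and> X = Y"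
| "zigzag C W X (Fwd f # s) Y \<longleftrightarrow> f \<in> Arr C \<and> Dom C f = X \<and> zigzag C W (Cod C f) s Y"
| "zigzag C W X (Bwd w # s) Y \<longleftrightarrow> w \<in> W \<and> Cod C w = X \<and> zigzag C W (Dom C w) s Y"

definition zigzag_cat ::
  "('o, 'm, 'z) cat_scheme \<Rightarrow> 'm set \<Rightarrow> ('o, 'o \<times> 'm step list \<times> 'o) cat" where
  "zigzag_cat C W =
    \<lparr> Obj = Obj C,
      Arr = {(X, s, Y). zigzag C W X s Y},
      Dom = (\<lambda>(X, s, Y). X),
      Cod = (\<lambda>(X, s, Y). Y),
      Ident = (\<lambda>X. (X, [], X)),
      Comp = (\<lambda>(X, s, Y) (Y', t, Z). (X, s @ t, Z)) \<rparr>"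

inductive zigzag_rule ::
  "('o, 'm, 'z) cat_scheme \<Rightarrow> 'm set \<Rightarrow> 'm step list \<Rightarrow> 'm step list \<Rightarrow> bool" for C W where
  "composable C f g \<Longrightarrow> zigzag_rule C W [Fwd f, Fwd g] [Fwd (f \<cdot>\<^bsub>C\<^esub> g)]"
| "X \<in> Obj C \<Longrightarrow> zigzag_rule C W [Fwd (Ident C X)] []"
| "w \<in> W \<Longrightarrow> zigzag_rule C W [Fwd w, Bwd w] []"
| "w \<in> W \<Longrightarrow> zigzag_rule C W [Bwd w, Fwd w] []"

inductive_set zigzag_eq ::
  "('o, 'm, 'z) cat_scheme \<Rightarrow> 'm set \<Rightarrow>
   (('o \<times> 'm step list \<times> 'o) \<times> ('o \<times> 'm step list \<times> 'o)) set" for C W where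
  rule: "\<lbrakk>zigzag_rule C W u v; zigzag C W X (l @ u @ r) Y; zigzag C W X (l @ v @ r) Y\<rbrakk>
     \<Longrightarrow> ((X, l @ u @ r, Y), (X, l @ v @ r, Y)) \<in> zigzag_eq C W"
| refl: "zigzag C W X s Y \<Longrightarrow> ((X, s, Y), (X, s, Y)) \<in> zigzag_eq C W"
| sym: "(x, y) \<in> zigzag_eq C W \<Longrightarrow> (y, x) \<in> zigzag_eq C W"
| trans: "\<lbrakk>(x, y) \<in> zigzag_eq C W; (y, z) \<in> zigzag_eq C W\<rbrakk> \<Longrightarrow> (x, z) \<in> zigzag_eq C W"

definition localisation ::
  "('o, 'm, 'z) cat_scheme \<Rightarrow> 'm set \<Rightarrow> ('o, ('o \<times> 'm step list \<times> 'o) set) cat" where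
  "localisation C W = quot_cat (zigzag_cat C W) (zigzag_eq C W)"

section \<open>Additive and exact categories\<close>

record ('o, 'm) preadditive_cat = "('o, 'm) cat" +
  Add :: "'m \<Rightarrow> 'm \<Rightarrow> 'm" (infixl "\<boxplus>\<index>" 65)
  Zero :: "'o \<Rightarrow> 'o \<Rightarrow> 'm"

definition hom_group :: "('o, 'm, 'z) preadditive_cat_scheme \<Rightarrow> 'o \<Rightarrow> 'o \<Rightarrow> 'm monoid" where
  "hom_group C X Y = \<lparr> carrier = Hom C X Y, mult = Add C, one = Zero C X Y \<rparr>"

definition Neg :: "('o, 'm, 'z) preadditive_cat_scheme \<Rightarrow> 'm \<Rightarrow> 'm" where
  "Neg C f = inv\<^bsub>hom_group C (Dom C f) (Cod C f)\<^esub> f"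

definition preadditive_category :: "('o, 'm, 'z) preadditive_cat_scheme \<Rightarrow> bool" where
  "preadditive_category C \<longleftrightarrow> category C \<and>
     (\<forall>X\<in>Obj C. \<forall>Y\<in>Obj C. comm_group (hom_group C X Y)) \<and>
     (\<forall>X\<in>Obj C. \<forall>Y\<in>Obj C. \<forall>Z\<in>Obj C. \<forall>f\<in>Hom C X Y. \<forall>f'\<in>Hom C X Y. \<forall>g\<in>Hom C Y Z. \<forall>g'\<in>Hom C Y Z.
        (f \<boxplus>\<^bsub>C\<^esub> f') \<cdot>\<^bsub>C\<^esub> g = f \<cdot>\<^bsub>C\<^esub> g \<boxplus>\<^bsub>C\<^esub> f' \<cdot>\<^bsub>C\<^esub> g \<and>
        f \<cdot>\<^bsub>C\<^esub> (g \<boxplus>\<^bsub>C\<^esub> g') = f \<cdot>\<^bsub>C\<^esub> g \<boxplus>\<^bsub>C\<^esub> f \<cdot>\<^bsub>C\<^esub> g')"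

definition zero_object :: "('o, 'm, 'z) cat_scheme \<Rightarrow> 'o \<Rightarrow> bool" where
  "zero_object C Z \<longleftrightarrow> Z \<in> Obj C \<and>
     (\<forall>X\<in>Obj C. (\<exists>!f. f \<in> Hom C X Z) \<and> (\<exists>!f. f \<in> Hom C Z X))"

definition biproduct ::
  "('o, 'm, 'z) preadditive_cat_scheme \<Rightarrow> 'o \<Rightarrow> 'o \<Rightarrow> 'o \<Rightarrow> 'm \<Rightarrow> 'm \<Rightarrow> 'm \<Rightarrow> 'm \<Rightarrow> bool" where
  "biproduct C X Y S i1 i2 p1 p2 \<longleftrightarrow>
     X \<in> Obj C \<and> Y \<in> Obj C \<and> S \<in> Obj C \<and>
     i1 \<in> Hom C X S \<and> i2 \<in> Hom C Y S \<and> p1 \<in> Hom C S X \<and> p2 \<in> Hom C S Y \<and>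
     i1 \<cdot>\<^bsub>C\<^esub> p1 = Ident C X \<and> i2 \<cdot>\<^bsub>C\<^esub> p2 = Ident C Y \<and>
     i1 \<cdot>\<^bsub>C\<^esub> p2 = Zero C X Y \<and> i2 \<cdot>\<^bsub>C\<^esub> p1 = Zero C Y X \<and>
     p1 \<cdot>\<^bsub>C\<^esub> i1 \<boxplus>\<^bsub>C\<^esub> p2 \<cdot>\<^bsub>C\<^esub> i2 = Ident C S"

definition additive_category :: "('o, 'm, 'z) preadditive_cat_scheme \<Rightarrow> bool" where
  "additive_category C \<longleftrightarrow> preadditive_category C \<and>
     (\<exists>Z. zero_object C Z) \<and>
     (\<forall>X\<in>Obj C. \<forall>Y\<in>Obj C. \<exists>S i1 i2 p1 p2. biproduct C X Y S i1 i2 p1 p2)"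

definition is_kernel :: "('o, 'm, 'z) preadditive_cat_scheme \<Rightarrow> 'm \<Rightarrow> 'm \<Rightarrow> bool" where
  "is_kernel C f k \<longleftrightarrow> composable C k f \<and> k \<cdot>\<^bsub>C\<^esub> f = Zero C (Dom C k) (Cod C f) \<and>
     (\<forall>g. composable C g f \<and> g \<cdot>\<^bsub>C\<^esub> f = Zero C (Dom C g) (Cod C f) \<longrightarrow>
        (\<exists>!u. u \<in> Hom C (Dom C g) (Dom C k) \<and> u \<cdot>\<^bsub>C\<^esub> k = g))"

definition is_cokernel :: "('o, 'm, 'z) preadditive_cat_scheme \<Rightarrow> 'm \<Rightarrow> 'm \<Rightarrow> bool" where
  "is_cokernel C f c \<longleftrightarrow> composable C f c \<and> f \<cdot>\<^bsub>C\<^esub> c = Zero C (Dom C f) (Cod C c) \<and>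
     (\<forall>g. composable C f g \<and> f \<cdot>\<^bsub>C\<^esub> g = Zero C (Dom C f) (Cod C g) \<longrightarrow>
        (\<exists>!u. u \<in> Hom C (Cod C c) (Cod C g) \<and> c \<cdot>\<^bsub>C\<^esub> u = g))"

text \<open>\<open>(i, p) \<in> Pure_Seq C\<close> means that \<open>i\<close> followed by \<open>p\<close> is a pure short exact sequence.\<close>

record ('o, 'm) exact_cat = "('o, 'm) preadditive_cat" +
  Pure_Seq :: "('m \<times> 'm) set"

definition pure_mono :: "('o, 'm, 'z) exact_cat_scheme \<Rightarrow> 'm \<Rightarrow> bool" where
  "pure_mono C i \<longleftrightarrow> (\<exists>p. (i, p) \<in> Pure_Seq C)"

definition pure_epi :: "('o, 'm, 'z) exact_cat_scheme \<Rightarrow> 'm \<Rightarrow> bool" where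
  "pure_epi C p \<longleftrightarrow> (\<exists>i. (i, p) \<in> Pure_Seq C)"

text \<open>Quillen's original axioms.  The last two clauses (his axiom c) are known to follow from the
  others (Keller).\<close>

definition exact_category :: "('o, 'm, 'z) exact_cat_scheme \<Rightarrow> bool" where
  "exact_category C \<longleftrightarrow> additive_category C \<and>
     \<comment> \<open>pure sequences are kernel-cokernel pairs, include the split ones, and are closed under
         isomorphism\<close>
     (\<forall>(i, p)\<in>Pure_Seq C. is_kernel C p i \<and> is_cokernel C i p) \<and>
     (\<forall>X Y S i1 i2 p1 p2. biproduct C X Y S i1 i2 p1 p2 \<longrightarrow> (i1, p2) \<in> Pure_Seq C) \<and>
     (\<forall>i p i' p' a b c. (i, p) \<in> Pure_Seq C \<and> is_iso C a \<and> is_iso C b \<and> is_iso C c \<and>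
        composable C i' p' \<and> commutes C i b a i' \<and> commutes C p c b p' \<longrightarrow> (i', p') \<in> Pure_Seq C) \<and>
     \<comment> \<open>composition, base change and cobase change\<close>
     (\<forall>p q. pure_epi C p \<and> pure_epi C q \<and> composable C p q \<longrightarrow> pure_epi C (p \<cdot>\<^bsub>C\<^esub> q)) \<and>
     (\<forall>i j. pure_mono C i \<and> pure_mono C j \<and> composable C i j \<longrightarrow> pure_mono C (i \<cdot>\<^bsub>C\<^esub> j)) \<and>
     (\<forall>p f. pure_epi C p \<and> f \<in> Arr C \<and> Cod C f = Cod C p \<longrightarrow>
        (\<exists>f' p'. pullback C f p f' p' \<and> pure_epi C p')) \<and>
     (\<forall>i f. pure_mono C i \<and> f \<in> Arr C \<and> Dom C f = Dom C i \<longrightarrow>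
        (\<exists>f' i'. pushout C i f f' i' \<and> pure_mono C i')) \<and>
     \<comment> \<open>axiom c\<close>
     (\<forall>f g. composable C g f \<and> (\<exists>k. is_kernel C f k) \<and> pure_epi C (g \<cdot>\<^bsub>C\<^esub> f) \<longrightarrow> pure_epi C f) \<and>
     (\<forall>f g. composable C f g \<and> (\<exists>c. is_cokernel C f c) \<and> pure_mono C (f \<cdot>\<^bsub>C\<^esub> g) \<longrightarrow> pure_mono C f)"

section \<open>Complexes, homotopy category, derived category\<close>

datatype ('o, 'm) cx = Cx (ob: "int \<Rightarrow> 'o") (diff: "int \<Rightarrow> 'm")

datatype ('o, 'm) chain_map =
  Chain_Map (src: "('o, 'm) cx") (tgt: "('o, 'm) cx") (cmp: "int \<Rightarrow> 'm")

definition is_complex :: "('o, 'm, 'z) preadditive_cat_scheme \<Rightarrow> ('o, 'm) cx \<Rightarrow> bool" where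
  "is_complex E X \<longleftrightarrow>
     (\<forall>n. ob X n \<in> Obj E \<and> diff X n \<in> Hom E (ob X n) (ob X (n + 1)) \<and>
        diff X n \<cdot>\<^bsub>E\<^esub> diff X (n + 1) = Zero E (ob X n) (ob X (n + 2)))"

definition is_chain_map :: "('o, 'm, 'z) preadditive_cat_scheme \<Rightarrow> ('o, 'm) chain_map \<Rightarrow> bool" where
  "is_chain_map E f \<longleftrightarrow> is_complex E (src f) \<and> is_complex E (tgt f) \<and>
     (\<forall>n. cmp f n \<in> Hom E (ob (src f) n) (ob (tgt f) n) \<and>
        diff (src f) n \<cdot>\<^bsub>E\<^esub> cmp f (n + 1) = cmp f n \<cdot>\<^bsub>E\<^esub> diff (tgt f) n)"

definition complexes ::
  "('o, 'm, 'z) exact_cat_scheme \<Rightarrow> (('o, 'm) cx, ('o, 'm) chain_map) exact_cat" where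
  "complexes E =
    \<lparr> Obj = {X. is_complex E X},
      Arr = {f. is_chain_map E f},
      Dom = src,
      Cod = tgt,
      Ident = (\<lambda>X. Chain_Map X X (\<lambda>n. Ident E (ob X n))),
      Comp = (\<lambda>f g. Chain_Map (src f) (tgt g) (\<lambda>n. cmp f n \<cdot>\<^bsub>E\<^esub> cmp g n)),
      Add = (\<lambda>f g. Chain_Map (src f) (tgt f) (\<lambda>n. cmp f n \<boxplus>\<^bsub>E\<^esub> cmp g n)),
      Zero = (\<lambda>X Y. Chain_Map X Y (\<lambda>n. Zero E (ob X n) (ob Y n))),
      Pure_Seq = {(i, p). is_chain_map E i \<and> is_chain_map E p \<and> tgt i = src p \<and>
                (\<forall>n. (cmp i n, cmp p n) \<in> Pure_Seq E)} \<rparr>"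

definition homotopic ::
  "('o, 'm, 'z) exact_cat_scheme \<Rightarrow> (('o, 'm) chain_map \<times> ('o, 'm) chain_map) set" where
  "homotopic E = {(f, g). is_chain_map E f \<and> is_chain_map E g \<and> src f = src g \<and> tgt f = tgt g \<and>
     (\<exists>h. \<forall>n. h n \<in> Hom E (ob (src f) n) (ob (tgt f) (n - 1)) \<and>
        cmp f n = cmp g n \<boxplus>\<^bsub>E\<^esub> (diff (src f) n \<cdot>\<^bsub>E\<^esub> h (n + 1) \<boxplus>\<^bsub>E\<^esub> h n \<cdot>\<^bsub>E\<^esub> diff (tgt f) (n - 1)))}"

definition homotopy_cat ::
  "('o, 'm, 'z) exact_cat_scheme \<Rightarrow> (('o, 'm) cx, ('o, 'm) chain_map set) cat" where
  "homotopy_cat E = quot_cat (complexes E) (homotopic E)"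

definition homotopy_equivalent ::
  "('o, 'm, 'z) exact_cat_scheme \<Rightarrow> ('o, 'm) cx \<Rightarrow> ('o, 'm) cx \<Rightarrow> bool" where
  "homotopy_equivalent E X Y \<longleftrightarrow>
     (\<exists>u\<in>Hom (complexes E) X Y. \<exists>v\<in>Hom (complexes E) Y X.
        (u \<cdot>\<^bsub>complexes E\<^esub> v, Ident (complexes E) X) \<in> homotopic E \<and>
        (v \<cdot>\<^bsub>complexes E\<^esub> u, Ident (complexes E) Y) \<in> homotopic E)"

definition purely_acyclic :: "('o, 'm, 'z) exact_cat_scheme \<Rightarrow> ('o, 'm) cx \<Rightarrow> bool" where
  "purely_acyclic E X \<longleftrightarrow> is_complex E X \<and>
     (\<exists>Z p i. \<forall>n. p n \<in> Hom E (ob X n) (Z (n + 1)) \<and> i n \<in> Hom E (Z n) (ob X n) \<and>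
        diff X n = p n \<cdot>\<^bsub>E\<^esub> i (n + 1) \<and> (i n, p n) \<in> Pure_Seq E)"

text \<open>\<open>K\<close> is a mapping cone of \<open>f: X \<rightarrow> Y\<close>: \<open>K^n = X^(n+1) \<oplus> Y^n\<close>, with the
  direct sums chosen arbitrarily.\<close>

definition mapping_cone ::
  "('o, 'm, 'z) exact_cat_scheme \<Rightarrow> ('o, 'm) chain_map \<Rightarrow> ('o, 'm) cx \<Rightarrow> bool" where
  "mapping_cone E f K \<longleftrightarrow>
     (\<exists>i1 i2 p1 p2. \<forall>n.
        biproduct E (ob (src f) (n + 1)) (ob (tgt f) n) (ob K n) (i1 n) (i2 n) (p1 n) (p2 n) \<and>
        diff K n = p1 n \<cdot>\<^bsub>E\<^esub> Neg E (diff (src f) (n + 1)) \<cdot>\<^bsub>E\<^esub> i1 (n + 1)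
          \<boxplus>\<^bsub>E\<^esub> p1 n \<cdot>\<^bsub>E\<^esub> cmp f (n + 1) \<cdot>\<^bsub>E\<^esub> i2 (n + 1)
          \<boxplus>\<^bsub>E\<^esub> p2 n \<cdot>\<^bsub>E\<^esub> diff (tgt f) n \<cdot>\<^bsub>E\<^esub> i2 (n + 1))"

definition quasi_iso :: "('o, 'm, 'z) exact_cat_scheme \<Rightarrow> ('o, 'm) chain_map \<Rightarrow> bool" where
  "quasi_iso E f \<longleftrightarrow> is_chain_map E f \<and>
     (\<exists>K A. mapping_cone E f K \<and> purely_acyclic E A \<and> homotopy_equivalent E K A)"

definition derived_cat ::
  "('o, 'm, 'z) exact_cat_scheme \<Rightarrow>
   (('o, 'm) cx, (('o, 'm) cx \<times> ('o, 'm) chain_map set step list \<times> ('o, 'm) cx) set) cat" where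
  "derived_cat E = localisation (homotopy_cat E) {homotopic E `` {f} |f. quasi_iso E f}"

section \<open>Uni-fractionable categories\<close>

definition multiplicative :: "('o, 'm, 'z) cat_scheme \<Rightarrow> 'm set \<Rightarrow> bool" where
  "multiplicative C D \<longleftrightarrow> D \<subseteq> Arr C \<and> (\<forall>X\<in>Obj C. Ident C X \<in> D) \<and>
     (\<forall>f g. composable C f g \<and> f \<in> D \<and> g \<in> D \<longrightarrow> f \<cdot>\<^bsub>C\<^esub> g \<in> D)"

definition semi_saturated :: "('o, 'm, 'z) cat_scheme \<Rightarrow> 'm set \<Rightarrow> bool" where
  "semi_saturated C D \<longleftrightarrow> multiplicative C D \<and>
     (\<forall>f g. composable C f g \<and> f \<in> D \<and> f \<cdot>\<^bsub>C\<^esub> g \<in> D \<longrightarrow> g \<in> D) \<and>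
     (\<forall>f g. composable C f g \<and> g \<in> D \<and> f \<cdot>\<^bsub>C\<^esub> g \<in> D \<longrightarrow> f \<in> D)"

text \<open>\<open>D\<close>, \<open>S\<close>, \<open>T\<close> are the sets of denominators, S-denominators and T-denominators.\<close>

definition uni_fractionable ::
  "('o, 'm, 'z) cat_scheme \<Rightarrow> 'm set \<Rightarrow> 'm set \<Rightarrow> 'm set \<Rightarrow> bool" where
  "uni_fractionable C D S T \<longleftrightarrow> category C \<and> semi_saturated C D \<and>
     multiplicative C S \<and> S \<subseteq> D \<and> multiplicative C T \<and> T \<subseteq> D \<and>
     (\<forall>i\<in>S. \<forall>f\<in>Arr C. Dom C f = Dom C i \<longrightarrow> (\<exists>f' i'. weak_pushout C i f f' i' \<and> i' \<in> S)) \<and>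
     (\<forall>p\<in>T. \<forall>f\<in>Arr C. Cod C f = Cod C p \<longrightarrow> (\<exists>f' p'. weak_pullback C f p f' p' \<and> p' \<in> T)) \<and>
     (\<forall>d\<in>D. \<exists>i\<in>S. \<exists>p\<in>T. composable C i p \<and> d = i \<cdot>\<^bsub>C\<^esub> p)"

text \<open>Closure under finite direct sums of morphisms, for every choice of the direct sums: the
  empty sums are the arrows between zero objects.\<close>

definition closed_under_finite_sums :: "('o, 'm, 'z) preadditive_cat_scheme \<Rightarrow> 'm set \<Rightarrow> bool" where
  "closed_under_finite_sums C D \<longleftrightarrow>
     (\<forall>Z Z'. zero_object C Z \<and> zero_object C Z' \<longrightarrow> Zero C Z Z' \<in> D) \<and>
     (\<forall>f g A i1 i2 p1 p2 B j1 j2 q1 q2. f \<in> D \<and> g \<in> D \<and>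
        biproduct C (Dom C f) (Dom C g) A i1 i2 p1 p2 \<and>
        biproduct C (Cod C f) (Cod C g) B j1 j2 q1 q2 \<longrightarrow>
        p1 \<cdot>\<^bsub>C\<^esub> f \<cdot>\<^bsub>C\<^esub> j1 \<boxplus>\<^bsub>C\<^esub> p2 \<cdot>\<^bsub>C\<^esub> g \<cdot>\<^bsub>C\<^esub> j2 \<in> D)"

definition additive_uni_fractionable ::
  "('o, 'm, 'z) preadditive_cat_scheme \<Rightarrow> 'm set \<Rightarrow> 'm set \<Rightarrow> 'm set \<Rightarrow> bool" where
  "additive_uni_fractionable C D S T \<longleftrightarrow>
     uni_fractionable C D S T \<and> additive_category C \<and> closed_under_finite_sums C D"

definition three_arrows :: "('o, 'm, 'z) cat_scheme \<Rightarrow> 'm set \<Rightarrow> ('m \<times> 'm \<times> 'm) set" where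
  "three_arrows C D =
     {(b, f, a). b \<in> D \<and> f \<in> Arr C \<and> a \<in> D \<and> Dom C b = Dom C f \<and> Cod C f = Cod C a}"

inductive_set fraction_eq ::
  "('o, 'm, 'z) cat_scheme \<Rightarrow> 'm set \<Rightarrow> (('m \<times> 'm \<times> 'm) \<times> ('m \<times> 'm \<times> 'm)) set" for C D where
  right: "\<lbrakk>(b, f, a) \<in> three_arrows C D; composable C a c; a \<cdot>\<^bsub>C\<^esub> c \<in> D\<rbrakk>
     \<Longrightarrow> ((b, f, a), (b, f \<cdot>\<^bsub>C\<^esub> c, a \<cdot>\<^bsub>C\<^esub> c)) \<in> fraction_eq C D"
| left: "\<lbrakk>(b, f, a) \<in> three_arrows C D; composable C c b; c \<cdot>\<^bsub>C\<^esub> b \<in> D\<rbrakk>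
     \<Longrightarrow> ((b, f, a), (c \<cdot>\<^bsub>C\<^esub> b, c \<cdot>\<^bsub>C\<^esub> f, a)) \<in> fraction_eq C D"
| refl: "x \<in> three_arrows C D \<Longrightarrow> (x, x) \<in> fraction_eq C D"
| sym: "(x, y) \<in> fraction_eq C D \<Longrightarrow> (y, x) \<in> fraction_eq C D"
| trans: "\<lbrakk>(x, y) \<in> fraction_eq C D; (y, z) \<in> fraction_eq C D\<rbrakk> \<Longrightarrow> (x, z) \<in> fraction_eq C D"

definition double_fraction ::
  "('o, 'm, 'z) cat_scheme \<Rightarrow> 'm set \<Rightarrow> 'm \<Rightarrow> 'm \<Rightarrow> 'm \<Rightarrow> ('m \<times> 'm \<times> 'm) set" where
  "double_fraction C D b f a = fraction_eq C D `` {(b, f, a)}"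

text \<open>\<open>fraction_comp_rel C D S T A A' F\<close>: \<open>F\<close> is a composite of the double fractions \<open>A\<close> and \<open>A'\<close>,
  for some choice of representatives and auxiliary arrows.\<close>

definition fraction_comp_rel ::
  "('o, 'm, 'z) cat_scheme \<Rightarrow> 'm set \<Rightarrow> 'm set \<Rightarrow> 'm set \<Rightarrow>
   ('m \<times> 'm \<times> 'm) set \<Rightarrow> ('m \<times> 'm \<times> 'm) set \<Rightarrow> ('m \<times> 'm \<times> 'm) set \<Rightarrow> bool" where
  "fraction_comp_rel C D S T A A' F \<longleftrightarrow>
     (\<exists>b1 f1 a1 b2 f2 a2 j q q' f1' j' f2'.
        (b1, f1, a1) \<in> A \<and> (b2, f2, a2) \<in> A' \<and>
        j \<in> S \<and> q \<in> T \<and> commutes C b2 a1 j q \<and>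
        q' \<in> T \<and> commutes C f1' q q' f1 \<and>
        j' \<in> S \<and> commutes C j f2' f2 j' \<and>
        F = double_fraction C D (q' \<cdot>\<^bsub>C\<^esub> b1) (f1' \<cdot>\<^bsub>C\<^esub> f2') (a2 \<cdot>\<^bsub>C\<^esub> j'))"

definition Frac ::
  "('o, 'm, 'z) cat_scheme \<Rightarrow> 'm set \<Rightarrow> 'm set \<Rightarrow> 'm set \<Rightarrow> ('o, ('m \<times> 'm \<times> 'm) set) cat" where
  "Frac C D S T =
    \<lparr> Obj = Obj C,
      Arr = three_arrows C D // fraction_eq C D,
      Dom = (\<lambda>A. THE X. \<exists>(b, f, a)\<in>A. X = Cod C b),
      Cod = (\<lambda>A. THE Y. \<exists>(b, f, a)\<in>A. Y = Dom C a),
      Ident = (\<lambda>X. double_fraction C D (Ident C X) (Ident C X) (Ident C X)),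
      Comp = (\<lambda>A A'. THE F. fraction_comp_rel C D S T A A' F) \<rparr>"

definition loc :: "('o, 'm, 'z) cat_scheme \<Rightarrow> 'm set \<Rightarrow> 'm \<Rightarrow> ('m \<times> 'm \<times> 'm) set" where
  "loc C D f = double_fraction C D (Ident C (Dom C f)) f (Ident C (Cod C f))"

definition saturated ::
  "('o, 'm, 'z) cat_scheme \<Rightarrow> 'm set \<Rightarrow> 'm set \<Rightarrow> 'm set \<Rightarrow> bool" where
  "saturated C D S T \<longleftrightarrow> (\<forall>f\<in>Arr C. is_iso (Frac C D S T) (loc C D f) \<longrightarrow> f \<in> D)"

section \<open>The denominators of the category of complexes\<close>

definition Den :: "('o, 'm, 'z) exact_cat_scheme \<Rightarrow> ('o, 'm) chain_map set" where
  "Den E = {f \<in> Arr (complexes E). quasi_iso E f}"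

definition SDen :: "('o, 'm, 'z) exact_cat_scheme \<Rightarrow> ('o, 'm) chain_map set" where
  "SDen E = {i \<in> Den E. pure_mono (complexes E) i}"

definition TDen :: "('o, 'm, 'z) exact_cat_scheme \<Rightarrow> ('o, 'm) chain_map set" where
  "TDen E = {p \<in> Den E. pure_epi (complexes E) p}"

end

(* A chain map f: X -> Y is the composite of the pure monomorphism X -> Y + I, where I is the cone
   of the identity of X, and the projection Y + I -> Y; the cokernel of the former is the cone of f.
   So the quasi-isomorphisms are the composites of pure monomorphisms with acyclic cokernel and pure
   epimorphisms with acyclic kernel, and the uni-fractionable structure follows formally from the
   closure properties of the class of acyclic complexes: two out of three in pure short exact
   sequences, retracts, and enough acyclic complexes to embed into.

   Null-homotopic maps factor through acyclic complexes, hence vanish in Frac.  Therefore inverting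
   the quasi-isomorphisms already identifies homotopic maps, and the derived category, a localisation
   of the homotopy category, is also the localisation of the category of complexes, which is Frac. *)

theory Submission
  imports Defs
begin

section \<open>Categories, quotients and zigzags\<close>

text \<open>The composition of \<open>Frac\<close> is a definite description, so that it is defined,
  independent of choices and associative has to be proved. All of this comes from a comparison with
  zigzags: a 3-arrow names the element "inverse of \<open>b\<close>, then \<open>f\<close>, then
  inverse of \<open>a\<close>" of the localisation, and every admissible composite names the
  product. The point is that distinct double fractions name distinct elements. For this, words act
  on 3-arrows by right multiplication; words that are equal in the localisation act alike up to
  fraction equality, and the word of a 3-arrow carries the identity to that 3-arrow.

  Acyclicity of complexes meets another obstacle: a general arrow of an exact category has neither
  kernel nor image. It is therefore divided into a local exactness condition, which can be chased as
  in an abelian category, and the existence of kernels of the differentials, which are constructed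
  anew each time. The splitting of idempotents in \<open>E\<close> produces kernels in two places:
  it removes the kernel hypothesis from axiom c, and it lets acyclicity pass to homotopy
  retracts.\<close>

locale category_loc =
  fixes C :: "('o, 'm, 'z) cat_scheme" (structure)
  assumes category: "category C"
begin

lemma dom_obj [simp]: "f \<in> Arr C \<Longrightarrow> Dom C f \<in> Obj C"
  and cod_obj [simp]: "f \<in> Arr C \<Longrightarrow> Cod C f \<in> Obj C"
  using category by (auto simp: category_def)

lemma id_arr [simp]:
  assumes "X \<in> Obj C"
  shows "Ident C X \<in> Arr C" "Dom C (Ident C X) = X" "Cod C (Ident C X) = X"
  using category assms by (auto simp: category_def Hom_def)

lemma comp_arr [simp]:
  assumes "f \<in> Arr C" "g \<in> Arr C" "Cod C f = Dom C g"
  shows "f \<cdot> g \<in> Arr C" "Dom C (f \<cdot> g) = Dom C f" "Cod C (f \<cdot> g) = Cod C g"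
  using category assms unfolding category_def composable_def Hom_def by blast+

lemma id_comp [simp]: "\<lbrakk>f \<in> Arr C; Dom C f = X\<rbrakk> \<Longrightarrow> Ident C X \<cdot> f = f"
  and comp_id [simp]: "\<lbrakk>f \<in> Arr C; Cod C f = X\<rbrakk> \<Longrightarrow> f \<cdot> Ident C X = f"
  using category by (auto simp: category_def)

lemma comp_assoc [simp]:
  "\<lbrakk>f \<in> Arr C; g \<in> Arr C; h \<in> Arr C; Cod C f = Dom C g; Cod C g = Dom C h\<rbrakk>
    \<Longrightarrow> (f \<cdot> g) \<cdot> h = f \<cdot> (g \<cdot> h)"
  using category by (auto simp: category_def composable_def)

lemma comp_reduce:
  "\<lbrakk>f \<cdot> g = h; f \<in> Arr C; g \<in> Arr C; k \<in> Arr C; Cod C f = Dom C g; Cod C g = Dom C k\<rbrakk>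
    \<Longrightarrow> f \<cdot> (g \<cdot> k) = h \<cdot> k"
  using comp_assoc by metis

lemma commutesD:
  assumes "commutes C f g h k"
  shows "f \<in> Arr C" "g \<in> Arr C" "h \<in> Arr C" "k \<in> Arr C" "Cod C f = Dom C g" "Cod C h = Dom C k"
    "Dom C f = Dom C h" "Cod C g = Cod C k" "f \<cdot> g = h \<cdot> k"
proof -
  show *: "f \<in> Arr C" "g \<in> Arr C" "h \<in> Arr C" "k \<in> Arr C" "Cod C f = Dom C g" "Cod C h = Dom C k"
    and e: "f \<cdot> g = h \<cdot> k"
    using assms by (auto simp: commutes_def composable_def)
  show "Dom C f = Dom C h" "Cod C g = Cod C k"
    using comp_arr[OF *(1,2,5)] comp_arr[OF *(3,4,6)] e by simp_all
qed

lemma is_isoI: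
  "\<lbrakk>f \<in> Arr C; g \<in> Arr C; Dom C g = Cod C f; Cod C g = Dom C f; f \<cdot> g = Ident C (Dom C f);
    g \<cdot> f = Ident C (Cod C f)\<rbrakk> \<Longrightarrow> is_iso C f"
  by (auto simp: is_iso_def Hom_def)

lemma is_isoE:
  assumes "is_iso C f"
  obtains g where "f \<in> Arr C" "g \<in> Arr C" "Dom C g = Cod C f" "Cod C g = Dom C f"
    "f \<cdot> g = Ident C (Dom C f)" "g \<cdot> f = Ident C (Cod C f)"
  using assms by (auto simp: is_iso_def Hom_def)

end

lemma categoryI:
  assumes "\<And>f. f \<in> Arr C \<Longrightarrow> Dom C f \<in> Obj C \<and> Cod C f \<in> Obj C"
    and "\<And>X. X \<in> Obj C \<Longrightarrow> Ident C X \<in> Arr C \<and> Dom C (Ident C X) = X \<and> Cod C (Ident C X) = X"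
    and "\<And>f g. \<lbrakk>f \<in> Arr C; g \<in> Arr C; Cod C f = Dom C g\<rbrakk> \<Longrightarrow>
      f \<cdot>\<^bsub>C\<^esub> g \<in> Arr C \<and> Dom C (f \<cdot>\<^bsub>C\<^esub> g) = Dom C f \<and> Cod C (f \<cdot>\<^bsub>C\<^esub> g) = Cod C g"
    and "\<And>f. f \<in> Arr C \<Longrightarrow> Ident C (Dom C f) \<cdot>\<^bsub>C\<^esub> f = f \<and> f \<cdot>\<^bsub>C\<^esub> Ident C (Cod C f) = f"
    and "\<And>f g h. \<lbrakk>f \<in> Arr C; g \<in> Arr C; h \<in> Arr C; Cod C f = Dom C g; Cod C g = Dom C h\<rbrakk> \<Longrightarrow>
      (f \<cdot>\<^bsub>C\<^esub> g) \<cdot>\<^bsub>C\<^esub> h = f \<cdot>\<^bsub>C\<^esub> (g \<cdot>\<^bsub>C\<^esub> h)"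
  shows "category C"
  unfolding category_def Hom_def composable_def using assms by auto

section \<open>Quotient of a category by a congruence\<close>

definition cat_congruence :: "('o, 'm, 'z) cat_scheme \<Rightarrow> ('m \<times> 'm) set \<Rightarrow> bool" where
  "cat_congruence C R \<longleftrightarrow> equiv (Arr C) R \<and>
     (\<forall>(f, g)\<in>R. Dom C f = Dom C g \<and> Cod C f = Cod C g) \<and>
     (\<forall>(f, f')\<in>R. \<forall>(g, g')\<in>R. Cod C f = Dom C g \<longrightarrow> (f \<cdot>\<^bsub>C\<^esub> g, f' \<cdot>\<^bsub>C\<^esub> g') \<in> R)"

locale quotient_loc = category_loc C for C :: "('o, 'm, 'z) cat_scheme" (structure) +
  fixes R :: "('m \<times> 'm) set"
  assumes congruence: "cat_congruence C R"
begin

lemma equiv: "equiv (Arr C) R"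
  using congruence by (simp add: cat_congruence_def)

lemma R_arr: "(f, g) \<in> R \<Longrightarrow> f \<in> Arr C \<and> g \<in> Arr C \<and> Dom C f = Dom C g \<and> Cod C f = Cod C g"
  using congruence equiv_type[OF equiv] by (auto simp: cat_congruence_def)

lemma R_refl: "f \<in> Arr C \<Longrightarrow> (f, f) \<in> R"
  using equiv by (simp add: equiv_def refl_on_def)

lemma R_comp: "\<lbrakk>(f, f') \<in> R; (g, g') \<in> R; Cod C f = Dom C g\<rbrakk> \<Longrightarrow> (f \<cdot> g, f' \<cdot> g') \<in> R"
  using congruence by (auto simp: cat_congruence_def)

lemma class_eq: "(f, g) \<in> R \<Longrightarrow> R `` {f} = R `` {g}"
  by (rule equiv_class_eq[OF equiv])

lemma class_eq_iff: "f \<in> Arr C \<Longrightarrow> g \<in> Arr C \<Longrightarrow> R `` {f} = R `` {g} \<longleftrightarrow> (f, g) \<in> R"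
  using eq_equiv_class_iff[OF equiv] by blast

lemma quot_simps [simp]:
  shows "Obj (quot_cat C R) = Obj C"
    and "Arr (quot_cat C R) = Arr C // R"
    and "Ident (quot_cat C R) X = R `` {Ident C X}"
  by (simp_all add: quot_cat_def)

lemma quot_arrE:
  assumes "A \<in> Arr (quot_cat C R)"
  obtains f where "f \<in> Arr C" "A = R `` {f}"
  using assms by (auto elim: quotientE)

lemma class_arr [simp]: "f \<in> Arr C \<Longrightarrow> R `` {f} \<in> Arr C // R"
  by (rule quotientI)

lemma quot_dom [simp]: "f \<in> Arr C \<Longrightarrow> Dom (quot_cat C R) (R `` {f}) = Dom C f"
  and quot_cod [simp]: "f \<in> Arr C \<Longrightarrow> Cod (quot_cat C R) (R `` {f}) = Cod C f"
  by (auto simp: quot_cat_def intro!: the_equality dest: R_arr R_refl)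

text \<open>Composition of classes is a definite description ranging over all pairs of
  representatives; the congruence property makes every pair give the same class.\<close>

lemma quot_comp [simp]:
  assumes "f \<in> Arr C" "g \<in> Arr C" "Cod C f = Dom C g"
  shows "R `` {f} \<cdot>\<^bsub>quot_cat C R\<^esub> R `` {g} = R `` {f \<cdot> g}"
proof -
  have "R `` {f' \<cdot> g'} = R `` {f \<cdot> g}" if "(f, f') \<in> R" "(g, g') \<in> R" for f' g'
    using R_comp[OF that] assms class_eq by metis
  then have "(THE F. \<exists>f'\<in>R `` {f}. \<exists>g'\<in>R `` {g}. F = R `` {f' \<cdot> g'}) = R `` {f \<cdot> g}"
    using assms R_refl by (intro the_equality) blast+
  then show ?thesis by (simp add: quot_cat_def)
qed

lemma quot_category: "category (quot_cat C R)"
proof (rule categoryI, goal_cases)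
  case (1 A) then show ?case by (auto elim!: quot_arrE simp del: quot_simps(2))
next
  case (2 X) then show ?case by simp
next
  case (3 A B) then show ?case by (auto elim!: quotientE)
next
  case (4 A) then show ?case by (auto elim!: quotientE)
next
  case (5 A B C) then show ?case by (auto elim!: quotientE)
qed

end

section \<open>Zigzags and the localisation\<close>

locale zigzag_loc = category_loc C for C :: "('o, 'm, 'z) cat_scheme" (structure) +
  fixes W :: "'m set"
  assumes W_arr: "w \<in> W \<Longrightarrow> w \<in> Arr C"
begin

abbreviation zeq :: "'o \<Rightarrow> 'm step list \<Rightarrow> 'm step list \<Rightarrow> 'o \<Rightarrow> bool" where
  "zeq X s t Y \<equiv> ((X, s, Y), (X, t, Y)) \<in> zigzag_eq C W"

lemma zigzag_append: "zigzag C W X (s @ t) Y \<longleftrightarrow> (\<exists>Z. zigzag C W X s Z \<and> zigzag C W Z t Y)"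
proof (induction s arbitrary: X)
  case Nil
  \<comment> \<open>The empty word exists only at an object, so splitting off an empty prefix
    requires that every zigzag starts at one.\<close>
  have "zigzag C W X t Y \<Longrightarrow> X \<in> Obj C" for X
    by (cases t rule: list.exhaust; (cases "hd t")?) (auto simp: W_arr)
  then show ?case by auto
next
  case (Cons a s) then show ?case by (cases a) auto
qed

lemma zigzag_ends: "zigzag C W X s Y \<Longrightarrow> X \<in> Obj C \<and> Y \<in> Obj C"
  using zigzag_append[of X "[]" s Y] zigzag_append[of X s "[]" Y] by auto

lemma zigzag_unique: "zigzag C W X s Y \<Longrightarrow> zigzag C W X s Z \<Longrightarrow> Y = Z"
proof (induction s arbitrary: X)
  case (Cons a s) then show ?case by (cases a) auto
qed auto

lemma zigzag_eq_type:
  "(x, y) \<in> zigzag_eq C W \<Longrightarrow>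
    (\<exists>X s t Y. x = (X, s, Y) \<and> y = (X, t, Y) \<and> zigzag C W X s Y \<and> zigzag C W X t Y)"
  by (induction rule: zigzag_eq.induct) auto

lemma zeq_type: "zeq X s t Y \<Longrightarrow> zigzag C W X s Y \<and> zigzag C W X t Y"
  using zigzag_eq_type by blast

lemma zeq_sym: "zeq X s t Y \<Longrightarrow> zeq X t s Y"
  by (rule zigzag_eq.sym)

lemma zeq_trans [trans]: "zeq X s t Y \<Longrightarrow> zeq X t u Y \<Longrightarrow> zeq X s u Y"
  by (rule zigzag_eq.trans)

text \<open>The generating rule already rewrites inside a context \<open>l'\<close>,
  \<open>r'\<close>. Enlarging this context gives another instance of the rule, and the closure
  under equivalence follows along.\<close>

lemma zeq_context:
  assumes "zeq X s t Y" "zigzag C W X' l X" "zigzag C W Y r Y'"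
  shows "zeq X' (l @ s @ r) (l @ t @ r) Y'"
proof -
  have "(x, y) \<in> zigzag_eq C W \<Longrightarrow> (\<And>X s t Y. x = (X, s, Y) \<Longrightarrow> y = (X, t, Y) \<Longrightarrow>
      zigzag C W X' l X \<Longrightarrow> zigzag C W Y r Y' \<Longrightarrow> zeq X' (l @ s @ r) (l @ t @ r) Y')" for x y
  proof (induction rule: zigzag_eq.induct)
    case (rule u v X l' r' Y)
    have "zeq X' ((l @ l') @ u @ (r' @ r)) ((l @ l') @ v @ (r' @ r)) Y'"
      using rule by (intro zigzag_eq.rule) (auto simp: zigzag_append)
    then show ?case using rule by auto
  next
    case (refl X s Y)
    then show ?case by (auto simp: zigzag_append intro!: zigzag_eq.refl) blast
  next
    case (sym x y)
    show ?case by (rule zeq_sym[OF sym.IH[OF sym.prems(2,1,3,4)]])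
  next
    case (trans x y z)
    obtain u where y: "y = (X, u, Y)" using zigzag_eq_type[OF trans.hyps(1)] trans.prems by auto
    show ?case
      using trans.IH(1)[OF trans.prems(1) y trans.prems(3,4)] trans.IH(2)[OF y trans.prems(2-4)]
      by (rule zeq_trans)
  qed
  then show ?thesis using assms by blast
qed

lemma zigzag_cat_simps [simp]:
  "Obj (zigzag_cat C W) = Obj C" "Arr (zigzag_cat C W) = {(X, s, Y). zigzag C W X s Y}"
  "Dom (zigzag_cat C W) (X, s, Y) = X" "Cod (zigzag_cat C W) (X, s, Y) = Y"
  "Ident (zigzag_cat C W) X = (X, [], X)"
  "(X, s, Y) \<cdot>\<^bsub>zigzag_cat C W\<^esub> (Y', t, Z) = (X, s @ t, Z)"
  by (simp_all add: zigzag_cat_def)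

lemma zigzag_category: "category (zigzag_cat C W)"
  by (rule categoryI) (auto simp: zigzag_append dest: zigzag_ends)

lemma zigzag_congruence: "cat_congruence (zigzag_cat C W) (zigzag_eq C W)"
proof -
  have 1: "equiv (Arr (zigzag_cat C W)) (zigzag_eq C W)"
    unfolding equiv_def refl_on_def sym_def trans_def
    by (auto intro: zigzag_eq.refl zigzag_eq.sym zigzag_eq.trans dest: zigzag_eq_type)
  have 2: "(f \<cdot>\<^bsub>zigzag_cat C W\<^esub> g, f' \<cdot>\<^bsub>zigzag_cat C W\<^esub> g') \<in> zigzag_eq C W"
    if h: "(f, f') \<in> zigzag_eq C W" "(g, g') \<in> zigzag_eq C W"
      "Cod (zigzag_cat C W) f = Dom (zigzag_cat C W) g" for f f' g g'
  proof -
    obtain X s s' Y where f: "f = (X, s, Y)" "f' = (X, s', Y)" "zeq X s s' Y"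
      using zigzag_eq_type[OF h(1)] h(1) by auto
    obtain Z t t' where g: "g = (Y, t, Z)" "g' = (Y, t', Z)" "zeq Y t t' Z"
      using zigzag_eq_type[OF h(2)] h(2,3) f by auto
    have "zeq X ([] @ s @ t) ([] @ s' @ t) Z"
      using f g by (intro zeq_context) (auto dest: zeq_type zigzag_ends)
    moreover have "zeq X (s' @ t @ []) (s' @ t' @ []) Z"
      using f g by (intro zeq_context) (auto dest: zeq_type zigzag_ends)
    ultimately show ?thesis using f g by (auto intro: zeq_trans)
  qed
  show ?thesis unfolding cat_congruence_def
    using 1 2 by (auto dest: zigzag_eq_type)
qed

sublocale zz: quotient_loc "zigzag_cat C W" "zigzag_eq C W"
  by unfold_locales (rule zigzag_category zigzag_congruence)+

text \<open>The prefix \<open>l\<close> determines its end point, so both words reach the rewritten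
  part at the same object; inspection of the four rules shows that they also leave it at the same
  object. Rewriting in context is thereby reduced to rewriting between fixed end points.\<close>

lemma zigzag_rule_ends:
  assumes r: "zigzag_rule C W u v" and u: "zigzag C W X (l @ u @ r) Y" and v: "zigzag C W X (l @ v @ r) Y"
  obtains Z Z' where "zigzag C W X l Z" "zigzag C W Z u Z'" "zigzag C W Z v Z'" "zigzag C W Z' r Y"
proof -
  obtain Z where Z: "zigzag C W X l Z" "zigzag C W Z (u @ r) Y"
    using u by (auto simp: zigzag_append)
  then obtain Z' where Z': "zigzag C W Z u Z'" "zigzag C W Z' r Y" by (auto simp: zigzag_append)
  obtain Z2 where "zigzag C W X l Z2" "zigzag C W Z2 (v @ r) Y"
    using v by (auto simp: zigzag_append)
  then have "zigzag C W Z (v @ r) Y" using Z zigzag_unique by metis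
  then obtain Z3 where Z3: "zigzag C W Z v Z3" "zigzag C W Z3 r Y" by (auto simp: zigzag_append)
  have "Z3 = Z'" using r Z' Z3 by cases (auto simp: composable_def dest: zigzag_ends)
  then show thesis using that Z Z' Z3 by simp
qed

abbreviation Loc :: "('o, ('o \<times> 'm step list \<times> 'o) set) cat" where
  "Loc \<equiv> localisation C W"

sublocale Loc: category_loc Loc
  by unfold_locales (simp add: localisation_def zz.quot_category)

definition zcl :: "'o \<Rightarrow> 'm step list \<Rightarrow> 'o \<Rightarrow> ('o \<times> 'm step list \<times> 'o) set" where
  "zcl X s Y = zigzag_eq C W `` {(X, s, Y)}"

lemma zcl_eq: "zeq X s t Y \<Longrightarrow> zcl X s Y = zcl X t Y"
  by (simp add: zcl_def zz.class_eq)

lemma zcl_eq_iff: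
  "zigzag C W X s Y \<Longrightarrow> zigzag C W X t Y \<Longrightarrow> zcl X s Y = zcl X t Y \<longleftrightarrow> zeq X s t Y"
  by (simp add: zcl_def zz.class_eq_iff)

lemma Loc_simps [simp]:
  "Obj Loc = Obj C" "Ident Loc X = zcl X [] X"
  "zigzag C W X s Y \<Longrightarrow> zcl X s Y \<in> Arr Loc"
  "zigzag C W X s Y \<Longrightarrow> Dom Loc (zcl X s Y) = X"
  "zigzag C W X s Y \<Longrightarrow> Cod Loc (zcl X s Y) = Y"
  by (auto simp: localisation_def zcl_def intro: quotientI)

lemma zcl_comp:
  "zigzag C W X s Y \<Longrightarrow> zigzag C W Y t Z \<Longrightarrow> zcl X s Y \<cdot>\<^bsub>Loc\<^esub> zcl Y t Z = zcl X (s @ t) Z"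
  unfolding localisation_def zcl_def
  using zz.quot_comp[of "(X, s, Y)" "(Y, t, Z)"] by simp

lemma Loc_arrE:
  assumes "A \<in> Arr Loc"
  obtains X s Y where "zigzag C W X s Y" "A = zcl X s Y"
  using assms by (auto simp: localisation_def zcl_def elim!: quotientE)

text \<open>The localisation functor on arrows; \<open>LB\<close> provides the inverses that it
  creates.\<close>

definition LF :: "'m \<Rightarrow> ('o \<times> 'm step list \<times> 'o) set" where
  "LF f = zcl (Dom C f) [Fwd f] (Cod C f)"

definition LB :: "'m \<Rightarrow> ('o \<times> 'm step list \<times> 'o) set" where
  "LB w = zcl (Cod C w) [Bwd w] (Dom C w)"

lemma LF_arr [simp]:
  assumes "f \<in> Arr C"
  shows "LF f \<in> Arr Loc" "Dom Loc (LF f) = Dom C f" "Cod Loc (LF f) = Cod C f"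
  using assms by (simp_all add: LF_def)

lemma LB_arr [simp]:
  assumes "w \<in> W"
  shows "LB w \<in> Arr Loc" "Dom Loc (LB w) = Cod C w" "Cod Loc (LB w) = Dom C w"
  using assms W_arr by (simp_all add: LB_def)

lemma zeq_rule:
  "zigzag_rule C W u v \<Longrightarrow> zigzag C W X u Y \<Longrightarrow> zigzag C W X v Y \<Longrightarrow> zeq X u v Y"
  using zigzag_eq.rule[of C W u v X "[]" "[]" Y] by simp

lemma LF_comp:
  "\<lbrakk>f \<in> Arr C; g \<in> Arr C; Cod C f = Dom C g\<rbrakk> \<Longrightarrow> LF (f \<cdot> g) = LF f \<cdot>\<^bsub>Loc\<^esub> LF g"
  by (auto simp: LF_def zcl_comp composable_def intro!: zcl_eq zeq_sym[OF zeq_rule] zigzag_rule.intros)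

lemma LF_id: "X \<in> Obj C \<Longrightarrow> LF (Ident C X) = Ident Loc X"
  by (auto simp: LF_def intro!: zcl_eq zeq_rule zigzag_rule.intros)

lemma LF_LB: "w \<in> W \<Longrightarrow> LF w \<cdot>\<^bsub>Loc\<^esub> LB w = Ident Loc (Dom C w)"
  and LB_LF: "w \<in> W \<Longrightarrow> LB w \<cdot>\<^bsub>Loc\<^esub> LF w = Ident Loc (Cod C w)"
  using W_arr by (auto simp: LF_def LB_def zcl_comp intro!: zcl_eq zeq_rule zigzag_rule.intros)

text \<open>Both sides are inverse to \<open>LF (v \<cdot> w)\<close>. Nothing is known about
  \<open>W\<close> being multiplicative, hence the hypothesis on the composite.\<close>

lemma LB_comp:
  assumes "v \<in> W" "w \<in> W" "v \<cdot> w \<in> W" "Cod C v = Dom C w"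
  shows "LB (v \<cdot> w) = LB w \<cdot>\<^bsub>Loc\<^esub> LB v"
proof -
  have [simp]: "v \<in> Arr C" "w \<in> Arr C" using assms W_arr by auto
  have "LB (v \<cdot> w) = LB (v \<cdot> w) \<cdot>\<^bsub>Loc\<^esub> (LF v \<cdot>\<^bsub>Loc\<^esub> (LF w \<cdot>\<^bsub>Loc\<^esub> (LB w \<cdot>\<^bsub>Loc\<^esub> LB v)))"
    using assms by (simp add: LF_LB Loc.comp_reduce[OF LF_LB] del: Loc_simps)
  also have "\<dots> = LB (v \<cdot> w) \<cdot>\<^bsub>Loc\<^esub> (LF (v \<cdot> w) \<cdot>\<^bsub>Loc\<^esub> (LB w \<cdot>\<^bsub>Loc\<^esub> LB v))"
    using assms by (simp add: LF_comp del: Loc_simps)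
  also have "\<dots> = LB w \<cdot>\<^bsub>Loc\<^esub> LB v"
    using assms by (simp add: Loc.comp_reduce[OF LB_LF] del: Loc_simps(2-))
  finally show ?thesis .
qed

end

text \<open>Made for \<open>Frac\<close>, whose composition is not known to be associative
  beforehand: that \<open>C\<close> is a category is a conclusion, pulled back from \<open>D\<close>
  along a map that is injective on arrows and respects the whole structure.\<close>

lemma category_transport:
  assumes D: "category D" and inj: "inj_on Fm (Arr C)" and im: "Fm ` Arr C = Arr D"
    and bij: "bij_betw Fo (Obj C) (Obj D)"
    and dom: "\<And>f. f \<in> Arr C \<Longrightarrow> Dom C f \<in> Obj C \<and> Fo (Dom C f) = Dom D (Fm f)"
    and cod: "\<And>f. f \<in> Arr C \<Longrightarrow> Cod C f \<in> Obj C \<and> Fo (Cod C f) = Cod D (Fm f)"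
    and ide: "\<And>X. X \<in> Obj C \<Longrightarrow> Ident C X \<in> Arr C \<and> Fm (Ident C X) = Ident D (Fo X)"
    and comp: "\<And>f g. \<lbrakk>f \<in> Arr C; g \<in> Arr C; Cod C f = Dom C g\<rbrakk> \<Longrightarrow>
      f \<cdot>\<^bsub>C\<^esub> g \<in> Arr C \<and> Fm (f \<cdot>\<^bsub>C\<^esub> g) = Fm f \<cdot>\<^bsub>D\<^esub> Fm g"
  shows "category C" "is_functor C D Fo Fm" "isomorphic_categories C D"
proof -
  interpret D: category_loc D by unfold_locales (rule D)
  have Fm [simp]: "f \<in> Arr C \<Longrightarrow> Fm f \<in> Arr D" for f using im by blast
  have Fo: "X \<in> Obj C \<Longrightarrow> Fo X \<in> Obj D" for X using bij by (auto simp: bij_betw_def)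
  have Foi: "X \<in> Obj C \<Longrightarrow> Y \<in> Obj C \<Longrightarrow> Fo X = Fo Y \<Longrightarrow> X = Y" for X Y
    using bij by (auto simp: bij_betw_def inj_on_def)
  have inj': "f \<in> Arr C \<Longrightarrow> g \<in> Arr C \<Longrightarrow> Fm f = Fm g \<Longrightarrow> f = g" for f g
    using inj by (auto simp: inj_on_def)
  have comp': "f \<cdot>\<^bsub>C\<^esub> g \<in> Arr C \<and> Dom C (f \<cdot>\<^bsub>C\<^esub> g) = Dom C f \<and> Cod C (f \<cdot>\<^bsub>C\<^esub> g) = Cod C g"
    if "f \<in> Arr C" "g \<in> Arr C" "Cod C f = Dom C g" for f g
    using that comp[OF that] dom[of f] dom[of "f \<cdot>\<^bsub>C\<^esub> g"] cod[of f] cod[of g] cod[of "f \<cdot>\<^bsub>C\<^esub> g"] dom[of g]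
    by (auto intro!: Foi)
  have ide': "Dom C (Ident C X) = X \<and> Cod C (Ident C X) = X" if "X \<in> Obj C" for X
    using that ide[OF that] dom[of "Ident C X"] cod[of "Ident C X"] Fo by (auto intro!: Foi)
  show C: "category C"
  proof (rule categoryI, goal_cases)
    case (1 f) then show ?case using dom cod by simp
  next
    case (2 X) then show ?case using ide ide' by simp
  next
    case (3 f g) then show ?case using comp' by simp
  next
    case (4 f)
    have "Ident C (Dom C f) \<cdot>\<^bsub>C\<^esub> f = f"
      using 4 dom[OF 4] ide[of "Dom C f"] ide'[of "Dom C f"] comp[of "Ident C (Dom C f)" f]
      by (intro inj') auto
    moreover have "f \<cdot>\<^bsub>C\<^esub> Ident C (Cod C f) = f"
      using 4 cod[OF 4] ide[of "Cod C f"] ide'[of "Cod C f"] comp[of f "Ident C (Cod C f)"]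
      by (intro inj') auto
    ultimately show ?case ..
  next
    case (5 f g h)
    have e: "Cod D (Fm f) = Dom D (Fm g)" "Cod D (Fm g) = Dom D (Fm h)"
      using 5 cod dom by metis+
    show ?case
      using 5 comp'[of f g] comp'[of g h] comp[of f g] comp[of g h] comp[of "f \<cdot>\<^bsub>C\<^esub> g" h]
        comp[of f "g \<cdot>\<^bsub>C\<^esub> h"] e
      by (intro inj') auto
  qed
  show "is_functor C D Fo Fm"
    using C D dom cod ide comp Fo by (auto simp: is_functor_def Hom_def composable_def)
  then show "isomorphic_categories C D"
    using bij inj im by (auto simp: isomorphic_categories_def bij_betw_def)
qed

lemma isomorphic_categories_sym:
  assumes "isomorphic_categories C D"
  shows "isomorphic_categories D C"
proof -
  obtain Fo Fm where F: "is_functor C D Fo Fm" "bij_betw Fo (Obj C) (Obj D)" "bij_betw Fm (Arr C) (Arr D)"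
    using assms by (auto simp: isomorphic_categories_def)
  interpret C: category_loc C using F by unfold_locales (simp add: is_functor_def)
  interpret D: category_loc D using F by unfold_locales (simp add: is_functor_def)
  let ?Go = "inv_into (Obj C) Fo" and ?Gm = "inv_into (Arr C) Fm"
  have o: "?Go (Fo X) = X" if "X \<in> Obj C" for X
    using F(2) that by (simp add: bij_betw_def)
  have m: "?Gm (Fm f) = f" if "f \<in> Arr C" for f
    using F(3) that by (simp add: bij_betw_def)
  have Fo: "Obj D = Fo ` Obj C" and Fm: "Arr D = Fm ` Arr C"
    using F(2,3) by (simp_all add: bij_betw_def)
  have Fid: "X \<in> Obj C \<Longrightarrow> Ident D (Fo X) = Fm (Ident C X)" for X
    using F(1) by (auto simp: is_functor_def)
  have Fdc: "f \<in> Arr C \<Longrightarrow> Dom D (Fm f) = Fo (Dom C f) \<and> Cod D (Fm f) = Fo (Cod C f)" for f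
    using F(1) by (auto simp: is_functor_def Hom_def)
  have Fc: "f \<in> Arr C \<Longrightarrow> g \<in> Arr C \<Longrightarrow> Cod C f = Dom C g \<Longrightarrow> Fm f \<cdot>\<^bsub>D\<^esub> Fm g = Fm (f \<cdot>\<^bsub>C\<^esub> g)" for f g
    using F(1) by (auto simp: is_functor_def composable_def)
  have "is_functor D C ?Go ?Gm"
    unfolding is_functor_def
  proof (intro conjI)
    show "\<forall>f g. composable D f g \<longrightarrow> ?Gm (f \<cdot>\<^bsub>D\<^esub> g) = ?Gm f \<cdot>\<^bsub>C\<^esub> ?Gm g"
    proof (intro allI impI)
      fix f g assume "composable D f g"
      then obtain f' g' where *: "f' \<in> Arr C" "g' \<in> Arr C" "f = Fm f'" "g = Fm g'" "Fo (Cod C f') = Fo (Dom C g')"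
        unfolding composable_def Fm using Fdc by auto
      then have "Cod C f' = Dom C g'" using o by (metis C.cod_obj C.dom_obj)
      then show "?Gm (f \<cdot>\<^bsub>D\<^esub> g) = ?Gm f \<cdot>\<^bsub>C\<^esub> ?Gm g" using * by (simp add: Fc m)
    qed
  qed (auto simp: C.category D.category Fo Fm o m Fid Fdc Hom_def)
  then show ?thesis
    using bij_betw_inv_into[OF F(2)] bij_betw_inv_into[OF F(3)]
    by (auto simp: isomorphic_categories_def)
qed

lemma isomorphic_categories_trans:
  assumes "isomorphic_categories C D" "isomorphic_categories D E"
  shows "isomorphic_categories C E"
proof -
  obtain Fo Fm where F: "is_functor C D Fo Fm" "bij_betw Fo (Obj C) (Obj D)" "bij_betw Fm (Arr C) (Arr D)"
    using assms by (auto simp: isomorphic_categories_def)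
  obtain Go Gm where G: "is_functor D E Go Gm" "bij_betw Go (Obj D) (Obj E)" "bij_betw Gm (Arr D) (Arr E)"
    using assms by (auto simp: isomorphic_categories_def)
  have "is_functor C E (Go \<circ> Fo) (Gm \<circ> Fm)"
    using F(1) G(1) by (auto simp: is_functor_def Hom_def composable_def)
  then show ?thesis
    using bij_betw_trans[OF F(2) G(2)] bij_betw_trans[OF F(3) G(3)]
    by (auto simp: isomorphic_categories_def)
qed

section \<open>The fraction category of a uni-fractionable category\<close>

locale unifrac_loc = category_loc C for C :: "('o, 'm, 'z) cat_scheme" (structure) +
  fixes D S T :: "'m set"
  assumes uni: "uni_fractionable C D S T"
begin

lemma mults: "multiplicative C D" "multiplicative C S" "multiplicative C T" "semi_saturated C D"
    "S \<subseteq> D" "T \<subseteq> D"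
proof -
  show *: "semi_saturated C D" using uni unfolding uni_fractionable_def by (elim conjE)
  show "multiplicative C D" using * unfolding semi_saturated_def by (elim conjE)
  show "multiplicative C S" "multiplicative C T" "S \<subseteq> D" "T \<subseteq> D"
    using uni unfolding uni_fractionable_def by - (elim conjE, assumption)+
qed

lemma D_arr [simp]: "d \<in> D \<Longrightarrow> d \<in> Arr C"
  using mults(1) by (auto simp: multiplicative_def)

lemma D_id [simp]: "X \<in> Obj C \<Longrightarrow> Ident C X \<in> D"
  using mults(1) by (auto simp: multiplicative_def)

lemma D_comp [simp]: "\<lbrakk>f \<in> D; g \<in> D; Cod C f = Dom C g\<rbrakk> \<Longrightarrow> f \<cdot> g \<in> D"
  using mults(1) D_arr unfolding multiplicative_def composable_def by blast

lemma D_right: "\<lbrakk>f \<in> D; g \<in> Arr C; Cod C f = Dom C g; f \<cdot> g \<in> D\<rbrakk> \<Longrightarrow> g \<in> D"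
  and D_left: "\<lbrakk>f \<in> Arr C; g \<in> D; Cod C f = Dom C g; f \<cdot> g \<in> D\<rbrakk> \<Longrightarrow> f \<in> D"
  using mults(4) D_arr unfolding semi_saturated_def composable_def by blast+

lemma S_D: "s \<in> S \<Longrightarrow> s \<in> D" and T_D: "t \<in> T \<Longrightarrow> t \<in> D"
  using mults(5,6) by auto

lemma S_comp: "\<lbrakk>f \<in> S; g \<in> S; Cod C f = Dom C g\<rbrakk> \<Longrightarrow> f \<cdot> g \<in> S"
  and T_comp: "\<lbrakk>f \<in> T; g \<in> T; Cod C f = Dom C g\<rbrakk> \<Longrightarrow> f \<cdot> g \<in> T"
  using mults(2,3) unfolding multiplicative_def composable_def by blast+

lemma fac:
  assumes "d \<in> D"
  obtains i p where "i \<in> S" "p \<in> T" "i \<in> Arr C" "p \<in> Arr C" "Cod C i = Dom C p" "d = i \<cdot> p"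
    "Dom C i = Dom C d" "Cod C p = Cod C d"
proof -
  have "\<forall>d\<in>D. \<exists>i\<in>S. \<exists>p\<in>T. composable C i p \<and> d = i \<cdot> p"
    using uni unfolding uni_fractionable_def by (elim conjE)
  then obtain i p where "i \<in> S" "p \<in> T" "composable C i p" "d = i \<cdot> p"
    using assms by blast
  then show thesis by (intro that[of i p]) (auto simp: composable_def)
qed

lemma pushS:
  assumes "i \<in> S" "f \<in> Arr C" "Dom C f = Dom C i"
  obtains f' i' where "weak_pushout C i f f' i'" "i' \<in> S" "f' \<in> Arr C" "i' \<in> Arr C"
    "Dom C f' = Cod C i" "Dom C i' = Cod C f" "Cod C f' = Cod C i'" "i \<cdot> f' = f \<cdot> i'"
proof -
  have "\<forall>i\<in>S. \<forall>f\<in>Arr C. Dom C f = Dom C i \<longrightarrow> (\<exists>f' i'. weak_pushout C i f f' i' \<and> i' \<in> S)"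
    using uni unfolding uni_fractionable_def by (elim conjE)
  then obtain f' i' where *: "weak_pushout C i f f' i'" "i' \<in> S"
    using assms by blast
  then have c: "composable C i f'" "composable C f i'" "i \<cdot> f' = f \<cdot> i'"
    by (auto simp: weak_pushout_def commutes_def)
  show thesis using c comp_arr(3)[of i f'] comp_arr(3)[of f i']
    by (intro that[OF *]) (auto simp: composable_def)
qed

lemma pullT:
  assumes "p \<in> T" "f \<in> Arr C" "Cod C f = Cod C p"
  obtains f' p' where "weak_pullback C f p f' p'" "p' \<in> T" "f' \<in> Arr C" "p' \<in> Arr C"
    "Cod C f' = Dom C p" "Cod C p' = Dom C f" "Dom C f' = Dom C p'" "f' \<cdot> p = p' \<cdot> f"
proof -
  have "\<forall>p\<in>T. \<forall>f\<in>Arr C. Cod C f = Cod C p \<longrightarrow> (\<exists>f' p'. weak_pullback C f p f' p' \<and> p' \<in> T)"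
    using uni unfolding uni_fractionable_def by (elim conjE)
  then obtain f' p' where *: "weak_pullback C f p f' p'" "p' \<in> T"
    using assms by blast
  then have c: "composable C f' p" "composable C p' f" "f' \<cdot> p = p' \<cdot> f"
    by (auto simp: weak_pullback_def commutes_def)
  show thesis using c comp_arr(2)[of f' p] comp_arr(2)[of p' f]
    by (intro that[OF *]) (auto simp: composable_def)
qed

sublocale zigzag_loc C D
  by unfold_locales (rule D_arr)

section \<open>Fraction equality and composition of a 3-arrow with an arrow\<close>

abbreviation feq :: "'m \<times> 'm \<times> 'm \<Rightarrow> 'm \<times> 'm \<times> 'm \<Rightarrow> bool" where
  "feq x y \<equiv> (x, y) \<in> fraction_eq C D"

abbreviation TA :: "('m \<times> 'm \<times> 'm) set" where
  "TA \<equiv> three_arrows C D"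

lemma TA_iff: "(b, f, a) \<in> TA \<longleftrightarrow>
    b \<in> D \<and> f \<in> Arr C \<and> a \<in> D \<and> Dom C b = Dom C f \<and> Cod C f = Cod C a"
  by (simp add: three_arrows_def)

lemma feq_right:
  "\<lbrakk>(b, f, a) \<in> TA; c \<in> Arr C; Cod C a = Dom C c; a \<cdot> c \<in> D\<rbrakk> \<Longrightarrow> feq (b, f, a) (b, f \<cdot> c, a \<cdot> c)"
  by (rule fraction_eq.right) (auto simp: composable_def TA_iff)

lemma feq_left:
  "\<lbrakk>(b, f, a) \<in> TA; c \<in> Arr C; Cod C c = Dom C b; c \<cdot> b \<in> D\<rbrakk> \<Longrightarrow> feq (b, f, a) (c \<cdot> b, c \<cdot> f, a)"
  by (rule fraction_eq.left) (auto simp: composable_def TA_iff)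

lemma feq_sym: "feq x y \<Longrightarrow> feq y x"
  by (rule fraction_eq.sym)

lemma feq_trans [trans]: "feq x y \<Longrightarrow> feq y z \<Longrightarrow> feq x z"
  by (rule fraction_eq.trans)

lemma feq_type: "feq x y \<Longrightarrow> x \<in> TA \<and> y \<in> TA \<and> Cod C (fst x) = Cod C (fst y) \<and>
    Dom C (snd (snd x)) = Dom C (snd (snd y))"
  by (induction rule: fraction_eq.induct) (auto simp: TA_iff composable_def)

text \<open>\<open>extension g b f a c f' i p v a'\<close>: after refining the 3-arrow \<open>(b, f, a)\<close> to
  \<open>(c b, f', i)\<close> with \<open>a = i p\<close>, the square \<open>i v = g a'\<close> allows it to be composed with \<open>g\<close>,
  the result being \<open>(c b, f' v, a')\<close>.\<close>

definition extension ::
  "'m \<Rightarrow> 'm \<Rightarrow> 'm \<Rightarrow> 'm \<Rightarrow> 'm \<Rightarrow> 'm \<Rightarrow> 'm \<Rightarrow> 'm \<Rightarrow> 'm \<Rightarrow> 'm \<Rightarrow> bool" where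
  "extension g b f a c f' i p v a' \<longleftrightarrow>
     c \<in> Arr C \<and> f' \<in> Arr C \<and> i \<in> D \<and> p \<in> Arr C \<and> v \<in> Arr C \<and> a' \<in> D \<and>
     Cod C c = Dom C b \<and> c \<cdot> b \<in> D \<and> Dom C f' = Dom C c \<and> Cod C f' = Dom C p \<and> c \<cdot> f = f' \<cdot> p \<and>
     Cod C i = Dom C p \<and> a = i \<cdot> p \<and> Dom C v = Dom C p \<and> Cod C v = Cod C a' \<and>
     Dom C i = Dom C g \<and> Dom C a' = Cod C g \<and> i \<cdot> v = g \<cdot> a'"

context
  fixes b f a g
  assumes x: "(b, f, a) \<in> TA" and g [simp]: "g \<in> Arr C" "Dom C g = Dom C a"
begin

lemma xs [simp]: "b \<in> D" "f \<in> Arr C" "a \<in> D" "Dom C f = Dom C b" "Cod C f = Cod C a"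
  using x by (auto simp: TA_iff)

lemma extension_simps:
  assumes "extension g b f a c f' i p v a'"
  shows "c \<in> Arr C" "f' \<in> Arr C" "i \<in> D" "p \<in> Arr C" "v \<in> Arr C" "a' \<in> D" "c \<cdot> b \<in> D"
    "Cod C c = Dom C b" "Dom C f' = Dom C c" "Cod C f' = Dom C p" "Cod C i = Dom C p" "Dom C v = Dom C p"
    "Cod C v = Cod C a'" "Dom C a' = Cod C g" "Dom C i = Dom C a" "Cod C p = Cod C a"
proof -
  have "i \<in> D" "p \<in> Arr C" "Cod C i = Dom C p" "a = i \<cdot> p"
    using assms unfolding extension_def by blast+
  then show "Cod C p = Cod C a" by simp
qed (use assms g in \<open>unfold extension_def, (elim conjE, simp only:)+\<close>)

lemma extension_TA: "extension g b f a c f' i p v a' \<Longrightarrow> (c \<cdot> b, f' \<cdot> v, a') \<in> TA"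
  using extension_simps[of c f' i p v a'] by (simp add: TA_iff)

text \<open>A T-denominator \<open>n\<close> is shifted from the first factor of \<open>a\<close> to
  the second. Pulling \<open>f'\<close> back along \<open>n\<close> enlarges the left leg by a
  T-denominator only, which fraction equality absorbs.\<close>

lemma extension_pull:
  assumes e: "extension g b f a c f' i p v a'" and n: "n \<in> T" "Cod C n = Dom C p"
    and j: "j \<in> D" "Cod C j = Dom C n" "j \<cdot> n = i"
  obtains c' f'' where "extension g b f a c' f'' j (n \<cdot> p) (n \<cdot> v) a'"
    "feq (c \<cdot> b, f' \<cdot> v, a') (c' \<cdot> b, f'' \<cdot> (n \<cdot> v), a')"
proof -
  note [simp] = extension_simps[OF e] T_D[OF n(1)] n(2) j(1,2)
  obtain f'' n' where p: "n' \<in> T" "f'' \<in> Arr C" "n' \<in> Arr C" "Cod C f'' = Dom C n" "Cod C n' = Dom C f'"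
    "Dom C f'' = Dom C n'" "f'' \<cdot> n = n' \<cdot> f'"
    by (rule pullT[OF n(1), of f']) simp_all
  note [simp] = p(2-6) T_D[OF p(1)]
  have r: "f'' \<cdot> (n \<cdot> k) = n' \<cdot> (f' \<cdot> k)" if "k \<in> Arr C" "Dom C k = Cod C n" for k
    using comp_reduce[OF p(7), of k] that by simp
  have c: "c \<cdot> f = f' \<cdot> p" and i: "i \<cdot> v = g \<cdot> a'" and a: "a = i \<cdot> p"
    using e by (simp_all add: extension_def)
  have ji: "j \<cdot> (n \<cdot> k) = i \<cdot> k" if "k \<in> Arr C" "Dom C k = Cod C n" for k
    using comp_reduce[OF j(3), of k] that by simp
  have cb: "n' \<cdot> (c \<cdot> b) \<in> D" by (rule D_comp) simp_all
  have [simp]: "Dom C j = Dom C a" using comp_arr(2)[of j n] by (simp add: j(3))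
  have "extension g b f a (n' \<cdot> c) f'' j (n \<cdot> p) (n \<cdot> v) a'"
    unfolding extension_def using cb c i a[symmetric] r ji by simp
  moreover have "feq (c \<cdot> b, f' \<cdot> v, a') (n' \<cdot> (c \<cdot> b), n' \<cdot> (f' \<cdot> v), a')"
    using cb by (intro feq_left extension_TA[OF e]) simp_all
  moreover have "n' \<cdot> (c \<cdot> b) = (n' \<cdot> c) \<cdot> b" "n' \<cdot> (f' \<cdot> v) = f'' \<cdot> (n \<cdot> v)"
    by (simp_all add: r)
  ultimately show thesis using that by metis
qed

text \<open>The opposite shift: an S-denominator \<open>s\<close> passes from the second factor of
  \<open>a\<close> to the first. Pushing \<open>v\<close> out along \<open>s\<close> prolongs the
  right leg by an S-denominator, so the double fraction stays the same.\<close>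

lemma extension_push:
  assumes e: "extension g b f a c f' j (s \<cdot> (t \<cdot> p)) v a'" and s: "s \<in> S" "t \<in> Arr C" "p \<in> Arr C"
    "Cod C s = Dom C t" "Cod C t = Dom C p"
  obtains v' a'' where "extension g b f a c (f' \<cdot> s) (j \<cdot> s) (t \<cdot> p) v' a''"
    "feq (c \<cdot> b, f' \<cdot> v, a') (c \<cdot> b, (f' \<cdot> s) \<cdot> v', a'')"
proof -
  have "Cod C (s \<cdot> (t \<cdot> p)) = Cod C p" using s S_D by simp
  then have [simp]: "Cod C p = Cod C a" using extension_simps(16)[OF e] by simp
  note [simp] = extension_simps[OF e] S_D[OF s(1)] s(2-5)
  obtain v' s' where p: "s' \<in> S" "v' \<in> Arr C" "s' \<in> Arr C" "Dom C v' = Cod C s" "Dom C s' = Cod C v"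
    "Cod C v' = Cod C s'" "s \<cdot> v' = v \<cdot> s'"
    by (rule pushS[OF s(1), of v]) simp_all
  note [simp] = p(2-6) S_D[OF p(1)]
  have i: "j \<cdot> v = g \<cdot> a'" and a: "a = j \<cdot> (s \<cdot> (t \<cdot> p))" and c: "c \<cdot> f = f' \<cdot> (s \<cdot> (t \<cdot> p))"
    using e by (simp_all add: extension_def)
  have jv: "j \<cdot> (v \<cdot> k) = g \<cdot> (a' \<cdot> k)" if "k \<in> Arr C" "Dom C k = Cod C a'" for k
    using comp_reduce[OF i, of k] that by simp
  have "extension g b f a c (f' \<cdot> s) (j \<cdot> s) (t \<cdot> p) v' (a' \<cdot> s')"
    unfolding extension_def using i a[symmetric] c p(7) jv by simp
  moreover have "feq (c \<cdot> b, f' \<cdot> v, a') (c \<cdot> b, (f' \<cdot> v) \<cdot> s', a' \<cdot> s')"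
    by (intro feq_right extension_TA[OF e]) simp_all
  moreover have "(f' \<cdot> v) \<cdot> s' = (f' \<cdot> s) \<cdot> v'" by (simp add: p(7))
  ultimately show thesis using that by metis
qed

text \<open>Over a fixed factorisation of \<open>a\<close>, the weak pullback of \<open>f\<close>
  and \<open>p\<close> together with the weak pushout of \<open>i\<close> and \<open>g\<close> is
  weakly universal: the result of any other extension arises from it by one refinement on the left
  (\<open>k\<close>) and one on the right (\<open>l\<close>).\<close>

lemma extension_canonical:
  assumes i: "i \<in> S" "p \<in> T" "Cod C i = Dom C p" "a = i \<cdot> p"
  obtains c f' v a' where "extension g b f a c f' i p v a'" "c \<in> T" "a' \<in> S"
    "\<And>c2 f2 v2 a2. extension g b f a c2 f2 i p v2 a2 \<Longrightarrow> feq (c2 \<cdot> b, f2 \<cdot> v2, a2) (c \<cdot> b, f' \<cdot> v, a')"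
proof -
  note [simp] = S_D[OF i(1)] T_D[OF i(2)] i(3)
  have [simp]: "Dom C i = Dom C a" "Cod C p = Cod C a" by (simp_all add: i(4))
  obtain f' c where c: "weak_pullback C f p f' c" "c \<in> T" "f' \<in> Arr C" "c \<in> Arr C"
    "Cod C f' = Dom C p" "Cod C c = Dom C f" "Dom C f' = Dom C c" "f' \<cdot> p = c \<cdot> f"
    by (rule pullT[OF i(2), of f]) simp_all
  obtain v a' where v: "weak_pushout C i g v a'" "a' \<in> S" "v \<in> Arr C" "a' \<in> Arr C"
    "Dom C v = Cod C i" "Dom C a' = Cod C g" "Cod C v = Cod C a'" "i \<cdot> v = g \<cdot> a'"
    by (rule pushS[OF i(1), of g]) simp_all
  note [simp] = c(3-7) v(3-7) T_D[OF c(2)] S_D[OF v(2)]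
  have e: "extension g b f a c f' i p v a'"
    unfolding extension_def using c(8) v(8) i(4)[symmetric] by simp
  show thesis
  proof (rule that[OF e c(2) v(2)])
    fix c2 f2 v2 a2 assume e2: "extension g b f a c2 f2 i p v2 a2"
    note [simp] = extension_simps[OF e2]
    have "commutes C f2 p c2 f" "commutes C i v2 g a2"
      using e2 by (simp_all add: commutes_def composable_def extension_def)
    then obtain k l where k: "k \<in> Hom C (Dom C f2) (Dom C f')" "k \<cdot> f' = f2" "k \<cdot> c = c2"
      and l: "l \<in> Hom C (Cod C v) (Cod C v2)" "v \<cdot> l = v2" "a' \<cdot> l = a2"
      using c(1) v(1) unfolding weak_pullback_def weak_pushout_def by blast
    have [simp]: "k \<in> Arr C" "Cod C k = Dom C c" "Dom C l = Cod C a'" "l \<in> Arr C"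
      using k(1) l(1) by (auto simp: Hom_def)
    have kk: "k \<cdot> (f' \<cdot> h) = f2 \<cdot> h" if "h \<in> Arr C" "Dom C h = Cod C f'" for h
      using comp_reduce[OF k(2), of h] that by simp
    have kc: "k \<cdot> (c \<cdot> b) = c2 \<cdot> b" using comp_reduce[OF k(3), of b] by simp
    have D2: "c2 \<cdot> b \<in> D" "a2 \<in> D" using e2 by (auto simp: extension_def)
    have 1: "feq (c \<cdot> b, f' \<cdot> v, a') (k \<cdot> (c \<cdot> b), k \<cdot> (f' \<cdot> v), a')"
      by (intro feq_left extension_TA[OF e]) (use kc D2 in simp_all)
    then have "feq (k \<cdot> (c \<cdot> b), k \<cdot> (f' \<cdot> v), a') (k \<cdot> (c \<cdot> b), (k \<cdot> (f' \<cdot> v)) \<cdot> l, a' \<cdot> l)"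
      by (intro feq_right) (use l(3) D2 feq_type[OF 1] in simp_all)
    with 1 have "feq (c \<cdot> b, f' \<cdot> v, a') (k \<cdot> (c \<cdot> b), (k \<cdot> (f' \<cdot> v)) \<cdot> l, a' \<cdot> l)"
      by (rule feq_trans)
    moreover have "(k \<cdot> (f' \<cdot> v)) \<cdot> l = f2 \<cdot> v2" by (simp add: kk l(2))
    ultimately show "feq (c2 \<cdot> b, f2 \<cdot> v2, a2) (c \<cdot> b, f' \<cdot> v, a')"
      unfolding kc l(3) by (metis feq_sym)
  qed
qed

lemma extension_exists:
  obtains c f' i p v a' where "extension g b f a c f' i p v a'" "c \<in> T" "a' \<in> S"
  using fac[of a] extension_canonical xs(3) by metis

text \<open>The factorisations \<open>i0 \<cdot> p0\<close> and \<open>i1 \<cdot> p1\<close> of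
  \<open>a\<close> are both refined to \<open>(j \<cdot> s) \<cdot> (t \<cdot> p0)\<close>. Its
  factors are again an S- and a T-denominator, so \<open>extension_canonical\<close> decides there.
  The refinements are made of the two shifts above.\<close>

lemma extension_unique_canonical:
  assumes e0: "extension g b f a c0 f0 i0 p0 v0 a0" and i0: "i0 \<in> S" "p0 \<in> T"
    and e1: "extension g b f a c1 f1 i1 p1 v1 a1"
  shows "feq (c1 \<cdot> b, f1 \<cdot> v1, a1) (c0 \<cdot> b, f0 \<cdot> v0, a0)"
proof -
  have a0: "a = i0 \<cdot> p0" and a1: "a = i1 \<cdot> p1"
    using e0 e1 unfolding extension_def by blast+
  note [simp] = S_D[OF i0(1)] T_D[OF i0(2)] extension_simps[OF e0] extension_simps[OF e1]
  obtain m0 m1 where m: "weak_pullback C p1 p0 m0 m1" "m1 \<in> T" "m0 \<in> Arr C" "m1 \<in> Arr C"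
    "Cod C m0 = Dom C p0" "Cod C m1 = Dom C p1" "Dom C m0 = Dom C m1" "m0 \<cdot> p0 = m1 \<cdot> p1"
    by (rule pullT[OF i0(2), of p1]) simp_all
  note [simp] = m(3-7) T_D[OF m(2)]
  \<comment> \<open>Both first factors lift to the weak pullback of \<open>p1\<close> and
    \<open>p0\<close> through one arrow \<open>r\<close>, which is a denominator because
    \<open>m1\<close> and \<open>r \<cdot> m1 = i1\<close> are.\<close>
  have "commutes C i0 p0 i1 p1" by (simp add: commutes_def composable_def a0[symmetric] a1[symmetric])
  then obtain r where r: "r \<in> Hom C (Dom C i0) (Dom C m0)" "r \<cdot> m0 = i0" "r \<cdot> m1 = i1"
    using m(1) unfolding weak_pullback_def by blast
  have [simp]: "r \<in> Arr C" "Dom C r = Dom C i0" "Cod C r = Dom C m1" using r(1) by (auto simp: Hom_def)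
  have rD: "r \<in> D" by (rule D_left[of r m1]) (simp_all add: r)
  obtain j q where j: "j \<in> S" "q \<in> T" "j \<in> Arr C" "q \<in> Arr C" "Cod C j = Dom C q" "r = j \<cdot> q"
    "Dom C j = Dom C r" "Cod C q = Cod C r"
    using fac[OF rD] by metis
  note [simp] = j(3-5,7,8) S_D[OF j(1)] T_D[OF j(2)]
  have jm1: "j \<cdot> (q \<cdot> m1) = i1" and jm0: "j \<cdot> (q \<cdot> m0) = i0"
    using comp_reduce[OF j(6)[symmetric], of m1] comp_reduce[OF j(6)[symmetric], of m0] r by simp_all
  have "q \<cdot> m0 \<in> D" by (rule D_right[of j]) (simp_all add: jm0)
  then obtain s t where s: "s \<in> S" "t \<in> T" "s \<in> Arr C" "t \<in> Arr C" "Cod C s = Dom C t" "q \<cdot> m0 = s \<cdot> t"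
    "Dom C s = Dom C (q \<cdot> m0)" "Cod C t = Cod C (q \<cdot> m0)"
    using fac[of "q \<cdot> m0"] by metis
  have s': "Dom C s = Dom C q" "Cod C t = Dom C p0" using s(7,8) by simp_all
  note [simp] = s(3-5) s' S_D[OF s(1)] T_D[OF s(2)]
  \<comment> \<open>Shifting \<open>q \<cdot> m1\<close> away from \<open>i1\<close> leaves the
    second factor \<open>q \<cdot> m1 \<cdot> p1\<close>. The weak pullback square and
    \<open>q \<cdot> m0 = s \<cdot> t\<close> express it through \<open>p0\<close>, and the S-part
    \<open>s\<close> can now be shifted back.\<close>
  have eqp: "(q \<cdot> m1) \<cdot> p1 = s \<cdot> (t \<cdot> p0)"
    using comp_reduce[OF s(6), of p0] m(8) by simp
  obtain c' f' where e': "extension g b f a c' f' j ((q \<cdot> m1) \<cdot> p1) ((q \<cdot> m1) \<cdot> v1) a1"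
    and 1: "feq (c1 \<cdot> b, f1 \<cdot> v1, a1) (c' \<cdot> b, f' \<cdot> ((q \<cdot> m1) \<cdot> v1), a1)"
    by (rule extension_pull[OF e1 T_comp[OF j(2) m(2)], of j]) (simp_all add: jm1)
  obtain v' a' where e'': "extension g b f a c' (f' \<cdot> s) (j \<cdot> s) (t \<cdot> p0) v' a'"
    and 2: "feq (c' \<cdot> b, f' \<cdot> ((q \<cdot> m1) \<cdot> v1), a1) (c' \<cdot> b, (f' \<cdot> s) \<cdot> v', a')"
    by (rule extension_push[OF e'[unfolded eqp] s(1)]) simp_all
  have js: "(j \<cdot> s) \<cdot> t = i0" using jm0 s(6) by simp
  obtain c'' f'' where e0': "extension g b f a c'' f'' (j \<cdot> s) (t \<cdot> p0) (t \<cdot> v0) a0"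
    and 3: "feq (c0 \<cdot> b, f0 \<cdot> v0, a0) (c'' \<cdot> b, f'' \<cdot> (t \<cdot> v0), a0)"
    by (rule extension_pull[OF e0 s(2), of "j \<cdot> s"]) (use js in simp_all)
  have "a = (j \<cdot> s) \<cdot> (t \<cdot> p0)" using a0 comp_reduce[OF js, of p0] by simp
  then obtain c f3 v a3 where 4: "\<And>c2 f2 v2 a2. extension g b f a c2 f2 (j \<cdot> s) (t \<cdot> p0) v2 a2 \<Longrightarrow>
      feq (c2 \<cdot> b, f2 \<cdot> v2, a2) (c \<cdot> b, f3 \<cdot> v, a3)"
    using extension_canonical[OF S_comp[OF j(1) s(1)] T_comp[OF s(2) i0(2)]] by (metis comp_arr(2,3) j(3,4,5) s'(1) s(3,4,5) s'(2) T_D D_arr i0(2))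
  show ?thesis using feq_trans[OF 1 feq_trans[OF 2 4[OF e'']]] feq_trans[OF 3 4[OF e0']]
    by (meson feq_sym feq_trans)
qed

lemma extension_unique:
  assumes e1: "extension g b f a c1 f1 i1 p1 v1 a1" and e2: "extension g b f a c2 f2 i2 p2 v2 a2"
  shows "feq (c1 \<cdot> b, f1 \<cdot> v1, a1) (c2 \<cdot> b, f2 \<cdot> v2, a2)"
proof -
  obtain i p where i: "i \<in> S" "p \<in> T" "Cod C i = Dom C p" "a = i \<cdot> p" using fac[OF xs(3)] by metis
  obtain c f' v a' where "extension g b f a c f' i p v a'" using extension_canonical[OF i] by metis
  then show ?thesis using extension_unique_canonical[OF _ i(1,2)] e1 e2 by (meson feq_sym feq_trans)
qed

end

declare xs [simp del]

section \<open>Action of arrows and of words on 3-arrows\<close>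

definition ext :: "'m \<Rightarrow> 'm \<times> 'm \<times> 'm \<Rightarrow> 'm \<times> 'm \<times> 'm \<Rightarrow> bool" where
  "ext g x y \<longleftrightarrow> (\<exists>b f a c f' i p v a'. x = (b, f, a) \<and> extension g b f a c f' i p v a' \<and>
     y = (c \<cdot> b, f' \<cdot> v, a'))"

lemma extI: "extension g b f a c f' i p v a' \<Longrightarrow> ext g (b, f, a) (c \<cdot> b, f' \<cdot> v, a')"
  unfolding ext_def by blast

abbreviation tgt3 :: "'m \<times> 'm \<times> 'm \<Rightarrow> 'o" where
  "tgt3 x \<equiv> Dom C (snd (snd x))"

lemma ext_type:
  assumes "ext g x y" "x \<in> TA" "g \<in> Arr C" "Dom C g = tgt3 x"
  shows "y \<in> TA" "tgt3 y = Cod C g" "Cod C (fst y) = Cod C (fst x)"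
proof -
  obtain b f a c f' i p v a' where e: "x = (b, f, a)" "extension g b f a c f' i p v a'"
    "y = (c \<cdot> b, f' \<cdot> v, a')" using assms(1) by (auto simp: ext_def)
  have h: "(b, f, a) \<in> TA" "g \<in> Arr C" "Dom C g = Dom C a" using assms e(1) by simp_all
  have b: "b \<in> D" using h(1) by (simp add: TA_iff)
  show "y \<in> TA" using extension_TA[OF h e(2)] by (simp only: e(3))
  show "tgt3 y = Cod C g" by (simp add: e(3) extension_simps[OF h e(2)])
  show "Cod C (fst y) = Cod C (fst x)" by (simp add: e(1,3) b extension_simps[OF h e(2)])
qed

lemma ext_exists: "x \<in> TA \<Longrightarrow> g \<in> Arr C \<Longrightarrow> Dom C g = tgt3 x \<Longrightarrow> \<exists>y. ext g x y"
  by (cases x) (use extension_exists in \<open>simp add: ext_def, metis\<close>)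

lemma ext_unique: "x \<in> TA \<Longrightarrow> g \<in> Arr C \<Longrightarrow> Dom C g = tgt3 x \<Longrightarrow> ext g x y \<Longrightarrow> ext g x y' \<Longrightarrow> feq y y'"
  by (cases x) (auto simp: ext_def intro: extension_unique)

text \<open>By \<open>ext_unique\<close> it suffices to exhibit one convenient extension on each
  side. For each generating relation an extension of the first 3-arrow is turned into one of the
  second whose result is equal to it or a refinement of it.\<close>

lemma ext_feq:
  "feq x x' \<Longrightarrow> g \<in> Arr C \<Longrightarrow> Dom C g = tgt3 x \<Longrightarrow> ext g x y \<Longrightarrow> ext g x' y' \<Longrightarrow> feq y y'"
proof (induction arbitrary: y y' rule: fraction_eq.induct)
  case (right b f a k)
  have g: "g \<in> Arr C" "Dom C g = Dom C a" using right(4,5) by simp_all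
  have k: "k \<in> Arr C" "Dom C k = Cod C a" using right(2) by (auto simp: composable_def)
  note [simp] = right(1)[unfolded TA_iff] right(3) k
  obtain c f' i p v a' where e: "extension g b f a c f' i p v a'"
    by (rule extension_exists[OF right(1) g])
  note [simp] = extension_simps[OF right(1) g e]
  have eqs: "c \<cdot> f = f' \<cdot> p" "i \<cdot> p = a" "i \<cdot> v = g \<cdot> a'" using e unfolding extension_def by blast+
  \<comment> \<open>The same data serve after a refinement on the right; only the second factor of
    the last leg grows from \<open>p\<close> to \<open>p \<cdot> k\<close>.\<close>
  have 1: "extension g b (f \<cdot> k) (a \<cdot> k) c f' i (p \<cdot> k) v a'"
    unfolding extension_def by (simp add: g eqs(3) comp_reduce[OF eqs(1)] comp_reduce[OF eqs(2)])
  have 2: "(b, f \<cdot> k, a \<cdot> k) \<in> TA" by (simp add: TA_iff)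
  have "feq y (c \<cdot> b, f' \<cdot> v, a')"
    using right(6) g extI[OF e] by (intro ext_unique[OF right(1)]) auto
  moreover have "feq (c \<cdot> b, f' \<cdot> v, a') y'"
    using right(7) g extI[OF 1] by (intro ext_unique[OF 2]) auto
  ultimately show ?case by (rule feq_trans)
next
  case (left b f a k)
  have g: "g \<in> Arr C" "Dom C g = Dom C a" using left(4,5) by simp_all
  have k: "k \<in> Arr C" "Cod C k = Dom C b" using left(2) by (auto simp: composable_def)
  note [simp] = left(3) k
  have [simp]: "b \<in> D" "f \<in> Arr C" "a \<in> D" "Dom C f = Dom C b" "Cod C f = Cod C a"
    using left(1) by (simp_all add: TA_iff)
  obtain c f' i p v a' where e: "extension g b f a c f' i p v a'" and c: "c \<in> T"
    by (rule extension_exists[OF left(1) g])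
  note [simp] = extension_simps[OF left(1) g e]
  \<comment> \<open>A refinement on the left is accommodated by pulling \<open>c\<close> back along
    \<open>k\<close>; this is why \<open>extension_exists\<close> also supplies
    \<open>c \<in> T\<close>.\<close>
  obtain k' c' where k: "c' \<in> T" "k' \<in> Arr C" "c' \<in> Arr C" "Cod C k' = Dom C c" "Cod C c' = Dom C k"
    "Dom C k' = Dom C c'" "k' \<cdot> c = c' \<cdot> k"
    by (rule pullT[OF c, of k]) simp_all
  note [simp] = k(2-6) T_D[OF k(1)]
  have eqs: "c \<cdot> f = f' \<cdot> p" "i \<cdot> p = a" "i \<cdot> v = g \<cdot> a'" using e unfolding extension_def by blast+
  have kb: "k' \<cdot> (c \<cdot> b) = c' \<cdot> (k \<cdot> b)" and kf: "k' \<cdot> (c \<cdot> f) = c' \<cdot> (k \<cdot> f)"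
    using comp_reduce[OF k(7), of b] comp_reduce[OF k(7), of f] by simp_all
  have D: "c' \<cdot> (k \<cdot> b) \<in> D" by (rule D_comp) simp_all
  have 1: "extension g (k \<cdot> b) (k \<cdot> f) a c' (k' \<cdot> f') i p v a'"
    unfolding extension_def by (simp add: g D eqs kf[symmetric])
  have 2: "(k \<cdot> b, k \<cdot> f, a) \<in> TA" by (simp add: TA_iff)
  have 3: "feq (c \<cdot> b, f' \<cdot> v, a') (k' \<cdot> (c \<cdot> b), k' \<cdot> (f' \<cdot> v), a')"
    by (intro feq_left extension_TA[OF left(1) g e]) (use D kb in simp_all)
  have "ext g (k \<cdot> b, k \<cdot> f, a) (c' \<cdot> (k \<cdot> b), (k' \<cdot> f') \<cdot> v, a')"
    by (rule extI[OF 1])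
  then have "ext g (k \<cdot> b, k \<cdot> f, a) (k' \<cdot> (c \<cdot> b), k' \<cdot> (f' \<cdot> v), a')"
    by (simp add: kb)
  then have "feq (k' \<cdot> (c \<cdot> b), k' \<cdot> (f' \<cdot> v), a') y'"
    using left(7) g by (intro ext_unique[OF 2]) auto
  moreover have "feq y (c \<cdot> b, f' \<cdot> v, a')"
    using left(6) g extI[OF e] by (intro ext_unique[OF left(1)]) auto
  ultimately show ?case using 3 by (meson feq_trans)
next
  case (refl x) then show ?case by (rule ext_unique)
next
  case (sym x z) then show ?case by (metis feq_sym feq_type)
next
  case (trans x z w)
  obtain u where "ext g z u" using ext_exists[of z g] trans by (metis feq_type)
  then show ?case using trans by (metis feq_trans feq_type)
qed

text \<open>Right multiplication in the localisation, carried out on 3-arrows. It is a relation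
  because composing with a forward letter involves choices; its result is determined up to fraction
  equality.\<close>

fun acts :: "'m step list \<Rightarrow> 'm \<times> 'm \<times> 'm \<Rightarrow> 'm \<times> 'm \<times> 'm \<Rightarrow> bool" where
  "acts [] x y \<longleftrightarrow> y = x"
| "acts (Fwd g # s) x y \<longleftrightarrow> (\<exists>z. ext g x z \<and> acts s z y)"
| "acts (Bwd w # s) (b, f, a) y \<longleftrightarrow> acts s (b, f, w \<cdot> a) y"

lemma acts_append: "acts (s @ t) x y \<longleftrightarrow> (\<exists>z. acts s x z \<and> acts t z y)"
proof (induction s x y rule: acts.induct)
  case (2 g s x y)
  then show ?case by (simp del: split_paired_Ex) blast
qed auto

lemma TA_Bwd: "(b, f, a) \<in> TA \<Longrightarrow> w \<in> D \<Longrightarrow> Cod C w = Dom C a \<Longrightarrow> (b, f, w \<cdot> a) \<in> TA"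
  by (simp add: TA_iff)

lemma feq_Bwd:
  assumes "feq (b, f, a) (b', f', a')" "w \<in> D" "Cod C w = Dom C a"
  shows "feq (b, f, w \<cdot> a) (b', f', w \<cdot> a')"
proof -
  have "feq x y \<Longrightarrow> Cod C w = tgt3 x \<Longrightarrow>
      feq (fst x, fst (snd x), w \<cdot> snd (snd x)) (fst y, fst (snd y), w \<cdot> snd (snd y))" for x y
  proof (induction rule: fraction_eq.induct)
    case (right b f a c)
    have [simp]: "b \<in> D" "a \<in> D" "c \<in> Arr C" "Cod C a = Dom C c" "f \<in> Arr C" "a \<cdot> c \<in> D"
      using right by (auto simp: TA_iff composable_def)
    have "w \<cdot> (a \<cdot> c) \<in> D" by (rule D_comp) (use right assms(2) in simp_all)
    then show ?case
      using feq_right[OF TA_Bwd[OF right(1) assms(2)], of c] right assms(2) by simp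
  next
    case (left b f a c)
    then show ?case using feq_left[OF TA_Bwd[OF left(1) assms(2)], of c] by (simp add: composable_def)
  next
    case (refl x)
    then show ?case using assms(2) by (cases x) (auto intro!: fraction_eq.refl TA_Bwd)
  next
    case (sym x y)
    then show ?case using feq_type[OF sym(1)] by (simp add: feq_sym)
  next
    case (trans x y z)
    then show ?case using feq_type[OF trans(1)] by (metis feq_trans)
  qed
  from this[OF assms(1)] show ?thesis using assms(3) by simp
qed

lemma acts_type:
  "acts s x y \<Longrightarrow> x \<in> TA \<Longrightarrow> zigzag C D (tgt3 x) s Y \<Longrightarrow>
    y \<in> TA \<and> tgt3 y = Y \<and> Cod C (fst y) = Cod C (fst x)"
proof (induction s x y rule: acts.induct)
  case (2 g s x y)
  then obtain z where z: "ext g x z" "acts s z y" by auto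
  show ?case using 2(1)[OF z(2)] ext_type[OF z(1)] 2(3,4) by simp
next
  case (3 w s b f a y)
  moreover have "a \<in> D" using 3 by (simp add: TA_iff)
  ultimately show ?case using TA_Bwd[of b f a w] by simp
qed auto

lemma acts_exists: "x \<in> TA \<Longrightarrow> zigzag C D (tgt3 x) s Y \<Longrightarrow> \<exists>y. acts s x y"
proof (induction s arbitrary: x)
  case (Cons st s)
  obtain b f a where x: "x = (b, f, a)" by (cases x)
  show ?case
  proof (cases st)
    case (Fwd g)
    have g: "g \<in> Arr C" "Dom C g = tgt3 x" "zigzag C D (Cod C g) s Y" using Cons.prems Fwd by auto
    obtain z where z: "ext g x z" using ext_exists[OF Cons.prems(1) g(1,2)] by blast
    have "\<exists>y. acts s z y" using Cons.IH[of z] ext_type[OF z Cons.prems(1) g(1,2)] g(3) by simp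
    then show ?thesis using z unfolding Fwd acts.simps by blast
  next
    case (Bwd w)
    have "a \<in> D" using Cons.prems x by (simp add: TA_iff)
    with Bwd show ?thesis using Cons.IH[of "(b, f, w \<cdot> a)"] Cons.prems x TA_Bwd[of b f a w] by simp
  qed
qed auto

lemma acts_feq:
  "\<lbrakk>feq x x'; zigzag C D (tgt3 x) s Y; acts s x y; acts s x' y'\<rbrakk> \<Longrightarrow> feq y y'"
proof (induction s arbitrary: x x')
  case (Cons st s)
  obtain b f a b' f' a' where x: "x = (b, f, a)" "x' = (b', f', a')" by (cases x, cases x')
  show ?case
  proof (cases st)
    case (Fwd g)
    then obtain z z' where z: "ext g x z" "acts s z y" "ext g x' z'" "acts s z' y'" using Cons by auto
    have g: "g \<in> Arr C" "Dom C g = tgt3 x" "zigzag C D (Cod C g) s Y" using Cons Fwd by auto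
    have "feq z z'" by (rule ext_feq[OF Cons.prems(1) g(1,2) z(1,3)])
    then show ?thesis using Cons.IH z g ext_type[OF z(1)] feq_type[OF Cons.prems(1)] by metis
  next
    case (Bwd w)
    have "a \<in> D" using feq_type[OF Cons.prems(1)] x by (simp add: TA_iff)
    moreover have "w \<in> D" "Cod C w = Dom C a" "zigzag C D (Dom C w) s Y" using Cons.prems x Bwd by auto
    ultimately show ?thesis
      using Cons.IH[OF feq_Bwd[OF Cons.prems(1)[unfolded x], of w]] Cons.prems(3,4) by (simp add: x Bwd)
  qed
qed auto

text \<open>The core of the faithfulness of double fractions: each generating rule of the zigzag
  congruence acts trivially up to fraction equality, as it must if the action is to factor through
  the localisation.\<close>

lemma acts_rule:
  assumes r: "zigzag_rule C D u v" and x: "x \<in> TA" and z: "zigzag C D (tgt3 x) u Y" "zigzag C D (tgt3 x) v Y"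
  shows "\<exists>y y'. acts u x y \<and> acts v x y' \<and> feq y y'"
proof -
  obtain b f a where xe: "x = (b, f, a)" by (cases x)
  have bfa: "(b, f, a) \<in> TA" and [simp]: "b \<in> D" "f \<in> Arr C" "a \<in> D" "Dom C f = Dom C b" "Cod C f = Cod C a"
    using x by (auto simp: xe TA_iff)
  show ?thesis using r
  proof cases
    case (1 g h)
    have g: "g \<in> Arr C" "Dom C g = Dom C a" and h: "h \<in> Arr C" "Dom C h = Cod C g"
      using 1 z xe by (auto simp: composable_def)
    obtain c f' i p v a' where e: "extension g b f a c f' i p v a'" "a' \<in> S"
      by (rule extension_exists[OF bfa g])
    note [simp] = extension_simps[OF bfa g e(1)] g h
    have eqs: "c \<cdot> f = f' \<cdot> p" "i \<cdot> p = a" "i \<cdot> v = g \<cdot> a'" using e(1) unfolding extension_def by blast+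
    \<comment> \<open>The last leg \<open>a'\<close> after the action of \<open>g\<close> is an
      S-denominator, so it serves as its own first factor and the action of \<open>h\<close> takes
      only one more pushout. The two pushout squares, placed side by side, give the extension along
      \<open>g \<cdot> h\<close>.\<close>
    obtain w a'' where p: "a'' \<in> S" "w \<in> Arr C" "a'' \<in> Arr C" "Dom C w = Cod C a'" "Dom C a'' = Cod C h"
      "Cod C w = Cod C a''" "a' \<cdot> w = h \<cdot> a''"
      by (rule pushS[OF e(2), of h]) simp_all
    note [simp] = p(2-6) S_D[OF p(1)]
    have "ext g x (c \<cdot> b, f' \<cdot> v, a')" unfolding xe by (rule extI[OF e(1)])
    moreover have "ext h (c \<cdot> b, f' \<cdot> v, a') (Ident C (Dom C c) \<cdot> (c \<cdot> b), (f' \<cdot> v) \<cdot> w, a'')"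
      by (rule extI[of _ _ _ _ _ _ a' "Ident C (Cod C a')"]) (simp add: extension_def p(7))
    moreover have "ext (g \<cdot> h) x (c \<cdot> b, f' \<cdot> (v \<cdot> w), a'')"
      unfolding xe
      by (rule extI[of _ _ _ _ _ _ i p])
        (simp add: extension_def eqs p(7) comp_reduce[OF eqs(3)])
    moreover have "(c \<cdot> b, f' \<cdot> (v \<cdot> w), a'') \<in> TA" by (simp add: TA_iff)
    ultimately show ?thesis unfolding 1 using fraction_eq.refl[of _ C D] by fastforce
  next
    case (2 X)
    have X: "X = Dom C a" using z xe 2 by simp
    have "ext (Ident C X) x (Ident C (Dom C b) \<cdot> b, f \<cdot> Ident C (Cod C f), a)"
      unfolding xe
      by (rule extI[of _ _ _ _ _ _ a "Ident C (Cod C a)"]) (simp add: extension_def X)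
    then have "ext (Ident C X) x x" by (simp add: xe)
    then have "acts u x x" "acts v x x" unfolding 2 acts.simps by blast+
    then show ?thesis using fraction_eq.refl[OF x] by blast
  next
    case (3 w)
    have w [simp]: "w \<in> D" and g: "w \<in> Arr C" "Dom C w = Dom C a" using 3 z xe by auto
    obtain c f' i p v a' where e: "extension w b f a c f' i p v a'" "a' \<in> S"
      by (rule extension_exists[OF bfa g])
    note [simp] = extension_simps[OF bfa g e(1)]
    have eqs: "c \<cdot> f = f' \<cdot> p" "i \<cdot> p = a" "i \<cdot> v = w \<cdot> a'" using e(1) unfolding extension_def by blast+
    have "ext w x (c \<cdot> b, f' \<cdot> v, a')" unfolding xe by (rule extI[OF e(1)])
    then have 1: "acts u x (c \<cdot> b, f' \<cdot> v, w \<cdot> a')" using 3 by auto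
    have t: "(c \<cdot> b, f', i) \<in> TA" by (simp add: TA_iff)
    have "w \<cdot> a' \<in> D" by simp
    then have "feq (c \<cdot> b, f', i) (c \<cdot> b, f' \<cdot> v, i \<cdot> v)"
      by (intro feq_right[OF t]) (simp_all add: eqs)
    moreover have "feq (c \<cdot> b, f', i) (c \<cdot> b, f' \<cdot> p, i \<cdot> p)"
      by (intro feq_right[OF t]) (simp_all add: eqs)
    moreover have "feq (b, f, a) (c \<cdot> b, c \<cdot> f, a)"
      by (intro feq_left[OF bfa]) simp_all
    ultimately have "feq (c \<cdot> b, f' \<cdot> v, w \<cdot> a') x"
      unfolding eqs xe by (meson feq_sym feq_trans)
    then show ?thesis using 1 3 by auto
  next
    case (4 w)
    have w [simp]: "w \<in> D" and g: "Cod C w = Dom C a" using 4 z xe by auto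
    \<comment> \<open>The last leg already begins with \<open>w\<close>, so the square demanded by
      \<open>extension\<close> is closed by an identity and \<open>a\<close>.\<close>
    have "ext w (b, f, w \<cdot> a) (Ident C (Dom C b) \<cdot> b, f \<cdot> Ident C (Cod C f), a)"
      by (rule extI[of _ _ _ _ _ _ "w \<cdot> a" "Ident C (Cod C a)"]) (simp add: extension_def g)
    then have "ext w (b, f, w \<cdot> a) x" by (simp add: xe)
    then have "acts u x x" using 4 xe by auto
    moreover have "acts v x x" using 4 by simp
    ultimately show ?thesis using fraction_eq.refl[OF x] by blast
  qed
qed

text \<open>At a rewriting inside a word, \<open>acts_rule\<close> handles the middle, and
  \<open>acts_feq\<close> carries fraction equality through the prefix and the suffix.\<close>

lemma acts_zeq:
  assumes "zeq X s t Y" "x \<in> TA" "tgt3 x = X" "acts s x y" "acts t x y'"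
  shows "feq y y'"
proof -
  have "(p, q) \<in> zigzag_eq C D \<Longrightarrow> (\<And>s t y y'. p = (X, s, Y) \<Longrightarrow> q = (X, t, Y) \<Longrightarrow>
    acts s x y \<Longrightarrow> acts t x y' \<Longrightarrow> feq y y')" for p q
  proof (induction rule: zigzag_eq.induct)
    case (rule u v X' l r Y')
    obtain x1 x2 where a: "acts l x x1" "acts u x1 x2" "acts r x2 y" using rule by (auto simp: acts_append)
    obtain x1' x2' where b: "acts l x x1'" "acts v x1' x2'" "acts r x2' y'" using rule by (auto simp: acts_append)
    obtain Z Z' where Z: "zigzag C D X l Z" and Z': "zigzag C D Z u Z'" "zigzag C D Z' r Y"
      and Z3: "zigzag C D Z v Z'"
      using zigzag_rule_ends[OF rule(1)] rule by blast
    have zl: "zigzag C D (tgt3 x) l Z" using Z assms(3) by simp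
    have x1: "x1 \<in> TA" "tgt3 x1 = Z" using acts_type[OF a(1) assms(2) zl] by auto
    have x1': "x1' \<in> TA" "tgt3 x1' = Z" using acts_type[OF b(1) assms(2) zl] by auto
    have 1: "feq x1 x1'"
      using acts_feq[OF fraction_eq.refl[OF assms(2)] zl a(1) b(1)] .
    obtain z z' where z: "acts u x1 z" "acts v x1 z'" "feq z z'"
      using acts_rule[OF rule(1) x1(1), of Z'] Z' Z3 x1 by auto
    have "feq x2 z" using acts_feq[OF fraction_eq.refl[OF x1(1)] _ a(2) z(1)] Z' x1 by auto
    moreover have "feq z' x2'" using acts_feq[OF 1 _ z(2) b(2)] Z3 x1 by auto
    ultimately have 2: "feq x2 x2'" using z(3) by (meson feq_trans)
    have "tgt3 x2 = Z'" using acts_type[OF a(2) x1(1)] Z' x1 by auto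
    then show ?case using acts_feq[OF 2 _ a(3) b(3)] Z' by auto
  next
    case (refl X' s Y')
    then show ?case using acts_feq[OF fraction_eq.refl[OF assms(2)], of s Y] assms(3) by auto
  next
    case (sym p q)
    then show ?case by (metis feq_sym)
  next
    case (trans p q r)
    obtain u where u: "q = (X, u, Y)" "zigzag C D X u Y" using zigzag_eq_type[OF trans.hyps(1)] trans.prems by auto
    then obtain z where "acts u x z" using acts_exists[OF assms(2)] assms(3) by metis
    then show ?case
      using trans.IH(1)[OF trans.prems(1) u(1) trans.prems(3)] trans.IH(2)[OF u(1) trans.prems(2) _ trans.prems(4)]
      by (metis feq_trans)
  qed
  then show ?thesis using assms by blast
qed

section \<open>Double fractions as elements of the localisation\<close>

definition frac_loc :: "'m \<times> 'm \<times> 'm \<Rightarrow> ('o \<times> 'm step list \<times> 'o) set" where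
  "frac_loc x = (case x of (b, f, a) \<Rightarrow> LB b \<cdot>\<^bsub>Loc\<^esub> (LF f \<cdot>\<^bsub>Loc\<^esub> LB a))"

lemma frac_loc_arr:
  assumes "x \<in> TA"
  shows "frac_loc x \<in> Arr Loc" "Dom Loc (frac_loc x) = Cod C (fst x)" "Cod Loc (frac_loc x) = tgt3 x"
  using assms by (auto simp: frac_loc_def TA_iff split: prod.splits)

lemma LF_LB_reduce: "w \<in> D \<Longrightarrow> k \<in> Arr Loc \<Longrightarrow> Dom Loc k = Dom C w \<Longrightarrow> LF w \<cdot>\<^bsub>Loc\<^esub> (LB w \<cdot>\<^bsub>Loc\<^esub> k) = k"
  and LB_LF_reduce: "w \<in> D \<Longrightarrow> k \<in> Arr Loc \<Longrightarrow> Dom Loc k = Cod C w \<Longrightarrow> LB w \<cdot>\<^bsub>Loc\<^esub> (LF w \<cdot>\<^bsub>Loc\<^esub> k) = k"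
  using Loc.comp_reduce[OF LF_LB] Loc.comp_reduce[OF LB_LF] Loc.id_comp by auto

lemma frac_loc_feq: "feq x y \<Longrightarrow> frac_loc x = frac_loc y"
proof (induction rule: fraction_eq.induct)
  case (right b f a c)
  have [simp]: "b \<in> D" "f \<in> Arr C" "a \<in> D" "Dom C f = Dom C b" "Cod C f = Dom C c" "c \<in> Arr C" "Cod C a = Dom C c"
    using right by (auto simp: TA_iff composable_def)
  have [simp]: "c \<in> D" by (rule D_right[of a]) (use right in simp_all)
  show ?case by (simp add: frac_loc_def LF_comp LB_comp LF_LB_reduce)
next
  case (left b f a c)
  have [simp]: "b \<in> D" "f \<in> Arr C" "a \<in> D" "Dom C f = Dom C b" "Cod C f = Cod C a" "c \<in> Arr C" "Cod C c = Dom C b"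
    using left by (auto simp: TA_iff composable_def)
  have [simp]: "c \<in> D" by (rule D_left[of _ b]) (use left in simp_all)
  show ?case by (simp add: frac_loc_def LF_comp LB_comp LB_LF_reduce)
qed simp_all

text \<open>A commutative square with two parallel denominators can be traversed backwards along
  them. All comparisons of composites below reduce to this.\<close>

lemma LF_LB_commute:
  assumes "f \<in> Arr C" "q \<in> D" "q' \<in> D" "f' \<in> Arr C" "Dom C f' = Dom C q'" "Cod C f' = Dom C q"
    "Cod C q' = Dom C f" "Cod C f = Cod C q" "f' \<cdot> q = q' \<cdot> f"
  shows "LB q' \<cdot>\<^bsub>Loc\<^esub> LF f' = LF f \<cdot>\<^bsub>Loc\<^esub> LB q"
proof -
  have "LF f' \<cdot>\<^bsub>Loc\<^esub> LF q = LF q' \<cdot>\<^bsub>Loc\<^esub> LF f" using assms by (simp flip: LF_comp)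
  then have "LB q' \<cdot>\<^bsub>Loc\<^esub> ((LF f' \<cdot>\<^bsub>Loc\<^esub> LF q) \<cdot>\<^bsub>Loc\<^esub> LB q) = LB q' \<cdot>\<^bsub>Loc\<^esub> ((LF q' \<cdot>\<^bsub>Loc\<^esub> LF f) \<cdot>\<^bsub>Loc\<^esub> LB q)"
    by simp
  then show ?thesis using assms by (simp add: LF_LB LB_LF_reduce del: Loc_simps(2-))
qed

lemma frac_loc_ext:
  assumes "ext g x y" "x \<in> TA" "g \<in> Arr C" "Dom C g = tgt3 x"
  shows "frac_loc y = frac_loc x \<cdot>\<^bsub>Loc\<^esub> LF g"
proof -
  obtain b f a c f' i p v a' where xy: "x = (b, f, a)" "y = (c \<cdot> b, f' \<cdot> v, a')"
    and e: "extension g b f a c f' i p v a'"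
    using assms(1) by (auto simp: ext_def)
  have bfa: "(b, f, a) \<in> TA" and g: "g \<in> Arr C" "Dom C g = Dom C a" using assms xy by simp_all
  have [simp]: "b \<in> D" "f \<in> Arr C" "a \<in> D" "Dom C f = Dom C b" "Cod C f = Cod C a"
    using bfa by (simp_all add: TA_iff)
  note [simp] = extension_simps[OF bfa g e] g
  have eqs: "f' \<cdot> p = c \<cdot> f" "i \<cdot> p = a" "i \<cdot> v = g \<cdot> a'" using e unfolding extension_def by simp_all
  have [simp]: "c \<in> D" by (rule D_left[of _ b]) simp_all
  have [simp]: "p \<in> D" by (rule D_right[of i]) (simp_all add: eqs)
  have 1: "LB c \<cdot>\<^bsub>Loc\<^esub> LF f' = LF f \<cdot>\<^bsub>Loc\<^esub> LB p" by (rule LF_LB_commute) (simp_all add: eqs)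
  have 2: "LF v \<cdot>\<^bsub>Loc\<^esub> LB a' = LB i \<cdot>\<^bsub>Loc\<^esub> LF g" by (rule LF_LB_commute[symmetric]) (simp_all add: eqs)
  have 3: "LB a = LB p \<cdot>\<^bsub>Loc\<^esub> LB i" using LB_comp[of i p] by (simp add: eqs)
  have "frac_loc y = LB b \<cdot>\<^bsub>Loc\<^esub> ((LB c \<cdot>\<^bsub>Loc\<^esub> LF f') \<cdot>\<^bsub>Loc\<^esub> (LF v \<cdot>\<^bsub>Loc\<^esub> LB a'))"
    by (simp add: xy frac_loc_def LF_comp LB_comp)
  also have "\<dots> = frac_loc x \<cdot>\<^bsub>Loc\<^esub> LF g" unfolding 1 2 by (simp add: xy frac_loc_def 3)
  finally show ?thesis .
qed

lemma frac_loc_acts: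
  "\<lbrakk>acts s x y; x \<in> TA; zigzag C D (tgt3 x) s Y\<rbrakk> \<Longrightarrow> frac_loc y = frac_loc x \<cdot>\<^bsub>Loc\<^esub> zcl (tgt3 x) s Y"
proof (induction s x y rule: acts.induct)
  case (1 x y)
  then show ?case using Loc.comp_id[OF frac_loc_arr(1)] by (auto simp: frac_loc_arr)
next
  case (2 g s x y)
  then obtain z where z: "ext g x z" "acts s z y" by auto
  have g: "g \<in> Arr C" "Dom C g = tgt3 x" "zigzag C D (Cod C g) s Y" using 2 by auto
  have zt: "z \<in> TA" "tgt3 z = Cod C g" using ext_type[OF z(1)] 2 g by auto
  have "frac_loc y = (frac_loc x \<cdot>\<^bsub>Loc\<^esub> LF g) \<cdot>\<^bsub>Loc\<^esub> zcl (Cod C g) s Y"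
    using 2(1)[OF z(2) zt(1)] zt g frac_loc_ext[OF z(1) 2(3) g(1,2)] by simp
  also have "\<dots> = frac_loc x \<cdot>\<^bsub>Loc\<^esub> (LF g \<cdot>\<^bsub>Loc\<^esub> zcl (Cod C g) s Y)"
    using 2(3) g by (simp add: frac_loc_arr)
  also have "LF g \<cdot>\<^bsub>Loc\<^esub> zcl (Cod C g) s Y = zcl (tgt3 x) (Fwd g # s) Y"
    using zcl_comp[of "Dom C g" "[Fwd g]" "Cod C g" s Y] g by (simp add: LF_def)
  finally show ?case .
next
  case (3 w s b f a y)
  have w: "w \<in> D" "Cod C w = Dom C a" "zigzag C D (Dom C w) s Y" using 3 by auto
  have [simp]: "b \<in> D" "f \<in> Arr C" "a \<in> D" "Dom C f = Dom C b" "Cod C f = Cod C a"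
    using 3 by (simp_all add: TA_iff)
  have "frac_loc y = frac_loc (b, f, w \<cdot> a) \<cdot>\<^bsub>Loc\<^esub> zcl (Dom C w) s Y"
    using 3(1) TA_Bwd[OF 3(3) w(1,2)] 3(2) w by simp
  also have "\<dots> = frac_loc (b, f, a) \<cdot>\<^bsub>Loc\<^esub> (LB w \<cdot>\<^bsub>Loc\<^esub> zcl (Dom C w) s Y)"
    using w by (simp add: frac_loc_def LB_comp)
  also have "LB w \<cdot>\<^bsub>Loc\<^esub> zcl (Dom C w) s Y = zcl (Dom C a) (Bwd w # s) Y"
    using zcl_comp[of "Cod C w" "[Bwd w]" "Dom C w" s Y] w by (simp add: LB_def)
  finally show ?case by simp
qed

lemma acts_three_arrow:
  assumes "(b, f, a) \<in> TA"
  shows "acts [Bwd b, Fwd f, Bwd a] (Ident C (Cod C b), Ident C (Cod C b), Ident C (Cod C b)) (b, f, a)"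
proof -
  have [simp]: "b \<in> D" "f \<in> Arr C" "a \<in> D" "Dom C f = Dom C b" "Cod C f = Cod C a"
    using assms by (simp_all add: TA_iff)
  have "ext f (Ident C (Cod C b), Ident C (Cod C b), b)
    (b \<cdot> Ident C (Cod C b), Ident C (Dom C b) \<cdot> f, Ident C (Cod C f))"
    by (rule extI[of _ _ _ _ _ _ "Ident C (Dom C b)" b]) (simp add: extension_def)
  then show ?thesis by (auto intro!: exI[of _ "Ident C (Cod C a)"])
qed

lemma Ident_TA: "X \<in> Obj C \<Longrightarrow> (Ident C X, Ident C X, Ident C X) \<in> TA"
  by (simp add: TA_iff)

text \<open>Equal elements of the localisation are represented by equal words up to
  \<open>zeq\<close>. Acting on the identity 3-arrow, the two words return \<open>(b, f, a)\<close>
  and \<open>(b', f', a')\<close>, which are therefore fraction equal.\<close>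

lemma frac_loc_inject:
  assumes "x \<in> TA" "y \<in> TA" "frac_loc x = frac_loc y"
  shows "feq x y"
proof -
  obtain b f a b' f' a' where xy: "x = (b, f, a)" "y = (b', f', a')" by (cases x, cases y)
  note [simp] = assms(1)[unfolded xy TA_iff] assms(2)[unfolded xy TA_iff]
  have e: "Cod C b' = Cod C b" "Dom C a' = Dom C a"
    using assms frac_loc_arr[OF assms(1)] frac_loc_arr[OF assms(2)] by (simp_all add: xy)
  have *: "frac_loc (b, f, a) = zcl (Cod C b) [Bwd b, Fwd f, Bwd a] (Dom C a)" if "(b, f, a) \<in> TA" for b f a
    using that by (auto simp: frac_loc_def LB_def LF_def zcl_comp TA_iff)
  have z: "zigzag C D (Cod C b) [Bwd b, Fwd f, Bwd a] (Dom C a)" if "(b, f, a) \<in> TA" for b f a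
    using that by (auto simp: TA_iff)
  have "zeq (Cod C b) [Bwd b, Fwd f, Bwd a] [Bwd b', Fwd f', Bwd a'] (Dom C a)"
    using assms(3) z[OF assms(1)[unfolded xy]] z[OF assms(2)[unfolded xy]]
      *[OF assms(1)[unfolded xy]] *[OF assms(2)[unfolded xy]] unfolding xy e
    by (subst zcl_eq_iff[symmetric]) simp_all
  then show ?thesis unfolding xy
  proof (rule acts_zeq)
    show "acts [Bwd b, Fwd f, Bwd a] (Ident C (Cod C b), Ident C (Cod C b), Ident C (Cod C b)) (b, f, a)"
      by (rule acts_three_arrow[OF assms(1)[unfolded xy]])
    show "acts [Bwd b', Fwd f', Bwd a'] (Ident C (Cod C b), Ident C (Cod C b), Ident C (Cod C b)) (b', f', a')"
      using acts_three_arrow[OF assms(2)[unfolded xy]] unfolding e .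
  qed (simp_all add: Ident_TA)
qed

text \<open>The 3-arrow sought is what a representing word makes of the identity 3-arrow.\<close>

lemma frac_loc_surj:
  assumes "A \<in> Arr Loc"
  obtains x where "x \<in> TA" "frac_loc x = A"
proof -
  obtain X s Y where A: "zigzag C D X s Y" "A = zcl X s Y" using assms by (rule Loc_arrE)
  have X: "X \<in> Obj C" using zigzag_ends[OF A(1)] by simp
  let ?x = "(Ident C X, Ident C X, Ident C X)"
  have z: "zigzag C D (tgt3 ?x) s Y" using A X by simp
  obtain y where y: "acts s ?x y" using acts_exists[OF Ident_TA[OF X] z] by auto
  have "LF (Ident C X) = Ident Loc X" by (rule LF_id[OF X])
  moreover have "LB (Ident C X) = Ident Loc X"
    using LB_LF[of "Ident C X"] X Loc.comp_id[of "LB (Ident C X)" X] LF_id[OF X] by simp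
  ultimately have "frac_loc ?x = Ident Loc X"
    using X Loc.id_comp[OF Loc.id_arr(1), of X] by (simp add: frac_loc_def)
  then have "frac_loc y = A"
    using frac_loc_acts[OF y Ident_TA[OF X] z] A X Loc.id_comp[of "zcl X s Y" X] by simp
  then show thesis using that acts_type[OF y Ident_TA[OF X] z] by blast
qed

section \<open>The fraction category is isomorphic to the localisation\<close>

lemma fraction_equiv: "equiv TA (fraction_eq C D)"
proof (rule equivI)
  show "fraction_eq C D \<subseteq> TA \<times> TA" using feq_type by auto
  show "refl_on TA (fraction_eq C D)" by (auto simp: refl_on_def intro: fraction_eq.refl)
  show "sym (fraction_eq C D)" by (rule symI) (rule feq_sym)
  show "trans (fraction_eq C D)" by (rule transI) (rule feq_trans)
qed

abbreviation Fr :: "('o, ('m \<times> 'm \<times> 'm) set) cat" where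
  "Fr \<equiv> Frac C D S T"

text \<open>The choice of a representative is harmless by \<open>frac_loc_feq\<close>.\<close>

definition Frac_Loc :: "('m \<times> 'm \<times> 'm) set \<Rightarrow> ('o \<times> 'm step list \<times> 'o) set" where
  "Frac_Loc A = frac_loc (SOME x. x \<in> A)"

lemma Frac_Loc_class: "x \<in> TA \<Longrightarrow> Frac_Loc (fraction_eq C D `` {x}) = frac_loc x"
  unfolding Frac_Loc_def by (rule someI2[of _ x]) (auto intro: fraction_eq.refl dest: frac_loc_feq)

lemma Frac_dom: "x \<in> TA \<Longrightarrow> Dom Fr (fraction_eq C D `` {x}) = Cod C (fst x)"
  and Frac_cod: "x \<in> TA \<Longrightarrow> Cod Fr (fraction_eq C D `` {x}) = tgt3 x"
proof -
  assume x: "x \<in> TA"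
  have r: "(fst x, fst (snd x), snd (snd x)) \<in> fraction_eq C D `` {x}" using fraction_eq.refl[OF x] by simp
  have "(THE X. \<exists>(b, f, a)\<in>fraction_eq C D `` {x}. X = Cod C b) = Cod C (fst x)"
  proof (rule the_equality)
    show "\<exists>(b, f, a)\<in>fraction_eq C D `` {x}. Cod C (fst x) = Cod C b" using r by blast
    show "X = Cod C (fst x)" if h: "\<exists>(b, f, a)\<in>fraction_eq C D `` {x}. X = Cod C b" for X
    proof -
      obtain b f a where "feq x (b, f, a)" "X = Cod C b" using h by auto
      then show ?thesis using feq_type[of x "(b, f, a)"] by simp
    qed
  qed
  then show "Dom Fr (fraction_eq C D `` {x}) = Cod C (fst x)" by (simp add: Frac_def)
  have "(THE X. \<exists>(b, f, a)\<in>fraction_eq C D `` {x}. X = Dom C a) = tgt3 x"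
  proof (rule the_equality)
    show "\<exists>(b, f, a)\<in>fraction_eq C D `` {x}. tgt3 x = Dom C a" using r by blast
    show "X = tgt3 x" if h: "\<exists>(b, f, a)\<in>fraction_eq C D `` {x}. X = Dom C a" for X
    proof -
      obtain b f a where "feq x (b, f, a)" "X = Dom C a" using h by auto
      then show ?thesis using feq_type[of x "(b, f, a)"] by simp
    qed
  qed
  then show "Cod Fr (fraction_eq C D `` {x}) = tgt3 x" by (simp add: Frac_def)
qed

lemma Frac_arrE:
  assumes "A \<in> Arr Fr"
  obtains x where "x \<in> TA" "A = fraction_eq C D `` {x}"
  using assms by (simp add: Frac_def) (erule quotientE)

text \<open>For any choice of auxiliary arrows, the two squares and
  \<open>j \<cdot> q = b2 \<cdot> a1\<close> allow the inverses to be moved past \<open>f1\<close>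
  and \<open>f2\<close>. Together with the injectivity of \<open>frac_loc\<close> this makes the
  composite independent of all choices.\<close>

lemma Frac_Loc_comp_rel:
  assumes x: "x \<in> TA" and y: "y \<in> TA" and xy: "tgt3 x = Cod C (fst y)"
    and F: "fraction_comp_rel C D S T (fraction_eq C D `` {x}) (fraction_eq C D `` {y}) F"
  obtains z where "z \<in> TA" "F = fraction_eq C D `` {z}" "frac_loc z = frac_loc x \<cdot>\<^bsub>Loc\<^esub> frac_loc y"
proof -
  obtain b1 f1 a1 b2 f2 a2 j q q' f1' j' f2' where *: "feq x (b1, f1, a1)" "feq y (b2, f2, a2)"
      "j \<in> S" "q \<in> T" "commutes C b2 a1 j q" "q' \<in> T" "commutes C f1' q q' f1"
      "j' \<in> S" "commutes C j f2' f2 j'"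
      "F = double_fraction C D (q' \<cdot> b1) (f1' \<cdot> f2') (a2 \<cdot> j')"
    using F unfolding fraction_comp_rel_def by blast
  have "(b1, f1, a1) \<in> TA" "(b2, f2, a2) \<in> TA" using *(1,2) feq_type by blast+
  then have [simp]: "b1 \<in> D" "f1 \<in> Arr C" "a1 \<in> D" "Dom C f1 = Dom C b1" "Cod C f1 = Cod C a1"
    "b2 \<in> D" "f2 \<in> Arr C" "a2 \<in> D" "Dom C f2 = Dom C b2" "Cod C f2 = Cod C a2"
    by (auto simp: TA_iff)
  note [simp] = S_D[OF *(3)] T_D[OF *(4)] T_D[OF *(6)] S_D[OF *(8)]
  have c: "composable C b2 a1" "composable C j q" "j \<cdot> q = b2 \<cdot> a1" "composable C f1' q" "composable C q' f1"
    "f1' \<cdot> q = q' \<cdot> f1" "composable C j f2'" "composable C f2 j'" "j \<cdot> f2' = f2 \<cdot> j'"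
    using *(5,7,9) by (auto simp: commutes_def)
  have f': "f1' \<in> Arr C" "f2' \<in> Arr C" using c by (auto simp: composable_def)
  have cd: "Cod C b2 = Dom C a1" "Cod C j = Dom C q" "Cod C f1' = Dom C q" "Cod C q' = Dom C b1"
     "Dom C f2' = Dom C q" "Dom C j' = Cod C a2"
    using c by (auto simp: composable_def)
  note [simp] = f' cd
  have dd: "Dom C j = Dom C b2" "Cod C q = Cod C a1" "Dom C f1' = Dom C q'" "Cod C f2' = Cod C j'"
    using arg_cong[OF c(3), of "Dom C"] arg_cong[OF c(3), of "Cod C"] arg_cong[OF c(6), of "Dom C"]
      arg_cong[OF c(9), of "Cod C"] by simp_all
  note [simp] = dd
  let ?z = "(q' \<cdot> b1, f1' \<cdot> f2', a2 \<cdot> j')"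
  have z: "?z \<in> TA" by (simp add: TA_iff)
  have 1: "LB q' \<cdot>\<^bsub>Loc\<^esub> LF f1' = LF f1 \<cdot>\<^bsub>Loc\<^esub> LB q" by (rule LF_LB_commute) (simp_all add: c)
  have 2: "LF f2' \<cdot>\<^bsub>Loc\<^esub> LB j' = LB j \<cdot>\<^bsub>Loc\<^esub> LF f2" by (rule LF_LB_commute[symmetric]) (simp_all add: c)
  have 3: "LB q \<cdot>\<^bsub>Loc\<^esub> LB j = LB a1 \<cdot>\<^bsub>Loc\<^esub> LB b2"
    using LB_comp[of j q] LB_comp[of b2 a1] c(3) by simp
  have "frac_loc ?z = LB b1 \<cdot>\<^bsub>Loc\<^esub> ((LB q' \<cdot>\<^bsub>Loc\<^esub> LF f1') \<cdot>\<^bsub>Loc\<^esub> ((LF f2' \<cdot>\<^bsub>Loc\<^esub> LB j') \<cdot>\<^bsub>Loc\<^esub> LB a2))"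
    by (simp add: frac_loc_def LF_comp LB_comp)
  also have "\<dots> = LB b1 \<cdot>\<^bsub>Loc\<^esub> (LF f1 \<cdot>\<^bsub>Loc\<^esub> ((LB q \<cdot>\<^bsub>Loc\<^esub> LB j) \<cdot>\<^bsub>Loc\<^esub> (LF f2 \<cdot>\<^bsub>Loc\<^esub> LB a2)))"
    unfolding 1 2 by simp
  also have "\<dots> = frac_loc (b1, f1, a1) \<cdot>\<^bsub>Loc\<^esub> frac_loc (b2, f2, a2)"
    unfolding 3 by (simp add: frac_loc_def)
  also have "\<dots> = frac_loc x \<cdot>\<^bsub>Loc\<^esub> frac_loc y"
    using frac_loc_feq[OF *(1)] frac_loc_feq[OF *(2)] by simp
  finally show thesis using that[OF z] *(10) by (simp add: double_fraction_def)
qed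

text \<open>A candidate for the composite exists by factorisation, weak pullback and weak pushout;
  any two candidates have the same image in the localisation and hence coincide, so the definite
  description denotes.\<close>

lemma Frac_comp:
  assumes x: "x \<in> TA" and y: "y \<in> TA" and xy: "tgt3 x = Cod C (fst y)"
  obtains z where "z \<in> TA" "fraction_eq C D `` {x} \<cdot>\<^bsub>Fr\<^esub> fraction_eq C D `` {y} = fraction_eq C D `` {z}"
    "frac_loc z = frac_loc x \<cdot>\<^bsub>Loc\<^esub> frac_loc y"
proof -
  let ?R = "fraction_comp_rel C D S T (fraction_eq C D `` {x}) (fraction_eq C D `` {y})"
  obtain b1 f1 a1 b2 f2 a2 where e: "x = (b1, f1, a1)" "y = (b2, f2, a2)" by (cases x, cases y)
  have [simp]: "b1 \<in> D" "f1 \<in> Arr C" "a1 \<in> D" "Dom C f1 = Dom C b1" "Cod C f1 = Cod C a1"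
    "b2 \<in> D" "f2 \<in> Arr C" "a2 \<in> D" "Dom C f2 = Dom C b2" "Cod C f2 = Cod C a2" "Cod C b2 = Dom C a1"
    using x y xy e by (auto simp: TA_iff)
  obtain j q where j: "j \<in> S" "q \<in> T" "j \<in> Arr C" "q \<in> Arr C" "Cod C j = Dom C q" "b2 \<cdot> a1 = j \<cdot> q"
    "Dom C j = Dom C (b2 \<cdot> a1)" "Cod C q = Cod C (b2 \<cdot> a1)"
    by (rule fac[of "b2 \<cdot> a1"]) simp_all
  obtain f1' q' where q: "q' \<in> T" "f1' \<in> Arr C" "q' \<in> Arr C" "Cod C f1' = Dom C q" "Cod C q' = Dom C f1"
     "f1' \<cdot> q = q' \<cdot> f1"
    by (rule pullT[OF j(2), of f1]) (simp_all add: j(3-5,7,8))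
  obtain f2' j' where j': "j' \<in> S" "f2' \<in> Arr C" "j' \<in> Arr C" "Dom C f2' = Cod C j" "Dom C j' = Cod C f2"
     "j \<cdot> f2' = f2 \<cdot> j'"
    by (rule pushS[OF j(1), of f2]) (simp_all add: j(3-5,7,8))
  have "?R (double_fraction C D (q' \<cdot> b1) (f1' \<cdot> f2') (a2 \<cdot> j'))"
    unfolding fraction_comp_rel_def
    by (rule exI[of _ b1], rule exI[of _ f1], rule exI[of _ a1], rule exI[of _ b2], rule exI[of _ f2], rule exI[of _ a2],
        rule exI[of _ j], rule exI[of _ q], rule exI[of _ q'], rule exI[of _ f1'], rule exI[of _ j'], rule exI[of _ f2'])
      (use x y e j q j' in \<open>simp add: fraction_eq.refl commutes_def composable_def\<close>)
  then obtain F where F: "?R F" ..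
  then obtain z where z: "z \<in> TA" "F = fraction_eq C D `` {z}" "frac_loc z = frac_loc x \<cdot>\<^bsub>Loc\<^esub> frac_loc y"
    by (rule Frac_Loc_comp_rel[OF x y xy])
  have "(THE F. ?R F) = F"
  proof (rule the_equality)
    show "?R F" by (rule F)
    fix G assume "?R G"
    then obtain w where w: "w \<in> TA" "G = fraction_eq C D `` {w}" "frac_loc w = frac_loc x \<cdot>\<^bsub>Loc\<^esub> frac_loc y"
      by (rule Frac_Loc_comp_rel[OF x y xy])
    then have "feq w z" using frac_loc_inject[OF w(1) z(1)] z by simp
    then show "G = F" using w z equiv_class_eq[OF fraction_equiv] by simp
  qed
  then show thesis using that[OF z(1)] z by (simp add: Frac_def)
qed

lemma Frac_transport:
  shows "category Fr" "is_functor Fr Loc id Frac_Loc" "isomorphic_categories Fr Loc"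
proof -
  note * = category_transport[of Loc Frac_Loc Fr id]
  have 1: "inj_on Frac_Loc (Arr Fr)"
  proof (rule inj_onI)
    fix A B assume AB: "A \<in> Arr Fr" "B \<in> Arr Fr" "Frac_Loc A = Frac_Loc B"
    obtain x y where x: "x \<in> TA" "A = fraction_eq C D `` {x}" and y: "y \<in> TA" "B = fraction_eq C D `` {y}"
      by (rule Frac_arrE[OF AB(1)], rule Frac_arrE[OF AB(2)])
    then have "feq x y" using AB(3) by (intro frac_loc_inject) (simp_all add: Frac_Loc_class)
    then show "A = B" unfolding x y by (rule equiv_class_eq[OF fraction_equiv])
  qed
  have 2: "Frac_Loc ` Arr Fr = Arr Loc"
  proof
    show "Frac_Loc ` Arr Fr \<subseteq> Arr Loc" by (auto elim!: Frac_arrE simp: Frac_Loc_class frac_loc_arr)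
    show "Arr Loc \<subseteq> Frac_Loc ` Arr Fr"
    proof
      fix A assume "A \<in> Arr Loc"
      then obtain x where "x \<in> TA" "frac_loc x = A" by (rule frac_loc_surj)
      then show "A \<in> Frac_Loc ` Arr Fr"
        by (intro image_eqI[of _ _ "fraction_eq C D `` {x}"])
          (simp_all add: Frac_Loc_class Frac_def quotientI)
    qed
  qed
  have 3: "bij_betw id (Obj Fr) (Obj Loc)" by (simp add: Frac_def)
  have 4: "Dom Fr f \<in> Obj Fr \<and> id (Dom Fr f) = Dom Loc (Frac_Loc f)"
    "Cod Fr f \<in> Obj Fr \<and> id (Cod Fr f) = Cod Loc (Frac_Loc f)" if "f \<in> Arr Fr" for f
    using that by (auto elim!: Frac_arrE simp: Frac_dom Frac_cod Frac_Loc_class frac_loc_arr)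
      (auto simp: Frac_def TA_iff)
  have 5: "Ident Fr X \<in> Arr Fr \<and> Frac_Loc (Ident Fr X) = Ident Loc (id X)" if "X \<in> Obj Fr" for X
  proof -
    have X: "X \<in> Obj C" using that by (simp add: Frac_def)
    have "LB (Ident C X) = Ident Loc X"
      using LB_LF[of "Ident C X"] X Loc.comp_id[of "LB (Ident C X)" X] LF_id[OF X] by simp
    then have "frac_loc (Ident C X, Ident C X, Ident C X) = Ident Loc X"
      using X Loc.id_comp[OF Loc.id_arr(1), of X] LF_id[OF X] by (simp add: frac_loc_def)
    then show ?thesis using Ident_TA[OF X]
      by (simp add: Frac_def double_fraction_def Frac_Loc_class quotientI)
  qed
  have 6: "A \<cdot>\<^bsub>Fr\<^esub> B \<in> Arr Fr \<and> Frac_Loc (A \<cdot>\<^bsub>Fr\<^esub> B) = Frac_Loc A \<cdot>\<^bsub>Loc\<^esub> Frac_Loc B"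
    if AB: "A \<in> Arr Fr" "B \<in> Arr Fr" "Cod Fr A = Dom Fr B" for A B
  proof -
    obtain x y where x: "x \<in> TA" "A = fraction_eq C D `` {x}" and y: "y \<in> TA" "B = fraction_eq C D `` {y}"
      by (rule Frac_arrE[OF AB(1)], rule Frac_arrE[OF AB(2)])
    have "tgt3 x = Cod C (fst y)" using AB(3) x y by (simp add: Frac_dom Frac_cod)
    then obtain z where "z \<in> TA" "fraction_eq C D `` {x} \<cdot>\<^bsub>Fr\<^esub> fraction_eq C D `` {y} = fraction_eq C D `` {z}"
      "frac_loc z = frac_loc x \<cdot>\<^bsub>Loc\<^esub> frac_loc y" by (rule Frac_comp[OF x(1) y(1)])
    then show ?thesis using x y by (simp add: Frac_Loc_class) (simp add: Frac_def quotientI)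
  qed
  show "category Fr" "is_functor Fr Loc id Frac_Loc" "isomorphic_categories Fr Loc"
    by (rule *[OF Loc.category 1 2 3 4 5 6]; assumption)+
qed

lemma Frac_Loc_loc: "f \<in> Arr C \<Longrightarrow> loc C D f \<in> Arr Fr \<and> Frac_Loc (loc C D f) = LF f"
proof -
  assume f: "f \<in> Arr C"
  have i: "LB (Ident C X) = Ident Loc X" if "X \<in> Obj C" for X
    using LB_LF[of "Ident C X"] that Loc.comp_id[of "LB (Ident C X)" X] LF_id[OF that] by simp
  have t: "(Ident C (Dom C f), f, Ident C (Cod C f)) \<in> TA" using f by (simp add: TA_iff)
  have "frac_loc (Ident C (Dom C f), f, Ident C (Cod C f)) = LF f"
    using f Loc.id_comp[of "LF f"] Loc.comp_id[of "LF f"] by (simp add: frac_loc_def i del: Loc_simps(2))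
  then show ?thesis using t by (simp add: loc_def double_fraction_def Frac_Loc_class) (simp add: Frac_def quotientI)
qed

end

section \<open>Localisation and quotient categories\<close>

text \<open>A letterwise map of words has to be checked on the generating rules only, because
  \<open>zeq_context\<close> puts their images back into the image of the context.\<close>

lemma zigzag_eq_map:
  assumes C: "zigzag_loc C W" and C': "zigzag_loc C' W'"
    and zz: "\<And>X s Y. zigzag C W X s Y \<Longrightarrow> zigzag C' W' X (map m s) Y"
    and rl: "\<And>u v X Y. \<lbrakk>zigzag_rule C W u v; zigzag C W X u Y; zigzag C W X v Y\<rbrakk> \<Longrightarrow>
      ((X, map m u, Y), (X, map m v, Y)) \<in> zigzag_eq C' W'"
    and e: "((X, s, Y), (X, t, Y)) \<in> zigzag_eq C W"
  shows "((X, map m s, Y), (X, map m t, Y)) \<in> zigzag_eq C' W'"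
proof -
  interpret C: zigzag_loc C W by (rule C)
  interpret C': zigzag_loc C' W' by (rule C')
  have "(x, y) \<in> zigzag_eq C W \<Longrightarrow> (\<And>s t. x = (X, s, Y) \<Longrightarrow> y = (X, t, Y) \<Longrightarrow>
      C'.zeq X (map m s) (map m t) Y)" for x y
  proof (induction rule: zigzag_eq.induct)
    case (rule u v X' l r Y')
    then have z: "zigzag C W X (l @ u @ r) Y" "zigzag C W X (l @ v @ r) Y" by auto
    obtain Z Z' where "zigzag C W X l Z" "zigzag C W Z u Z'" "zigzag C W Z v Z'" "zigzag C W Z' r Y"
      by (rule C.zigzag_rule_ends[OF rule(1) z])
    then have "C'.zeq X (map m l @ map m u @ map m r) (map m l @ map m v @ map m r) Y"
      using rl[OF rule(1)] zz by (blast intro: C'.zeq_context)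
    then show ?case using rule by auto
  next
    case (refl X' s Y')
    then show ?case by (auto intro: zigzag_eq.refl zz)
  next
    case (sym x y)
    then show ?case by (blast intro: zigzag_eq.sym)
  next
    case (trans x y z)
    obtain u where u: "y = (X, u, Y)" using C.zigzag_eq_type[OF trans.hyps(1)] trans.prems by auto
    show ?case by (rule C'.zeq_trans[OF trans.IH(1)[OF trans.prems(1) u] trans.IH(2)[OF u trans.prems(2)]])
  qed
  then show ?thesis using e by blast
qed

text \<open>The hypotheses say that \<open>W\<close> is a union of congruence classes and that
  inverting \<open>W\<close> identifies congruent arrows. Under them, dividing by \<open>R\<close>
  before inverting does not change the localisation.\<close>

locale quotient_localisation =
  quotient_loc C R + zigzag_loc C W
  for C :: "('o, 'm, 'z) cat_scheme" (structure) and R W +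
  assumes W_sat: "\<lbrakk>(f, g) \<in> R; f \<in> W\<rbrakk> \<Longrightarrow> g \<in> W"
    and R_zeq: "(f, g) \<in> R \<Longrightarrow> zeq (Dom C f) [Fwd f] [Fwd g] (Cod C f)"
begin

abbreviation "Q \<equiv> quot_cat C R"

abbreviation "WQ \<equiv> {R `` {f} |f. f \<in> W}"

sublocale Q: zigzag_loc Q WQ
  by unfold_locales (use quot_category W_arr in \<open>auto intro: quotientI\<close>)

text \<open>Arrows that become equal in the localisation have equal inverses there.\<close>

lemma R_zeq_Bwd:
  assumes "(f, g) \<in> R" "f \<in> W"
  shows "zeq (Cod C f) [Bwd f] [Bwd g] (Dom C f)"
proof -
  have g: "g \<in> W" "Dom C f = Dom C g" "Cod C f = Cod C g" using assms W_sat R_arr by blast+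
  have "LF f = LF g" using R_zeq[OF assms(1)] g by (simp add: LF_def zcl_eq)
  then have "LB f \<cdot>\<^bsub>Loc\<^esub> (LF f \<cdot>\<^bsub>Loc\<^esub> LB g) = LB f \<cdot>\<^bsub>Loc\<^esub> (LF g \<cdot>\<^bsub>Loc\<^esub> LB g)" by simp
  then have "LB f = LB g"
    using assms g W_arr by (simp add: LF_LB Loc.comp_reduce[OF LB_LF] del: Loc_simps(2-))
  then show ?thesis using assms g W_arr by (subst zcl_eq_iff[symmetric]) (auto simp: LB_def)
qed

definition rep :: "'m set \<Rightarrow> 'm" where
  "rep A = (SOME f. f \<in> A)"

lemma rep: "f \<in> Arr C \<Longrightarrow> (f, rep (R `` {f})) \<in> R"
  unfolding rep_def using someI[of "\<lambda>g. (f, g) \<in> R" f] R_refl by auto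

primrec qstep :: "'m step \<Rightarrow> 'm set step" where
  "qstep (Fwd f) = Fwd (R `` {f})"
| "qstep (Bwd f) = Bwd (R `` {f})"

primrec lstep :: "'m set step \<Rightarrow> 'm step" where
  "lstep (Fwd A) = Fwd (rep A)"
| "lstep (Bwd A) = Bwd (rep A)"

lemma zigzag_qstep: "zigzag C W X s Y \<Longrightarrow> zigzag Q WQ X (map qstep s) Y"
proof (induction s arbitrary: X)
  case (Cons a s) then show ?case using W_arr by (cases a) auto
qed simp

lemma zigzag_lstep:
  "zigzag Q WQ X s Y \<Longrightarrow> zigzag C W X (map lstep s) Y \<and> map qstep (map lstep s) = s"
proof (induction s arbitrary: X)
  case (Cons a s)
  show ?case
  proof (cases a)
    case (Fwd A)
    then obtain f where f: "f \<in> Arr C" "A = R `` {f}" using Cons by (auto elim!: quotientE)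
    have r: "rep A \<in> Arr C" "Dom C (rep A) = Dom C f" "Cod C (rep A) = Cod C f" "R `` {rep A} = A"
      using R_arr[OF rep[OF f(1)]] class_eq[OF rep[OF f(1)]] f by auto
    then show ?thesis using Cons Fwd f by auto
  next
    case (Bwd A)
    then obtain f where f: "f \<in> W" "A = R `` {f}" using Cons by auto
    have r: "rep A \<in> W" "Dom C (rep A) = Dom C f" "Cod C (rep A) = Cod C f" "R `` {rep A} = A"
      using R_arr[OF rep[OF W_arr[OF f(1)]]] class_eq[OF rep[OF W_arr[OF f(1)]]] W_sat[OF rep[OF W_arr[OF f(1)]]] f
      by auto
    then show ?thesis using Cons Bwd f W_arr by auto
  qed
qed simp

lemma zeq_qstep: "zeq X s t Y \<Longrightarrow> Q.zeq X (map qstep s) (map qstep t) Y"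
proof (rule zigzag_eq_map[of C W Q WQ qstep])
  fix u v X Y
  assume r: "zigzag_rule C W u v" and z: "zigzag C W X u Y" "zigzag C W X v Y"
  have "zigzag_rule Q WQ (map qstep u) (map qstep v)"
    using r
  proof cases
    case (1 f g)
    then show ?thesis
      using zigzag_rule.intros(1)[of Q "R `` {f}" "R `` {g}" WQ] by (simp add: composable_def)
  next
    case (2 X)
    then show ?thesis using zigzag_rule.intros(2)[of X Q WQ] by simp
  qed (auto intro!: zigzag_rule.intros)
  then show "Q.zeq X (map qstep u) (map qstep v) Y"
    using z by (intro Q.zeq_rule zigzag_qstep)
qed (rule zigzag_loc_axioms Q.zigzag_loc_axioms zigzag_qstep, assumption?)+

text \<open>Chosen representatives respect compositions and identities only up to \<open>R\<close>;
  by \<open>R_zeq\<close> that is enough for the words to be equal in the localisation.\<close>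

lemma zeq_lstep: "Q.zeq X s t Y \<Longrightarrow> zeq X (map lstep s) (map lstep t) Y"
proof (rule zigzag_eq_map[of Q WQ C W lstep])
  fix u v X Y
  assume r: "zigzag_rule Q WQ u v" and z: "zigzag Q WQ X u Y" "zigzag Q WQ X v Y"
  have z': "zigzag C W X (map lstep u) Y" "zigzag C W X (map lstep v) Y"
    using z zigzag_lstep by blast+
  show "zeq X (map lstep u) (map lstep v) Y"
    using r
  proof cases
    case (1 A B)
    obtain f g where f: "f \<in> Arr C" "A = R `` {f}" and g: "g \<in> Arr C" "B = R `` {g}"
      using 1(3) by (auto simp: composable_def elim!: quotientE)
    have fg: "Cod C f = Dom C g" using 1(3) f g by (simp add: composable_def)
    have r: "rep A \<in> Arr C" "Dom C (rep A) = Dom C f" "Cod C (rep A) = Cod C f"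
      "rep B \<in> Arr C" "Dom C (rep B) = Dom C g" "Cod C (rep B) = Cod C g"
      using R_arr[OF rep[OF f(1)]] R_arr[OF rep[OF g(1)]] f g by auto
    have "(f \<cdot> g, rep A \<cdot> rep B) \<in> R" using R_comp[OF rep[OF f(1)] rep[OF g(1)] fg] f g by simp
    moreover have "(f \<cdot> g, rep (A \<cdot>\<^bsub>Q\<^esub> B)) \<in> R" using rep[of "f \<cdot> g"] f g fg by simp
    ultimately have "(rep A \<cdot> rep B, rep (A \<cdot>\<^bsub>Q\<^esub> B)) \<in> R"
      using equiv by (meson equiv_def symE transE)
    then have "zeq (Dom C f) [Fwd (rep A \<cdot> rep B)] [Fwd (rep (A \<cdot>\<^bsub>Q\<^esub> B))] (Cod C g)"
      using R_zeq[of "rep A \<cdot> rep B"] r fg by simp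
    moreover have [simp]: "Cod C g \<in> Obj C" using g by simp
    moreover have "zeq (Dom C f) [Fwd (rep A), Fwd (rep B)] [Fwd (rep A \<cdot> rep B)] (Cod C g)"
      using r fg by (intro zeq_rule zigzag_rule.intros) (auto simp: composable_def)
    moreover have "X = Dom C f" "Y = Cod C g" using z 1 f g by auto
    ultimately show ?thesis unfolding 1 by (auto intro: zeq_trans)
  next
    case (2 Z)
    have Z: "Z \<in> Obj C" "X = Z" "Y = Z" using 2 z by auto
    have "(Ident C Z, rep (Ident Q Z)) \<in> R" using rep[of "Ident C Z"] Z by simp
    then have "zeq Z [Fwd (Ident C Z)] [Fwd (rep (Ident Q Z))] Z" using R_zeq Z by fastforce
    moreover have "zeq Z [Fwd (Ident C Z)] [] Z" using Z by (intro zeq_rule zigzag_rule.intros) auto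
    ultimately show ?thesis unfolding 2 using Z by (auto intro: zeq_trans zeq_sym)
  next
    case (3 A)
    then have "rep A \<in> W" using z' by auto
    then show ?thesis using z' unfolding 3 by (intro zeq_rule) (auto intro!: zigzag_rule.intros)
  next
    case (4 A)
    then have "rep A \<in> W" using z' by auto
    then show ?thesis using z' unfolding 4 by (intro zeq_rule) (auto intro!: zigzag_rule.intros)
  qed
qed (use zigzag_loc_axioms Q.zigzag_loc_axioms zigzag_lstep in blast)+

lemma zeq_lstep_qstep: "zigzag C W X s Y \<Longrightarrow> zeq X (map lstep (map qstep s)) s Y"
proof (induction s arbitrary: X)
  case Nil then show ?case by (auto intro: zigzag_eq.refl)
next
  case (Cons a s)
  obtain b Z where b: "lstep (qstep a) = b" "zeq X [b] [a] Z" "zigzag C W Z s Y"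
  proof (cases a)
    case (Fwd f)
    then have "f \<in> Arr C" "X = Dom C f" "zigzag C W (Cod C f) s Y" using Cons by auto
    then show thesis using that R_zeq[OF rep[of f]] Fwd by (auto intro: zeq_sym)
  next
    case (Bwd f)
    then have "f \<in> W" "X = Cod C f" "zigzag C W (Dom C f) s Y" using Cons by auto
    then show thesis using that R_zeq_Bwd[OF rep[of f]] W_arr Bwd by (auto intro: zeq_sym)
  qed
  have z: "zeq Z (map lstep (map qstep s)) s Y" by (rule Cons.IH[OF b(3)])
  have "zeq X ([] @ [b] @ map lstep (map qstep s)) ([] @ [a] @ map lstep (map qstep s)) Y"
    using zeq_type[OF b(2)] zeq_type[OF z] zigzag_ends by (intro zeq_context[OF b(2)]) auto
  moreover have "zeq X ([a] @ map lstep (map qstep s) @ []) ([a] @ s @ []) Y"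
    using zeq_type[OF b(2)] zigzag_ends[OF b(3)] by (intro zeq_context[OF z]) auto
  ultimately show ?case using b(1) by (auto intro: zeq_trans)
qed

definition Loc_Q :: "('o \<times> 'm step list \<times> 'o) set \<Rightarrow> ('o \<times> 'm set step list \<times> 'o) set" where
  "Loc_Q A = (case SOME z. z \<in> A of (X, s, Y) \<Rightarrow> Q.zcl X (map qstep s) Y)"

lemma Loc_Q_zcl:
  assumes "zigzag C W X s Y"
  shows "Loc_Q (zcl X s Y) = Q.zcl X (map qstep s) Y"
proof -
  have "(X, s, Y) \<in> zcl X s Y" using assms by (auto simp: zcl_def intro: zigzag_eq.refl)
  then have "(SOME z. z \<in> zcl X s Y) \<in> zcl X s Y" by (rule someI)
  then have e: "((X, s, Y), (SOME z. z \<in> zcl X s Y)) \<in> zigzag_eq C W" by (simp add: zcl_def)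
  obtain t where "(SOME z. z \<in> zcl X s Y) = (X, t, Y)" using zigzag_eq_type[OF e] by auto
  then show ?thesis using e zeq_qstep[of X s Y t] by (simp add: Loc_Q_def Q.zcl_eq)
qed

text \<open>\<open>qstep\<close> and \<open>lstep\<close> are mutually inverse in the required
  sense: lifting a word of classes and projecting it again returns the word itself, and the opposite
  composite is the identity up to \<open>zeq\<close>.\<close>

lemma Loc_isomorphic: "isomorphic_categories Loc Q.Loc"
proof (rule category_transport[of _ Loc_Q _ id])
  show "category Q.Loc" by (rule Q.Loc.category)
  show "inj_on Loc_Q (Arr Loc)"
  proof (rule inj_onI)
    fix A B assume AB: "A \<in> Arr Loc" "B \<in> Arr Loc" "Loc_Q A = Loc_Q B"
    obtain X s Y X' t Y' where A: "zigzag C W X s Y" "A = zcl X s Y"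
      and B: "zigzag C W X' t Y'" "B = zcl X' t Y'"
      by (rule Loc_arrE[OF AB(1)], rule Loc_arrE[OF AB(2)])
    have e: "Q.zcl X (map qstep s) Y = Q.zcl X' (map qstep t) Y'"
      using AB(3) A B by (simp add: Loc_Q_zcl)
    have z: "zigzag Q WQ X (map qstep s) Y" "zigzag Q WQ X' (map qstep t) Y'"
      using A B zigzag_qstep by auto
    have XY: "X' = X" "Y' = Y"
      using arg_cong[OF e, of "Dom Q.Loc"] arg_cong[OF e, of "Cod Q.Loc"] z by simp_all
    have "zeq X (map lstep (map qstep s)) (map lstep (map qstep t)) Y"
      using e z by (intro zeq_lstep) (simp add: XY Q.zcl_eq_iff)
    then have "zeq X s t Y" using zeq_lstep_qstep A B XY by (meson zeq_sym zeq_trans)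
    then show "A = B" using A B XY by (simp add: zcl_eq)
  qed
  show "Loc_Q ` Arr Loc = Arr Q.Loc"
  proof
    show "Loc_Q ` Arr Loc \<subseteq> Arr Q.Loc" using zigzag_qstep by (auto elim!: Loc_arrE simp: Loc_Q_zcl)
    show "Arr Q.Loc \<subseteq> Loc_Q ` Arr Loc"
    proof
      fix A assume "A \<in> Arr Q.Loc"
      then obtain X s Y where A: "zigzag Q WQ X s Y" "A = Q.zcl X s Y" by (rule Q.Loc_arrE)
      have "zigzag C W X (map lstep s) Y" "map qstep (map lstep s) = s" using zigzag_lstep[OF A(1)] by auto
      then show "A \<in> Loc_Q ` Arr Loc"
        using A by (intro image_eqI[of _ _ "zcl X (map lstep s) Y"]) (simp_all add: Loc_Q_zcl del: map_map)
    qed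
  qed
  show "bij_betw id (Obj Loc) (Obj Q.Loc)" by simp
  show "Dom Loc f \<in> Obj Loc \<and> id (Dom Loc f) = Dom Q.Loc (Loc_Q f)"
    "Cod Loc f \<in> Obj Loc \<and> id (Cod Loc f) = Cod Q.Loc (Loc_Q f)" if "f \<in> Arr Loc" for f
    using that by (auto elim!: Loc_arrE simp: Loc_Q_zcl zigzag_qstep dest: zigzag_ends)
  show "Ident Loc X \<in> Arr Loc \<and> Loc_Q (Ident Loc X) = Ident Q.Loc (id X)" if "X \<in> Obj Loc" for X
    using that by (simp add: Loc_Q_zcl)
  show "A \<cdot>\<^bsub>Loc\<^esub> B \<in> Arr Loc \<and> Loc_Q (A \<cdot>\<^bsub>Loc\<^esub> B) = Loc_Q A \<cdot>\<^bsub>Q.Loc\<^esub> Loc_Q B"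
    if AB: "A \<in> Arr Loc" "B \<in> Arr Loc" "Cod Loc A = Dom Loc B" for A B
  proof -
    obtain X s Y Y' t Z where A: "zigzag C W X s Y" "A = zcl X s Y"
      and B: "zigzag C W Y' t Z" "B = zcl Y' t Z"
      by (rule Loc_arrE[OF AB(1)], rule Loc_arrE[OF AB(2)])
    have Y: "Y' = Y" using AB(3) A B by simp
    have z: "zigzag C W X (s @ t) Z" using A B Y by (auto simp: zigzag_append)
    show ?thesis using A B z zigzag_qstep[OF A(1)] zigzag_qstep[OF B(1)]
      by (simp add: Y zcl_comp Loc_Q_zcl Q.zcl_comp)
  qed
qed

end

section \<open>Preadditive categories and duality\<close>

locale preadditive_loc =
  fixes C :: "('o, 'm, 'z) preadditive_cat_scheme" (structure)
  assumes preadditive: "preadditive_category C"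
begin

sublocale category_loc C
  by unfold_locales (use preadditive in \<open>simp add: preadditive_category_def\<close>)

lemma hom_comm_group: "X \<in> Obj C \<Longrightarrow> Y \<in> Obj C \<Longrightarrow> comm_group (hom_group C X Y)"
  using preadditive by (simp add: preadditive_category_def)

lemma hom_group_simps:
  "carrier (hom_group C X Y) = Hom C X Y" "mult (hom_group C X Y) = Add C" "one (hom_group C X Y) = Zero C X Y"
  by (simp_all add: hom_group_def)

lemma Hom_iff: "f \<in> Hom C X Y \<longleftrightarrow> f \<in> Arr C \<and> Dom C f = X \<and> Cod C f = Y"
  by (simp add: Hom_def)

lemma zero_arr [simp]:
  assumes "X \<in> Obj C" "Y \<in> Obj C"
  shows "Zero C X Y \<in> Arr C" "Dom C (Zero C X Y) = X" "Cod C (Zero C X Y) = Y"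
  using monoid.one_closed[OF group.is_monoid[OF comm_group.axioms(2)[OF hom_comm_group[OF assms]]]]
  by (simp_all add: hom_group_simps Hom_iff)

lemma add_arr [simp]:
  assumes "f \<in> Arr C" "g \<in> Arr C" "Dom C f = Dom C g" "Cod C f = Cod C g"
  shows "f \<boxplus> g \<in> Arr C" "Dom C (f \<boxplus> g) = Dom C g" "Cod C (f \<boxplus> g) = Cod C g"
  using monoid.m_closed[OF group.is_monoid[OF comm_group.axioms(2)[OF hom_comm_group[of "Dom C g" "Cod C g"]]], of f g] assms
  by (simp_all add: hom_group_simps Hom_iff)

lemma neg_arr [simp]:
  assumes "f \<in> Arr C"
  shows "Neg C f \<in> Arr C" "Dom C (Neg C f) = Dom C f" "Cod C (Neg C f) = Cod C f"
  using group.inv_closed[OF comm_group.axioms(2)[OF hom_comm_group[of "Dom C f" "Cod C f"]], of f] assms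
  by (simp_all add: hom_group_simps Hom_iff Neg_def)

lemma add_comm: "\<lbrakk>f \<in> Arr C; g \<in> Arr C; Dom C f = Dom C g; Cod C f = Cod C g\<rbrakk> \<Longrightarrow> f \<boxplus> g = g \<boxplus> f"
  using comm_monoid.m_comm[OF comm_group.axioms(1)[OF hom_comm_group[of "Dom C g" "Cod C g"]], of f g]
  by (simp add: hom_group_simps Hom_iff)

lemma add_assoc [simp]:
  "\<lbrakk>f \<in> Arr C; g \<in> Arr C; h \<in> Arr C; Dom C f = Dom C g; Cod C f = Cod C g; Dom C g = Dom C h; Cod C g = Cod C h\<rbrakk>
    \<Longrightarrow> f \<boxplus> g \<boxplus> h = f \<boxplus> (g \<boxplus> h)"
  using monoid.m_assoc[OF group.is_monoid[OF comm_group.axioms(2)[OF hom_comm_group[of "Dom C h" "Cod C h"]]], of f g h]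
  by (simp add: hom_group_simps Hom_iff)

lemma add_lcomm:
  "\<lbrakk>f \<in> Arr C; g \<in> Arr C; h \<in> Arr C; Dom C f = Dom C g; Cod C f = Cod C g; Dom C g = Dom C h; Cod C g = Cod C h\<rbrakk>
    \<Longrightarrow> f \<boxplus> (g \<boxplus> h) = g \<boxplus> (f \<boxplus> h)"
  using add_assoc[of f g h] add_assoc[of g f h] add_comm[of f g] by simp

lemmas add_ac = add_comm add_lcomm

lemma zero_add [simp]: "\<lbrakk>f \<in> Arr C; Dom C f = X; Cod C f = Y\<rbrakk> \<Longrightarrow> Zero C X Y \<boxplus> f = f"
  using monoid.l_one[OF group.is_monoid[OF comm_group.axioms(2)[OF hom_comm_group[of "Dom C f" "Cod C f"]]], of f]
  by (auto simp: hom_group_simps Hom_iff)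

lemma add_zero [simp]: "\<lbrakk>f \<in> Arr C; Dom C f = X; Cod C f = Y\<rbrakk> \<Longrightarrow> f \<boxplus> Zero C X Y = f"
  using zero_add[of f X Y] add_comm[of f "Zero C X Y"] by auto

lemma add_neg [simp]: "f \<in> Arr C \<Longrightarrow> f \<boxplus> Neg C f = Zero C (Dom C f) (Cod C f)"
  using group.r_inv[OF comm_group.axioms(2)[OF hom_comm_group[of "Dom C f" "Cod C f"]], of f]
  by (simp add: hom_group_simps Hom_iff Neg_def)

lemma neg_add_self [simp]: "f \<in> Arr C \<Longrightarrow> Neg C f \<boxplus> f = Zero C (Dom C f) (Cod C f)"
  using add_comm[of f "Neg C f"] by simp

lemma add_neg_cancel [simp]:
  assumes "f \<in> Arr C" "g \<in> Arr C" "Dom C g = Dom C f" "Cod C g = Cod C f"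
  shows "f \<boxplus> (Neg C f \<boxplus> g) = g" "Neg C f \<boxplus> (f \<boxplus> g) = g"
proof -
  note [simp] = assms
  have "f \<boxplus> (Neg C f \<boxplus> g) = f \<boxplus> Neg C f \<boxplus> g" by (rule add_assoc[symmetric]) simp_all
  also have "\<dots> = g" by (simp del: add_assoc)
  finally show "f \<boxplus> (Neg C f \<boxplus> g) = g" .
  have "Neg C f \<boxplus> (f \<boxplus> g) = Neg C f \<boxplus> f \<boxplus> g" by (rule add_assoc[symmetric]) simp_all
  also have "\<dots> = g" by (simp del: add_assoc)
  finally show "Neg C f \<boxplus> (f \<boxplus> g) = g" .
qed

lemma add_left_imp_eq:
  assumes e: "f \<boxplus> g = f \<boxplus> h" and h: "f \<in> Arr C" "g \<in> Arr C" "h \<in> Arr C" "Dom C g = Dom C f" "Cod C g = Cod C f"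
    "Dom C h = Dom C f" "Cod C h = Cod C f"
  shows "g = h"
proof -
  have "g = Neg C f \<boxplus> (f \<boxplus> g)" using h by simp
  also have "\<dots> = h" unfolding e using h by simp
  finally show ?thesis .
qed

lemma neg_unique:
  assumes "f \<boxplus> g = Zero C (Dom C f) (Cod C f)" "f \<in> Arr C" "g \<in> Arr C" "Dom C g = Dom C f" "Cod C g = Cod C f"
  shows "g = Neg C f"
  using add_left_imp_eq[of f g "Neg C f"] assms by simp

lemma sub_eq_zero:
  assumes "f \<boxplus> Neg C g = Zero C (Dom C g) (Cod C g)" "f \<in> Arr C" "g \<in> Arr C" "Dom C f = Dom C g" "Cod C f = Cod C g"
  shows "f = g"
proof -
  have "f = f \<boxplus> (Neg C g \<boxplus> g)" using assms(2-) by simp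
  also have "\<dots> = f \<boxplus> Neg C g \<boxplus> g" by (rule add_assoc[symmetric]) (use assms(2-) in simp_all)
  also have "\<dots> = g" unfolding assms(1) using assms(2-) by simp
  finally show ?thesis .
qed

lemma comp_add [simp]:
  "\<lbrakk>f \<in> Arr C; g \<in> Arr C; h \<in> Arr C; Cod C f = Dom C g; Dom C g = Dom C h; Cod C g = Cod C h\<rbrakk>
    \<Longrightarrow> f \<cdot> (g \<boxplus> h) = f \<cdot> g \<boxplus> f \<cdot> h"
  and add_comp [simp]:
  "\<lbrakk>f \<in> Arr C; g \<in> Arr C; h \<in> Arr C; Cod C f = Dom C h; Dom C f = Dom C g; Cod C f = Cod C g\<rbrakk>
    \<Longrightarrow> (f \<boxplus> g) \<cdot> h = f \<cdot> h \<boxplus> g \<cdot> h"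
proof -
  have *: "\<forall>X\<in>Obj C. \<forall>Y\<in>Obj C. \<forall>Z\<in>Obj C. \<forall>f\<in>Hom C X Y. \<forall>f'\<in>Hom C X Y. \<forall>g\<in>Hom C Y Z. \<forall>g'\<in>Hom C Y Z.
        (f \<boxplus> f') \<cdot> g = f \<cdot> g \<boxplus> f' \<cdot> g \<and> f \<cdot> (g \<boxplus> g') = f \<cdot> g \<boxplus> f \<cdot> g'"
    using preadditive by (simp add: preadditive_category_def)
  show "\<lbrakk>f \<in> Arr C; g \<in> Arr C; h \<in> Arr C; Cod C f = Dom C g; Dom C g = Dom C h; Cod C g = Cod C h\<rbrakk>
    \<Longrightarrow> f \<cdot> (g \<boxplus> h) = f \<cdot> g \<boxplus> f \<cdot> h"
    using *[rule_format, of "Dom C f" "Dom C h" "Cod C h" f f g h] by (auto simp: Hom_iff)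
  show "\<lbrakk>f \<in> Arr C; g \<in> Arr C; h \<in> Arr C; Cod C f = Dom C h; Dom C f = Dom C g; Cod C f = Cod C g\<rbrakk>
    \<Longrightarrow> (f \<boxplus> g) \<cdot> h = f \<cdot> h \<boxplus> g \<cdot> h"
    using *[rule_format, of "Dom C f" "Dom C h" "Cod C h" f g h h] by (auto simp: Hom_iff)
qed

lemma comp_zero [simp]:
  assumes "f \<in> Arr C" "Cod C f = Y" "Z \<in> Obj C"
  shows "f \<cdot> Zero C Y Z = Zero C (Dom C f) Z"
proof -
  have Y: "Y \<in> Obj C" using assms by auto
  have "f \<cdot> (Zero C Y Z \<boxplus> Zero C Y Z) = f \<cdot> Zero C Y Z \<boxplus> Zero C (Dom C f) Z" using assms Y by simp
  then have "f \<cdot> Zero C Y Z \<boxplus> f \<cdot> Zero C Y Z = f \<cdot> Zero C Y Z \<boxplus> Zero C (Dom C f) Z"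
    using assms Y by (subst (asm) comp_add) simp_all
  then show ?thesis using assms Y by (elim add_left_imp_eq) simp_all
qed

lemma zero_comp [simp]:
  assumes "f \<in> Arr C" "Dom C f = Y" "X \<in> Obj C"
  shows "Zero C X Y \<cdot> f = Zero C X (Cod C f)"
proof -
  have Y: "Y \<in> Obj C" using assms by auto
  have "(Zero C X Y \<boxplus> Zero C X Y) \<cdot> f = Zero C X Y \<cdot> f \<boxplus> Zero C X (Cod C f)" using assms Y by simp
  then have "Zero C X Y \<cdot> f \<boxplus> Zero C X Y \<cdot> f = Zero C X Y \<cdot> f \<boxplus> Zero C X (Cod C f)"
    using assms Y by (subst (asm) add_comp) simp_all
  then show ?thesis using assms Y by (elim add_left_imp_eq) simp_all
qed

lemma comp_neg [simp]: "\<lbrakk>f \<in> Arr C; g \<in> Arr C; Cod C f = Dom C g\<rbrakk> \<Longrightarrow> f \<cdot> Neg C g = Neg C (f \<cdot> g)"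
  by (rule neg_unique) (simp_all flip: comp_add)

lemma neg_comp [simp]: "\<lbrakk>f \<in> Arr C; g \<in> Arr C; Cod C f = Dom C g\<rbrakk> \<Longrightarrow> Neg C f \<cdot> g = Neg C (f \<cdot> g)"
  by (rule neg_unique) (simp_all flip: add_comp)

lemma neg_neg [simp]: "f \<in> Arr C \<Longrightarrow> Neg C (Neg C f) = f"
  by (rule neg_unique[symmetric]) simp_all

lemma neg_zero [simp]: "X \<in> Obj C \<Longrightarrow> Y \<in> Obj C \<Longrightarrow> Neg C (Zero C X Y) = Zero C X Y"
  by (rule neg_unique[symmetric]) simp_all

lemma neg_add [simp]:
  "\<lbrakk>f \<in> Arr C; g \<in> Arr C; Dom C f = Dom C g; Cod C f = Cod C g\<rbrakk> \<Longrightarrow> Neg C (f \<boxplus> g) = Neg C f \<boxplus> Neg C g"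
  by (rule neg_unique[symmetric]) (simp_all add: add_lcomm[of g])

lemma biproduct_simps:
  assumes "biproduct C X Y S i1 i2 p1 p2"
  shows "X \<in> Obj C" "Y \<in> Obj C" "S \<in> Obj C" "i1 \<in> Arr C" "i2 \<in> Arr C" "p1 \<in> Arr C" "p2 \<in> Arr C"
    "Dom C i1 = X" "Dom C i2 = Y" "Cod C i1 = S" "Cod C i2 = S" "Dom C p1 = S" "Dom C p2 = S" "Cod C p1 = X" "Cod C p2 = Y"
    "i1 \<cdot> p1 = Ident C X" "i2 \<cdot> p2 = Ident C Y" "i1 \<cdot> p2 = Zero C X Y" "i2 \<cdot> p1 = Zero C Y X"
    "\<And>k. k \<in> Arr C \<Longrightarrow> Dom C k = X \<Longrightarrow> i1 \<cdot> (p1 \<cdot> k) = k"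
    "\<And>k. k \<in> Arr C \<Longrightarrow> Dom C k = Y \<Longrightarrow> i2 \<cdot> (p2 \<cdot> k) = k"
    "\<And>k. k \<in> Arr C \<Longrightarrow> Dom C k = Y \<Longrightarrow> i1 \<cdot> (p2 \<cdot> k) = Zero C X (Cod C k)"
    "\<And>k. k \<in> Arr C \<Longrightarrow> Dom C k = X \<Longrightarrow> i2 \<cdot> (p1 \<cdot> k) = Zero C Y (Cod C k)"
  using assms unfolding biproduct_def Hom_def by (simp_all add: comp_reduce)

lemma biproduct_sum: "biproduct C X Y S i1 i2 p1 p2 \<Longrightarrow> p1 \<cdot> i1 \<boxplus> p2 \<cdot> i2 = Ident C S"
  by (simp add: biproduct_def)

lemma biproduct_into:
  assumes b: "biproduct C X Y S i1 i2 p1 p2" and f: "f \<in> Arr C" "Cod C f = S"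
  shows "f = f \<cdot> p1 \<cdot> i1 \<boxplus> f \<cdot> p2 \<cdot> i2"
proof -
  note [simp] = biproduct_simps[OF b] f
  have "f = f \<cdot> (p1 \<cdot> i1 \<boxplus> p2 \<cdot> i2)" by (simp only: biproduct_sum[OF b] comp_id[OF f])
  then show ?thesis by simp
qed

lemma biproduct_from:
  assumes b: "biproduct C X Y S i1 i2 p1 p2" and f: "f \<in> Arr C" "Dom C f = S"
  shows "f = p1 \<cdot> (i1 \<cdot> f) \<boxplus> p2 \<cdot> (i2 \<cdot> f)"
proof -
  note [simp] = biproduct_simps[OF b] f
  have "f = (p1 \<cdot> i1 \<boxplus> p2 \<cdot> i2) \<cdot> f" by (simp only: biproduct_sum[OF b] id_comp[OF f])
  then show ?thesis by simp
qed

lemma biproduct_eqI: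
  assumes b: "biproduct C X Y S i1 i2 p1 p2"
    and f: "f \<in> Arr C" "g \<in> Arr C" "Cod C f = S" "Cod C g = S" "f \<cdot> p1 = g \<cdot> p1" "f \<cdot> p2 = g \<cdot> p2"
  shows "f = g"
proof -
  note [simp] = biproduct_simps[OF b] f(1-4)
  have "f = f \<cdot> p1 \<cdot> i1 \<boxplus> f \<cdot> p2 \<cdot> i2" by (rule biproduct_into[OF b f(1,3)])
  also have "\<dots> = g" unfolding f(5,6) by (rule biproduct_into[OF b f(2,4), symmetric])
  finally show ?thesis .
qed

text \<open>By subtraction, uniqueness of factorisations through \<open>k\<close> reduces to the
  case of an arrow that becomes zero on composition with \<open>k\<close>.\<close>

lemma is_kernelI:
  assumes k: "k \<in> Arr C" "f \<in> Arr C" "Cod C k = Dom C f" "k \<cdot> f = Zero C (Dom C k) (Cod C f)"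
    and e: "\<And>g. \<lbrakk>g \<in> Arr C; Cod C g = Dom C f; g \<cdot> f = Zero C (Dom C g) (Cod C f)\<rbrakk> \<Longrightarrow>
      \<exists>u\<in>Arr C. Dom C u = Dom C g \<and> Cod C u = Dom C k \<and> u \<cdot> k = g"
    and m: "\<And>u X. \<lbrakk>u \<in> Arr C; Dom C u = X; Cod C u = Dom C k; u \<cdot> k = Zero C X (Cod C k)\<rbrakk> \<Longrightarrow> u = Zero C X (Dom C k)"
  shows "is_kernel C f k"
proof -
  have "\<exists>!u. u \<in> Hom C (Dom C g) (Dom C k) \<and> u \<cdot> k = g"
    if g: "composable C g f \<and> g \<cdot> f = Zero C (Dom C g) (Cod C f)" for g
  proof -
    obtain u where u: "u \<in> Arr C" "Dom C u = Dom C g" "Cod C u = Dom C k" "u \<cdot> k = g"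
      using e[of g] g by (auto simp: composable_def)
    show ?thesis
    proof (intro ex1I[of _ u] conjI)
      fix v assume "v \<in> Hom C (Dom C g) (Dom C k) \<and> v \<cdot> k = g"
      then have v: "v \<in> Arr C" "Dom C v = Dom C g" "Cod C v = Dom C k" "v \<cdot> k = g" by (simp_all add: Hom_iff)
      note [simp] = u(1-3) v(1-3) k(1-3)
      have [simp]: "Cod C g = Dom C f" "g \<in> Arr C" using g by (simp_all add: composable_def)
      have "v \<boxplus> Neg C u = Zero C (Dom C g) (Dom C k)"
        by (rule m) (simp_all add: u(4) v(4))
      then show "v = u" using sub_eq_zero[of v u] by simp
    qed (use u in \<open>simp_all add: Hom_iff\<close>)
  qed
  then show ?thesis using k unfolding is_kernel_def composable_def by simp
qed

lemma is_kernelD: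
  assumes "is_kernel C f k"
  shows "k \<in> Arr C" "f \<in> Arr C" "Cod C k = Dom C f" "k \<cdot> f = Zero C (Dom C k) (Cod C f)"
  using assms by (auto simp: is_kernel_def composable_def)

lemma kernel_lift:
  assumes "is_kernel C f k" "g \<in> Arr C" "Cod C g = Dom C f" "g \<cdot> f = Zero C (Dom C g) (Cod C f)"
  obtains u where "u \<in> Arr C" "Dom C u = Dom C g" "Cod C u = Dom C k" "u \<cdot> k = g"
proof -
  have "composable C g f \<and> g \<cdot> f = Zero C (Dom C g) (Cod C f)"
    using assms is_kernelD[OF assms(1)] by (simp add: composable_def)
  then obtain u where "u \<in> Hom C (Dom C g) (Dom C k)" "u \<cdot> k = g"
    using assms(1) unfolding is_kernel_def by metis
  then show thesis by (intro that[of u]) (simp_all add: Hom_iff)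
qed

lemma kernel_mono:
  assumes k: "is_kernel C f k" and u: "u \<in> Arr C" "v \<in> Arr C" "Dom C u = Dom C v" "Cod C u = Dom C k" "Cod C v = Dom C k"
    and e: "u \<cdot> k = v \<cdot> k"
  shows "u = v"
proof -
  note [simp] = is_kernelD[OF k] u
  have "composable C (u \<cdot> k) f \<and> u \<cdot> k \<cdot> f = Zero C (Dom C (u \<cdot> k)) (Cod C f)"
    by (simp add: composable_def)
  then have "\<exists>!w. w \<in> Hom C (Dom C (u \<cdot> k)) (Dom C k) \<and> w \<cdot> k = u \<cdot> k"
    using k unfolding is_kernel_def by blast
  moreover have "u \<in> Hom C (Dom C (u \<cdot> k)) (Dom C k)" "v \<in> Hom C (Dom C (u \<cdot> k)) (Dom C k)"
    by (simp_all add: Hom_iff)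
  ultimately show ?thesis using e by metis
qed

text \<open>A natural choice \<open>\<phi>\<close> of factorisations through \<open>w\<close> makes \<open>\<phi> w\<close> an idempotent, and
  the kernel is obtained by splitting it.\<close>

lemma kernel_as_retract:
  assumes spl: "idempotent_splitting C"
    and w: "w \<in> Arr C" "d \<in> Arr C" "Cod C w = Dom C d" "w \<cdot> d = Zero C (Dom C w) (Cod C d)"
    and phi: "\<And>z. \<lbrakk>z \<in> Arr C; Cod C z = Dom C d; z \<cdot> d = Zero C (Dom C z) (Cod C d)\<rbrakk> \<Longrightarrow>
      \<phi> z \<in> Arr C \<and> Dom C (\<phi> z) = Dom C z \<and> Cod C (\<phi> z) = Dom C w \<and> \<phi> z \<cdot> w = z"
    and nat: "\<And>u z. \<lbrakk>u \<in> Arr C; z \<in> Arr C; Cod C u = Dom C z; Cod C z = Dom C d; z \<cdot> d = Zero C (Dom C z) (Cod C d)\<rbrakk> \<Longrightarrow>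
      \<phi> (u \<cdot> z) = u \<cdot> \<phi> z"
  shows "\<exists>k. is_kernel C d k"
proof -
  note [simp] = w
  have e [simp]: "\<phi> w \<in> Arr C" "Dom C (\<phi> w) = Dom C w" "Cod C (\<phi> w) = Dom C w" and ew: "\<phi> w \<cdot> w = w"
    using phi[of w] by simp_all
  have "\<phi> w \<cdot> \<phi> w = \<phi> (\<phi> w \<cdot> w)" by (rule nat[symmetric]) simp_all
  then have "\<phi> w \<cdot> \<phi> w = \<phi> w" by (simp add: ew)
  then have D: "\<phi> w \<cdot> \<phi> w = \<phi> w" "\<phi> w \<in> Hom C (Dom C w) (Dom C w)" "Dom C w \<in> Obj C" by (simp_all add: Hom_iff)
  have "\<exists>Y\<in>Obj C. \<exists>r\<in>Hom C (Dom C w) Y. \<exists>s\<in>Hom C Y (Dom C w). r \<cdot> s = \<phi> w \<and> s \<cdot> r = Ident C Y"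
    using spl D unfolding idempotent_splitting_def by blast
  then obtain Y r s where Y: "Y \<in> Obj C" and rsH: "r \<in> Hom C (Dom C w) Y" "s \<in> Hom C Y (Dom C w)"
    and rs: "r \<cdot> s = \<phi> w" "s \<cdot> r = Ident C Y" by blast
  then have r [simp]: "r \<in> Arr C" "Dom C r = Dom C w" "Cod C r = Y"
    and s [simp]: "s \<in> Arr C" "Dom C s = Y" "Cod C s = Dom C w"
    by (simp_all add: Hom_iff)
  have se: "s \<cdot> \<phi> w = s" using comp_reduce[of s r "Ident C Y" s] rs by simp
  have "is_kernel C d (s \<cdot> w)"
  proof (rule is_kernelI)
    fix z assume z: "z \<in> Arr C" "Cod C z = Dom C d" "z \<cdot> d = Zero C (Dom C z) (Cod C d)"
    note [simp] = z(1,2) and pz = phi[OF z]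
    have [simp]: "\<phi> z \<in> Arr C" "Dom C (\<phi> z) = Dom C z" "Cod C (\<phi> z) = Dom C w" using pz by auto
    have "(\<phi> z \<cdot> r) \<cdot> (s \<cdot> w) = \<phi> z \<cdot> (\<phi> w \<cdot> w)" using comp_reduce[OF rs(1), of w] by simp
    then have "(\<phi> z \<cdot> r) \<cdot> (s \<cdot> w) = z" by (simp add: ew pz)
    then show "\<exists>u\<in>Arr C. Dom C u = Dom C z \<and> Cod C u = Dom C (s \<cdot> w) \<and> u \<cdot> (s \<cdot> w) = z"
      by (intro bexI[of _ "\<phi> z \<cdot> r"]) simp_all
  next
    fix u X assume u: "u \<in> Arr C" "Dom C u = X" "Cod C u = Dom C (s \<cdot> w)" "u \<cdot> (s \<cdot> w) = Zero C X (Cod C (s \<cdot> w))"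
    then have [simp]: "u \<in> Arr C" "Dom C u = X" "Cod C u = Y" and u0: "u \<cdot> (s \<cdot> w) = Zero C X (Dom C d)" by simp_all
    have [simp]: "X \<in> Obj C" using dom_obj[OF u(1)] u(2) by simp
    \<comment> \<open>The arrow \<open>w\<close> need not be monic. Naturality of
      \<open>\<phi>\<close> recovers \<open>u \<cdot> s\<close> from
      \<open>(u \<cdot> s) \<cdot> w\<close>, which is zero.\<close>
    have "u \<cdot> s = (u \<cdot> s) \<cdot> \<phi> w" using se by simp
    also have "\<dots> = \<phi> ((u \<cdot> s) \<cdot> w)" by (rule nat[symmetric]) simp_all
    also have "(u \<cdot> s) \<cdot> w = Zero C X (Dom C w) \<cdot> w" using u0 by simp
    also have "\<phi> \<dots> = Zero C X (Dom C w) \<cdot> \<phi> w" by (rule nat) simp_all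
    finally have "u \<cdot> s = Zero C X (Dom C w)" by simp
    then have "u \<cdot> (s \<cdot> r) = Zero C X Y" using comp_reduce[of u s _ r] by simp
    then show "u = Zero C X (Dom C (s \<cdot> w))" by (simp add: rs)
  qed simp_all
  then show ?thesis ..
qed

end

section \<open>Duality\<close>

definition op_cat :: "('o, 'm, 'z) exact_cat_scheme \<Rightarrow> ('o, 'm) exact_cat" where
  "op_cat C = \<lparr> Obj = Obj C, Arr = Arr C, Dom = Cod C, Cod = Dom C, Ident = Ident C,
     Comp = (\<lambda>f g. g \<cdot>\<^bsub>C\<^esub> f), Add = Add C, Zero = (\<lambda>X Y. Zero C Y X),
     Pure_Seq = {(p, i). (i, p) \<in> Pure_Seq C} \<rparr>"

lemma op_simps [simp]:
  "Obj (op_cat C) = Obj C" "Arr (op_cat C) = Arr C" "Dom (op_cat C) = Cod C" "Cod (op_cat C) = Dom C"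
  "Ident (op_cat C) = Ident C" "f \<cdot>\<^bsub>op_cat C\<^esub> g = g \<cdot>\<^bsub>C\<^esub> f" "Add (op_cat C) = Add C"
  "Zero (op_cat C) X Y = Zero C Y X" "(p, i) \<in> Pure_Seq (op_cat C) \<longleftrightarrow> (i, p) \<in> Pure_Seq C"
  "Hom (op_cat C) X Y = Hom C Y X" "composable (op_cat C) f g \<longleftrightarrow> composable C g f"
  "commutes (op_cat C) f g h k \<longleftrightarrow> commutes C g f k h"
  "hom_group (op_cat C) X Y = hom_group C Y X"
  by (auto simp: op_cat_def Hom_def composable_def commutes_def hom_group_def)

lemma op_neg [simp]: "Neg (op_cat C) f = Neg C f"
  by (simp add: Neg_def)

lemma op_notions [simp]:
  "is_iso (op_cat C) f \<longleftrightarrow> is_iso C f"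
  "pushout (op_cat C) i f f' i' \<longleftrightarrow> pullback C f i f' i'"
  "pullback (op_cat C) f p f' p' \<longleftrightarrow> pushout C p f f' p'"
  "is_kernel (op_cat C) f k \<longleftrightarrow> is_cokernel C f k"
  "is_cokernel (op_cat C) f k \<longleftrightarrow> is_kernel C f k"
  "biproduct (op_cat C) X Y S i1 i2 p1 p2 \<longleftrightarrow> biproduct C X Y S p1 p2 i1 i2"
  "zero_object (op_cat C) X \<longleftrightarrow> zero_object C X"
  "pure_mono (op_cat C) i \<longleftrightarrow> pure_epi C i"
  "pure_epi (op_cat C) p \<longleftrightarrow> pure_mono C p"
  by (auto simp: is_iso_def pushout_def pullback_def is_kernel_def is_cokernel_def biproduct_def
      zero_object_def pure_mono_def pure_epi_def)

lemma category_op: "category C \<Longrightarrow> category (op_cat C)"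
  unfolding category_def by (simp add: composable_def Hom_def)

lemma preadditive_op: "preadditive_category C \<Longrightarrow> preadditive_category (op_cat C)"
  unfolding preadditive_category_def by (simp add: category_op)

lemma additive_op: "additive_category C \<Longrightarrow> additive_category (op_cat C)"
  unfolding additive_category_def op_simps op_notions using preadditive_op by blast

lemma idempotent_splitting_op: "idempotent_splitting C \<Longrightarrow> idempotent_splitting (op_cat C)"
  unfolding idempotent_splitting_def op_simps by blast

lemma biproduct_swap:
  assumes "preadditive_category C" "biproduct C X Y S i1 i2 p1 p2"
  shows "biproduct C Y X S i2 i1 p2 p1"
proof -
  interpret preadditive_loc C by unfold_locales (rule assms)
  show ?thesis using assms(2) biproduct_simps[OF assms(2)] add_comm[of "p2 \<cdot>\<^bsub>C\<^esub> i2" "p1 \<cdot>\<^bsub>C\<^esub> i1"]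
    by (simp add: biproduct_def)
qed

lemma exact_op:
  assumes "exact_category C"
  shows "exact_category (op_cat C)"
proof -
  note A = assms[unfolded exact_category_def]
  note A3 = A[THEN conjunct2, THEN conjunct2]
  note A5 = A3[THEN conjunct2, THEN conjunct2]
  note A7 = A5[THEN conjunct2, THEN conjunct2]
  note A9 = A7[THEN conjunct2, THEN conjunct2]
  have ax1: "additive_category C" by (rule A[THEN conjunct1])
  have ax2: "is_kernel C p i \<and> is_cokernel C i p" if "(i, p) \<in> Pure_Seq C" for i p
    using A[THEN conjunct2, THEN conjunct1] that by auto
  have ax3: "(i1, p2) \<in> Pure_Seq C" if "biproduct C X Y S i1 i2 p1 p2" for X Y S i1 i2 p1 p2
    using A3[THEN conjunct1] that by blast
  have ax4: "(i', p') \<in> Pure_Seq C" if "(i, p) \<in> Pure_Seq C" "is_iso C a" "is_iso C b" "is_iso C c" "composable C i' p'"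
      "commutes C i b a i'" "commutes C p c b p'" for i p i' p' a b c
    using A3[THEN conjunct2, THEN conjunct1, rule_format, of i p a b c i' p'] that by simp
  note ax5 = A5[THEN conjunct1] and ax6 = A5[THEN conjunct2, THEN conjunct1]
    and ax7 = A7[THEN conjunct1] and ax8 = A7[THEN conjunct2, THEN conjunct1]
    and ax9 = A9[THEN conjunct1] and ax10 = A9[THEN conjunct2]
  have pre: "preadditive_category C" using ax1 by (simp add: additive_category_def)
  interpret preadditive_loc C by unfold_locales (rule pre)
  \<comment> \<open>Closure under isomorphism is stated with isomorphisms from the given sequence to
    the new one. In the opposite category they point the other way, so they are replaced by their
    inverses.\<close>
  have iso: "(p', i') \<in> Pure_Seq C" if h: "(p, i) \<in> Pure_Seq C" "is_iso C a" "is_iso C b" "is_iso C c" "composable C p' i'"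
      "commutes C b i i' a" "commutes C c p p' b" for i p i' p' a b c
  proof -
    obtain a' where a: "a \<in> Arr C" "a' \<in> Arr C" "Dom C a' = Cod C a" "Cod C a' = Dom C a"
      "a \<cdot>\<^bsub>C\<^esub> a' = Ident C (Dom C a)" "a' \<cdot>\<^bsub>C\<^esub> a = Ident C (Cod C a)" using h(2) by (rule is_isoE)
    obtain b' where b: "b \<in> Arr C" "b' \<in> Arr C" "Dom C b' = Cod C b" "Cod C b' = Dom C b"
      "b \<cdot>\<^bsub>C\<^esub> b' = Ident C (Dom C b)" "b' \<cdot>\<^bsub>C\<^esub> b = Ident C (Cod C b)" using h(3) by (rule is_isoE)
    obtain c' where c: "c \<in> Arr C" "c' \<in> Arr C" "Dom C c' = Cod C c" "Cod C c' = Dom C c"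
      "c \<cdot>\<^bsub>C\<^esub> c' = Ident C (Dom C c)" "c' \<cdot>\<^bsub>C\<^esub> c = Ident C (Cod C c)" using h(4) by (rule is_isoE)
    have ci: "i \<in> Arr C" "i' \<in> Arr C" "p \<in> Arr C" "p' \<in> Arr C" "Cod C b = Dom C i" "Cod C i' = Dom C a" "b \<cdot>\<^bsub>C\<^esub> i = i' \<cdot>\<^bsub>C\<^esub> a"
      "Cod C c = Dom C p" "Cod C p' = Dom C b" "c \<cdot>\<^bsub>C\<^esub> p = p' \<cdot>\<^bsub>C\<^esub> b"
      using h by (auto simp: commutes_def composable_def)
    have d: "Cod C i = Cod C a" "Dom C i' = Dom C b" "Cod C p = Cod C b" "Dom C p' = Dom C c"
      using commutesD[OF h(6)] commutesD[OF h(7)] by simp_all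
    note [simp] = ci(1-6,8,9) d a(1-4) b(1-4) c(1-4)
    have "i \<cdot>\<^bsub>C\<^esub> a' = (b' \<cdot>\<^bsub>C\<^esub> (b \<cdot>\<^bsub>C\<^esub> i)) \<cdot>\<^bsub>C\<^esub> a'" using comp_reduce[OF b(6), of i] by simp
    also have "\<dots> = b' \<cdot>\<^bsub>C\<^esub> i'" unfolding ci(7) by (simp add: a(5))
    finally have 1: "commutes C i a' b' i'" by (simp add: commutes_def composable_def)
    have "p \<cdot>\<^bsub>C\<^esub> b' = (c' \<cdot>\<^bsub>C\<^esub> (c \<cdot>\<^bsub>C\<^esub> p)) \<cdot>\<^bsub>C\<^esub> b'" using comp_reduce[OF c(6), of p] by simp
    also have "\<dots> = c' \<cdot>\<^bsub>C\<^esub> p'" unfolding ci(10) by (simp add: b(5))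
    finally have 2: "commutes C p b' c' p'" by (simp add: commutes_def composable_def)
    have "is_iso C b'" by (rule is_isoI[of _ b]) (use b in simp_all)
    moreover have "is_iso C c'" by (rule is_isoI[of _ c]) (use c in simp_all)
    moreover have "is_iso C a'" by (rule is_isoI[of _ a]) (use a in simp_all)
    ultimately show ?thesis using ax4[OF h(1) _ _ _ h(5) 2 1] by blast
  qed
  show ?thesis
    unfolding exact_category_def op_simps op_notions
  proof (intro conjI, goal_cases)
    case 1 show ?case by (rule additive_op[OF ax1])
  next
    case 2 show ?case using ax2 by auto
  next
    case 3 show ?case using ax3 biproduct_swap[OF pre] by blast
  next
    case 4 show ?case using iso by blast
  next
    case 5 show ?case using ax6 by blast
  next
    case 6 show ?case using ax5 by blast
  next
    case 7 show ?case using ax8 by blast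
  next
    case 8 show ?case using ax7 by blast
  next
    case 9 show ?case using ax10 by blast
  next
    case 10 show ?case using ax9 by blast
  qed
qed

locale preadditive_dual_loc = preadditive_loc C
  for C :: "('o, 'm, 'z) exact_cat_scheme" (structure)
begin

lemma preadditive_loc_op: "preadditive_loc (op_cat C)"
  by unfold_locales (rule preadditive_op[OF preadditive])

lemma is_cokernelI:
  assumes k: "k \<in> Arr C" "f \<in> Arr C" "Dom C k = Cod C f" "f \<cdot> k = Zero C (Dom C f) (Cod C k)"
    and e: "\<And>g. \<lbrakk>g \<in> Arr C; Dom C g = Cod C f; f \<cdot> g = Zero C (Dom C f) (Cod C g)\<rbrakk> \<Longrightarrow>
      \<exists>u\<in>Arr C. Cod C u = Cod C g \<and> Dom C u = Cod C k \<and> k \<cdot> u = g"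
    and m: "\<And>u X. \<lbrakk>u \<in> Arr C; Cod C u = X; Dom C u = Cod C k; k \<cdot> u = Zero C (Dom C k) X\<rbrakk> \<Longrightarrow> u = Zero C (Cod C k) X"
  shows "is_cokernel C f k"
proof -
  interpret op: preadditive_loc "op_cat C" by (rule preadditive_loc_op)
  have "is_kernel (op_cat C) f k"
    by (rule op.is_kernelI) (use assms in simp_all)
  then show ?thesis by simp
qed

text \<open>Two arrows into the summands agree over the common target exactly if the arrow into the
  direct sum is killed by the difference. This form is convenient for complexes, where a kernel
  comes with its differential.\<close>

lemma pullback_from_kernel:
  assumes b: "biproduct C X Z S i1 i2 p1 p2" and p: "p \<in> Arr C" "Dom C p = X" and f: "f \<in> Arr C" "Dom C f = Z" "Cod C f = Cod C p"
    and k: "is_kernel C (p1 \<cdot> p \<boxplus> Neg C (p2 \<cdot> f)) k"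
  shows "pullback C f p (k \<cdot> p1) (k \<cdot> p2)"
proof -
  note [simp] = biproduct_simps[OF b] p f
  have [simp]: "k \<in> Arr C" "Cod C k = S" using is_kernelD[OF k] by simp_all
  have "k \<cdot> (p1 \<cdot> p) \<boxplus> Neg C (k \<cdot> (p2 \<cdot> f)) = Zero C (Dom C k) (Cod C p)" using is_kernelD(4)[OF k] by simp
  then have e: "k \<cdot> (p1 \<cdot> p) = k \<cdot> (p2 \<cdot> f)" using sub_eq_zero[of "k \<cdot> (p1 \<cdot> p)" "k \<cdot> (p2 \<cdot> f)"] by simp
  have "\<exists>!u. u \<in> Hom C (Dom C g) (Dom C (k \<cdot> p1)) \<and> u \<cdot> (k \<cdot> p1) = g \<and> u \<cdot> (k \<cdot> p2) = h"
    if gh: "commutes C g p h f" for g h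
  proof -
    have [simp]: "g \<in> Arr C" "h \<in> Arr C" "Cod C g = X" "Cod C h = Z" "Dom C h = Dom C g" "g \<cdot> p = h \<cdot> f"
      using commutesD[OF gh] by simp_all
    let ?w = "g \<cdot> i1 \<boxplus> h \<cdot> i2"
    have "?w \<cdot> (p1 \<cdot> p \<boxplus> Neg C (p2 \<cdot> f)) = Zero C (Dom C g) (Cod C p)" by simp
    then obtain u where u: "u \<in> Arr C" "Dom C u = Dom C ?w" "Cod C u = Dom C k" "u \<cdot> k = ?w"
      using kernel_lift[OF k, of ?w] by auto
    have [simp]: "u \<in> Arr C" "Dom C u = Dom C g" "Cod C u = Dom C k" using u by simp_all
    show ?thesis
    proof (intro ex1I[of _ u] conjI)
      show "u \<cdot> (k \<cdot> p1) = g" "u \<cdot> (k \<cdot> p2) = h"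
        using comp_reduce[OF u(4), of p1] comp_reduce[OF u(4), of p2] by simp_all
      fix v assume v: "v \<in> Hom C (Dom C g) (Dom C (k \<cdot> p1)) \<and> v \<cdot> (k \<cdot> p1) = g \<and> v \<cdot> (k \<cdot> p2) = h"
      then have [simp]: "v \<in> Arr C" "Dom C v = Dom C g" "Cod C v = Dom C k" by (simp_all add: Hom_iff)
      have "v \<cdot> k = ?w" by (rule biproduct_eqI[OF b]) (use v in simp_all)
      then show "v = u" using kernel_mono[OF k, of v u] by (simp add: u(4))
    qed (simp add: Hom_iff)
  qed
  moreover have "commutes C (k \<cdot> p1) p (k \<cdot> p2) f" using e by (simp add: commutes_def composable_def)
  ultimately show ?thesis unfolding pullback_def by blast
qed

end

lemma (in preadditive_dual_loc) pushout_from_cokernel: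
  assumes "biproduct C Y Z S i1 i2 p1 p2" "i \<in> Arr C" "Cod C i = Y" "f \<in> Arr C" "Cod C f = Z" "Dom C f = Dom C i"
    and "is_cokernel C (i \<cdot> i1 \<boxplus> Neg C (f \<cdot> i2)) c"
  shows "pushout C i f (i1 \<cdot> c) (i2 \<cdot> c)"
proof -
  interpret op: preadditive_loc "op_cat C" by (rule preadditive_loc_op)
  interpret op: preadditive_dual_loc "op_cat C" by unfold_locales
  show ?thesis using op.pullback_from_kernel[of Y Z S p1 p2 i1 i2 i f c] assms by simp
qed

section \<open>Exact categories in which split-off factors of pure morphisms are pure\<close>

text \<open>The last two clauses say that no kernel or cokernel is needed in axiom c; this is what
  splitting idempotents is used for, and unlike idempotent splitting it obviously passes from
  \<open>E\<close> to \<open>C(E)\<close>.\<close>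

definition pure_category :: "('o, 'm, 'z) exact_cat_scheme \<Rightarrow> bool" where
  "pure_category C \<longleftrightarrow> exact_category C \<and>
     (\<forall>f g. composable C f g \<and> pure_epi C (f \<cdot>\<^bsub>C\<^esub> g) \<longrightarrow> pure_epi C g) \<and>
     (\<forall>f g. composable C f g \<and> pure_mono C (f \<cdot>\<^bsub>C\<^esub> g) \<longrightarrow> pure_mono C f)"

lemma pure_category_op: "pure_category C \<Longrightarrow> pure_category (op_cat C)"
  unfolding pure_category_def using exact_op by (simp; blast)

locale exact_loc =
  fixes C :: "('o, 'm, 'z) exact_cat_scheme" (structure)
  assumes exact: "exact_category C"
begin

lemma additive: "additive_category C"
  using exact unfolding exact_category_def by (elim conjE)

sublocale preadditive_dual_loc C
  by unfold_locales (use additive in \<open>simp add: additive_category_def\<close>)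

lemma biproduct_exists:
  assumes "X \<in> Obj C" "Y \<in> Obj C"
  obtains S i1 i2 p1 p2 where "biproduct C X Y S i1 i2 p1 p2"
  using additive assms unfolding additive_category_def by blast

lemma zero_object_exists: obtains Z where "zero_object C Z"
  using additive unfolding additive_category_def by blast

lemma zero_object_simps:
  assumes "zero_object C Z"
  shows "Z \<in> Obj C" "\<And>f. f \<in> Arr C \<Longrightarrow> Cod C f = Z \<Longrightarrow> f = Zero C (Dom C f) Z"
    "\<And>f. f \<in> Arr C \<Longrightarrow> Dom C f = Z \<Longrightarrow> f = Zero C Z (Cod C f)"
proof -
  show Z: "Z \<in> Obj C" using assms by (simp add: zero_object_def)
  fix f assume f: "f \<in> Arr C"
  have u: "\<exists>!g. g \<in> Hom C X Z" "\<exists>!g. g \<in> Hom C Z X" if "X \<in> Obj C" for X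
    using assms that by (simp_all add: zero_object_def)
  show "f = Zero C (Dom C f) Z" if "Cod C f = Z"
    using u(1)[of "Dom C f"] f that Z by (metis Hom_iff dom_obj zero_arr)
  show "f = Zero C Z (Cod C f)" if "Dom C f = Z"
    using u(2)[of "Cod C f"] f that Z by (metis Hom_iff cod_obj zero_arr)
qed

lemma seq_ker: "(i, p) \<in> Pure_Seq C \<Longrightarrow> is_kernel C p i"
  and seq_coker: "(i, p) \<in> Pure_Seq C \<Longrightarrow> is_cokernel C i p"
proof -
  have "\<forall>x\<in>Pure_Seq C. case x of (i, p) \<Rightarrow> is_kernel C p i \<and> is_cokernel C i p"
    using exact unfolding exact_category_def by (elim conjE)
  then show "(i, p) \<in> Pure_Seq C \<Longrightarrow> is_kernel C p i" "(i, p) \<in> Pure_Seq C \<Longrightarrow> is_cokernel C i p"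
    by auto
qed

lemma biproduct_seq: "biproduct C X Y S i1 i2 p1 p2 \<Longrightarrow> (i1, p2) \<in> Pure_Seq C"
proof -
  have "\<forall>X Y S i1 i2 p1 p2. biproduct C X Y S i1 i2 p1 p2 \<longrightarrow> (i1, p2) \<in> Pure_Seq C"
    using exact unfolding exact_category_def by (elim conjE)
  then show "biproduct C X Y S i1 i2 p1 p2 \<Longrightarrow> (i1, p2) \<in> Pure_Seq C" by blast
qed

lemma biproduct_seq': "biproduct C X Y S i1 i2 p1 p2 \<Longrightarrow> (i2, p1) \<in> Pure_Seq C"
  using biproduct_seq biproduct_swap[OF preadditive] by blast

lemma seq_iso:
  assumes "(i, p) \<in> Pure_Seq C" "is_iso C a" "is_iso C b" "is_iso C c" "composable C i' p'"
    "commutes C i b a i'" "commutes C p c b p'"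
  shows "(i', p') \<in> Pure_Seq C"
proof -
  have "\<forall>i p i' p' a b c. (i, p) \<in> Pure_Seq C \<and> is_iso C a \<and> is_iso C b \<and> is_iso C c \<and>
        composable C i' p' \<and> commutes C i b a i' \<and> commutes C p c b p' \<longrightarrow> (i', p') \<in> Pure_Seq C"
    using exact unfolding exact_category_def by (elim conjE)
  from this[rule_format, of i p a b c i' p'] show ?thesis using assms by simp
qed

lemma pure_epi_comp: "\<lbrakk>pure_epi C p; pure_epi C q; Cod C p = Dom C q\<rbrakk> \<Longrightarrow> pure_epi C (p \<cdot> q)"
  and pure_mono_comp: "\<lbrakk>pure_mono C i; pure_mono C j; Cod C i = Dom C j\<rbrakk> \<Longrightarrow> pure_mono C (i \<cdot> j)"
proof -
  have *: "\<forall>p q. pure_epi C p \<and> pure_epi C q \<and> composable C p q \<longrightarrow> pure_epi C (p \<cdot> q)"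
    "\<forall>i j. pure_mono C i \<and> pure_mono C j \<and> composable C i j \<longrightarrow> pure_mono C (i \<cdot> j)"
    using exact unfolding exact_category_def by - (elim conjE, assumption)+
  have "pure_epi C p \<Longrightarrow> p \<in> Arr C" "pure_mono C p \<Longrightarrow> p \<in> Arr C" for p
    using seq_ker unfolding pure_epi_def pure_mono_def by (blast dest: is_kernelD)+
  then show "\<lbrakk>pure_epi C p; pure_epi C q; Cod C p = Dom C q\<rbrakk> \<Longrightarrow> pure_epi C (p \<cdot> q)"
    "\<lbrakk>pure_mono C i; pure_mono C j; Cod C i = Dom C j\<rbrakk> \<Longrightarrow> pure_mono C (i \<cdot> j)"
    using * by (auto simp: composable_def)
qed

lemma seq_arr:
  assumes "(i, p) \<in> Pure_Seq C"
  shows "i \<in> Arr C" "p \<in> Arr C" "Cod C i = Dom C p" "i \<cdot> p = Zero C (Dom C i) (Cod C p)"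
  using is_kernelD[OF seq_ker[OF assms]] by simp_all

lemma seq_reduce:
  "\<lbrakk>(i, p) \<in> Pure_Seq C; k \<in> Arr C; Dom C k = Cod C p\<rbrakk> \<Longrightarrow> i \<cdot> (p \<cdot> k) = Zero C (Dom C i) (Cod C k)"
  using comp_reduce[OF seq_arr(4)] by (simp add: seq_arr)

lemma seq_lift:
  assumes "(i, p) \<in> Pure_Seq C" "g \<in> Arr C" "Cod C g = Dom C p" "g \<cdot> p = Zero C (Dom C g) (Cod C p)"
  obtains u where "u \<in> Arr C" "Dom C u = Dom C g" "Cod C u = Dom C i" "u \<cdot> i = g"
  using kernel_lift[OF seq_ker[OF assms(1)] assms(2-)] by blast

lemma seq_mono:
  "\<lbrakk>(i, p) \<in> Pure_Seq C; u \<cdot> i = v \<cdot> i; u \<in> Arr C; v \<in> Arr C; Dom C u = Dom C v; Cod C u = Dom C i; Cod C v = Dom C i\<rbrakk> \<Longrightarrow> u = v"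
  using kernel_mono[OF seq_ker] by blast

lemma seq_desc:
  assumes "(i, p) \<in> Pure_Seq C" "g \<in> Arr C" "Dom C g = Dom C p" "i \<cdot> g = Zero C (Dom C i) (Cod C g)"
  obtains u where "u \<in> Arr C" "Dom C u = Cod C p" "Cod C u = Cod C g" "p \<cdot> u = g"
proof -
  interpret op: preadditive_loc "op_cat C" by unfold_locales (rule preadditive_op[OF preadditive])
  show thesis
    using op.kernel_lift[of i p g] seq_coker[OF assms(1)] seq_arr[OF assms(1)] assms(2-) that by auto
qed

lemma seq_epi:
  "\<lbrakk>(i, p) \<in> Pure_Seq C; p \<cdot> u = p \<cdot> v; u \<in> Arr C; v \<in> Arr C; Cod C u = Cod C v; Dom C u = Cod C p; Dom C v = Cod C p\<rbrakk> \<Longrightarrow> u = v"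
proof -
  interpret op: preadditive_loc "op_cat C" by unfold_locales (rule preadditive_op[OF preadditive])
  show "\<lbrakk>(i, p) \<in> Pure_Seq C; p \<cdot> u = p \<cdot> v; u \<in> Arr C; v \<in> Arr C; Cod C u = Cod C v; Dom C u = Cod C p; Dom C v = Cod C p\<rbrakk> \<Longrightarrow> u = v"
    using op.kernel_mono[of i p u v] seq_coker[of i p] by simp
qed

lemma pure_epi_seq: "pure_epi C p \<Longrightarrow> \<exists>i. (i, p) \<in> Pure_Seq C"
  and pure_mono_seq: "pure_mono C i \<Longrightarrow> \<exists>p. (i, p) \<in> Pure_Seq C"
  by (simp_all add: pure_epi_def pure_mono_def)

lemma seq_pure: "(i, p) \<in> Pure_Seq C \<Longrightarrow> pure_epi C p" "(i, p) \<in> Pure_Seq C \<Longrightarrow> pure_mono C i"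
  by (auto simp: pure_epi_def pure_mono_def)

lemma pure_epi_arr: "pure_epi C p \<Longrightarrow> p \<in> Arr C" and pure_mono_arr: "pure_mono C i \<Longrightarrow> i \<in> Arr C"
  using pure_epi_seq pure_mono_seq seq_arr by blast+

lemma pure_epi_cancel:
  "\<lbrakk>pure_epi C q; q \<cdot> u = q \<cdot> v; u \<in> Arr C; v \<in> Arr C; Cod C u = Cod C v; Dom C u = Cod C q; Dom C v = Cod C q\<rbrakk> \<Longrightarrow> u = v"
  using pure_epi_seq seq_epi by blast

lemma pure_pullback:
  assumes "pure_epi C p" "f \<in> Arr C" "Cod C f = Cod C p"
  obtains f' p' where "pullback C f p f' p'" "pure_epi C p'" "f' \<in> Arr C" "p' \<in> Arr C"
    "Cod C f' = Dom C p" "Cod C p' = Dom C f" "Dom C f' = Dom C p'" "f' \<cdot> p = p' \<cdot> f"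
proof -
  have "\<forall>p f. pure_epi C p \<and> f \<in> Arr C \<and> Cod C f = Cod C p \<longrightarrow> (\<exists>f' p'. pullback C f p f' p' \<and> pure_epi C p')"
    using exact unfolding exact_category_def by (elim conjE)
  then obtain f' p' where *: "pullback C f p f' p'" "pure_epi C p'" using assms by blast
  then have c: "commutes C f' p p' f" by (simp add: pullback_def)
  show thesis using commutesD[OF c] by (intro that[OF *]) auto
qed

lemma pure_pushout:
  assumes "pure_mono C i" "f \<in> Arr C" "Dom C f = Dom C i"
  obtains f' i' where "pushout C i f f' i'" "pure_mono C i'" "f' \<in> Arr C" "i' \<in> Arr C"
    "Dom C f' = Cod C i" "Dom C i' = Cod C f" "Cod C f' = Cod C i'" "i \<cdot> f' = f \<cdot> i'"
proof -
  have "\<forall>i f. pure_mono C i \<and> f \<in> Arr C \<and> Dom C f = Dom C i \<longrightarrow> (\<exists>f' i'. pushout C i f f' i' \<and> pure_mono C i')"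
    using exact unfolding exact_category_def by (elim conjE)
  then obtain f' i' where *: "pushout C i f f' i'" "pure_mono C i'" using assms by blast
  then have c: "commutes C i f' f i'" by (simp add: pushout_def)
  show thesis using commutesD[OF c] by (intro that[OF *]) auto
qed

lemma pullback_lift:
  assumes "pullback C f p f' p'" "g \<in> Arr C" "h \<in> Arr C" "Cod C g = Dom C p" "Cod C h = Dom C f" "g \<cdot> p = h \<cdot> f"
    "f \<in> Arr C" "p \<in> Arr C"
  obtains k where "k \<in> Arr C" "Dom C k = Dom C g" "Cod C k = Dom C f'" "k \<cdot> f' = g" "k \<cdot> p' = h"
proof -
  have "commutes C g p h f" using assms by (simp add: commutes_def composable_def)
  then obtain k where "k \<in> Hom C (Dom C g) (Dom C f')" "k \<cdot> f' = g" "k \<cdot> p' = h"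
    using assms(1) unfolding pullback_def by blast
  then show thesis by (intro that[of k]) (simp_all add: Hom_iff)
qed

lemma pullback_eqI:
  assumes P: "pullback C f p f' p'" and u: "u \<in> Arr C" "v \<in> Arr C" "Dom C u = Dom C v" "Cod C u = Dom C f'" "Cod C v = Dom C f'"
    and e: "u \<cdot> f' = v \<cdot> f'" "u \<cdot> p' = v \<cdot> p'"
  shows "u = v"
proof -
  have c: "commutes C f' p p' f" using P by (simp add: pullback_def)
  note [simp] = commutesD(1-8)[OF c] u
  have "commutes C (u \<cdot> f') p (u \<cdot> p') f"
    using commutesD(9)[OF c] commutesD(7)[OF c] by (simp add: commutes_def composable_def)
  then have "\<exists>!k. k \<in> Hom C (Dom C (u \<cdot> f')) (Dom C f') \<and> k \<cdot> f' = u \<cdot> f' \<and> k \<cdot> p' = u \<cdot> p'"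
    using P unfolding pullback_def by blast
  moreover have "u \<in> Hom C (Dom C (u \<cdot> f')) (Dom C f')" "v \<in> Hom C (Dom C (u \<cdot> f')) (Dom C f')"
    using u by (simp_all add: Hom_iff del: commutesD)
  ultimately show ?thesis using e by metis
qed

lemma is_iso_Ident: "X \<in> Obj C \<Longrightarrow> is_iso C (Ident C X)"
  by (rule is_isoI[of _ "Ident C X"]) simp_all

text \<open>Kernels are unique up to isomorphism, and pure sequences are closed under isomorphism.
  Purity of a sequence thus splits into purity of \<open>p\<close> and a universal property.\<close>

lemma pure_seq_kernel:
  assumes p: "pure_epi C p" and k: "is_kernel C p k"
  shows "(k, p) \<in> Pure_Seq C"
proof -
  obtain i where i: "(i, p) \<in> Pure_Seq C" using pure_epi_seq[OF p] by blast
  note [simp] = seq_arr(1-3)[OF i] is_kernelD(1,3)[OF k]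
  obtain u where u: "u \<in> Arr C" "Dom C u = Dom C i" "Cod C u = Dom C k" "u \<cdot> k = i"
    by (rule kernel_lift[OF k, of i]) (simp_all add: seq_arr(4)[OF i])
  obtain v where v: "v \<in> Arr C" "Dom C v = Dom C k" "Cod C v = Dom C i" "v \<cdot> i = k"
    by (rule kernel_lift[OF seq_ker[OF i], of k]) (simp_all add: is_kernelD(4)[OF k])
  note [simp] = u(1-3) v(1-3)
  have "u \<cdot> v = Ident C (Dom C i)" by (rule seq_mono[OF i]) (simp_all add: u v)
  moreover have "v \<cdot> u = Ident C (Dom C k)" by (rule kernel_mono[OF k]) (simp_all add: u v)
  ultimately have "is_iso C u" by (intro is_isoI[of _ v]) simp_all
  then show ?thesis
    by (rule seq_iso[OF i _ is_iso_Ident is_iso_Ident, of _ "Dom C p" "Cod C p"])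
      (simp_all add: commutes_def composable_def u(4))
qed

lemma exact_loc_op: "exact_loc (op_cat C)"
  by unfold_locales (rule exact_op[OF exact])

lemma pure_seq_cokernel:
  assumes "pure_mono C i" "is_cokernel C i c"
  shows "(i, c) \<in> Pure_Seq C"
proof -
  interpret op: exact_loc "op_cat C" by (rule exact_loc_op)
  show ?thesis using op.pure_seq_kernel[of i c] assms by simp
qed

lemma pure_mono_Ident: "X \<in> Obj C \<Longrightarrow> pure_mono C (Ident C X)"
  and pure_epi_Ident: "X \<in> Obj C \<Longrightarrow> pure_epi C (Ident C X)"
  and Ident_seq: "\<lbrakk>zero_object C Z; X \<in> Obj C\<rbrakk> \<Longrightarrow> (Ident C X, Zero C X Z) \<in> Pure_Seq C"
    "\<lbrakk>zero_object C Z; X \<in> Obj C\<rbrakk> \<Longrightarrow> (Zero C Z X, Ident C X) \<in> Pure_Seq C"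
proof -
  \<comment> \<open>Identities are pure because \<open>X\<close> is a direct sum of itself and a
    zero object.\<close>
  have *: "biproduct C X Z X (Ident C X) (Zero C Z X) (Ident C X) (Zero C X Z)"
    if "zero_object C Z" "X \<in> Obj C" for X Z
    using zero_object_simps[OF that(1)] that(2) zero_object_simps(2)[OF that(1), of "Ident C Z"]
    by (simp add: biproduct_def Hom_iff)
  show 1: "\<lbrakk>zero_object C Z; X \<in> Obj C\<rbrakk> \<Longrightarrow> (Ident C X, Zero C X Z) \<in> Pure_Seq C" for Z X
    using biproduct_seq[OF *] by blast
  show 2: "\<lbrakk>zero_object C Z; X \<in> Obj C\<rbrakk> \<Longrightarrow> (Zero C Z X, Ident C X) \<in> Pure_Seq C" for Z X
    using biproduct_seq'[OF *] by blast
  obtain Z where Z: "zero_object C Z" by (rule zero_object_exists)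
  show "X \<in> Obj C \<Longrightarrow> pure_mono C (Ident C X)" by (rule seq_pure(2)[OF 1[OF Z]])
  show "X \<in> Obj C \<Longrightarrow> pure_epi C (Ident C X)" by (rule seq_pure(1)[OF 2[OF Z]])
qed

text \<open>Axiom c applies once \<open>f\<close> has a kernel. Base change of
  \<open>g \<cdot> f\<close> along \<open>f\<close> yields \<open>f'\<close> and \<open>p'\<close>,
  and the difference of \<open>p'\<close> and \<open>f' \<cdot> g\<close> is annihilated by
  \<open>f\<close>. An arrow \<open>z\<close> annihilated by \<open>f\<close> factors through this
  difference canonically, by the lift to the pullback with components zero and \<open>z\<close>. The
  kernel is therefore a retract of the pullback, obtained by splitting an idempotent.\<close>

lemma pure_epi_if_split_factor:
  assumes spl: "idempotent_splitting C" and c: "composable C g f" and e: "pure_epi C (g \<cdot> f)"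
  shows "pure_epi C f"
proof -
  have [simp]: "f \<in> Arr C" "g \<in> Arr C" "Cod C g = Dom C f" using c by (auto simp: composable_def)
  obtain f' p' where P: "pullback C f (g \<cdot> f) f' p'" "pure_epi C p'" "f' \<in> Arr C" "p' \<in> Arr C"
    "Cod C f' = Dom C (g \<cdot> f)" "Cod C p' = Dom C f" "Dom C f' = Dom C p'" "f' \<cdot> (g \<cdot> f) = p' \<cdot> f"
    by (rule pure_pullback[OF e, of f]) simp_all
  have [simp]: "f' \<in> Arr C" "p' \<in> Arr C" "Cod C f' = Dom C g" "Cod C p' = Dom C f" "Dom C f' = Dom C p'"
    using P by simp_all
  define \<phi> where "\<phi> z = (SOME u. u \<in> Arr C \<and> Dom C u = Dom C z \<and> Cod C u = Dom C f' \<and>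
    u \<cdot> f' = Zero C (Dom C z) (Dom C g) \<and> u \<cdot> p' = z)" for z
  have phi: "\<phi> z \<in> Arr C \<and> Dom C (\<phi> z) = Dom C z \<and> Cod C (\<phi> z) = Dom C f' \<and>
    \<phi> z \<cdot> f' = Zero C (Dom C z) (Dom C g) \<and> \<phi> z \<cdot> p' = z"
    if z: "z \<in> Arr C" "Cod C z = Dom C f" "z \<cdot> f = Zero C (Dom C z) (Cod C f)" for z
  proof -
    obtain u where u: "u \<in> Arr C" "Dom C u = Dom C (Zero C (Dom C z) (Dom C g))" "Cod C u = Dom C f'"
      "u \<cdot> f' = Zero C (Dom C z) (Dom C g)" "u \<cdot> p' = z"
      by (rule pullback_lift[OF P(1), of "Zero C (Dom C z) (Dom C g)" z]) (use z in simp_all)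
    have "Dom C u = Dom C z" unfolding u(2) by (rule zero_arr) (use z in simp_all)
    then have "\<exists>u. u \<in> Arr C \<and> Dom C u = Dom C z \<and> Cod C u = Dom C f' \<and>
      u \<cdot> f' = Zero C (Dom C z) (Dom C g) \<and> u \<cdot> p' = z" using u by blast
    then show ?thesis unfolding \<phi>_def by (rule someI_ex)
  qed
  let ?w = "p' \<boxplus> Neg C (f' \<cdot> g)"
  have wf: "?w \<cdot> f = Zero C (Dom C p') (Cod C f)" using P(8) by simp
  have "\<exists>k. is_kernel C f k"
  proof (rule kernel_as_retract[OF spl, of ?w f \<phi>])
    fix z assume z: "z \<in> Arr C" "Cod C z = Dom C f" "z \<cdot> f = Zero C (Dom C z) (Cod C f)"
    have [simp]: "\<phi> z \<in> Arr C" "Dom C (\<phi> z) = Dom C z" "Cod C (\<phi> z) = Dom C p'" "\<phi> z \<cdot> p' = z"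
      using phi[OF z] by simp_all
    have "\<phi> z \<cdot> (f' \<cdot> g) = Zero C (Dom C z) (Dom C f)"
      using comp_reduce[of "\<phi> z" f' "Zero C (Dom C z) (Dom C g)" g] phi[OF z] z by simp
    then show "\<phi> z \<in> Arr C \<and> Dom C (\<phi> z) = Dom C z \<and> Cod C (\<phi> z) = Dom C ?w \<and> \<phi> z \<cdot> ?w = z"
      using z by simp
  next
    fix u z assume u: "u \<in> Arr C" "z \<in> Arr C" "Cod C u = Dom C z" "Cod C z = Dom C f" "z \<cdot> f = Zero C (Dom C z) (Cod C f)"
    note pz = phi[OF u(2,4,5)]
    have pu: "\<phi> (u \<cdot> z) \<in> Arr C \<and> Dom C (\<phi> (u \<cdot> z)) = Dom C (u \<cdot> z) \<and> Cod C (\<phi> (u \<cdot> z)) = Dom C f' \<and>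
      \<phi> (u \<cdot> z) \<cdot> f' = Zero C (Dom C (u \<cdot> z)) (Dom C g) \<and> \<phi> (u \<cdot> z) \<cdot> p' = u \<cdot> z"
      by (rule phi) (use u in simp_all)
    \<comment> \<open>Both sides have the same components in the pullback. This uniqueness makes the
      chosen lifts natural.\<close>
    show "\<phi> (u \<cdot> z) = u \<cdot> \<phi> z"
      by (rule pullback_eqI[OF P(1)]) (use u pz pu in simp_all)
  qed (use wf in simp_all)
  moreover have "\<forall>f g. composable C g f \<and> (\<exists>k. is_kernel C f k) \<and> pure_epi C (g \<cdot> f) \<longrightarrow> pure_epi C f"
    using exact unfolding exact_category_def by (elim conjE)
  ultimately show ?thesis using c e by blast
qed

lemma pure_category_if_idempotent_splitting:
  assumes "idempotent_splitting C"
  shows "pure_category C"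
proof -
  interpret op: exact_loc "op_cat C" by (rule exact_loc_op)
  show ?thesis unfolding pure_category_def
    using exact pure_epi_if_split_factor[OF assms] op.pure_epi_if_split_factor[OF idempotent_splitting_op[OF assms]]
    by auto
qed

end

section \<open>Diagram lemmas by local lifting\<close>

locale pure_loc =
  fixes C :: "('o, 'm, 'z) exact_cat_scheme" (structure)
  assumes pure: "pure_category C"
begin

sublocale exact_loc C
  by unfold_locales (use pure in \<open>simp add: pure_category_def\<close>)

lemma pure_loc_op: "pure_loc (op_cat C)"
  by unfold_locales (rule pure_category_op[OF pure])

lemma pure_epi_right: "\<lbrakk>pure_epi C (f \<cdot> g); f \<in> Arr C; g \<in> Arr C; Cod C f = Dom C g\<rbrakk> \<Longrightarrow> pure_epi C g"
  and pure_mono_left: "\<lbrakk>pure_mono C (f \<cdot> g); f \<in> Arr C; g \<in> Arr C; Cod C f = Dom C g\<rbrakk> \<Longrightarrow> pure_mono C f"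
  using pure unfolding pure_category_def composable_def by blast+

text \<open>A pure epimorphism \<open>q\<close> is the cokernel of some \<open>l\<close>, so a
  factorisation \<open>y\<close> of \<open>q \<cdot> g\<close> descends to one of \<open>g\<close>:
  the composite \<open>l \<cdot> y\<close> vanishes because it does so after \<open>k\<close>.
  Kernels may thus be recognised on generalised elements.\<close>

lemma is_kernel_locally:
  assumes k: "k \<in> Arr C" "f \<in> Arr C" "Cod C k = Dom C f" "k \<cdot> f = Zero C (Dom C k) (Cod C f)"
    and m: "\<And>u X. \<lbrakk>u \<in> Arr C; Dom C u = X; Cod C u = Dom C k; u \<cdot> k = Zero C X (Cod C k)\<rbrakk> \<Longrightarrow> u = Zero C X (Dom C k)"
    and e: "\<And>g. \<lbrakk>g \<in> Arr C; Cod C g = Dom C f; g \<cdot> f = Zero C (Dom C g) (Cod C f)\<rbrakk> \<Longrightarrow>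
      \<exists>q y. pure_epi C q \<and> Cod C q = Dom C g \<and> y \<in> Arr C \<and> Dom C y = Dom C q \<and> Cod C y = Dom C k \<and> q \<cdot> g = y \<cdot> k"
  shows "is_kernel C f k"
proof (rule is_kernelI)
  fix g assume g: "g \<in> Arr C" "Cod C g = Dom C f" "g \<cdot> f = Zero C (Dom C g) (Cod C f)"
  obtain q y where q: "pure_epi C q" "Cod C q = Dom C g" and y: "y \<in> Arr C" "Dom C y = Dom C q" "Cod C y = Dom C k"
    and qg: "q \<cdot> g = y \<cdot> k" using e[OF g] by blast
  obtain l where l: "(l, q) \<in> Pure_Seq C" using pure_epi_seq[OF q(1)] by blast
  note [simp] = seq_arr(1-3)[OF l] q(2) y k(1-3) g(1,2)
  have "(l \<cdot> y) \<cdot> k = l \<cdot> (q \<cdot> g)" by (simp add: qg)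
  also have "\<dots> = Zero C (Dom C l) (Cod C k)" by (simp add: seq_reduce[OF l])
  finally have "l \<cdot> y = Zero C (Dom C l) (Dom C k)" by (intro m) simp_all
  then obtain u where u: "u \<in> Arr C" "Dom C u = Cod C q" "Cod C u = Cod C y" "q \<cdot> u = y"
    using seq_desc[OF l, of y] by auto
  note [simp] = u(1-3)
  have "q \<cdot> (u \<cdot> k) = q \<cdot> g" using comp_reduce[OF u(4), of k] qg by simp
  then have "u \<cdot> k = g" by (rule seq_epi[OF l]) simp_all
  then show "\<exists>u\<in>Arr C. Dom C u = Dom C g \<and> Cod C u = Dom C k \<and> u \<cdot> k = g"
    by (intro bexI[of _ u]) simp_all
qed (use assms in auto)

text \<open>Noether's isomorphism theorem. The induced \<open>\<beta>\<close> is a pure epimorphism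
  as a right factor of \<open>c3\<close>; that \<open>\<alpha>\<close> is its kernel is checked on
  elements lifted along \<open>c\<close> and \<open>c2\<close>.\<close>

lemma cokernel_comp_seq:
  assumes s: "(s, c) \<in> Pure_Seq C" and t: "(t, c3) \<in> Pure_Seq C" and st: "(s \<cdot> t, c2) \<in> Pure_Seq C"
    and cod: "Cod C s = Dom C t"
  obtains \<alpha> \<beta> where "(\<alpha>, \<beta>) \<in> Pure_Seq C" "Dom C \<alpha> = Cod C c" "Cod C \<alpha> = Cod C c2" "Cod C \<beta> = Cod C c3"
proof -
  note [simp] = seq_arr(1,2)[OF s] seq_arr(1,2)[OF t] seq_arr(2)[OF st] cod
  have d [simp]: "Dom C c = Dom C t" "Dom C c3 = Cod C t" "Dom C c2 = Cod C t"
    using seq_arr(3)[OF s] seq_arr(3)[OF t] seq_arr(3)[OF st] by simp_all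
  have z: "s \<cdot> c = Zero C (Dom C s) (Cod C c)" "t \<cdot> c3 = Zero C (Dom C t) (Cod C c3)"
    "s \<cdot> (t \<cdot> c2) = Zero C (Dom C s) (Cod C c2)"
    using seq_arr(4)[OF s] seq_arr(4)[OF t] seq_arr(4)[OF st] by simp_all
  obtain \<alpha> where a: "\<alpha> \<in> Arr C" "Dom C \<alpha> = Cod C c" "Cod C \<alpha> = Cod C c2" "c \<cdot> \<alpha> = t \<cdot> c2"
    using seq_desc[OF s, of "t \<cdot> c2"] z by auto
  obtain \<beta> where b: "\<beta> \<in> Arr C" "Dom C \<beta> = Cod C c2" "Cod C \<beta> = Cod C c3" "c2 \<cdot> \<beta> = c3"
    using seq_desc[OF st, of c3] z by auto
  note [simp] = a(1-3) b(1-3)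
  have bp: "pure_epi C \<beta>"
    using pure_epi_right[of c2 \<beta>] seq_pure(1)[OF t] by (simp add: b(4))
  have c2b: "n \<cdot> (c2 \<cdot> \<beta>) = n \<cdot> c3" for n by (simp add: b(4))
  have "is_kernel C \<beta> \<alpha>"
  proof (rule is_kernel_locally)
    have "c \<cdot> (\<alpha> \<cdot> \<beta>) = c \<cdot> Zero C (Cod C c) (Cod C c3)"
      using comp_reduce[OF a(4), of \<beta>] by (simp add: b(4) z)
    then have "\<alpha> \<cdot> \<beta> = Zero C (Cod C c) (Cod C c3)" by (rule seq_epi[OF s]) simp_all
    then show "\<alpha> \<cdot> \<beta> = Zero C (Dom C \<alpha>) (Cod C \<beta>)" by simp
  next
    fix u X assume u: "u \<in> Arr C" "Dom C u = X" "Cod C u = Dom C \<alpha>" "u \<cdot> \<alpha> = Zero C X (Cod C \<alpha>)"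
    obtain m q where q: "pure_epi C q" "m \<in> Arr C" "q \<in> Arr C" "Cod C m = Dom C c" "Cod C q = Dom C u"
      "Dom C m = Dom C q" "m \<cdot> c = q \<cdot> u"
      by (rule pure_pullback[OF seq_pure(1)[OF s], of u]) (use u in simp_all)
    have [simp]: "u \<in> Arr C" "Dom C u = X" "Cod C u = Cod C c" "X \<in> Obj C" "m \<in> Arr C" "q \<in> Arr C" "Cod C m = Dom C t"
      "Cod C q = X" "Dom C m = Dom C q" using u q dom_obj[OF u(1)] by simp_all
    have "m \<cdot> (t \<cdot> c2) = (m \<cdot> c) \<cdot> \<alpha>" by (simp add: a(4))
    also have "\<dots> = Zero C (Dom C q) (Cod C c2)" unfolding q(7) using u(4) by simp
    finally obtain x where x: "x \<in> Arr C" "Dom C x = Dom C q" "Cod C x = Dom C s" "x \<cdot> (s \<cdot> t) = m \<cdot> t"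
      using seq_lift[OF st, of "m \<cdot> t"] by auto
    note [simp] = x(1-3)
    have "x \<cdot> s = m" by (rule seq_mono[OF t]) (simp_all add: x(4))
    then have "q \<cdot> u = (x \<cdot> s) \<cdot> c" by (simp add: q(7))
    then have "q \<cdot> u = q \<cdot> Zero C X (Cod C c)" by (simp add: z)
    then show "u = Zero C X (Dom C \<alpha>)" using pure_epi_cancel[OF q(1)] by simp
  next
    fix g assume g: "g \<in> Arr C" "Cod C g = Dom C \<beta>" "g \<cdot> \<beta> = Zero C (Dom C g) (Cod C \<beta>)"
    obtain n q where q: "pure_epi C q" "n \<in> Arr C" "q \<in> Arr C" "Cod C n = Dom C c2" "Cod C q = Dom C g"
      "Dom C n = Dom C q" "n \<cdot> c2 = q \<cdot> g"
      by (rule pure_pullback[OF seq_pure(1)[OF st], of g]) (use g in simp_all)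
    have [simp]: "g \<in> Arr C" "Cod C g = Cod C c2" "n \<in> Arr C" "q \<in> Arr C" "Cod C n = Cod C t" "Cod C q = Dom C g"
      "Dom C n = Dom C q" using g q by simp_all
    have "n \<cdot> c3 = (n \<cdot> c2) \<cdot> \<beta>" by (simp add: b(4))
    also have "\<dots> = Zero C (Dom C q) (Cod C c3)" unfolding q(7) using g(3) by simp
    finally obtain m where m: "m \<in> Arr C" "Dom C m = Dom C q" "Cod C m = Dom C t" "m \<cdot> t = n"
      using seq_lift[OF t, of n] by auto
    note [simp] = m(1-3)
    have "q \<cdot> g = (m \<cdot> c) \<cdot> \<alpha>" using comp_reduce[OF m(4), of c2] q(7) by (simp add: a(4))
    then show "\<exists>q y. pure_epi C q \<and> Cod C q = Dom C g \<and> y \<in> Arr C \<and> Dom C y = Dom C q \<and> Cod C y = Dom C \<alpha> \<and> q \<cdot> g = y \<cdot> \<alpha>"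
      using q(1) by (intro exI[of _ q] exI[of _ "m \<cdot> c"]) simp
  qed simp_all
  then show thesis using that[of \<alpha> \<beta>] pure_seq_kernel[OF bp, of \<alpha>] by simp
qed

lemma kernel_comp_seq:
  assumes "(k, p) \<in> Pure_Seq C" "(k3, q) \<in> Pure_Seq C" "(k2, p \<cdot> q) \<in> Pure_Seq C" "Cod C p = Dom C q"
  obtains \<alpha> \<beta> where "(\<alpha>, \<beta>) \<in> Pure_Seq C" "Dom C \<alpha> = Dom C k" "Cod C \<alpha> = Dom C k2" "Cod C \<beta> = Dom C k3"
proof -
  interpret op: pure_loc "op_cat C" by (rule pure_loc_op)
  obtain \<alpha> \<beta> where "(\<beta>, \<alpha>) \<in> Pure_Seq C" "Cod C \<alpha> = Dom C k3" "Dom C \<alpha> = Dom C k2" "Dom C \<beta> = Dom C k"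
    by (rule op.cokernel_comp_seq[of q k3 p k k2]) (use assms in simp_all)
  then show thesis using that[of \<beta> \<alpha>] seq_arr(3)[of \<beta> \<alpha>] by simp
qed

text \<open>Since \<open>s1 \<cdot> \<pi>\<close> is monic, the kernel of \<open>\<pi>\<close> meets
  \<open>s1\<close> trivially and embeds into the cokernel of \<open>s1\<close>; the quotient is the
  cokernel of \<open>s1 \<cdot> \<pi>\<close>.\<close>

lemma kernel_cokernel_seq:
  assumes s1: "(s1, c1) \<in> Pure_Seq C" and k: "(k, \<pi>) \<in> Pure_Seq C" and s: "(s1 \<cdot> \<pi>, c) \<in> Pure_Seq C"
    and cod: "Cod C s1 = Dom C \<pi>"
  obtains \<kappa> \<gamma> where "(\<kappa>, \<gamma>) \<in> Pure_Seq C" "Dom C \<kappa> = Dom C k" "Cod C \<kappa> = Cod C c1" "Cod C \<gamma> = Cod C c"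
proof -
  note [simp] = seq_arr(1,2)[OF s1] seq_arr(1,2)[OF k] seq_arr(2)[OF s] cod seq_arr(3)[OF k]
  have [simp]: "Dom C c1 = Dom C \<pi>" "Dom C c = Cod C \<pi>"
    using seq_arr(3)[OF s1] seq_arr(3)[OF s] by simp_all
  have z: "s1 \<cdot> c1 = Zero C (Dom C s1) (Cod C c1)" "k \<cdot> \<pi> = Zero C (Dom C k) (Cod C \<pi>)"
    "s1 \<cdot> (\<pi> \<cdot> c) = Zero C (Dom C s1) (Cod C c)"
    using seq_arr(4)[OF s1] seq_arr(4)[OF k] seq_arr(4)[OF s] by simp_all
  obtain \<gamma> where g: "\<gamma> \<in> Arr C" "Dom C \<gamma> = Cod C c1" "Cod C \<gamma> = Cod C c" "c1 \<cdot> \<gamma> = \<pi> \<cdot> c"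
    using seq_desc[OF s1, of "\<pi> \<cdot> c"] z by auto
  note [simp] = g(1-3)
  have "pure_epi C (c1 \<cdot> \<gamma>)" unfolding g(4)
    using seq_pure(1)[OF k] seq_pure(1)[OF s] by (intro pure_epi_comp) simp_all
  then have gp: "pure_epi C \<gamma>" by (rule pure_epi_right) simp_all
  have "is_kernel C \<gamma> (k \<cdot> c1)"
  proof (rule is_kernel_locally)
    show "(k \<cdot> c1) \<cdot> \<gamma> = Zero C (Dom C (k \<cdot> c1)) (Cod C \<gamma>)"
      using seq_reduce[OF k] by (simp add: g(4))
  next
    fix u X assume u: "u \<in> Arr C" "Dom C u = X" "Cod C u = Dom C (k \<cdot> c1)" "u \<cdot> (k \<cdot> c1) = Zero C X (Cod C (k \<cdot> c1))"
    have [simp]: "u \<in> Arr C" "Dom C u = X" "Cod C u = Dom C k" "X \<in> Obj C"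
      using u dom_obj[OF u(1)] by simp_all
    obtain x where x: "x \<in> Arr C" "Dom C x = X" "Cod C x = Dom C s1" "x \<cdot> s1 = u \<cdot> k"
      using seq_lift[OF s1, of "u \<cdot> k"] u(4) by auto
    note [simp] = x(1-3)
    have "x \<cdot> (s1 \<cdot> \<pi>) = Zero C X (Dom C s1) \<cdot> (s1 \<cdot> \<pi>)"
      using comp_reduce[OF x(4), of \<pi>] by (simp add: z)
    then have "x = Zero C X (Dom C s1)" by (rule seq_mono[OF s]) simp_all
    then have "u \<cdot> k = Zero C X (Dom C k) \<cdot> k" using x(4) by simp
    then have "u = Zero C X (Dom C k)" by (rule seq_mono[OF k]) simp_all
    then show "u = Zero C X (Dom C (k \<cdot> c1))" by simp
  next
    fix h assume h: "h \<in> Arr C" "Cod C h = Dom C \<gamma>" "h \<cdot> \<gamma> = Zero C (Dom C h) (Cod C \<gamma>)"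
    obtain n q where q: "pure_epi C q" "n \<in> Arr C" "q \<in> Arr C" "Cod C n = Dom C c1" "Cod C q = Dom C h"
      "Dom C n = Dom C q" "n \<cdot> c1 = q \<cdot> h"
      by (rule pure_pullback[OF seq_pure(1)[OF s1], of h]) (use h in simp_all)
    have [simp]: "h \<in> Arr C" "Cod C h = Cod C c1" "n \<in> Arr C" "q \<in> Arr C" "Cod C n = Dom C \<pi>" "Cod C q = Dom C h"
      "Dom C n = Dom C q" using h q by simp_all
    have "(n \<cdot> \<pi>) \<cdot> c = (n \<cdot> c1) \<cdot> \<gamma>" by (simp add: g(4))
    also have "\<dots> = Zero C (Dom C q) (Cod C c)" unfolding q(7) using h(3) by simp
    finally obtain x where x: "x \<in> Arr C" "Dom C x = Dom C q" "Cod C x = Dom C s1" "x \<cdot> (s1 \<cdot> \<pi>) = n \<cdot> \<pi>"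
      using seq_lift[OF s, of "n \<cdot> \<pi>"] by auto
    note [simp] = x(1-3)
    \<comment> \<open>Modulo \<open>s1\<close>, the element \<open>n\<close> moves into the kernel
      of \<open>\<pi>\<close>: the elements \<open>n\<close> and \<open>x \<cdot> s1\<close> have
      the same image under \<open>\<pi>\<close>.\<close>
    have "(n \<boxplus> Neg C (x \<cdot> s1)) \<cdot> \<pi> = Zero C (Dom C q) (Cod C \<pi>)" by (simp add: x(4))
    then obtain y where y: "y \<in> Arr C" "Dom C y = Dom C q" "Cod C y = Dom C k" "y \<cdot> k = n \<boxplus> Neg C (x \<cdot> s1)"
      using seq_lift[OF k, of "n \<boxplus> Neg C (x \<cdot> s1)"] by auto
    note [simp] = y(1-3)
    have "y \<cdot> (k \<cdot> c1) = (n \<boxplus> Neg C (x \<cdot> s1)) \<cdot> c1" using comp_reduce[OF y(4), of c1] by simp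
    also have "\<dots> = q \<cdot> h" by (simp add: z q(7))
    finally have "q \<cdot> h = y \<cdot> (k \<cdot> c1)" by simp
    then show "\<exists>q y. pure_epi C q \<and> Cod C q = Dom C h \<and> y \<in> Arr C \<and> Dom C y = Dom C q \<and>
        Cod C y = Dom C (k \<cdot> c1) \<and> q \<cdot> h = y \<cdot> (k \<cdot> c1)"
      using q(1) by (intro exI[of _ q] exI[of _ y]) simp
  qed simp_all
  then show thesis using that[of "k \<cdot> c1" \<gamma>] pure_seq_kernel[OF gp, of "k \<cdot> c1"] by simp
qed

text \<open>The second component \<open>e\<close> is a pure monomorphism, and left factors inherit
  purity.\<close>

lemma graph_pure_mono:
  assumes b: "biproduct C Y I S i1 i2 p1 p2" and e: "pure_mono C e" "Cod C e = I"
    and f: "f \<in> Arr C" "Dom C f = Dom C e" "Cod C f = Y"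
  shows "pure_mono C (f \<cdot> i1 \<boxplus> e \<cdot> i2)"
proof -
  note [simp] = biproduct_simps[OF b] e(2) f pure_mono_arr[OF e(1)]
  have "(f \<cdot> i1 \<boxplus> e \<cdot> i2) \<cdot> p2 = e" by simp
  then show ?thesis using e(1) pure_mono_left[of "f \<cdot> i1 \<boxplus> e \<cdot> i2" p2] by simp
qed

text \<open>The image of the kernel of \<open>p\<close> under \<open>s\<close> lies in the summand
  \<open>I\<close>, and modulo \<open>s\<close> every element of \<open>S\<close> can be moved into
  \<open>I\<close> because \<open>p\<close> is onto. This lets the acyclicity of the kernel of
  \<open>p\<close> be read off from \<open>I\<close> and the cokernel of \<open>s\<close>.\<close>

lemma graph_cokernel_seq:
  assumes b: "biproduct C Y I S i1 i2 p1 p2" and k: "(k, p) \<in> Pure_Seq C"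
    and s: "(s, c) \<in> Pure_Seq C" "Cod C s = S" "s \<cdot> p1 = p"
  shows "(k \<cdot> (s \<cdot> p2), i2 \<cdot> c) \<in> Pure_Seq C"
proof -
  note [simp] = biproduct_simps[OF b] seq_arr(1-3)[OF k] seq_arr(1,2)[OF s(1)] s(2)
  have [simp]: "Dom C c = S" using seq_arr(3)[OF s(1)] by simp
  have [simp]: "Dom C p = Dom C s" "Cod C p = Y" using comp_arr(2,3)[of s p1] s(3) by simp_all
  have kp: "k \<cdot> (s \<cdot> p1) = Zero C (Dom C k) Y" using seq_arr(4)[OF k] by (simp add: s(3))
  have sc: "s \<cdot> c = Zero C (Dom C s) (Cod C c)" using seq_arr(4)[OF s(1)] .
  have ks: "k \<cdot> s = (k \<cdot> (s \<cdot> p2)) \<cdot> i2"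
    using biproduct_into[OF b, of "k \<cdot> s"] kp by simp
  \<comment> \<open>Locally, \<open>x\<close> is a preimage under \<open>p\<close> of the first
    component of an element of \<open>S\<close>. Subtracting \<open>x \<cdot> s\<close> leaves an
    element \<open>w\<close> of \<open>I\<close> with the same image under \<open>c\<close>, which
    makes \<open>i2 \<cdot> c\<close> a right factor of a pure epimorphism.\<close>
  obtain x v where v: "pure_epi C v" "x \<in> Arr C" "v \<in> Arr C" "Cod C x = Dom C p" "Cod C v = Dom C p1"
    "Dom C x = Dom C v" "x \<cdot> p = v \<cdot> p1"
    by (rule pure_pullback[OF seq_pure(1)[OF k], of p1]) simp_all
  have [simp]: "x \<in> Arr C" "v \<in> Arr C" "Cod C x = Dom C s" "Cod C v = S" "Dom C x = Dom C v"
    using v by simp_all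
  define w where "w = (v \<boxplus> Neg C (x \<cdot> s)) \<cdot> p2"
  have w [simp]: "w \<in> Arr C" "Dom C w = Dom C v" "Cod C w = I" by (simp_all add: w_def)
  have "v \<boxplus> Neg C (x \<cdot> s) = w \<cdot> i2"
    using biproduct_into[OF b, of "v \<boxplus> Neg C (x \<cdot> s)"] v(7) by (simp add: w_def s(3))
  then have "(w \<cdot> i2) \<cdot> c = v \<cdot> c" using sc by (simp flip: \<open>v \<boxplus> Neg C (x \<cdot> s) = w \<cdot> i2\<close>)
  then have "w \<cdot> (i2 \<cdot> c) = v \<cdot> c" by simp
  moreover have "pure_epi C (v \<cdot> c)" using v(1) seq_pure(1)[OF s(1)] by (intro pure_epi_comp) simp_all
  ultimately have pe: "pure_epi C (i2 \<cdot> c)" using pure_epi_right[of w "i2 \<cdot> c"] by simp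
  have "is_kernel C (i2 \<cdot> c) (k \<cdot> (s \<cdot> p2))"
  proof (rule is_kernelI)
    have "(k \<cdot> (s \<cdot> p2)) \<cdot> (i2 \<cdot> c) = (k \<cdot> s) \<cdot> c" unfolding ks by simp
    also have "\<dots> = Zero C (Dom C k) (Cod C c)" by (simp add: sc)
    finally show "(k \<cdot> (s \<cdot> p2)) \<cdot> (i2 \<cdot> c) = Zero C (Dom C (k \<cdot> (s \<cdot> p2))) (Cod C (i2 \<cdot> c))" by simp
  next
    fix u X assume u: "u \<in> Arr C" "Dom C u = X" "Cod C u = Dom C (k \<cdot> (s \<cdot> p2))"
      "u \<cdot> (k \<cdot> (s \<cdot> p2)) = Zero C X (Cod C (k \<cdot> (s \<cdot> p2)))"
    have [simp]: "u \<in> Arr C" "Dom C u = X" "Cod C u = Dom C k" "X \<in> Obj C"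
      using u dom_obj[OF u(1)] by simp_all
    have "u \<cdot> (k \<cdot> s) = u \<cdot> ((k \<cdot> (s \<cdot> p2)) \<cdot> i2)" unfolding ks[symmetric] ..
    also have "\<dots> = (u \<cdot> (k \<cdot> (s \<cdot> p2))) \<cdot> i2" by simp
    also have "\<dots> = Zero C X S" unfolding u(4) by simp
    finally have "(u \<cdot> k) \<cdot> s = Zero C X (Dom C s) \<cdot> s" by simp
    then have "u \<cdot> k = Zero C X (Dom C s)" by (rule seq_mono[OF s(1)]) simp_all
    then have "u \<cdot> k = Zero C X (Dom C k) \<cdot> k" by simp
    then have "u = Zero C X (Dom C k)" by (rule seq_mono[OF k]) simp_all
    then show "u = Zero C X (Dom C (k \<cdot> (s \<cdot> p2)))" by simp
  next
    fix z assume z: "z \<in> Arr C" "Cod C z = Dom C (i2 \<cdot> c)" "z \<cdot> (i2 \<cdot> c) = Zero C (Dom C z) (Cod C (i2 \<cdot> c))"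
    have [simp]: "z \<in> Arr C" "Cod C z = I" using z by simp_all
    obtain y where y: "y \<in> Arr C" "Dom C y = Dom C z" "Cod C y = Dom C s" "y \<cdot> s = z \<cdot> i2"
      using seq_lift[OF s(1), of "z \<cdot> i2"] z(3) by auto
    note [simp] = y(1-3)
    have "y \<cdot> p = Zero C (Dom C z) Y"
      using comp_reduce[OF y(4), of p1] by (simp add: s(3))
    then obtain u where u: "u \<in> Arr C" "Dom C u = Dom C z" "Cod C u = Dom C k" "u \<cdot> k = y"
      using seq_lift[OF k, of y] by auto
    note [simp] = u(1-3)
    have "u \<cdot> (k \<cdot> (s \<cdot> p2)) = (y \<cdot> s) \<cdot> p2" using comp_reduce[OF u(4), of "s \<cdot> p2"] by simp
    also have "\<dots> = z" unfolding y(4) by simp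
    finally show "\<exists>u\<in>Arr C. Dom C u = Dom C z \<and> Cod C u = Dom C (k \<cdot> (s \<cdot> p2)) \<and> u \<cdot> (k \<cdot> (s \<cdot> p2)) = z"
      by (intro bexI[of _ u]) simp_all
  qed simp_all
  then show ?thesis by (rule pure_seq_kernel[OF pe])
qed

text \<open>Stabilising by an identity leaves the cokernel alone. This is what allows factorisations
  with different auxiliary summands to be composed.\<close>

lemma sum_identity_seq:
  assumes b: "biproduct C Y I M i1 i2 p1 p2" and b': "biproduct C N I M' j1 j2 q1 q2"
    and t: "(t, c) \<in> Pure_Seq C" "Dom C t = Y" "Cod C t = N"
  shows "(p1 \<cdot> t \<cdot> j1 \<boxplus> p2 \<cdot> j2, q1 \<cdot> c) \<in> Pure_Seq C"
proof -
  note [simp] = biproduct_simps[OF b] biproduct_simps[OF b'] seq_arr(1,2)[OF t(1)] t(2,3)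
  have [simp]: "Dom C c = N" using seq_arr(3)[OF t(1)] by simp
  have tc: "t \<cdot> c = Zero C Y (Cod C c)" using seq_arr(4)[OF t(1)] by simp
  have pe: "pure_epi C (q1 \<cdot> c)"
    using seq_pure(1)[OF biproduct_seq'[OF b']] seq_pure(1)[OF t(1)] by (intro pure_epi_comp) simp_all
  let ?T = "p1 \<cdot> (t \<cdot> j1) \<boxplus> p2 \<cdot> j2"
  have Tq: "?T \<cdot> q1 = p1 \<cdot> t" "?T \<cdot> q2 = p2" by simp_all
  have "is_kernel C (q1 \<cdot> c) ?T"
  proof (rule is_kernelI)
    show "?T \<cdot> (q1 \<cdot> c) = Zero C (Dom C ?T) (Cod C (q1 \<cdot> c))" by (simp add: tc)
  next
    fix u X assume u: "u \<in> Arr C" "Dom C u = X" "Cod C u = Dom C ?T" "u \<cdot> ?T = Zero C X (Cod C ?T)"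
    have [simp]: "u \<in> Arr C" "Dom C u = X" "Cod C u = M" "X \<in> Obj C"
      using u dom_obj[OF u(1)] by simp_all
    have "u \<cdot> (?T \<cdot> q1) = Zero C X N" "u \<cdot> (?T \<cdot> q2) = Zero C X I"
      using comp_reduce[OF u(4), of q1] comp_reduce[OF u(4), of q2] by simp_all
    then have 1: "(u \<cdot> p1) \<cdot> t = Zero C X Y \<cdot> t" and 2: "u \<cdot> p2 = Zero C X I" by (simp_all add: Tq)
    from 1 have 3: "u \<cdot> p1 = Zero C X Y" by (rule seq_mono[OF t(1)]) simp_all
    have "u = Zero C X M" by (rule biproduct_eqI[OF b]) (simp_all add: 2 3)
    then show "u = Zero C X (Dom C ?T)" by simp
  next
    fix g assume g: "g \<in> Arr C" "Cod C g = Dom C (q1 \<cdot> c)" "g \<cdot> (q1 \<cdot> c) = Zero C (Dom C g) (Cod C (q1 \<cdot> c))"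
    have [simp]: "g \<in> Arr C" "Cod C g = M'" using g by simp_all
    obtain u where u: "u \<in> Arr C" "Dom C u = Dom C g" "Cod C u = Y" "u \<cdot> t = g \<cdot> q1"
      using seq_lift[OF t(1), of "g \<cdot> q1"] g(3) by auto
    note [simp] = u(1-3)
    have "(u \<cdot> i1 \<boxplus> g \<cdot> q2 \<cdot> i2) \<cdot> ?T = g"
      by (rule biproduct_eqI[OF b']) (simp_all add: u(4))
    then show "\<exists>u\<in>Arr C. Dom C u = Dom C g \<and> Cod C u = Dom C ?T \<and> u \<cdot> ?T = g"
      by (intro bexI[of _ "u \<cdot> i1 \<boxplus> g \<cdot> q2 \<cdot> i2"]) simp_all
  qed simp_all
  then show ?thesis using pure_seq_kernel[OF pe] by simp
qed

lemma sum_identity_seq':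
  assumes b: "biproduct C Y I M i1 i2 p1 p2" and b': "biproduct C N I M' j1 j2 q1 q2"
    and t: "(k, t) \<in> Pure_Seq C" "Dom C t = N" "Cod C t = Y"
  shows "(k \<cdot> j1, q1 \<cdot> t \<cdot> i1 \<boxplus> q2 \<cdot> i2) \<in> Pure_Seq C"
proof -
  interpret op: pure_loc "op_cat C" by (rule pure_loc_op)
  note [simp] = biproduct_simps[OF b] biproduct_simps[OF b'] seq_arr(1,2)[OF t(1)] t(2,3)
  show ?thesis using op.sum_identity_seq[of Y I M p1 p2 i1 i2 N M' q1 q2 j1 j2 t k] b b' t by simp
qed

text \<open>The cokernel of \<open>i\<close> extends over the pushout by zero on the other leg, and
  every arrow that annihilates \<open>i'\<close> descends to it. S-denominators are stable under
  cobase change for this reason.\<close>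

lemma pushout_cokernel:
  assumes P: "pushout C i f f' i'" and i: "(i, c) \<in> Pure_Seq C" and i': "pure_mono C i'"
  obtains c' where "(i', c') \<in> Pure_Seq C" "Cod C c' = Cod C c" "f' \<cdot> c' = c"
proof -
  have cm: "commutes C i f' f i'" using P by (simp add: pushout_def)
  note [simp] = commutesD(1-7)[OF cm] seq_arr(1,2)[OF i]
  have [simp]: "Dom C c = Dom C f'" "Cod C f' = Cod C i'"
    using seq_arr(3)[OF i] commutesD(8)[OF cm] by simp_all
  have ic: "i \<cdot> c = Zero C (Dom C f) (Cod C c)" using seq_arr(4)[OF i] by simp
  have uni: "\<exists>!k. k \<in> Hom C (Cod C f') (Cod C g) \<and> f' \<cdot> k = g \<and> i' \<cdot> k = h"
    if "g \<in> Arr C" "h \<in> Arr C" "Dom C g = Cod C i" "Dom C h = Cod C f" "i \<cdot> g = f \<cdot> h" for g h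
    using P that unfolding pushout_def by (simp add: commutes_def composable_def)
  obtain c' where "c' \<in> Hom C (Cod C f') (Cod C c)" "f' \<cdot> c' = c" "i' \<cdot> c' = Zero C (Cod C f) (Cod C c)"
    using uni[of c "Zero C (Cod C f) (Cod C c)"] ic by auto
  then have c': "c' \<in> Arr C" "Dom C c' = Cod C i'" "Cod C c' = Cod C c" and fc: "f' \<cdot> c' = c"
    and ic': "i' \<cdot> c' = Zero C (Dom C i') (Cod C c)" by (simp_all add: Hom_iff)
  note [simp] = c'
  have "is_cokernel C i' c'"
  proof (rule is_cokernelI)
    fix g assume g: "g \<in> Arr C" "Dom C g = Cod C i'" "i' \<cdot> g = Zero C (Dom C i') (Cod C g)"
    note [simp] = g(1,2)
    have "i \<cdot> (f' \<cdot> g) = Zero C (Dom C i) (Cod C g)"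
      using comp_reduce[OF commutesD(9)[OF cm], of g] g(3) by simp
    then obtain u where u: "u \<in> Arr C" "Dom C u = Cod C c" "Cod C u = Cod C g" "c \<cdot> u = f' \<cdot> g"
      using seq_desc[OF i, of "f' \<cdot> g"] by auto
    note [simp] = u(1-3)
    have "f' \<cdot> (c' \<cdot> u) = f' \<cdot> g" "i' \<cdot> (c' \<cdot> u) = i' \<cdot> g"
      using comp_reduce[OF fc, of u] comp_reduce[OF ic', of u] u(4) g(3) by simp_all
    moreover have "\<exists>!k. k \<in> Hom C (Cod C f') (Cod C (f' \<cdot> g)) \<and> f' \<cdot> k = f' \<cdot> g \<and> i' \<cdot> k = i' \<cdot> g"
      using comp_reduce[OF commutesD(9)[OF cm], of g] by (intro uni) simp_all
    moreover have "g \<in> Hom C (Cod C f') (Cod C (f' \<cdot> g))" "c' \<cdot> u \<in> Hom C (Cod C f') (Cod C (f' \<cdot> g))"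
      by (simp_all add: Hom_iff)
    ultimately have "c' \<cdot> u = g" by metis
    then show "\<exists>u\<in>Arr C. Cod C u = Cod C g \<and> Dom C u = Cod C c' \<and> c' \<cdot> u = g"
      by (intro bexI[of _ u]) simp_all
  next
    fix u X assume u: "u \<in> Arr C" "Cod C u = X" "Dom C u = Cod C c'" "c' \<cdot> u = Zero C (Dom C c') X"
    have [simp]: "u \<in> Arr C" "Cod C u = X" "Dom C u = Cod C c" "X \<in> Obj C" using u cod_obj[OF u(1)] by simp_all
    have "c \<cdot> u = c \<cdot> Zero C (Cod C c) X" using comp_reduce[OF fc, of u] u(4) by simp
    then have "u = Zero C (Cod C c) X" by (rule seq_epi[OF i]) simp_all
    then show "u = Zero C (Cod C c') X" by simp
  qed (simp_all add: ic')
  then show thesis using that[of c'] pure_seq_cokernel[OF i', of c'] fc by simp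
qed

lemma pullback_kernel:
  assumes "pullback C f p f' p'" "(k, p) \<in> Pure_Seq C" "pure_epi C p'"
  obtains k' where "(k', p') \<in> Pure_Seq C" "Dom C k' = Dom C k"
proof -
  interpret op: pure_loc "op_cat C" by (rule pure_loc_op)
  show thesis by (rule op.pushout_cokernel[of p f f' p' k]) (use assms that in simp_all)
qed

lemma pullback_swap:
  assumes P: "pullback C f p f' p'"
  shows "pullback C p f p' f'"
proof -
  have cm: "commutes C f' p p' f" using P by (simp add: pullback_def)
  have "\<exists>!k. k \<in> Hom C (Dom C g) (Dom C p') \<and> k \<cdot> p' = g \<and> k \<cdot> f' = h" if gh: "commutes C g f h p" for g h
  proof -
    have "commutes C h p g f" using gh by (simp add: commutes_def)
    then have "\<exists>!k. k \<in> Hom C (Dom C h) (Dom C f') \<and> k \<cdot> f' = h \<and> k \<cdot> p' = g"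
      using P unfolding pullback_def by blast
    then show ?thesis unfolding commutesD(7)[OF cm] commutesD(7)[OF gh] by metis
  qed
  moreover have "commutes C p' f f' p" using cm by (simp add: commutes_def)
  ultimately show ?thesis unfolding pullback_def by blast
qed

text \<open>The axiom provides some pullback with a pure projection. Comparison with the given one
  exhibits \<open>f'\<close> as a right factor of that projection.\<close>

lemma pullback_pure_epi:
  assumes P: "pullback C f p f' p'" and f: "pure_epi C f" and p: "p \<in> Arr C" "Cod C p = Cod C f"
  shows "pure_epi C f'"
proof -
  obtain g g' where g: "pullback C p f g g'" "pure_epi C g'" "g \<in> Arr C" "g' \<in> Arr C" "Cod C g = Dom C f" "Cod C g' = Dom C p"
    "Dom C g = Dom C g'" "g \<cdot> f = g' \<cdot> p"
    by (rule pure_pullback[OF f p])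
  obtain k where k: "k \<in> Arr C" "Dom C k = Dom C g'" "Cod C k = Dom C f'" "k \<cdot> f' = g'" "k \<cdot> p' = g"
    by (rule pullback_lift[OF P, of g' g]) (use g p pure_epi_arr[OF f] in simp_all)
  have "f' \<in> Arr C" using P by (auto simp: pullback_def commutes_def composable_def)
  then show ?thesis using pure_epi_right[of k f'] g(2) k by simp
qed

lemma pushout_pure_mono:
  assumes P: "pushout C i f f' i'" and i: "pure_mono C i"
  shows "pure_mono C i'"
proof -
  interpret op: pure_loc "op_cat C" by (rule pure_loc_op)
  have "commutes C i f' f i'" using P by (simp add: pushout_def)
  then show ?thesis using op.pullback_pure_epi[OF op.pullback_swap, of f i f' i'] P i commutesD[of i f' f i'] by simp
qed

lemma pullback_pure_epi':
  assumes P: "pullback C f p f' p'" and p: "pure_epi C p"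
  shows "pure_epi C p'"
proof -
  have "commutes C f' p p' f" using P by (simp add: pullback_def)
  then show ?thesis using pullback_pure_epi[OF pullback_swap[OF P] p] commutesD[of f' p p' f] by simp
qed

end

section \<open>Localisation at a class of acyclic objects\<close>

locale acyclic_loc = pure_loc C
  for C :: "('o, 'm, 'z) exact_cat_scheme" (structure) +
  fixes A :: "'o set"
  assumes A_obj: "X \<in> A \<Longrightarrow> X \<in> Obj C"
    and A_zero: "zero_object C Z \<Longrightarrow> Z \<in> A"
    and A_extension: "\<lbrakk>(i, p) \<in> Pure_Seq C; Dom C i \<in> A; Cod C p \<in> A\<rbrakk> \<Longrightarrow> Cod C i \<in> A"
    and A_quotient: "\<lbrakk>(i, p) \<in> Pure_Seq C; Dom C i \<in> A; Cod C i \<in> A\<rbrakk> \<Longrightarrow> Cod C p \<in> A"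
    and A_sub: "\<lbrakk>(i, p) \<in> Pure_Seq C; Cod C i \<in> A; Cod C p \<in> A\<rbrakk> \<Longrightarrow> Dom C i \<in> A"
    and A_retract: "\<lbrakk>s \<in> Arr C; r \<in> Arr C; Cod C s = Dom C r; s \<cdot> r = Ident C (Dom C s); Cod C s \<in> A\<rbrakk> \<Longrightarrow> Dom C s \<in> A"
    and A_enough: "X \<in> Obj C \<Longrightarrow> \<exists>e. pure_mono C e \<and> Dom C e = X \<and> Cod C e \<in> A"
begin

section \<open>Denominators and their factorisations\<close>

definition SA :: "'m set" where
  "SA = {i. \<exists>c. (i, c) \<in> Pure_Seq C \<and> Cod C c \<in> A}"

definition TD :: "'m set" where
  "TD = {p. \<exists>k. (k, p) \<in> Pure_Seq C \<and> Dom C k \<in> A}"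

text \<open>With the factorisation built into the definition, (Fac) is immediate and the work lies
  in two out of three.\<close>

definition DA :: "'m set" where
  "DA = {s \<cdot> p |s p. s \<in> SA \<and> p \<in> TD \<and> Cod C s = Dom C p}"

lemma SA_arr: "s \<in> SA \<Longrightarrow> s \<in> Arr C" and TD_arr: "p \<in> TD \<Longrightarrow> p \<in> Arr C"
  by (auto simp: SA_def TD_def dest: seq_arr)

lemma Ident_SA: "X \<in> Obj C \<Longrightarrow> Ident C X \<in> SA" and Ident_TD: "X \<in> Obj C \<Longrightarrow> Ident C X \<in> TD"
proof -
  obtain Z where Z: "zero_object C Z" by (rule zero_object_exists)
  show "X \<in> Obj C \<Longrightarrow> Ident C X \<in> SA"
    using Ident_seq(1)[OF Z, of X] zero_arr(3)[of X Z] A_zero[OF Z] zero_object_simps(1)[OF Z]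
    unfolding SA_def by auto
  show "X \<in> Obj C \<Longrightarrow> Ident C X \<in> TD"
    using Ident_seq(2)[OF Z, of X] zero_arr(2)[of Z X] A_zero[OF Z] zero_object_simps(1)[OF Z]
    unfolding TD_def by auto
qed

lemma SA_comp:
  assumes "s \<in> SA" "t \<in> SA" "Cod C s = Dom C t"
  shows "s \<cdot> t \<in> SA"
proof -
  obtain c c3 where s: "(s, c) \<in> Pure_Seq C" "Cod C c \<in> A" and t: "(t, c3) \<in> Pure_Seq C" "Cod C c3 \<in> A"
    using assms by (auto simp: SA_def)
  obtain c2 where c2: "(s \<cdot> t, c2) \<in> Pure_Seq C"
    using pure_mono_seq[OF pure_mono_comp[OF seq_pure(2)[OF s(1)] seq_pure(2)[OF t(1)] assms(3)]] by blast
  obtain \<alpha> \<beta> where "(\<alpha>, \<beta>) \<in> Pure_Seq C" "Dom C \<alpha> = Cod C c" "Cod C \<alpha> = Cod C c2" "Cod C \<beta> = Cod C c3"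
    by (rule cokernel_comp_seq[OF s(1) t(1) c2 assms(3)])
  then have "Cod C c2 \<in> A" using A_extension[of \<alpha> \<beta>] s t by simp
  then show ?thesis using c2 by (auto simp: SA_def)
qed

lemma TD_comp:
  assumes "p \<in> TD" "q \<in> TD" "Cod C p = Dom C q"
  shows "p \<cdot> q \<in> TD"
proof -
  obtain k k3 where p: "(k, p) \<in> Pure_Seq C" "Dom C k \<in> A" and q: "(k3, q) \<in> Pure_Seq C" "Dom C k3 \<in> A"
    using assms by (auto simp: TD_def)
  obtain k2 where k2: "(k2, p \<cdot> q) \<in> Pure_Seq C"
    using pure_epi_seq[OF pure_epi_comp[OF seq_pure(1)[OF p(1)] seq_pure(1)[OF q(1)] assms(3)]] by blast
  obtain \<alpha> \<beta> where "(\<alpha>, \<beta>) \<in> Pure_Seq C" "Dom C \<alpha> = Dom C k" "Cod C \<alpha> = Dom C k2" "Cod C \<beta> = Dom C k3"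
    by (rule kernel_comp_seq[OF p(1) q(1) k2 assms(3)])
  then have "Dom C k2 \<in> A" using A_extension[of \<alpha> \<beta>] p q by simp
  then show ?thesis using k2 by (auto simp: TD_def)
qed

text \<open>The arrows \<open>s\<close> and \<open>s'\<close> have a common lift \<open>s0\<close>
  to the pullback of \<open>p\<close> and \<open>p'\<close>. Its cokernel is an extension of the
  cokernel of \<open>s\<close>, and also of that of \<open>s'\<close>, by an acyclic object; hence
  acyclicity passes from one to the other.\<close>

lemma cokernel_independent:
  assumes s: "(s, c) \<in> Pure_Seq C" and p: "p \<in> TD" "Cod C s = Dom C p"
    and s': "(s', c') \<in> Pure_Seq C" and p': "p' \<in> TD" "Cod C s' = Dom C p'"
    and e: "s \<cdot> p = s' \<cdot> p'" and A: "Cod C c' \<in> A"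
  shows "Cod C c \<in> A"
proof -
  obtain k where k: "(k, p) \<in> Pure_Seq C" "Dom C k \<in> A" using p by (auto simp: TD_def)
  obtain k' where k': "(k', p') \<in> Pure_Seq C" "Dom C k' \<in> A" using p' by (auto simp: TD_def)
  note [simp] = seq_arr(1,2)[OF s] seq_arr(1,2)[OF s'] seq_arr(2)[OF k(1)] seq_arr(2)[OF k'(1)] p(2) p'(2)
  have [simp]: "Cod C p' = Cod C p" using comp_arr(3)[of s p] comp_arr(3)[of s' p'] e by simp
  obtain f g where P: "pullback C p p' f g" "pure_epi C g" "f \<in> Arr C" "g \<in> Arr C" "Cod C f = Dom C p'"
    "Cod C g = Dom C p" "Dom C f = Dom C g" "f \<cdot> p' = g \<cdot> p"
    by (rule pure_pullback[OF seq_pure(1)[OF k'(1)], of p]) simp_all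
  note [simp] = P(3-7)
  have fp: "pure_epi C f" by (rule pullback_pure_epi[OF P(1) seq_pure(1)[OF k(1)]]) simp_all
  obtain k1 where k1: "(k1, g) \<in> Pure_Seq C" "Dom C k1 = Dom C k'" by (rule pullback_kernel[OF P(1) k'(1) P(2)])
  obtain k2 where k2: "(k2, f) \<in> Pure_Seq C" "Dom C k2 = Dom C k"
    by (rule pullback_kernel[OF pullback_swap[OF P(1)] k(1) fp])
  obtain s0 where s0: "s0 \<in> Arr C" "Dom C s0 = Dom C s'" "Cod C s0 = Dom C f" "s0 \<cdot> f = s'" "s0 \<cdot> g = s"
    by (rule pullback_lift[OF P(1), of s' s]) (simp_all add: e)
  have "pure_mono C s0" using pure_mono_left[of s0 f] seq_pure(2)[OF s'] s0 by simp
  then obtain c0 where c0: "(s0, c0) \<in> Pure_Seq C" using pure_mono_seq by blast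
  obtain \<kappa> \<gamma> where 1: "(\<kappa>, \<gamma>) \<in> Pure_Seq C" "Dom C \<kappa> = Dom C k1" "Cod C \<kappa> = Cod C c0" "Cod C \<gamma> = Cod C c"
    by (rule kernel_cokernel_seq[OF c0 k1(1), of c]) (use s s0 in simp_all)
  obtain \<kappa>' \<gamma>' where 2: "(\<kappa>', \<gamma>') \<in> Pure_Seq C" "Dom C \<kappa>' = Dom C k2" "Cod C \<kappa>' = Cod C c0" "Cod C \<gamma>' = Cod C c'"
    by (rule kernel_cokernel_seq[OF c0 k2(1), of c']) (use s' s0 in simp_all)
  have "Cod C c0 \<in> A" using A_extension[OF 2(1)] 2 k2 k A by simp
  then show ?thesis using A_quotient[OF 1(1)] 1 k1 k' by simp
qed

lemma DA_iff:
  assumes s: "(s, c) \<in> Pure_Seq C" and p: "p \<in> TD" "Cod C s = Dom C p"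
  shows "s \<cdot> p \<in> DA \<longleftrightarrow> Cod C c \<in> A"
proof
  assume "s \<cdot> p \<in> DA"
  then obtain s' p' where h: "s' \<in> SA" "p' \<in> TD" "Cod C s' = Dom C p'" "s \<cdot> p = s' \<cdot> p'"
    unfolding DA_def by blast
  then obtain c' where "(s', c') \<in> Pure_Seq C" "Cod C c' \<in> A" by (auto simp: SA_def)
  then show "Cod C c \<in> A" using cokernel_independent[OF s p _ h(2,3,4)] by blast
next
  assume "Cod C c \<in> A"
  then show "s \<cdot> p \<in> DA" using s p unfolding DA_def SA_def by blast
qed

lemma DA_arr: "f \<in> DA \<Longrightarrow> f \<in> Arr C"
  using SA_arr TD_arr by (auto simp: DA_def)

lemma SA_DA: "s \<in> SA \<Longrightarrow> s \<in> DA"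
  unfolding DA_def using Ident_TD[of "Cod C s"] SA_arr[of s]
  by (intro CollectI exI[of _ s] exI[of _ "Ident C (Cod C s)"]) simp

lemma TD_DA: "p \<in> TD \<Longrightarrow> p \<in> DA"
  unfolding DA_def using Ident_SA[of "Dom C p"] TD_arr[of p]
  by (intro CollectI exI[of _ "Ident C (Dom C p)"] exI[of _ p]) simp

lemma biproduct_TD: "biproduct C X I S i1 i2 p1 p2 \<Longrightarrow> I \<in> A \<Longrightarrow> p1 \<in> TD"
  unfolding TD_def using biproduct_seq'[of X I S i1 i2 p1 p2] biproduct_simps(9)[of X I S i1 i2 p1 p2] by auto

text \<open>The object \<open>Cod C c\<close> is an abstract mapping cone of \<open>f\<close>: by
  \<open>DA_iff\<close> its acyclicity decides membership in \<open>DA\<close>.\<close>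

lemma canonical_factorisation:
  assumes f: "f \<in> Arr C"
  obtains I S i1 i2 p1 p2 e c where "biproduct C (Cod C f) I S i1 i2 p1 p2" "I \<in> A" "e \<in> Arr C" "Dom C e = Dom C f" "Cod C e = I"
    "(f \<cdot> i1 \<boxplus> e \<cdot> i2, c) \<in> Pure_Seq C" "(f \<cdot> i1 \<boxplus> e \<cdot> i2) \<cdot> p1 = f" "p1 \<in> TD" "f \<in> DA \<longleftrightarrow> Cod C c \<in> A"
proof -
  obtain e where e: "pure_mono C e" "Dom C e = Dom C f" "Cod C e \<in> A" using A_enough[of "Dom C f"] f by auto
  obtain S i1 i2 p1 p2 where b: "biproduct C (Cod C f) (Cod C e) S i1 i2 p1 p2"
    by (rule biproduct_exists[of "Cod C f" "Cod C e"]) (simp_all add: f A_obj[OF e(3)])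
  note [simp] = biproduct_simps[OF b] pure_mono_arr[OF e(1)] e(2) f
  have "pure_mono C (f \<cdot> i1 \<boxplus> e \<cdot> i2)" by (rule graph_pure_mono[OF b e(1)]) simp_all
  then obtain c where c: "(f \<cdot> i1 \<boxplus> e \<cdot> i2, c) \<in> Pure_Seq C" using pure_mono_seq by blast
  have "(f \<cdot> i1 \<boxplus> e \<cdot> i2) \<cdot> p1 = f" by simp
  then show thesis using that[OF b e(3) _ _ _ c] biproduct_TD[OF b e(3)] DA_iff[OF c biproduct_TD[OF b e(3)]] by simp
qed

text \<open>The abstract cones of \<open>f\<close>, \<open>f \<cdot> g\<close> and \<open>g\<close>
  form a pure short exact sequence, a strict counterpart of the octahedral axiom. Two out of three
  for \<open>DA\<close> thus becomes two out of three for \<open>A\<close>.\<close>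

lemma DA_comp_seq:
  assumes f: "f \<in> Arr C" and g: "g \<in> Arr C" and fg: "Cod C f = Dom C g"
  obtains \<alpha> \<beta> where "(\<alpha>, \<beta>) \<in> Pure_Seq C" "f \<in> DA \<longleftrightarrow> Dom C \<alpha> \<in> A" "f \<cdot> g \<in> DA \<longleftrightarrow> Cod C \<alpha> \<in> A" "g \<in> DA \<longleftrightarrow> Cod C \<beta> \<in> A"
proof -
  obtain I M i1 i2 p1 p2 e c where F: "biproduct C (Cod C f) I M i1 i2 p1 p2" "I \<in> A" "e \<in> Arr C" "Dom C e = Dom C f" "Cod C e = I"
    "(f \<cdot> i1 \<boxplus> e \<cdot> i2, c) \<in> Pure_Seq C" "(f \<cdot> i1 \<boxplus> e \<cdot> i2) \<cdot> p1 = f" "p1 \<in> TD" "f \<in> DA \<longleftrightarrow> Cod C c \<in> A"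
    by (rule canonical_factorisation[OF f])
  obtain J N j1 j2 q1 q2 e' d where G: "biproduct C (Cod C g) J N j1 j2 q1 q2" "J \<in> A" "e' \<in> Arr C" "Dom C e' = Dom C g" "Cod C e' = J"
    "(g \<cdot> j1 \<boxplus> e' \<cdot> j2, d) \<in> Pure_Seq C" "(g \<cdot> j1 \<boxplus> e' \<cdot> j2) \<cdot> q1 = g" "q1 \<in> TD" "g \<in> DA \<longleftrightarrow> Cod C d \<in> A"
    by (rule canonical_factorisation[OF g])
  define s where "s = f \<cdot> i1 \<boxplus> e \<cdot> i2"
  define t where "t = g \<cdot> j1 \<boxplus> e' \<cdot> j2"
  note [simp] = biproduct_simps[OF F(1)] biproduct_simps[OF G(1)] F(3-5) G(3-5) f g fg
  have s [simp]: "s \<in> Arr C" "Dom C s = Dom C f" "Cod C s = M" and t [simp]: "t \<in> Arr C" "Dom C t = Dom C g" "Cod C t = N"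
    by (simp_all add: s_def t_def)
  have sc: "(s, c) \<in> Pure_Seq C" and td: "(t, d) \<in> Pure_Seq C" and sp: "s \<cdot> p1 = f" and tq: "t \<cdot> q1 = g"
    using F(6,7) G(6,7) by (simp_all add: s_def t_def)
  have [simp]: "I \<in> Obj C" using F(2) A_obj by blast
  obtain M' k1 k2 r1 r2 where b: "biproduct C N I M' k1 k2 r1 r2" by (rule biproduct_exists[of N I]) simp_all
  note [simp] = biproduct_simps[OF b]
  \<comment> \<open>The embedding \<open>t\<close> starts at the target of \<open>f\<close> while
    \<open>s\<close> ends in \<open>M\<close>, which has the additional summand \<open>I\<close>.
    Adding the identity of \<open>I\<close> to \<open>t\<close> makes the two composable without
    changing the cokernel.\<close>
  define T where "T = p1 \<cdot> t \<cdot> k1 \<boxplus> p2 \<cdot> k2"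
  have T: "(T, r1 \<cdot> d) \<in> Pure_Seq C" unfolding T_def by (rule sum_identity_seq[OF _ b td]) (use F(1) in simp_all)
  have Ta [simp]: "T \<in> Arr C" "Dom C T = M" "Cod C T = M'" by (simp_all add: T_def)
  have Tr: "T \<cdot> r1 = p1 \<cdot> t" by (simp add: T_def)
  have "pure_mono C (s \<cdot> T)" using seq_pure(2)[OF sc] seq_pure(2)[OF T] by (intro pure_mono_comp) simp_all
  then obtain c2 where c2: "(s \<cdot> T, c2) \<in> Pure_Seq C" using pure_mono_seq by blast
  have dd: "d \<in> Arr C" "Dom C d = N" using seq_arr(2,3)[OF td] by simp_all
  obtain \<alpha> \<beta> where ab: "(\<alpha>, \<beta>) \<in> Pure_Seq C" "Dom C \<alpha> = Cod C c" "Cod C \<alpha> = Cod C c2" "Cod C \<beta> = Cod C (r1 \<cdot> d)"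
    by (rule cokernel_comp_seq[OF sc T c2]) simp_all
  have rq: "r1 \<cdot> q1 \<in> TD" by (rule TD_comp[OF biproduct_TD[OF b F(2)] G(8)]) simp
  have "(s \<cdot> T) \<cdot> (r1 \<cdot> q1) = s \<cdot> ((T \<cdot> r1) \<cdot> q1)" by simp
  also have "\<dots> = (s \<cdot> p1) \<cdot> (t \<cdot> q1)" unfolding Tr by simp
  finally have e: "(s \<cdot> T) \<cdot> (r1 \<cdot> q1) = f \<cdot> g" unfolding sp tq .
  have "f \<cdot> g \<in> DA \<longleftrightarrow> Cod C c2 \<in> A" using DA_iff[OF c2 rq] unfolding e by simp
  then show thesis using that[OF ab(1)] ab F(9) G(9) dd by simp
qed

lemma DA_comp: "\<lbrakk>f \<in> DA; g \<in> DA; Cod C f = Dom C g\<rbrakk> \<Longrightarrow> f \<cdot> g \<in> DA"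
  by (rule DA_comp_seq[of f g]) (auto simp: DA_arr intro: A_extension)

lemma DA_right: "\<lbrakk>f \<in> DA; g \<in> Arr C; Cod C f = Dom C g; f \<cdot> g \<in> DA\<rbrakk> \<Longrightarrow> g \<in> DA"
  by (rule DA_comp_seq[of f g]) (auto simp: DA_arr intro: A_quotient)

lemma DA_left: "\<lbrakk>f \<in> Arr C; g \<in> DA; Cod C f = Dom C g; f \<cdot> g \<in> DA\<rbrakk> \<Longrightarrow> f \<in> DA"
  by (rule DA_comp_seq[of f g]) (auto simp: DA_arr intro: A_sub)

lemma SA_eq: "SA = {i \<in> DA. pure_mono C i}"
proof (intro equalityI subsetI CollectI conjI)
  fix i assume "i \<in> {i \<in> DA. pure_mono C i}"
  then obtain c where i: "i \<in> DA" "(i, c) \<in> Pure_Seq C" using pure_mono_seq by blast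
  note [simp] = seq_arr(1)[OF i(2)]
  have "i \<cdot> Ident C (Cod C i) \<in> DA \<longleftrightarrow> Cod C c \<in> A" by (rule DA_iff[OF i(2) Ident_TD]) simp_all
  then show "i \<in> SA" using i by (auto simp: SA_def)
qed (use SA_DA in \<open>auto simp: SA_def dest: seq_pure\<close>)

text \<open>For a pure epimorphism in \<open>DA\<close>, \<open>graph_cokernel_seq\<close> presents
  its kernel as the kernel of a pure epimorphism from the acyclic \<open>I\<close> onto the acyclic
  cone.\<close>

lemma TD_eq: "TD = {p \<in> DA. pure_epi C p}"
proof (intro equalityI subsetI CollectI conjI)
  fix p assume "p \<in> {p \<in> DA. pure_epi C p}"
  then obtain k where p: "p \<in> DA" "(k, p) \<in> Pure_Seq C" using pure_epi_seq by blast
  obtain I S i1 i2 p1 p2 e c where F: "biproduct C (Cod C p) I S i1 i2 p1 p2" "I \<in> A" "e \<in> Arr C" "Dom C e = Dom C p" "Cod C e = I"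
    "(p \<cdot> i1 \<boxplus> e \<cdot> i2, c) \<in> Pure_Seq C" "(p \<cdot> i1 \<boxplus> e \<cdot> i2) \<cdot> p1 = p" "p1 \<in> TD" "p \<in> DA \<longleftrightarrow> Cod C c \<in> A"
    by (rule canonical_factorisation[OF seq_arr(2)[OF p(2)]])
  note [simp] = biproduct_simps[OF F(1)] F(3-5) seq_arr(1-3)[OF p(2)]
  have cd: "c \<in> Arr C" "Dom C c = S" using seq_arr(2,3)[OF F(6)] by simp_all
  have "(k \<cdot> ((p \<cdot> i1 \<boxplus> e \<cdot> i2) \<cdot> p2), i2 \<cdot> c) \<in> Pure_Seq C"
    by (rule graph_cokernel_seq[OF F(1) p(2) F(6) _ F(7)]) simp
  then have "Dom C (k \<cdot> ((p \<cdot> i1 \<boxplus> e \<cdot> i2) \<cdot> p2)) \<in> A"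
    by (rule A_sub) (use F(2,9) p(1) cd in simp_all)
  then show "p \<in> TD" using p by (auto simp: TD_def)
qed (use TD_DA in \<open>auto simp: TD_def dest: seq_pure\<close>)

lemma uni_fractionable: "uni_fractionable C DA SA TD"
  unfolding uni_fractionable_def
proof (intro conjI)
  show "category C" by (rule category)
  show "semi_saturated C DA" unfolding semi_saturated_def multiplicative_def composable_def
    using DA_arr DA_comp DA_right DA_left SA_DA Ident_SA by blast
  show "multiplicative C SA" unfolding multiplicative_def composable_def using SA_arr SA_comp Ident_SA by blast
  show "multiplicative C TD" unfolding multiplicative_def composable_def using TD_arr TD_comp Ident_TD by blast
  show "SA \<subseteq> DA" "TD \<subseteq> DA" using SA_DA TD_DA by auto
  show "\<forall>i\<in>SA. \<forall>f\<in>Arr C. Dom C f = Dom C i \<longrightarrow> (\<exists>f' i'. weak_pushout C i f f' i' \<and> i' \<in> SA)"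
  proof (intro ballI impI)
    fix i f assume i: "i \<in> SA" and f: "f \<in> Arr C" "Dom C f = Dom C i"
    then obtain c where c: "(i, c) \<in> Pure_Seq C" "Cod C c \<in> A" by (auto simp: SA_def)
    obtain f' i' where P: "pushout C i f f' i'" "pure_mono C i'" by (rule pure_pushout[OF seq_pure(2)[OF c(1)] f])
    obtain c' where "(i', c') \<in> Pure_Seq C" "Cod C c' = Cod C c" by (rule pushout_cokernel[OF P(1) c(1) P(2)])
    then have "i' \<in> SA" using c(2) by (auto simp: SA_def)
    moreover have "weak_pushout C i f f' i'" using P(1) unfolding pushout_def weak_pushout_def by blast
    ultimately show "\<exists>f' i'. weak_pushout C i f f' i' \<and> i' \<in> SA" by blast
  qed
  show "\<forall>p\<in>TD. \<forall>f\<in>Arr C. Cod C f = Cod C p \<longrightarrow> (\<exists>f' p'. weak_pullback C f p f' p' \<and> p' \<in> TD)"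
  proof (intro ballI impI)
    fix p f assume p: "p \<in> TD" and f: "f \<in> Arr C" "Cod C f = Cod C p"
    then obtain k where k: "(k, p) \<in> Pure_Seq C" "Dom C k \<in> A" by (auto simp: TD_def)
    obtain f' p' where P: "pullback C f p f' p'" "pure_epi C p'" by (rule pure_pullback[OF seq_pure(1)[OF k(1)] f])
    obtain k' where "(k', p') \<in> Pure_Seq C" "Dom C k' = Dom C k" by (rule pullback_kernel[OF P(1) k(1) P(2)])
    then have "p' \<in> TD" using k(2) by (auto simp: TD_def)
    moreover have "weak_pullback C f p f' p'" using P(1) unfolding pullback_def weak_pullback_def by blast
    ultimately show "\<exists>f' p'. weak_pullback C f p f' p' \<and> p' \<in> TD" by blast
  qed
  show "\<forall>d\<in>DA. \<exists>i\<in>SA. \<exists>p\<in>TD. composable C i p \<and> d = i \<cdot> p"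
    unfolding composable_def using SA_arr TD_arr by (auto simp: DA_def)
qed

sublocale unifrac_loc C DA SA TD
  by unfold_locales (rule uni_fractionable)

text \<open>The factors \<open>s\<close> and \<open>p\<close> of \<open>f\<close> are stabilised by
  the identity of \<open>J\<close> separately, which keeps the cokernel of the one and the kernel of
  the other.\<close>

lemma sum_identity_DA:
  assumes f: "f \<in> DA" and b: "biproduct C (Dom C f) J M i1 i2 p1 p2" and b': "biproduct C (Cod C f) J M' j1 j2 q1 q2"
  shows "p1 \<cdot> f \<cdot> j1 \<boxplus> p2 \<cdot> j2 \<in> DA"
proof -
  obtain s p where sp: "s \<in> SA" "p \<in> TD" "Cod C s = Dom C p" "f = s \<cdot> p" using f by (auto simp: DA_def)
  note [simp] = SA_arr[OF sp(1)] TD_arr[OF sp(2)] sp(3)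
  have [simp]: "Dom C f = Dom C s" "Cod C f = Cod C p" by (simp_all add: sp(4))
  note [simp] = biproduct_simps[OF b] biproduct_simps[OF b']
  obtain N k1 k2 r1 r2 where n: "biproduct C (Dom C p) J N k1 k2 r1 r2" by (rule biproduct_exists[of "Dom C p" J]) simp_all
  note [simp] = biproduct_simps[OF n]
  obtain c k where c: "(s, c) \<in> Pure_Seq C" "Cod C c \<in> A" and k: "(k, p) \<in> Pure_Seq C" "Dom C k \<in> A"
    using sp by (auto simp: SA_def TD_def)
  have d: "Dom C c = Dom C p" "c \<in> Arr C" "Cod C k = Dom C p" "k \<in> Arr C"
    using seq_arr(2,3)[OF c(1)] seq_arr(1,3)[OF k(1)] by simp_all
  have "(p1 \<cdot> s \<cdot> k1 \<boxplus> p2 \<cdot> k2, r1 \<cdot> c) \<in> Pure_Seq C"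
    by (rule sum_identity_seq[OF _ n c(1)]) (use b in simp_all)
  then have 1: "p1 \<cdot> s \<cdot> k1 \<boxplus> p2 \<cdot> k2 \<in> SA" using c(2) d unfolding SA_def by auto
  have "(k \<cdot> k1, r1 \<cdot> p \<cdot> j1 \<boxplus> r2 \<cdot> j2) \<in> Pure_Seq C"
    by (rule sum_identity_seq'[OF _ n k(1)]) (use b' in simp_all)
  then have 2: "r1 \<cdot> p \<cdot> j1 \<boxplus> r2 \<cdot> j2 \<in> TD" using k(2) d unfolding TD_def by auto
  have "(p1 \<cdot> s \<cdot> k1 \<boxplus> p2 \<cdot> k2) \<cdot> (r1 \<cdot> p \<cdot> j1 \<boxplus> r2 \<cdot> j2) = p1 \<cdot> f \<cdot> j1 \<boxplus> p2 \<cdot> j2"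
    by (simp add: sp(4))
  then show ?thesis using 1 2 unfolding DA_def by force
qed

text \<open>Two arrows are added one at a time: their sum is \<open>f\<close> plus an identity,
  followed by an identity plus \<open>g\<close>.\<close>

lemma sums_DA: "closed_under_finite_sums C DA"
  unfolding closed_under_finite_sums_def
proof (intro conjI allI impI)
  fix Z Z' assume "zero_object C Z \<and> zero_object C Z'"
  then have Z: "zero_object C Z" "zero_object C Z'" by auto
  have "(Zero C Z Z', Ident C Z') \<in> Pure_Seq C" using Ident_seq(2)[OF Z(1)] zero_object_simps(1)[OF Z(2)] by blast
  then have "Zero C Z Z' \<in> SA" using A_zero[OF Z(2)] zero_object_simps(1)[OF Z(2)] unfolding SA_def by auto
  then show "Zero C Z Z' \<in> DA" by (rule SA_DA)
next
  fix f g M i1 i2 p1 p2 N j1 j2 q1 q2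
  assume "f \<in> DA \<and> g \<in> DA \<and> biproduct C (Dom C f) (Dom C g) M i1 i2 p1 p2 \<and> biproduct C (Cod C f) (Cod C g) N j1 j2 q1 q2"
  then have fg: "f \<in> DA" "g \<in> DA" and b: "biproduct C (Dom C f) (Dom C g) M i1 i2 p1 p2" "biproduct C (Cod C f) (Cod C g) N j1 j2 q1 q2"
    by auto
  note [simp] = fg[THEN DA_arr] biproduct_simps[OF b(1)] biproduct_simps[OF b(2)]
  obtain L k1 k2 r1 r2 where l: "biproduct C (Cod C f) (Dom C g) L k1 k2 r1 r2"
    by (rule biproduct_exists[of "Cod C f" "Dom C g"]) simp_all
  note [simp] = biproduct_simps[OF l] and sw = biproduct_swap[OF preadditive]
  have "p1 \<cdot> f \<cdot> k1 \<boxplus> p2 \<cdot> k2 \<in> DA" by (rule sum_identity_DA[OF fg(1) b(1) l])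
  moreover have "r2 \<cdot> g \<cdot> j2 \<boxplus> r1 \<cdot> j1 \<in> DA" by (rule sum_identity_DA[OF fg(2) sw[OF l] sw[OF b(2)]])
  ultimately have "(p1 \<cdot> f \<cdot> k1 \<boxplus> p2 \<cdot> k2) \<cdot> (r2 \<cdot> g \<cdot> j2 \<boxplus> r1 \<cdot> j1) \<in> DA" by (rule DA_comp) simp_all
  moreover have "(p1 \<cdot> f \<cdot> k1 \<boxplus> p2 \<cdot> k2) \<cdot> (r2 \<cdot> g \<cdot> j2 \<boxplus> r1 \<cdot> j1) = p1 \<cdot> f \<cdot> j1 \<boxplus> p2 \<cdot> g \<cdot> j2"
    by (simp add: add_comm[of "p2 \<cdot> (g \<cdot> j2)"])
  ultimately show "p1 \<cdot> f \<cdot> j1 \<boxplus> p2 \<cdot> g \<cdot> j2 \<in> DA" by simp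
qed

section \<open>Arrows that vanish in the fraction category\<close>

definition null :: "'m \<Rightarrow> bool" where
  "null f \<longleftrightarrow> (\<exists>u v. u \<in> Arr C \<and> v \<in> Arr C \<and> Cod C u = Dom C v \<and> Cod C u \<in> A \<and> f = u \<cdot> v)"

definition null_in_Frac :: "'m \<Rightarrow> bool" where
  "null_in_Frac f \<longleftrightarrow> f \<in> Arr C \<and> (\<exists>d\<in>DA. Dom C d = Cod C f \<and> null (f \<cdot> d))"

lemma nullI: "\<lbrakk>u \<in> Arr C; v \<in> Arr C; Cod C u = Dom C v; Cod C u \<in> A\<rbrakk> \<Longrightarrow> null (u \<cdot> v)"
  unfolding null_def by blast

lemma null_comp_right: "null f \<Longrightarrow> g \<in> Arr C \<Longrightarrow> Cod C f = Dom C g \<Longrightarrow> null (f \<cdot> g)"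
proof -
  assume "null f" and g: "g \<in> Arr C" "Cod C f = Dom C g"
  then obtain u v where f: "u \<in> Arr C" "v \<in> Arr C" "Cod C u = Dom C v" "Cod C u \<in> A" "f = u \<cdot> v" by (auto simp: null_def)
  have "null (u \<cdot> (v \<cdot> g))" using f g by (intro nullI) simp_all
  then show ?thesis using f g by simp
qed

lemma null_comp_left: "null f \<Longrightarrow> g \<in> Arr C \<Longrightarrow> Cod C g = Dom C f \<Longrightarrow> null (g \<cdot> f)"
proof -
  assume "null f" and g: "g \<in> Arr C" "Cod C g = Dom C f"
  then obtain u v where f: "u \<in> Arr C" "v \<in> Arr C" "Cod C u = Dom C v" "Cod C u \<in> A" "f = u \<cdot> v" by (auto simp: null_def)
  have "null ((g \<cdot> u) \<cdot> v)" using f g by (intro nullI) simp_all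
  then show ?thesis using f g by simp
qed

lemma null_add:
  assumes "null f" "null g" "Dom C f = Dom C g" "Cod C f = Cod C g"
  shows "null (f \<boxplus> g)"
proof -
  obtain u v where f: "u \<in> Arr C" "v \<in> Arr C" "Cod C u = Dom C v" "Cod C u \<in> A" "f = u \<cdot> v" using assms by (auto simp: null_def)
  obtain u' v' where g: "u' \<in> Arr C" "v' \<in> Arr C" "Cod C u' = Dom C v'" "Cod C u' \<in> A" "g = u' \<cdot> v'" using assms by (auto simp: null_def)
  have e: "Dom C u = Dom C u'" "Cod C v = Cod C v'" using assms f g by simp_all
  obtain S i1 i2 p1 p2 where b: "biproduct C (Cod C u) (Cod C u') S i1 i2 p1 p2"
    by (rule biproduct_exists[of "Cod C u" "Cod C u'"]) (use f g in simp_all)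
  note [simp] = biproduct_simps[OF b] f(1-3) g(1-3) e
  have "S \<in> A" using A_extension[OF biproduct_seq[OF b]] f g by simp
  then have "null ((u \<cdot> i1 \<boxplus> u' \<cdot> i2) \<cdot> (p1 \<cdot> v \<boxplus> p2 \<cdot> v'))" by (intro nullI) simp_all
  then show ?thesis by (simp add: f(5) g(5))
qed

lemma null_zero:
  assumes "X \<in> Obj C" "Y \<in> Obj C"
  shows "null (Zero C X Y)"
proof -
  obtain Z where Z: "zero_object C Z" by (rule zero_object_exists)
  have "null (Zero C X Z \<cdot> Zero C Z Y)"
    using assms zero_object_simps(1)[OF Z] A_zero[OF Z] by (intro nullI) simp_all
  then show ?thesis using assms zero_object_simps(1)[OF Z] by simp
qed

text \<open>If \<open>c \<cdot> f = u \<cdot> v\<close> passes through an acyclic object, then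
  \<open>e0\<close>, with components \<open>c\<close> and \<open>u\<close>, is a denominator
  annihilated by the difference of \<open>f\<close> and \<open>v\<close>. After \<open>e0\<close> is
  made a pure monomorphism, this difference factors through its acyclic cokernel, and
  \<open>f\<close> is the restriction of the difference to the first summand.\<close>

lemma null_cancel_DA:
  assumes c: "c \<in> DA" and f: "f \<in> Arr C" "Cod C c = Dom C f" and n: "null (c \<cdot> f)"
  shows "null f"
proof -
  obtain u v where uv: "u \<in> Arr C" "v \<in> Arr C" "Cod C u = Dom C v" "Cod C u \<in> A" "u \<cdot> v = c \<cdot> f"
    using n unfolding null_def by metis
  note [simp] = uv(1-3) f c[THEN DA_arr]
  have [simp]: "Dom C u = Dom C c" "Cod C v = Cod C f"
    using comp_arr(2,3)[of u v] uv(5) by simp_all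
  obtain S i1 i2 p1 p2 where b: "biproduct C (Dom C f) (Dom C v) S i1 i2 p1 p2"
    by (rule biproduct_exists[of "Dom C f" "Dom C v"]) simp_all
  note [simp] = biproduct_simps[OF b]
  define e0 where "e0 = c \<cdot> i1 \<boxplus> u \<cdot> i2"
  have e0 [simp]: "e0 \<in> Arr C" "Dom C e0 = Dom C c" "Cod C e0 = S" by (simp_all add: e0_def)
  have e01: "e0 \<cdot> p1 = c" "e0 \<cdot> p2 = u" by (simp_all add: e0_def)
  have "p1 \<in> TD" by (rule biproduct_TD[OF b]) (use uv in simp)
  then have e0D: "e0 \<in> DA" using c by (intro DA_left[of e0 p1]) (simp_all add: TD_DA e01)
  obtain I W j1 j2 q1 q2 e k where F: "biproduct C (Cod C e0) I W j1 j2 q1 q2" "I \<in> A" "e \<in> Arr C" "Dom C e = Dom C e0" "Cod C e = I"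
    "(e0 \<cdot> j1 \<boxplus> e \<cdot> j2, k) \<in> Pure_Seq C" "(e0 \<cdot> j1 \<boxplus> e \<cdot> j2) \<cdot> q1 = e0" "q1 \<in> TD" "e0 \<in> DA \<longleftrightarrow> Cod C k \<in> A"
    by (rule canonical_factorisation[OF e0(1)])
  note [simp] = biproduct_simps[OF F(1)] F(3-5)
  have [simp]: "k \<in> Arr C" "Dom C k = W" using seq_arr(2,3)[OF F(6)] by simp_all
  define h where "h = q1 \<cdot> (p1 \<cdot> f \<boxplus> Neg C (p2 \<cdot> v))"
  have [simp]: "h \<in> Arr C" "Dom C h = W" "Cod C h = Cod C f" by (simp_all add: h_def)
  have "(e0 \<cdot> j1 \<boxplus> e \<cdot> j2) \<cdot> h = e0 \<cdot> (p1 \<cdot> f \<boxplus> Neg C (p2 \<cdot> v))"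
    unfolding h_def using comp_reduce[OF F(7), of "p1 \<cdot> f \<boxplus> Neg C (p2 \<cdot> v)"] by simp
  also have "\<dots> = Zero C (Dom C c) (Cod C f)"
    using comp_reduce[OF e01(1), of f] comp_reduce[OF e01(2), of v] by (simp add: uv(5))
  finally obtain w where w: "w \<in> Arr C" "Dom C w = Cod C k" "Cod C w = Cod C h" "k \<cdot> w = h"
    using seq_desc[OF F(6), of h] by auto
  note [simp] = w(1-3)
  have "null ((i1 \<cdot> j1 \<cdot> k) \<cdot> w)" using e0D F(9) by (intro nullI) simp_all
  also have "(i1 \<cdot> j1 \<cdot> k) \<cdot> w = i1 \<cdot> j1 \<cdot> h" by (simp add: w(4))
  also have "\<dots> = f" by (simp add: h_def)
  finally show ?thesis .
qed

text \<open>Cancelling \<open>c\<close> from itself shows that the identity of its target is null,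
  so the target is a retract of an acyclic object. The arrow from the source to a zero object is
  then a denominator and a pure epimorphism, so it has an acyclic kernel, of which the source is a
  retract.\<close>

lemma null_DA_source:
  assumes c: "c \<in> DA" and n: "null c"
  shows "Dom C c \<in> A"
proof -
  note [simp] = c[THEN DA_arr]
  obtain Z where Z: "zero_object C Z" by (rule zero_object_exists)
  have [simp]: "Z \<in> Obj C" by (rule zero_object_simps(1)[OF Z])
  have "null (c \<cdot> Ident C (Cod C c))" using n by simp
  then have "null (Ident C (Cod C c))" using null_cancel_DA[OF c, of "Ident C (Cod C c)"] by simp
  then obtain u v where uv: "u \<in> Arr C" "v \<in> Arr C" "Cod C u = Dom C v" "Cod C u \<in> A" "Ident C (Cod C c) = u \<cdot> v"
    unfolding null_def by blast
  have "Dom C (u \<cdot> v) = Cod C c" unfolding uv(5)[symmetric] by simp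
  then have "Dom C u = Cod C c" using comp_arr(2)[OF uv(1-3)] by simp
  then have AC: "Cod C c \<in> A" using A_retract[OF uv(1-3) _ uv(4)] uv(5) by simp
  have zero_TD: "Zero C X Z \<in> TD" if "X \<in> A" for X
    using Ident_seq(1)[OF Z, of X] that A_obj[OF that] by (auto simp: TD_def)
  have "c \<cdot> Zero C (Cod C c) Z \<in> DA" by (rule DA_comp[OF c TD_DA[OF zero_TD[OF AC]]]) simp_all
  moreover have zs: "(Ident C (Dom C c), Zero C (Dom C c) Z) \<in> Pure_Seq C" by (rule Ident_seq(1)[OF Z]) simp
  ultimately have "Zero C (Dom C c) Z \<in> TD" using seq_pure(1)[OF zs] by (simp add: TD_eq)
  then obtain k where k: "(k, Zero C (Dom C c) Z) \<in> Pure_Seq C" "Dom C k \<in> A" by (auto simp: TD_def)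
  note [simp] = seq_arr(1)[OF k(1)]
  have kc: "Cod C k = Dom C c" using seq_arr(3)[OF k(1)] by simp
  obtain u where u: "u \<in> Arr C" "Dom C u = Dom C (Ident C (Dom C c))" "Cod C u = Dom C k" "u \<cdot> k = Ident C (Dom C c)"
    by (rule seq_lift[OF k(1), of "Ident C (Dom C c)"]) simp_all
  then show ?thesis using A_retract[of u k] k(2) by simp
qed

text \<open>Adding to \<open>d\<close> a component into an acyclic object turns it into an
  S-denominator, and the contribution of this component is null by construction.\<close>

lemma null_in_Frac_SA:
  assumes "null_in_Frac f"
  obtains s where "s \<in> SA" "Dom C s = Cod C f" "null (f \<cdot> s)"
proof -
  obtain d where f: "f \<in> Arr C" and d: "d \<in> DA" "Dom C d = Cod C f" "null (f \<cdot> d)"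
    using assms by (auto simp: null_in_Frac_def)
  note [simp] = f d(2) DA_arr[OF d(1)]
  obtain I S i1 i2 p1 p2 e c where F: "biproduct C (Cod C d) I S i1 i2 p1 p2" "I \<in> A" "e \<in> Arr C" "Dom C e = Dom C d" "Cod C e = I"
    "(d \<cdot> i1 \<boxplus> e \<cdot> i2, c) \<in> Pure_Seq C" "(d \<cdot> i1 \<boxplus> e \<cdot> i2) \<cdot> p1 = d" "p1 \<in> TD" "d \<in> DA \<longleftrightarrow> Cod C c \<in> A"
    by (rule canonical_factorisation[OF DA_arr[OF d(1)]])
  note [simp] = biproduct_simps[OF F(1)] F(3-5)
  have 1: "null ((f \<cdot> d) \<cdot> i1)" using d(3) by (rule null_comp_right) simp_all
  have 2: "null ((f \<cdot> e) \<cdot> i2)" using F(2) by (intro nullI) simp_all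
  have "null ((f \<cdot> d) \<cdot> i1 \<boxplus> (f \<cdot> e) \<cdot> i2)" by (rule null_add[OF 1 2]) simp_all
  then have "null (f \<cdot> (d \<cdot> i1 \<boxplus> e \<cdot> i2))" by simp
  moreover have "d \<cdot> i1 \<boxplus> e \<cdot> i2 \<in> SA" using F(6,9) d(1) by (auto simp: SA_def)
  ultimately show thesis using that by simp
qed

text \<open>The S-denominator supplied by \<open>null_in_Frac_SA\<close> can be pushed out along
  \<open>g\<close>; for an arbitrary denominator there would be no such square at hand.\<close>

lemma null_in_Frac_comp_right:
  assumes f: "null_in_Frac f" and g: "g \<in> Arr C" "Cod C f = Dom C g"
  shows "null_in_Frac (f \<cdot> g)"
proof -
  obtain s where s: "s \<in> SA" "Dom C s = Cod C f" "null (f \<cdot> s)" by (rule null_in_Frac_SA[OF f])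
  have fa: "f \<in> Arr C" using f by (simp add: null_in_Frac_def)
  obtain g' s' where p: "s' \<in> SA" "g' \<in> Arr C" "s' \<in> Arr C" "Dom C g' = Cod C s" "Dom C s' = Cod C g" "Cod C g' = Cod C s'"
    "s \<cdot> g' = g \<cdot> s'"
    by (rule pushS[OF s(1) g(1)]) (use s(2) g(2) in simp_all)
  note [simp] = fa g SA_arr[OF s(1)] s(2) p(2-6)
  have "null ((f \<cdot> s) \<cdot> g')" using s(3) by (rule null_comp_right) simp_all
  then have "null ((f \<cdot> g) \<cdot> s')" by (simp add: p(7))
  then show ?thesis using SA_DA[OF p(1)] unfolding null_in_Frac_def by (intro conjI bexI[of _ s']) simp_all
qed

lemma null_in_Frac_cancel_right:
  assumes f: "null_in_Frac (f \<cdot> c)" and c: "f \<in> Arr C" "c \<in> DA" "Cod C f = Dom C c"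
  shows "null_in_Frac f"
proof -
  obtain d where d: "d \<in> DA" "Dom C d = Cod C (f \<cdot> c)" "null ((f \<cdot> c) \<cdot> d)"
    using f by (auto simp: null_in_Frac_def)
  note [simp] = c(1,3) c(2)[THEN DA_arr] DA_arr[OF d(1)]
  have [simp]: "Dom C d = Cod C c" using d(2) by simp
  have "c \<cdot> d \<in> DA" by (rule DA_comp[OF c(2) d(1)]) simp
  moreover have "null (f \<cdot> (c \<cdot> d))" using d(3) by simp
  ultimately show ?thesis unfolding null_in_Frac_def by (intro conjI bexI[of _ "c \<cdot> d"]) simp_all
qed

lemma null_in_Frac_left:
  assumes c: "f \<in> Arr C" "c \<in> DA" "Cod C c = Dom C f"
  shows "null_in_Frac (c \<cdot> f) \<longleftrightarrow> null_in_Frac f"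
proof -
  note [simp] = c(1,3) c(2)[THEN DA_arr]
  have "null ((c \<cdot> f) \<cdot> d) \<longleftrightarrow> null (f \<cdot> d)" if "d \<in> DA" "Dom C d = Cod C f" for d
    using that DA_arr[OF that(1)] null_cancel_DA[OF c(2), of "f \<cdot> d"] null_comp_left[of "f \<cdot> d" c] by auto
  then show ?thesis unfolding null_in_Frac_def by auto
qed

text \<open>Makes vanishing an invariant of double fractions. By semi-saturation the arrows
  \<open>c\<close> of the generating relations are denominators, so vanishing passes across them in
  both directions.\<close>

lemma null_in_Frac_feq: "feq x y \<Longrightarrow> null_in_Frac (fst (snd x)) \<longleftrightarrow> null_in_Frac (fst (snd y))"
proof (induction rule: fraction_eq.induct)
  case (right b f a c)
  have h: "a \<in> DA" "f \<in> Arr C" "c \<in> Arr C" "Cod C a = Dom C c" "Cod C f = Dom C c" "a \<cdot> c \<in> DA"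
    using right by (auto simp: TA_iff composable_def)
  have "c \<in> DA" by (rule DA_right[OF h(1,3,4,6)])
  then show ?case
    using null_in_Frac_comp_right[OF _ h(3,5)] null_in_Frac_cancel_right[OF _ h(2) _ h(5)] by auto
next
  case (left b f a c)
  have h: "b \<in> DA" "f \<in> Arr C" "c \<in> Arr C" "Cod C c = Dom C b" "Cod C c = Dom C f" "c \<cdot> b \<in> DA"
    using left by (auto simp: TA_iff composable_def)
  have "c \<in> DA" by (rule DA_left[OF h(3,1,4,6)])
  then show ?case using null_in_Frac_left[OF h(2) _ h(5)] by auto
qed auto

text \<open>The arrow from an acyclic object to a zero object lies in \<open>TD\<close>, so acyclic
  objects become zero in the localisation.\<close>

lemma LF_null:
  assumes "null f"
  shows "LF f = LF (Zero C (Dom C f) (Cod C f))"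
proof -
  obtain u v where uv: "u \<in> Arr C" "v \<in> Arr C" "Cod C u = Dom C v" "Cod C u \<in> A" "f = u \<cdot> v"
    using assms unfolding null_def by blast
  obtain Z where Z: "zero_object C Z" by (rule zero_object_exists)
  have [simp]: "Z \<in> Obj C" by (rule zero_object_simps(1)[OF Z])
  let ?B = "Dom C v" let ?z = "Zero C ?B Z" let ?y = "Zero C Z ?B"
  note [simp] = uv(1-3)
  have z: "?z \<in> TD" using Ident_seq(1)[OF Z, of ?B] uv(4) by (auto simp: TD_def)
  have "LF ?z \<cdot>\<^bsub>Loc\<^esub> (LF ?y \<cdot>\<^bsub>Loc\<^esub> LF ?z) = LF ?z" by (simp flip: LF_comp)
  then have "(LF ?z \<cdot>\<^bsub>Loc\<^esub> (LF ?y \<cdot>\<^bsub>Loc\<^esub> LF ?z)) \<cdot>\<^bsub>Loc\<^esub> LB ?z = LF ?z \<cdot>\<^bsub>Loc\<^esub> LB ?z" by simp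
  then have 1: "LF ?z \<cdot>\<^bsub>Loc\<^esub> LF ?y = Ident Loc ?B"
    using TD_DA[OF z] by (simp add: LF_LB del: Loc_simps(2-))
  have "LF f = LF u \<cdot>\<^bsub>Loc\<^esub> LF v" by (simp add: uv(5) LF_comp)
  also have "\<dots> = LF u \<cdot>\<^bsub>Loc\<^esub> ((LF ?z \<cdot>\<^bsub>Loc\<^esub> LF ?y) \<cdot>\<^bsub>Loc\<^esub> LF v)"
    unfolding 1 using Loc.id_comp[of "LF v" ?B] by simp
  also have "\<dots> = LF (u \<cdot> (?z \<cdot> (?y \<cdot> v)))" by (simp add: LF_comp del: zero_comp comp_zero)
  also have "u \<cdot> (?z \<cdot> (?y \<cdot> v)) = Zero C (Dom C f) (Cod C f)" by (simp add: uv(5))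
  finally show ?thesis .
qed

text \<open>\<open>frac_loc_inject\<close> converts the equation into a fraction equality with a
  zero arrow, along which vanishing is invariant.\<close>

lemma LF_eq_zero_imp:
  assumes f: "f \<in> Arr C" and e: "LF f = LF (Zero C (Dom C f) (Cod C f))"
  shows "null_in_Frac f"
proof -
  let ?x = "\<lambda>f. (Ident C (Dom C f), f, Ident C (Cod C f))" and ?o = "Zero C (Dom C f) (Cod C f)"
  note [simp] = f
  have LB_id: "LB (Ident C X) = Ident Loc X" if "X \<in> Obj C" for X
    using LB_LF[of "Ident C X"] that Loc.comp_id[of "LB (Ident C X)" X] LF_id[OF that] by simp
  have x: "frac_loc (?x g) = LF g" if g: "g \<in> Arr C" for g
    using g Loc.id_comp[of "LF g"] Loc.comp_id[of "LF g"] by (simp add: frac_loc_def LB_id del: Loc_simps(2))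
  have "feq (?x f) (?x ?o)"
    by (rule frac_loc_inject) (use e x[of f] x[of ?o] in \<open>simp_all add: TA_iff\<close>)
  moreover have "null_in_Frac ?o"
    unfolding null_in_Frac_def using null_zero[of "Dom C f" "Cod C f"]
    by (intro conjI bexI[of _ "Ident C (Cod C f)"]) simp_all
  ultimately show ?thesis using null_in_Frac_feq[of "?x f" "?x ?o"] by simp
qed

text \<open>A direct sum with an acyclic object serves as a cylinder: \<open>f\<close> and
  \<open>g\<close> are obtained from one arrow, \<open>p1 \<cdot> g \<boxplus> p2 \<cdot> v\<close>,
  by composing it with two sections of the denominator \<open>p1\<close>. Such sections agree in the
  localisation and are denominators themselves.\<close>

lemma null_difference:
  assumes f: "f \<in> Arr C" "g \<in> Arr C" "Dom C f = Dom C g" "Cod C f = Cod C g" and n: "null (f \<boxplus> Neg C g)"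
  shows "LF f = LF g" "f \<in> DA \<Longrightarrow> g \<in> DA"
proof -
  obtain u v where uv: "u \<in> Arr C" "v \<in> Arr C" "Cod C u = Dom C v" "Cod C u \<in> A" "u \<cdot> v = f \<boxplus> Neg C g"
    using n unfolding null_def by metis
  note [simp] = f uv(1-3)
  have [simp]: "Dom C u = Dom C g" "Cod C v = Cod C g" using comp_arr(2,3)[of u v] uv(5) by simp_all
  obtain S i1 i2 p1 p2 where b: "biproduct C (Dom C g) (Dom C v) S i1 i2 p1 p2"
    by (rule biproduct_exists[of "Dom C g" "Dom C v"]) simp_all
  note [simp] = biproduct_simps[OF b]
  have p1: "p1 \<in> DA" by (rule TD_DA[OF biproduct_TD[OF b]]) (use uv in simp)
  let ?\<alpha> = "i1 \<boxplus> u \<cdot> i2" and ?m = "p1 \<cdot> g \<boxplus> p2 \<cdot> v"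
  have "?\<alpha> \<cdot> ?m = g \<boxplus> (f \<boxplus> Neg C g)" by (simp add: uv(5))
  also have "\<dots> = f" by (simp add: add_lcomm[of g])
  finally have fm: "f = ?\<alpha> \<cdot> ?m" ..
  have gm: "g = i1 \<cdot> ?m" by simp
  have 1: "LF ?\<alpha> \<cdot>\<^bsub>Loc\<^esub> LF p1 = LF i1 \<cdot>\<^bsub>Loc\<^esub> LF p1" by (simp flip: LF_comp)
  then have "(LF ?\<alpha> \<cdot>\<^bsub>Loc\<^esub> LF p1) \<cdot>\<^bsub>Loc\<^esub> LB p1 = (LF i1 \<cdot>\<^bsub>Loc\<^esub> LF p1) \<cdot>\<^bsub>Loc\<^esub> LB p1" by (rule arg_cong)
  then have "LF ?\<alpha> = LF i1" using p1 by (simp add: LF_LB del: Loc_simps(2-))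
  then have "LF (?\<alpha> \<cdot> ?m) = LF (i1 \<cdot> ?m)" by (subst (1 2) LF_comp) simp_all
  then show "LF f = LF g" unfolding fm[symmetric] gm[symmetric] .
  have ai: "?\<alpha> \<in> DA" "i1 \<in> DA" by (rule DA_left[OF _ p1]; simp)+
  assume "f \<in> DA"
  then have 2: "?\<alpha> \<cdot> ?m \<in> DA" by (simp only: fm[symmetric])
  have 3: "?m \<in> DA" by (rule DA_right[OF ai(1) _ _ 2]) simp_all
  have "i1 \<cdot> ?m \<in> DA" by (rule DA_comp[OF ai(2) 3]) simp
  then show "g \<in> DA" by simp
qed

text \<open>If \<open>j \<cdot> d\<close> is null through \<open>u\<close>, pushing \<open>j\<close>
  out along \<open>u\<close> gives \<open>u'\<close> with \<open>u' \<cdot> r = d\<close> and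
  \<open>u' \<cdot> \<pi> = \<delta>\<close>. Here \<open>\<pi>\<close> is a T-denominator, so
  \<open>u'\<close> vanishes together with \<open>\<delta>\<close>. Then the denominator
  \<open>d\<close> vanishes too, and \<open>null_DA_source\<close> applies to a composite that
  starts at the middle term.\<close>

lemma acyclic_if_null_in_Frac:
  assumes s: "(j, \<delta>) \<in> Pure_Seq C" and j: "null_in_Frac j" and d: "null_in_Frac \<delta>"
  shows "Cod C j \<in> A"
proof -
  note [simp] = seq_arr(1,2)[OF s]
  have [simp]: "Dom C \<delta> = Cod C j" using seq_arr(3)[OF s] by simp
  obtain d where d0: "d \<in> DA" "Dom C d = Cod C j" "null (j \<cdot> d)" using j by (auto simp: null_in_Frac_def)
  obtain u v where uv: "u \<in> Arr C" "v \<in> Arr C" "Cod C u = Dom C v" "Cod C u \<in> A" "u \<cdot> v = j \<cdot> d"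
    using d0(3) unfolding null_def by metis
  note [simp] = DA_arr[OF d0(1)] d0(2) uv(1-3)
  have [simp]: "Dom C u = Dom C j" "Cod C v = Cod C d" using comp_arr(2,3)[of u v] uv(5) by simp_all
  obtain u' j' where P: "pushout C j u u' j'" "pure_mono C j'" "u' \<in> Arr C" "j' \<in> Arr C" "Dom C u' = Cod C j" "Dom C j' = Cod C u"
    "Cod C u' = Cod C j'" "j \<cdot> u' = u \<cdot> j'"
    by (rule pure_pushout[OF seq_pure(2)[OF s], of u]) simp_all
  note [simp] = P(3-7)
  obtain \<pi> where pi: "(j', \<pi>) \<in> Pure_Seq C" "Cod C \<pi> = Cod C \<delta>" "u' \<cdot> \<pi> = \<delta>"
    by (rule pushout_cokernel[OF P(1) s P(2)])
  have "commutes C j d u v" using uv(5) by (simp add: commutes_def composable_def)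
  then obtain r where "r \<in> Hom C (Cod C u') (Cod C d)" "u' \<cdot> r = d"
    using P(1) unfolding pushout_def by blast
  then have r: "r \<in> Arr C" "Dom C r = Cod C j'" "Cod C r = Cod C d" "u' \<cdot> r = d" by (simp_all add: Hom_iff)
  note [simp] = r(1-3) seq_arr(2)[OF pi(1)]
  have [simp]: "Dom C \<pi> = Cod C j'" using seq_arr(3)[OF pi(1)] by simp
  have "\<pi> \<in> TD" using pi(1) uv(4) by (auto simp: TD_def)
  then have "null_in_Frac u'"
    using d by (intro null_in_Frac_cancel_right[of u' \<pi>]) (simp_all add: pi(3) TD_DA)
  then have "null_in_Frac (u' \<cdot> r)" by (rule null_in_Frac_comp_right) simp_all
  then obtain e where e: "e \<in> DA" "Dom C e = Cod C d" "null (d \<cdot> e)" by (auto simp: null_in_Frac_def r(4))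
  have "d \<cdot> e \<in> DA" using d0 e by (intro DA_comp) simp_all
  then show ?thesis using null_DA_source[OF _ e(3)] DA_arr[OF e(1)] e(2) by simp
qed

text \<open>Null arrows are zero in the localisation, where \<open>LF f\<close> can be cancelled;
  \<open>LF_eq_zero_imp\<close> returns to \<open>C\<close>.\<close>

lemma null_in_Frac_if_LF_iso:
  assumes f: "f \<in> Arr C" and iso: "is_iso Loc (LF f)"
  shows "\<lbrakk>\<phi> \<in> Arr C; Cod C \<phi> = Dom C f; null (\<phi> \<cdot> f)\<rbrakk> \<Longrightarrow> null_in_Frac \<phi>"
    and "\<lbrakk>j \<in> Arr C; Dom C j = Cod C f; null (f \<cdot> j)\<rbrakk> \<Longrightarrow> null_in_Frac j"
proof -
  obtain g where g: "LF f \<in> Arr Loc" "g \<in> Arr Loc" "Dom Loc g = Cod Loc (LF f)" "Cod Loc g = Dom Loc (LF f)"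
    "LF f \<cdot>\<^bsub>Loc\<^esub> g = Ident Loc (Dom Loc (LF f))" "g \<cdot>\<^bsub>Loc\<^esub> LF f = Ident Loc (Cod Loc (LF f))"
    by (rule Loc.is_isoE[OF iso])
  note [simp] = f
  have gs: "Dom Loc g = Cod C f" "Cod Loc g = Dom C f" using g by simp_all
  { assume p: "\<phi> \<in> Arr C" "Cod C \<phi> = Dom C f" "null (\<phi> \<cdot> f)"
    note [simp] = p(1,2) g(2) gs
    let ?o = "Zero C (Dom C \<phi>) (Dom C f)"
    have "LF (\<phi> \<cdot> f) = LF (?o \<cdot> f)" using LF_null[OF p(3)] by simp
    then have "LF \<phi> \<cdot>\<^bsub>Loc\<^esub> LF f = LF ?o \<cdot>\<^bsub>Loc\<^esub> LF f" by (subst (1 2) LF_comp[symmetric]) simp_all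
    then have "(LF \<phi> \<cdot>\<^bsub>Loc\<^esub> LF f) \<cdot>\<^bsub>Loc\<^esub> g = (LF ?o \<cdot>\<^bsub>Loc\<^esub> LF f) \<cdot>\<^bsub>Loc\<^esub> g" by (rule arg_cong)
    then have "LF \<phi> = LF ?o" by (simp add: g(5) del: Loc_simps(2-))
    then show "null_in_Frac \<phi>" by (intro LF_eq_zero_imp) simp_all }
  { assume p: "j \<in> Arr C" "Dom C j = Cod C f" "null (f \<cdot> j)"
    note [simp] = p(1,2) g(2) gs
    let ?o = "Zero C (Cod C f) (Cod C j)"
    have "LF (f \<cdot> j) = LF (f \<cdot> ?o)" using LF_null[OF p(3)] by simp
    then have 1: "LF f \<cdot>\<^bsub>Loc\<^esub> LF j = LF f \<cdot>\<^bsub>Loc\<^esub> LF ?o" by (subst (1 2) LF_comp[symmetric]) simp_all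
    have "(g \<cdot>\<^bsub>Loc\<^esub> LF f) \<cdot>\<^bsub>Loc\<^esub> LF j = (g \<cdot>\<^bsub>Loc\<^esub> LF f) \<cdot>\<^bsub>Loc\<^esub> LF ?o" using 1 by simp
    then have "LF j = LF ?o" unfolding g(6) by (simp del: Loc_simps(2-))
    then show "null_in_Frac j" by (intro LF_eq_zero_imp) simp_all }
qed

lemma Frac_iso_imp_LF_iso:
  assumes f: "f \<in> Arr C" and iso: "is_iso Fr (loc C DA f)"
  shows "is_iso Loc (LF f)"
proof -
  have F: "is_functor Fr Loc id Frac_Loc" by (rule Frac_transport)
  have l: "loc C DA f \<in> Arr Fr" "Frac_Loc (loc C DA f) = LF f" using Frac_Loc_loc[OF f] by auto
  interpret Fr: category_loc Fr by unfold_locales (rule Frac_transport)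
  obtain g where g: "g \<in> Arr Fr" "Dom Fr g = Cod Fr (loc C DA f)" "Cod Fr g = Dom Fr (loc C DA f)"
    "loc C DA f \<cdot>\<^bsub>Fr\<^esub> g = Ident Fr (Dom Fr (loc C DA f))" "g \<cdot>\<^bsub>Fr\<^esub> loc C DA f = Ident Fr (Cod Fr (loc C DA f))"
    by (rule Fr.is_isoE[OF iso])
  have Fd: "Frac_Loc h \<in> Arr Loc \<and> Dom Loc (Frac_Loc h) = Dom Fr h \<and> Cod Loc (Frac_Loc h) = Cod Fr h" if "h \<in> Arr Fr" for h
    using F that by (auto simp: is_functor_def Hom_def)
  have Fi: "Frac_Loc (Ident Fr X) = Ident Loc X" if "X \<in> Obj Fr" for X using F that by (auto simp: is_functor_def)
  have Fc: "Frac_Loc (h \<cdot>\<^bsub>Fr\<^esub> k) = Frac_Loc h \<cdot>\<^bsub>Loc\<^esub> Frac_Loc k" if "h \<in> Arr Fr" "k \<in> Arr Fr" "Cod Fr h = Dom Fr k" for h k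
    using F that by (auto simp: is_functor_def composable_def)
  show ?thesis
  proof (rule Loc.is_isoI[of _ "Frac_Loc g"])
    show "LF f \<cdot>\<^bsub>Loc\<^esub> Frac_Loc g = Ident Loc (Dom Loc (LF f))"
      using Fc[OF l(1) g(1)] g(2,4) l Fi[OF Fr.dom_obj[OF l(1)]] Fd[OF l(1)] by simp
    show "Frac_Loc g \<cdot>\<^bsub>Loc\<^esub> LF f = Ident Loc (Cod Loc (LF f))"
      using Fc[OF g(1) l(1)] g(3,5) l Fi[OF Fr.cod_obj[OF l(1)]] Fd[OF l(1)] by simp
  qed (use Fd[OF l(1)] Fd[OF g(1)] g(2,3) l(2) in simp_all)
qed

end

section \<open>The exact category of complexes\<close>

locale complexes_loc = pure_loc E
  for E :: "('o, 'm, 'z) exact_cat_scheme" (structure)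
begin

abbreviation CE :: "(('o, 'm) cx, ('o, 'm) chain_map) exact_cat" where
  "CE \<equiv> complexes E"

section \<open>Complexes as an additive category\<close>

lemma is_complexI:
  assumes "\<And>n. ob X n \<in> Obj E" "\<And>n. diff X n \<in> Arr E" "\<And>n. Dom E (diff X n) = ob X n" "\<And>n. Cod E (diff X n) = ob X (n + 1)"
    "\<And>n. diff X n \<cdot> diff X (n + 1) = Zero E (ob X n) (ob X (n + 2))"
  shows "is_complex E X"
  using assms by (simp add: is_complex_def Hom_iff)

lemma is_complexD [simp]:
  assumes "is_complex E X"
  shows "ob X n \<in> Obj E" "diff X n \<in> Arr E" "Dom E (diff X n) = ob X n" "Cod E (diff X n) = ob X (n + 1)"
    "diff X n \<cdot> diff X (n + 1) = Zero E (ob X n) (ob X (n + 2))"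
  using assms by (simp_all add: is_complex_def Hom_iff)

lemma diff_diff_reduce [simp]:
  "\<lbrakk>is_complex E X; k \<in> Arr E; Dom E k = ob X (n + 2)\<rbrakk> \<Longrightarrow> diff X n \<cdot> (diff X (n + 1) \<cdot> k) = Zero E (ob X n) (Cod E k)"
  using comp_reduce[OF is_complexD(5)[of X n], of k] by (simp add: add.assoc)

lemma is_chain_mapI:
  assumes "is_complex E X" "is_complex E Y" "\<And>n. c n \<in> Arr E" "\<And>n. Dom E (c n) = ob X n" "\<And>n. Cod E (c n) = ob Y n"
    "\<And>n. diff X n \<cdot> c (n + 1) = c n \<cdot> diff Y n"
  shows "is_chain_map E (Chain_Map X Y c)"
  using assms by (simp add: is_chain_map_def Hom_iff)

lemma is_chain_mapD:
  assumes "is_chain_map E f"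
  shows "is_complex E (src f)" "is_complex E (tgt f)" "cmp f n \<in> Arr E" "Dom E (cmp f n) = ob (src f) n"
    "Cod E (cmp f n) = ob (tgt f) n" "diff (src f) n \<cdot> cmp f (n + 1) = cmp f n \<cdot> diff (tgt f) n"
  using assms by (simp_all add: is_chain_map_def Hom_iff)

lemmas chain_map_simps [simp] = is_chain_mapD(1-5)

lemma CE_simps [simp]:
  "Obj CE = {X. is_complex E X}" "Arr CE = {f. is_chain_map E f}" "Dom CE = src" "Cod CE = tgt"
  "Ident CE X = Chain_Map X X (\<lambda>n. Ident E (ob X n))"
  "f \<cdot>\<^bsub>CE\<^esub> g = Chain_Map (src f) (tgt g) (\<lambda>n. cmp f n \<cdot> cmp g n)"
  "f \<boxplus>\<^bsub>CE\<^esub> g = Chain_Map (src f) (tgt f) (\<lambda>n. cmp f n \<boxplus> cmp g n)"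
  "Zero CE X Y = Chain_Map X Y (\<lambda>n. Zero E (ob X n) (ob Y n))"
  "(i, p) \<in> Pure_Seq CE \<longleftrightarrow> is_chain_map E i \<and> is_chain_map E p \<and> tgt i = src p \<and> (\<forall>n. (cmp i n, cmp p n) \<in> Pure_Seq E)"
  by (simp_all add: complexes_def)

lemma chain_map_eqI: "\<lbrakk>src f = src g; tgt f = tgt g; \<And>n. cmp f n = cmp g n\<rbrakk> \<Longrightarrow> f = g"
  by (rule chain_map.expand) auto

lemma chain_map_comp:
  assumes "is_chain_map E f" "is_chain_map E g" "tgt f = src g"
  shows "is_chain_map E (Chain_Map (src f) (tgt g) (\<lambda>n. cmp f n \<cdot> cmp g n))"
proof (rule is_chain_mapI)
  fix n
  have "diff (src f) n \<cdot> (cmp f (n + 1) \<cdot> cmp g (n + 1)) = cmp f n \<cdot> (diff (src g) n \<cdot> cmp g (n + 1))"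
    using comp_reduce[OF is_chain_mapD(6)[OF assms(1), of n], of "cmp g (n + 1)"] assms by simp
  also have "\<dots> = (cmp f n \<cdot> cmp g n) \<cdot> diff (tgt g) n"
    using assms by (simp add: is_chain_mapD(6))
  finally show "diff (src f) n \<cdot> (cmp f (n + 1) \<cdot> cmp g (n + 1)) = (cmp f n \<cdot> cmp g n) \<cdot> diff (tgt g) n" .
qed (use assms in simp_all)

lemma category_CE: "category CE"
proof (rule categoryI, goal_cases)
  case (1 f) then show ?case by simp
next
  case (2 X) then show ?case by (auto intro!: is_chain_mapI)
next
  case (3 f g) then show ?case using chain_map_comp[of f g] by simp
next
  case (4 f) then show ?case by (auto intro!: chain_map_eqI)
next
  case (5 f g h) then show ?case by (auto intro!: chain_map_eqI)
qed

lemma chain_map_add: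
  assumes "is_chain_map E f" "is_chain_map E g" "src f = src g" "tgt f = tgt g"
  shows "is_chain_map E (Chain_Map (src f) (tgt f) (\<lambda>n. cmp f n \<boxplus> cmp g n))"
proof (rule is_chain_mapI)
  fix n
  show "diff (src f) n \<cdot> (cmp f (n + 1) \<boxplus> cmp g (n + 1)) = (cmp f n \<boxplus> cmp g n) \<cdot> diff (tgt f) n"
    using is_chain_mapD(6)[OF assms(1), of n] is_chain_mapD(6)[OF assms(2), of n] assms by simp
qed (use assms in simp_all)

lemma chain_map_zero: "is_complex E X \<Longrightarrow> is_complex E Y \<Longrightarrow> is_chain_map E (Chain_Map X Y (\<lambda>n. Zero E (ob X n) (ob Y n)))"
  by (rule is_chain_mapI) simp_all

lemma chain_map_neg:
  assumes "is_chain_map E f"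
  shows "is_chain_map E (Chain_Map (src f) (tgt f) (\<lambda>n. Neg E (cmp f n)))"
  using assms is_chain_mapD(6)[OF assms] by (intro is_chain_mapI) simp_all

lemma preadditive_CE: "preadditive_category CE"
  unfolding preadditive_category_def
proof (intro conjI ballI)
  show "category CE" by (rule category_CE)
next
  fix X Y assume "X \<in> Obj CE" "Y \<in> Obj CE"
  then have XY: "is_complex E X" "is_complex E Y" by simp_all
  show "comm_group (hom_group CE X Y)"
  proof (rule comm_groupI, goal_cases)
    case (1 f g) then show ?case using chain_map_add[of f g] by (simp add: hom_group_def Hom_def)
  next
    case 2 then show ?case using XY chain_map_zero by (simp add: hom_group_def Hom_def)
  next
    case (3 f g h) then show ?case by (auto simp: hom_group_def Hom_def intro!: chain_map_eqI)
  next
    case (4 f g) then show ?case by (auto simp: hom_group_def Hom_def intro!: chain_map_eqI add_comm)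
  next
    case (5 f) then show ?case by (auto simp: hom_group_def Hom_def intro!: chain_map_eqI)
  next
    case (6 f)
    then show ?case using chain_map_neg[of f]
      by (auto simp: hom_group_def Hom_def intro!: chain_map_eqI bexI[of _ "Chain_Map (src f) (tgt f) (\<lambda>n. Neg E (cmp f n))"])
  qed
next
  fix X Y Z f f' g g'
  assume "f \<in> Hom CE X Y" "f' \<in> Hom CE X Y" "g \<in> Hom CE Y Z" "g' \<in> Hom CE Y Z"
  then show "(f \<boxplus>\<^bsub>CE\<^esub> f') \<cdot>\<^bsub>CE\<^esub> g = f \<cdot>\<^bsub>CE\<^esub> g \<boxplus>\<^bsub>CE\<^esub> f' \<cdot>\<^bsub>CE\<^esub> g"
    "f \<cdot>\<^bsub>CE\<^esub> (g \<boxplus>\<^bsub>CE\<^esub> g') = f \<cdot>\<^bsub>CE\<^esub> g \<boxplus>\<^bsub>CE\<^esub> f \<cdot>\<^bsub>CE\<^esub> g'"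
    by (auto simp: Hom_def intro!: chain_map_eqI)
qed

sublocale CE: preadditive_dual_loc CE
  by unfold_locales (rule preadditive_CE)

lemma Neg_CE [simp]:
  assumes f: "is_chain_map E f"
  shows "Neg CE f = Chain_Map (src f) (tgt f) (\<lambda>n. Neg E (cmp f n))"
  by (rule CE.neg_unique[symmetric]) (use f chain_map_neg[OF f] in \<open>auto intro!: chain_map_eqI\<close>)

lemma biproduct_CE_imp:
  assumes "biproduct CE X Y S i1 i2 p1 p2"
  shows "biproduct E (ob X n) (ob Y n) (ob S n) (cmp i1 n) (cmp i2 n) (cmp p1 n) (cmp p2 n)"
  using assms unfolding biproduct_def Hom_def by (auto dest: fun_cong)

lemma biproduct_complex:
  assumes X: "is_complex E X" and Y: "is_complex E Y"
    and b: "\<And>n. biproduct E (ob X n) (ob Y n) (S n) (i1 n) (i2 n) (p1 n) (p2 n)"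
  defines "B \<equiv> Cx S (\<lambda>n. p1 n \<cdot> diff X n \<cdot> i1 (n + 1) \<boxplus> p2 n \<cdot> diff Y n \<cdot> i2 (n + 1))"
  shows "biproduct CE X Y B (Chain_Map X B i1) (Chain_Map Y B i2) (Chain_Map B X p1) (Chain_Map B Y p2)"
proof -
  note [simp] = biproduct_simps[OF b] X Y
  have B: "is_complex E B" by (rule is_complexI) (simp_all add: B_def add.assoc)
  have "is_chain_map E (Chain_Map X B i1)" by (rule is_chain_mapI[OF X B]) (simp_all add: B_def)
  moreover have "is_chain_map E (Chain_Map Y B i2)" by (rule is_chain_mapI[OF Y B]) (simp_all add: B_def)
  moreover have "is_chain_map E (Chain_Map B X p1)" by (rule is_chain_mapI[OF B X]) (simp_all add: B_def)
  moreover have "is_chain_map E (Chain_Map B Y p2)" by (rule is_chain_mapI[OF B Y]) (simp_all add: B_def)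
  ultimately show ?thesis using B b
    by (auto simp: biproduct_def Hom_def B_def intro!: chain_map_eqI)
qed

lemma biproduct_CE_exists:
  assumes X: "is_complex E X" and Y: "is_complex E Y"
  shows "\<exists>S i1 i2 p1 p2. biproduct CE X Y S i1 i2 p1 p2"
proof -
  have "\<exists>t. case t of (S, i1, i2, p1, p2) \<Rightarrow> biproduct E (ob X n) (ob Y n) S i1 i2 p1 p2" for n
  proof -
    obtain S i1 i2 p1 p2 where "biproduct E (ob X n) (ob Y n) S i1 i2 p1 p2"
      by (rule biproduct_exists[of "ob X n" "ob Y n"]) (use X Y in simp_all)
    then show ?thesis by (intro exI[of _ "(S, i1, i2, p1, p2)"]) simp
  qed
  then obtain t where t: "\<And>n. case t n of (S, i1, i2, p1, p2) \<Rightarrow> biproduct E (ob X n) (ob Y n) S i1 i2 p1 p2"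
    by metis
  have "biproduct E (ob X n) (ob Y n) (fst (t n)) (fst (snd (t n))) (fst (snd (snd (t n))))
    (fst (snd (snd (snd (t n))))) (snd (snd (snd (snd (t n)))))" for n
    using t[of n] by (simp add: case_prod_beta)
  from biproduct_complex[OF X Y this] show ?thesis by blast
qed

lemma zero_complex:
  assumes "zero_object E Z"
  shows "zero_object CE (Cx (\<lambda>n. Z) (\<lambda>n. Zero E Z Z))"
proof -
  let ?Z = "Cx (\<lambda>n::int. Z) (\<lambda>n. Zero E Z Z)"
  have Z [simp]: "Z \<in> Obj E" by (rule zero_object_simps(1)[OF assms])
  have zc [simp]: "is_complex E ?Z" by (rule is_complexI) simp_all
  have "\<exists>!f. f \<in> Hom CE X ?Z" "\<exists>!f. f \<in> Hom CE ?Z X" if X: "is_complex E X" for X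
  proof -
    show "\<exists>!f. f \<in> Hom CE X ?Z"
    proof (rule ex1I[of _ "Chain_Map X ?Z (\<lambda>n. Zero E (ob X n) Z)"])
      show "Chain_Map X ?Z (\<lambda>n. Zero E (ob X n) Z) \<in> Hom CE X ?Z"
        using chain_map_zero[OF X zc] by (simp add: Hom_def)
      fix f assume "f \<in> Hom CE X ?Z"
      then have f: "is_chain_map E f" "src f = X" "tgt f = ?Z" by (simp_all add: Hom_def)
      have a: "cmp f n \<in> Arr E" "Dom E (cmp f n) = ob X n" "Cod E (cmp f n) = Z" for n using f by simp_all
      have "cmp f n = Zero E (ob X n) Z" for n
        using zero_object_simps(2)[OF assms a(1,3)] unfolding a(2) .
      then show "f = Chain_Map X ?Z (\<lambda>n. Zero E (ob X n) Z)"
        using f by (intro chain_map_eqI) simp_all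
    qed
    show "\<exists>!f. f \<in> Hom CE ?Z X"
    proof (rule ex1I[of _ "Chain_Map ?Z X (\<lambda>n. Zero E Z (ob X n))"])
      show "Chain_Map ?Z X (\<lambda>n. Zero E Z (ob X n)) \<in> Hom CE ?Z X"
        using chain_map_zero[OF zc X] by (simp add: Hom_def)
      fix f assume "f \<in> Hom CE ?Z X"
      then have f: "is_chain_map E f" "src f = ?Z" "tgt f = X" by (simp_all add: Hom_def)
      have a: "cmp f n \<in> Arr E" "Dom E (cmp f n) = Z" "Cod E (cmp f n) = ob X n" for n using f by simp_all
      have "cmp f n = Zero E Z (ob X n)" for n
        using zero_object_simps(3)[OF assms a(1,2)] unfolding a(3) .
      then show "f = Chain_Map ?Z X (\<lambda>n. Zero E Z (ob X n))"
        using f by (intro chain_map_eqI) simp_all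
    qed
  qed
  then show ?thesis by (simp add: zero_object_def)
qed

lemma additive_CE: "additive_category CE"
  unfolding additive_category_def
  using preadditive_CE zero_complex zero_object_exists biproduct_CE_exists by (metis CE_simps(1) mem_Collect_eq)

text \<open>The differential of the source restricts to the degreewise kernels, and its square is
  zero there because it becomes zero after the monomorphism \<open>i (n + 2)\<close>.\<close>

lemma kernel_complex:
  assumes p: "is_chain_map E p" "\<And>n. pure_epi E (cmp p n)"
  obtains i where "(i, p) \<in> Pure_Seq CE"
proof -
  have "\<forall>n. \<exists>i. (i, cmp p n) \<in> Pure_Seq E" using p(2) pure_epi_seq by blast
  then obtain i where i: "\<And>n. (i n, cmp p n) \<in> Pure_Seq E" by metis
  note [simp] = seq_arr(1)[OF i] p(1)
  have cod [simp]: "Cod E (i n) = ob (src p) n" for n using seq_arr(3)[OF i] by simp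
  have ip: "i n \<cdot> cmp p n = Zero E (Dom E (i n)) (ob (tgt p) n)" for n using seq_arr(4)[OF i] by simp
  have "\<exists>d. d \<in> Arr E \<and> Dom E d = Dom E (i n) \<and> Cod E d = Dom E (i (n + 1)) \<and> d \<cdot> i (n + 1) = i n \<cdot> diff (src p) n" for n
  proof -
    have "(i n \<cdot> diff (src p) n) \<cdot> cmp p (n + 1) = Zero E (Dom E (i n)) (ob (tgt p) (n + 1))"
      using comp_reduce[OF ip[of n], of "diff (tgt p) n"] is_chain_mapD(6)[OF p(1), of n] by simp
    then show ?thesis using seq_lift[OF i, of "i n \<cdot> diff (src p) n" "n + 1"] by auto
  qed
  then obtain d where d: "\<And>n. d n \<in> Arr E \<and> Dom E (d n) = Dom E (i n) \<and> Cod E (d n) = Dom E (i (n + 1)) \<and>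
      d n \<cdot> i (n + 1) = i n \<cdot> diff (src p) n" by metis
  have [simp]: "d n \<in> Arr E" "Dom E (d n) = Dom E (i n)" "Cod E (d n) = Dom E (i (n + 1))" for n using d by auto
  have di: "d n \<cdot> i (n + 1) = i n \<cdot> diff (src p) n" for n using d by auto
  let ?K = "Cx (\<lambda>n. Dom E (i n)) d"
  have K: "is_complex E ?K"
  proof (rule is_complexI)
    fix n
    have "(d n \<cdot> d (n + 1)) \<cdot> i (n + 2) = Zero E (Dom E (i n)) (Dom E (i (n + 2))) \<cdot> i (n + 2)"
      using di[of "n + 1"] comp_reduce[OF di[of n], of "diff (src p) (n + 1)"] by (simp add: add.assoc)
    then have "d n \<cdot> d (n + 1) = Zero E (Dom E (i n)) (Dom E (i (n + 2)))"
      by (rule seq_mono[OF i]) (simp_all add: add.assoc)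
    then show "diff ?K n \<cdot> diff ?K (n + 1) = Zero E (ob ?K n) (ob ?K (n + 2))" by simp
  qed simp_all
  have "is_chain_map E (Chain_Map ?K (src p) i)"
    by (rule is_chain_mapI[OF K]) (simp_all add: di)
  then show thesis using that[of "Chain_Map ?K (src p) i"] i by simp
qed

lemma cokernel_complex:
  assumes i: "is_chain_map E i" "\<And>n. pure_mono E (cmp i n)"
  obtains p where "(i, p) \<in> Pure_Seq CE"
proof -
  have "\<forall>n. \<exists>p. (cmp i n, p) \<in> Pure_Seq E" using i(2) pure_mono_seq by blast
  then obtain p where p: "\<And>n. (cmp i n, p n) \<in> Pure_Seq E" by metis
  note [simp] = seq_arr(2)[OF p] i(1)
  have dom [simp]: "Dom E (p n) = ob (tgt i) n" for n using seq_arr(3)[OF p, of n] by simp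
  have ip: "cmp i n \<cdot> p n = Zero E (ob (src i) n) (Cod E (p n))" for n using seq_arr(4)[OF p] by simp
  have "\<exists>d. d \<in> Arr E \<and> Dom E d = Cod E (p n) \<and> Cod E d = Cod E (p (n + 1)) \<and> p n \<cdot> d = diff (tgt i) n \<cdot> p (n + 1)" for n
  proof -
    have "cmp i n \<cdot> (diff (tgt i) n \<cdot> p (n + 1)) = Zero E (ob (src i) n) (Cod E (p (n + 1)))"
      using comp_reduce[OF is_chain_mapD(6)[OF i(1), of n, symmetric], of "p (n + 1)"] ip by simp
    then show ?thesis using seq_desc[OF p, of "diff (tgt i) n \<cdot> p (n + 1)" n] by auto
  qed
  then obtain d where d: "\<And>n. d n \<in> Arr E \<and> Dom E (d n) = Cod E (p n) \<and> Cod E (d n) = Cod E (p (n + 1)) \<and>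
      p n \<cdot> d n = diff (tgt i) n \<cdot> p (n + 1)" by metis
  have [simp]: "d n \<in> Arr E" "Dom E (d n) = Cod E (p n)" "Cod E (d n) = Cod E (p (n + 1))" for n using d by auto
  have pd: "p n \<cdot> d n = diff (tgt i) n \<cdot> p (n + 1)" for n using d by auto
  let ?K = "Cx (\<lambda>n. Cod E (p n)) d"
  have K: "is_complex E ?K"
  proof (rule is_complexI)
    fix n
    have "p n \<cdot> (d n \<cdot> d (n + 1)) = p n \<cdot> Zero E (Cod E (p n)) (Cod E (p (n + 2)))"
      using pd[of "n + 1"] comp_reduce[OF pd[of n], of "d (n + 1)"] by (simp add: add.assoc)
    then have "d n \<cdot> d (n + 1) = Zero E (Cod E (p n)) (Cod E (p (n + 2)))"
      by (rule seq_epi[OF p]) (simp_all add: add.assoc)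
    then show "diff ?K n \<cdot> diff ?K (n + 1) = Zero E (ob ?K n) (ob ?K (n + 2))" by simp
  qed simp_all
  have "is_chain_map E (Chain_Map (tgt i) ?K p)"
    by (rule is_chain_mapI[OF _ K]) (simp_all add: pd)
  then show thesis using that[of "Chain_Map (tgt i) ?K p"] p by simp
qed

section \<open>Degreewise exact structure\<close>

lemma pure_mono_CE: "pure_mono CE i \<longleftrightarrow> is_chain_map E i \<and> (\<forall>n. pure_mono E (cmp i n))"
proof
  show "pure_mono CE i \<Longrightarrow> is_chain_map E i \<and> (\<forall>n. pure_mono E (cmp i n))" by (auto simp: pure_mono_def)
  show "pure_mono CE i" if h: "is_chain_map E i \<and> (\<forall>n. pure_mono E (cmp i n))"
    using cokernel_complex[of i] h unfolding pure_mono_def[of CE] by blast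
qed

lemma pure_epi_CE: "pure_epi CE p \<longleftrightarrow> is_chain_map E p \<and> (\<forall>n. pure_epi E (cmp p n))"
proof
  show "pure_epi CE p \<Longrightarrow> is_chain_map E p \<and> (\<forall>n. pure_epi E (cmp p n))" by (auto simp: pure_epi_def)
  show "pure_epi CE p" if h: "is_chain_map E p \<and> (\<forall>n. pure_epi E (cmp p n))"
    using kernel_complex[of p] h unfolding pure_epi_def[of CE] by blast
qed

text \<open>Degreewise lifts are unique, and since the components of \<open>i\<close> are monic, the
  lifts commute with the differentials.\<close>

lemma seq_CE_kernel:
  assumes "(i, p) \<in> Pure_Seq CE"
  shows "is_kernel CE p i"
proof -
  have [simp]: "is_chain_map E i" "is_chain_map E p" "tgt i = src p" and s: "\<And>n. (cmp i n, cmp p n) \<in> Pure_Seq E"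
    using assms by simp_all
  note [simp] = seq_arr(4)[OF s]
  show ?thesis
  proof (rule CE.is_kernelI)
    fix g assume g: "g \<in> Arr CE" "Cod CE g = Dom CE p" "g \<cdot>\<^bsub>CE\<^esub> p = Zero CE (Dom CE g) (Cod CE p)"
    have [simp]: "is_chain_map E g" "tgt g = src p" using g by simp_all
    have gp: "cmp g n \<cdot> cmp p n = Zero E (ob (src g) n) (ob (tgt p) n)" for n
      using g(3) by (auto dest: fun_cong)
    have "\<exists>u. u \<in> Arr E \<and> Dom E u = ob (src g) n \<and> Cod E u = ob (src i) n \<and> u \<cdot> cmp i n = cmp g n" for n
      using seq_lift[OF s, of "cmp g n" n] gp by auto
    then obtain u where u: "\<And>n. u n \<in> Arr E \<and> Dom E (u n) = ob (src g) n \<and> Cod E (u n) = ob (src i) n \<and> u n \<cdot> cmp i n = cmp g n"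
      by metis
    have [simp]: "u n \<in> Arr E" "Dom E (u n) = ob (src g) n" "Cod E (u n) = ob (src i) n" "u n \<cdot> cmp i n = cmp g n" for n
      using u by auto
    have "is_chain_map E (Chain_Map (src g) (src i) u)"
    proof (rule is_chain_mapI)
      fix n
      have "(u n \<cdot> diff (src i) n) \<cdot> cmp i (n + 1) = (u n \<cdot> cmp i n) \<cdot> diff (src p) n"
        using is_chain_mapD(6)[of i n] comp_reduce[of "u n" "cmp i n" "cmp g n" "diff (src p) n"] by simp
      also have "\<dots> = (diff (src g) n \<cdot> u (n + 1)) \<cdot> cmp i (n + 1)"
        using is_chain_mapD(6)[of g n] comp_reduce[of "u n" "cmp i n" "cmp g n" "diff (src p) n"] by simp
      finally have "u n \<cdot> diff (src i) n = diff (src g) n \<cdot> u (n + 1)"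
        by (rule seq_mono[OF s[of "n + 1"]]) simp_all
      then show "diff (src g) n \<cdot> u (n + 1) = u n \<cdot> diff (src i) n" by (rule HOL.sym)
    qed simp_all
    then show "\<exists>u\<in>Arr CE. Dom CE u = Dom CE g \<and> Cod CE u = Dom CE i \<and> u \<cdot>\<^bsub>CE\<^esub> i = g"
      by (intro bexI[of _ "Chain_Map (src g) (src i) u"]) (auto intro!: chain_map_eqI)
  next
    fix u X assume u: "u \<in> Arr CE" "Dom CE u = X" "Cod CE u = Dom CE i" "u \<cdot>\<^bsub>CE\<^esub> i = Zero CE X (Cod CE i)"
    have [simp]: "is_chain_map E u" "src u = X" "tgt u = src i" using u by simp_all
    have X [simp]: "is_complex E X" using is_chain_mapD(1)[of u] by simp
    have "cmp u n \<cdot> cmp i n = Zero E (ob X n) (ob (src i) n) \<cdot> cmp i n" for n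
      using u(4) by (auto dest: fun_cong)
    then have "cmp u n = Zero E (ob X n) (ob (src i) n)" for n
      by (rule seq_mono[OF s]) simp_all
    then show "u = Zero CE X (Dom CE i)" by (auto intro!: chain_map_eqI)
  qed (auto intro!: chain_map_eqI)
qed

lemma seq_CE_cokernel:
  assumes "(i, p) \<in> Pure_Seq CE"
  shows "is_cokernel CE i p"
proof -
  have [simp]: "is_chain_map E i" "is_chain_map E p" "tgt i = src p" and s: "\<And>n. (cmp i n, cmp p n) \<in> Pure_Seq E"
    using assms by simp_all
  note [simp] = seq_arr(4)[OF s]
  show ?thesis
  proof (rule CE.is_cokernelI)
    fix g assume g: "g \<in> Arr CE" "Dom CE g = Cod CE i" "i \<cdot>\<^bsub>CE\<^esub> g = Zero CE (Dom CE i) (Cod CE g)"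
    have [simp]: "is_chain_map E g" "src g = src p" using g by simp_all
    have ig: "cmp i n \<cdot> cmp g n = Zero E (ob (src i) n) (ob (tgt g) n)" for n
      using g(3) by (auto dest: fun_cong)
    have "\<exists>u. u \<in> Arr E \<and> Dom E u = ob (tgt p) n \<and> Cod E u = ob (tgt g) n \<and> cmp p n \<cdot> u = cmp g n" for n
      using seq_desc[OF s, of "cmp g n" n] ig by auto
    then obtain u where u: "\<And>n. u n \<in> Arr E \<and> Dom E (u n) = ob (tgt p) n \<and> Cod E (u n) = ob (tgt g) n \<and> cmp p n \<cdot> u n = cmp g n"
      by metis
    have [simp]: "u n \<in> Arr E" "Dom E (u n) = ob (tgt p) n" "Cod E (u n) = ob (tgt g) n" "cmp p n \<cdot> u n = cmp g n" for n
      using u by auto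
    have "is_chain_map E (Chain_Map (tgt p) (tgt g) u)"
    proof (rule is_chain_mapI)
      fix n
      have "cmp p n \<cdot> (diff (tgt p) n \<cdot> u (n + 1)) = diff (src p) n \<cdot> (cmp p (n + 1) \<cdot> u (n + 1))"
        using comp_reduce[OF is_chain_mapD(6)[of p n, symmetric], of "u (n + 1)"] by (simp del: u)
      also have "\<dots> = cmp g n \<cdot> diff (tgt g) n" using is_chain_mapD(6)[of g n] by simp
      also have "\<dots> = cmp p n \<cdot> (u n \<cdot> diff (tgt g) n)"
        using comp_reduce[of "cmp p n" "u n" "cmp g n" "diff (tgt g) n"] by simp
      finally show "diff (tgt p) n \<cdot> u (n + 1) = u n \<cdot> diff (tgt g) n"
        by (rule seq_epi[OF s[of n]]) simp_all
    qed simp_all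
    then show "\<exists>u\<in>Arr CE. Cod CE u = Cod CE g \<and> Dom CE u = Cod CE p \<and> p \<cdot>\<^bsub>CE\<^esub> u = g"
      by (intro bexI[of _ "Chain_Map (tgt p) (tgt g) u"]) (auto intro!: chain_map_eqI)
  next
    fix u X assume u: "u \<in> Arr CE" "Cod CE u = X" "Dom CE u = Cod CE p" "p \<cdot>\<^bsub>CE\<^esub> u = Zero CE (Dom CE p) X"
    have [simp]: "is_chain_map E u" "tgt u = X" "src u = tgt p" using u by simp_all
    have X [simp]: "is_complex E X" using is_chain_mapD(2)[of u] by simp
    have "cmp p n \<cdot> cmp u n = cmp p n \<cdot> Zero E (ob (tgt p) n) (ob X n)" for n
      using u(4) by (auto dest: fun_cong)
    then have "cmp u n = Zero E (ob (tgt p) n) (ob X n)" for n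
      by (rule seq_epi[OF s]) simp_all
    then show "u = Zero CE (Cod CE p) X" by (auto intro!: chain_map_eqI)
  qed (auto intro!: chain_map_eqI)
qed

lemma iso_CE:
  assumes "is_iso CE f"
  shows "is_iso E (cmp f n)"
proof -
  obtain g where g: "f \<in> Arr CE" "g \<in> Arr CE" "Dom CE g = Cod CE f" "Cod CE g = Dom CE f"
    "f \<cdot>\<^bsub>CE\<^esub> g = Ident CE (Dom CE f)" "g \<cdot>\<^bsub>CE\<^esub> f = Ident CE (Cod CE f)" by (rule CE.is_isoE[OF assms])
  have "cmp f n \<cdot> cmp g n = Ident E (ob (src f) n)" "cmp g n \<cdot> cmp f n = Ident E (ob (tgt f) n)"
    using g(5,6) by (auto dest: fun_cong)
  then show ?thesis by (intro is_isoI[of _ "cmp g n"]) (use g(1-4) in simp_all)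
qed

text \<open>The cokernel of the arrow with components \<open>i\<close> and minus \<open>f\<close>
  comes with a differential. That arrow is a pure monomorphism in each degree because its first
  component is one.\<close>

lemma pushout_CE:
  assumes i: "pure_mono CE i" and f: "is_chain_map E f" "src f = src i"
  shows "\<exists>f' i'. pushout CE i f f' i' \<and> pure_mono CE i'"
proof -
  have [simp]: "is_chain_map E i" and im: "\<And>n. pure_mono E (cmp i n)" using i by (simp_all add: pure_mono_CE)
  note [simp] = f
  obtain S i1 i2 p1 p2 where b: "biproduct CE (tgt i) (tgt f) S i1 i2 p1 p2"
    using biproduct_CE_exists[of "tgt i" "tgt f"] by auto
  note bn = biproduct_CE_imp[OF b]
  let ?m = "i \<cdot>\<^bsub>CE\<^esub> i1 \<boxplus>\<^bsub>CE\<^esub> Neg CE (f \<cdot>\<^bsub>CE\<^esub> i2)"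
  have bs: "is_chain_map E i1" "src i1 = tgt i" "tgt i1 = S" "is_chain_map E i2" "src i2 = tgt f" "tgt i2 = S"
    using CE.biproduct_simps(4,5,8-11)[OF b] by simp_all
  have ii: "is_chain_map E (i \<cdot>\<^bsub>CE\<^esub> i1)" using chain_map_comp[of i i1] bs by simp
  have fi: "is_chain_map E (f \<cdot>\<^bsub>CE\<^esub> i2)" using chain_map_comp[of f i2] bs by simp
  have m: "?m \<in> Arr CE" using chain_map_add[OF ii chain_map_neg[OF fi]] fi bs by simp
  have cm: "cmp ?m n = cmp i n \<cdot> cmp i1 n \<boxplus> Neg E (cmp f n \<cdot> cmp i2 n)" for n using fi by simp
  have "pure_mono E (cmp ?m n)" for n
  proof -
    note [simp] = biproduct_simps[OF bn]
    have "cmp ?m n \<cdot> cmp p1 n = cmp i n" unfolding cm by simp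
    then show ?thesis using pure_mono_left[of "cmp ?m n" "cmp p1 n"] im[of n] unfolding cm by simp
  qed
  then obtain c where c: "(?m, c) \<in> Pure_Seq CE" using cokernel_complex[of ?m] m by auto
  have P: "pushout CE i f (i1 \<cdot>\<^bsub>CE\<^esub> c) (i2 \<cdot>\<^bsub>CE\<^esub> c)"
    by (rule CE.pushout_from_cokernel[OF b _ _ _ _ _ seq_CE_cokernel[OF c]]) simp_all
  \<comment> \<open>In each degree the construction is a pushout in \<open>E\<close>, so the new leg
    inherits purity from \<open>i\<close>.\<close>
  have "pure_mono E (cmp i2 n \<cdot> cmp c n)" for n
  proof (rule pushout_pure_mono[OF pushout_from_cokernel[OF bn] im])
    have "(cmp ?m n, cmp c n) \<in> Pure_Seq E" using c by simp
    then show "is_cokernel E (cmp i n \<cdot> cmp i1 n \<boxplus> Neg E (cmp f n \<cdot> cmp i2 n)) (cmp c n)"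
      unfolding cm by (rule seq_coker)
  qed simp_all
  moreover have "i2 \<cdot>\<^bsub>CE\<^esub> c \<in> Arr CE" using CE.commutesD(4)[of i "i1 \<cdot>\<^bsub>CE\<^esub> c" f "i2 \<cdot>\<^bsub>CE\<^esub> c"] P unfolding pushout_def by blast
  ultimately have "pure_mono CE (i2 \<cdot>\<^bsub>CE\<^esub> c)" by (simp add: pure_mono_CE)
  then show ?thesis using P by blast
qed

text \<open>Dual to \<open>pushout_CE\<close> but argued directly, since the opposite of a category
  of complexes is again one only after the degrees are reversed.\<close>

lemma pullback_CE:
  assumes p: "pure_epi CE p" and f: "is_chain_map E f" "tgt f = tgt p"
  shows "\<exists>f' p'. pullback CE f p f' p' \<and> pure_epi CE p'"
proof -
  have [simp]: "is_chain_map E p" and pm: "\<And>n. pure_epi E (cmp p n)" using p by (simp_all add: pure_epi_CE)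
  note [simp] = f
  obtain S i1 i2 p1 p2 where b: "biproduct CE (src p) (src f) S i1 i2 p1 p2"
    using biproduct_CE_exists[of "src p" "src f"] by auto
  note bn = biproduct_CE_imp[OF b]
  let ?m = "p1 \<cdot>\<^bsub>CE\<^esub> p \<boxplus>\<^bsub>CE\<^esub> Neg CE (p2 \<cdot>\<^bsub>CE\<^esub> f)"
  have bs: "is_chain_map E p1" "src p1 = S" "tgt p1 = src p" "is_chain_map E p2" "src p2 = S" "tgt p2 = src f"
    using CE.biproduct_simps(6,7,12-15)[OF b] by simp_all
  have ii: "is_chain_map E (p1 \<cdot>\<^bsub>CE\<^esub> p)" using chain_map_comp[of p1 p] bs by simp
  have fi: "is_chain_map E (p2 \<cdot>\<^bsub>CE\<^esub> f)" using chain_map_comp[of p2 f] bs by simp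
  have m: "?m \<in> Arr CE" using chain_map_add[OF ii chain_map_neg[OF fi]] fi bs by simp
  have cm: "cmp ?m n = cmp p1 n \<cdot> cmp p n \<boxplus> Neg E (cmp p2 n \<cdot> cmp f n)" for n using fi by simp
  have "pure_epi E (cmp ?m n)" for n
  proof -
    note [simp] = biproduct_simps[OF bn]
    have "cmp i1 n \<cdot> cmp ?m n = cmp p n" unfolding cm by simp
    then show ?thesis using pure_epi_right[of "cmp i1 n" "cmp ?m n"] pm[of n] unfolding cm by simp
  qed
  then obtain k where k: "(k, ?m) \<in> Pure_Seq CE" using kernel_complex[of ?m] m by auto
  have P: "pullback CE f p (k \<cdot>\<^bsub>CE\<^esub> p1) (k \<cdot>\<^bsub>CE\<^esub> p2)"
    by (rule CE.pullback_from_kernel[OF b _ _ _ _ _ seq_CE_kernel[OF k]]) simp_all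
  have "pure_epi E (cmp k n \<cdot> cmp p2 n)" for n
  proof (rule pullback_pure_epi'[OF pullback_from_kernel[OF bn] pm])
    have "(cmp k n, cmp ?m n) \<in> Pure_Seq E" using k by simp
    then show "is_kernel E (cmp p1 n \<cdot> cmp p n \<boxplus> Neg E (cmp p2 n \<cdot> cmp f n)) (cmp k n)"
      unfolding cm by (rule seq_ker)
  qed simp_all
  moreover have "k \<cdot>\<^bsub>CE\<^esub> p2 \<in> Arr CE" using CE.commutesD(3)[of "k \<cdot>\<^bsub>CE\<^esub> p1" p "k \<cdot>\<^bsub>CE\<^esub> p2" f] P unfolding pullback_def by blast
  ultimately have "pure_epi CE (k \<cdot>\<^bsub>CE\<^esub> p2)" by (simp add: pure_epi_CE)
  then show ?thesis using P by blast
qed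

lemma wic_CE:
  shows "\<lbrakk>composable CE f g; pure_epi CE (f \<cdot>\<^bsub>CE\<^esub> g)\<rbrakk> \<Longrightarrow> pure_epi CE g"
    and "\<lbrakk>composable CE f g; pure_mono CE (f \<cdot>\<^bsub>CE\<^esub> g)\<rbrakk> \<Longrightarrow> pure_mono CE f"
proof -
  assume "composable CE f g" "pure_epi CE (f \<cdot>\<^bsub>CE\<^esub> g)"
  then have h: "is_chain_map E f" "is_chain_map E g" "tgt f = src g" "\<And>n. pure_epi E (cmp f n \<cdot> cmp g n)"
    by (simp_all add: composable_def pure_epi_CE)
  then show "pure_epi CE g" using pure_epi_right[OF h(4)] by (simp add: pure_epi_CE)
next
  assume "composable CE f g" "pure_mono CE (f \<cdot>\<^bsub>CE\<^esub> g)"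
  then have h: "is_chain_map E f" "is_chain_map E g" "tgt f = src g" "\<And>n. pure_mono E (cmp f n \<cdot> cmp g n)"
    by (simp_all add: composable_def pure_mono_CE)
  then show "pure_mono CE f" using pure_mono_left[OF h(4)] by (simp add: pure_mono_CE)
qed

lemma seq_iso_CE:
  assumes "(i, p) \<in> Pure_Seq CE" "is_iso CE a" "is_iso CE b" "is_iso CE c" "composable CE i' p'"
    "commutes CE i b a i'" "commutes CE p c b p'"
  shows "(i', p') \<in> Pure_Seq CE"
proof -
  have h: "is_chain_map E i'" "is_chain_map E p'" "tgt i' = src p'" using assms(5) by (simp_all add: composable_def)
  have c1: "commutes E (cmp i n) (cmp b n) (cmp a n) (cmp i' n)" for n
    using assms(6) CE.commutesD[OF assms(6)] by (auto simp: commutes_def composable_def dest: fun_cong)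
  have c2: "commutes E (cmp p n) (cmp c n) (cmp b n) (cmp p' n)" for n
    using assms(7) CE.commutesD[OF assms(7)] by (auto simp: commutes_def composable_def dest: fun_cong)
  have "(cmp i' n, cmp p' n) \<in> Pure_Seq E" for n
    using assms(1) h by (intro seq_iso[OF _ iso_CE[OF assms(2)] iso_CE[OF assms(3)] iso_CE[OF assms(4)] _ c1 c2])
      (simp_all add: composable_def)
  then show ?thesis using h by simp
qed

lemma exact_CE: "exact_category CE"
  unfolding exact_category_def
proof (intro conjI, goal_cases)
  case 1 show ?case by (rule additive_CE)
next
  case 2 show ?case using seq_CE_kernel seq_CE_cokernel by blast
next
  case 3
  have "(i1, p2) \<in> Pure_Seq CE" if b: "biproduct CE X Y S i1 i2 p1 p2" for X Y S i1 i2 p1 p2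
    using CE.biproduct_simps[OF b] biproduct_seq[OF biproduct_CE_imp[OF b]] by simp
  then show ?case by blast
next
  case 4 show ?case using seq_iso_CE by blast
next
  case 5
  have "pure_epi CE (p \<cdot>\<^bsub>CE\<^esub> q)" if "pure_epi CE p" "pure_epi CE q" "composable CE p q" for p q
    using that chain_map_comp[of p q] pure_epi_comp unfolding pure_epi_CE by (simp add: composable_def)
  then show ?case by blast
next
  case 6
  have "pure_mono CE (p \<cdot>\<^bsub>CE\<^esub> q)" if "pure_mono CE p" "pure_mono CE q" "composable CE p q" for p q
    using that chain_map_comp[of p q] pure_mono_comp unfolding pure_mono_CE by (simp add: composable_def)
  then show ?case by blast
next
  case 7 show ?case using pullback_CE by simp
next
  case 8 show ?case using pushout_CE by simp
next
  case 9 show ?case using wic_CE(1) by blast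
next
  case 10 show ?case using wic_CE(2) by blast
qed

lemma pure_category_CE: "pure_category CE"
  unfolding pure_category_def using exact_CE wic_CE by blast

sublocale CE: pure_loc CE
  by unfold_locales (rule pure_category_CE)

end

section \<open>Purely acyclic complexes\<close>

context complexes_loc
begin

lemma chain_map_reduce:
  assumes "is_chain_map E f" "k \<in> Arr E" "Dom E k = ob (tgt f) (n + 1)"
  shows "cmp f n \<cdot> (diff (tgt f) n \<cdot> k) = diff (src f) n \<cdot> (cmp f (n + 1) \<cdot> k)"
  using comp_reduce[OF is_chain_mapD(6)[OF assms(1), of n, symmetric], of k] assms by simp

lemma diff_diff_pred [simp]:
  assumes "is_complex E X"
  shows "diff X (n - 1) \<cdot> diff X n = Zero E (ob X (n - 1)) (ob X (n + 1))"
proof -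
  have "n - 1 + 1 = n" "n - 1 + 2 = n + 1" by simp_all
  then show ?thesis using is_complexD(5)[OF assms, of "n - 1"] by metis
qed

text \<open>Exactness tested on generalised elements: after a pure epimorphism every cycle becomes a
  boundary.  This amounts to exactness in an ambient abelian category, so that diagrams can be
  chased; together with the existence of kernels of the differentials it is pure acyclicity.\<close>

definition exact_at :: "('o, 'm) cx \<Rightarrow> int \<Rightarrow> bool" where
  "exact_at X n \<longleftrightarrow> (\<forall>z. z \<in> Arr E \<and> Cod E z = ob X n \<and> z \<cdot> diff X n = Zero E (Dom E z) (ob X (n + 1)) \<longrightarrow>
     (\<exists>q w. pure_epi E q \<and> Cod E q = Dom E z \<and> w \<in> Arr E \<and> Dom E w = Dom E q \<and> Cod E w = ob X (n - 1) \<and>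
       q \<cdot> z = w \<cdot> diff X (n - 1)))"

lemma exact_atE:
  assumes "exact_at X n" "z \<in> Arr E" "Cod E z = ob X n" "z \<cdot> diff X n = Zero E (Dom E z) (ob X (n + 1))"
  obtains q w where "pure_epi E q" "q \<in> Arr E" "Cod E q = Dom E z" "w \<in> Arr E" "Dom E w = Dom E q" "Cod E w = ob X (n - 1)"
    "q \<cdot> z = w \<cdot> diff X (n - 1)"
  using assms pure_epi_arr unfolding exact_at_def by metis

text \<open>Base change makes pure epimorphisms surjective on generalised elements.\<close>

lemma local_lift:
  assumes "pure_epi E p" "z \<in> Arr E" "Cod E z = Cod E p"
  obtains q w where "pure_epi E q" "q \<in> Arr E" "Cod E q = Dom E z" "w \<in> Arr E" "Dom E w = Dom E q" "Cod E w = Dom E p"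
    "q \<cdot> z = w \<cdot> p"
proof -
  obtain f' p' where "pure_epi E p'" "f' \<in> Arr E" "p' \<in> Arr E" "Cod E f' = Dom E p" "Cod E p' = Dom E z"
    "Dom E f' = Dom E p'" "f' \<cdot> p = p' \<cdot> z"
    by (rule pure_pullback[OF assms])
  then show thesis using that[of p' f'] by simp
qed

lemma acyclicI:
  assumes X: "is_complex E X" and k: "\<And>n. \<exists>k. is_kernel E (diff X n) k" and ex: "\<And>n. exact_at X n"
  shows "purely_acyclic E X"
proof -
  obtain k where k: "\<And>n. is_kernel E (diff X n) (k n)" using k by metis
  note [simp] = X is_kernelD(1)[OF k]
  have [simp]: "Cod E (k n) = ob X n" for n using is_kernelD(3)[OF k, of n] by simp
  have kd: "k n \<cdot> diff X n = Zero E (Dom E (k n)) (ob X (n + 1))" for n using is_kernelD(4)[OF k, of n] by simp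
  have "\<exists>e. e \<in> Arr E \<and> Dom E e = ob X n \<and> Cod E e = Dom E (k (n + 1)) \<and> e \<cdot> k (n + 1) = diff X n" for n
    using kernel_lift[OF k, of "diff X n" "n + 1"] by (auto simp: add.assoc)
  then obtain e where e: "\<And>n. e n \<in> Arr E \<and> Dom E (e n) = ob X n \<and> Cod E (e n) = Dom E (k (n + 1)) \<and> e n \<cdot> k (n + 1) = diff X n"
    by metis
  have [simp]: "e n \<in> Arr E" "Dom E (e n) = ob X n" "Cod E (e n) = Dom E (k (n + 1))" for n using e by auto
  have ek: "e n \<cdot> k (n + 1) = diff X n" for n using e by auto
  have "(k n, e n) \<in> Pure_Seq E" for n
  proof (rule pure_seq_kernel)
    \<comment> \<open>Exactness is applied to the universal cycle \<open>k (n + 1)\<close>. The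
      resulting pure epimorphism \<open>q\<close> equals \<open>w \<cdot> e n\<close>, so
      \<open>e n\<close> is one as well.\<close>
    obtain q w where q: "pure_epi E q" "q \<in> Arr E" "Cod E q = Dom E (k (n + 1))" "w \<in> Arr E" "Dom E w = Dom E q"
      "Cod E w = ob X n" "q \<cdot> k (n + 1) = w \<cdot> diff X n"
      by (rule exact_atE[OF ex, of "k (n + 1)" "n + 1"]) (simp_all add: kd)
    have "w \<cdot> e n = q" by (rule kernel_mono[OF k[of "n + 1"]]) (use q in \<open>simp_all add: ek\<close>)
    then show "pure_epi E (e n)" using pure_epi_right[of w "e n"] q by simp
    have "(k n \<cdot> e n) \<cdot> k (n + 1) = Zero E (Dom E (k n)) (Dom E (k (n + 1))) \<cdot> k (n + 1)" by (simp add: ek kd)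
    then have ke: "k n \<cdot> e n = Zero E (Dom E (k n)) (Dom E (k (n + 1)))" by (rule kernel_mono[OF k, rotated -1]) simp_all
    show "is_kernel E (e n) (k n)"
    proof (rule is_kernelI)
      fix g assume g: "g \<in> Arr E" "Cod E g = Dom E (e n)" "g \<cdot> e n = Zero E (Dom E g) (Cod E (e n))"
      have "g \<cdot> diff X n = Zero E (Dom E g) (ob X (n + 1))"
        using comp_reduce[OF g(3), of "k (n + 1)"] g by (simp add: ek)
      then obtain u where "u \<in> Arr E" "Dom E u = Dom E g" "Cod E u = Dom E (k n)" "u \<cdot> k n = g"
        using kernel_lift[OF k, of g n] g by auto
      then show "\<exists>u\<in>Arr E. Dom E u = Dom E g \<and> Cod E u = Dom E (k n) \<and> u \<cdot> k n = g" by blast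
    next
      fix u Y assume u: "u \<in> Arr E" "Dom E u = Y" "Cod E u = Dom E (k n)" "u \<cdot> k n = Zero E Y (Cod E (k n))"
      have [simp]: "Y \<in> Obj E" using dom_obj[OF u(1)] u(2) by simp
      have "u \<cdot> k n = Zero E Y (Dom E (k n)) \<cdot> k n" using u by simp
      then show "u = Zero E Y (Dom E (k n))" by (rule kernel_mono[OF k, rotated -1]) (use u in simp_all)
    qed (simp_all add: ke)
  qed
  then show ?thesis unfolding purely_acyclic_def
    by (intro conjI X exI[of _ "\<lambda>n. Dom E (k n)"] exI[of _ e] exI[of _ k]) (simp add: Hom_iff ek)
qed

lemma acyclicE:
  assumes "purely_acyclic E X"
  obtains e k where "is_complex E X" "\<And>n. (k n, e n) \<in> Pure_Seq E" "\<And>n. e n \<in> Arr E" "\<And>n. k n \<in> Arr E"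
    "\<And>n. Dom E (e n) = ob X n" "\<And>n. Cod E (k n) = ob X n" "\<And>n. Cod E (e n) = Dom E (k (n + 1))"
    "\<And>n. e n \<cdot> k (n + 1) = diff X n" "\<And>n. is_kernel E (diff X n) (k n)" "\<And>n. exact_at X n"
proof -
  obtain Z e k where X: "is_complex E X" and h: "\<And>n. e n \<in> Hom E (ob X n) (Z (n + 1)) \<and> k n \<in> Hom E (Z n) (ob X n) \<and>
     diff X n = e n \<cdot> k (n + 1) \<and> (k n, e n) \<in> Pure_Seq E"
    using assms unfolding purely_acyclic_def by blast
  have s: "(k n, e n) \<in> Pure_Seq E" for n using h by blast
  have a [simp]: "e n \<in> Arr E" "k n \<in> Arr E" "Dom E (e n) = ob X n" "Cod E (k n) = ob X n" "Cod E (e n) = Dom E (k (n + 1))" for n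
    using h[of n] h[of "n + 1"] by (simp_all add: Hom_iff)
  have ek: "e n \<cdot> k (n + 1) = diff X n" for n using h by simp
  note [simp] = X
  have ker: "is_kernel E (diff X n) (k n)" for n
  proof (rule is_kernelI)
    show "k n \<cdot> diff X n = Zero E (Dom E (k n)) (Cod E (diff X n))"
      using seq_reduce[OF s, of "k (n + 1)" n] by (simp add: ek)
  next
    fix g assume g: "g \<in> Arr E" "Cod E g = Dom E (diff X n)" "g \<cdot> diff X n = Zero E (Dom E g) (Cod E (diff X n))"
    have "(g \<cdot> e n) \<cdot> k (n + 1) = Zero E (Dom E g) (Dom E (k (n + 1))) \<cdot> k (n + 1)" using g by (simp add: ek)
    then have "g \<cdot> e n = Zero E (Dom E g) (Dom E (k (n + 1)))" by (rule seq_mono[OF s]) (use g in simp_all)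
    then obtain u where "u \<in> Arr E" "Dom E u = Dom E g" "Cod E u = Dom E (k n)" "u \<cdot> k n = g"
      using seq_lift[OF s, of g n] g by auto
    then show "\<exists>u\<in>Arr E. Dom E u = Dom E g \<and> Cod E u = Dom E (k n) \<and> u \<cdot> k n = g" by blast
  next
    fix u Y assume u: "u \<in> Arr E" "Dom E u = Y" "Cod E u = Dom E (k n)" "u \<cdot> k n = Zero E Y (Cod E (k n))"
    have [simp]: "Y \<in> Obj E" using dom_obj[OF u(1)] u(2) by simp
    have "u \<cdot> k n = Zero E Y (Dom E (k n)) \<cdot> k n" using u by simp
    then show "u = Zero E Y (Dom E (k n))" by (rule seq_mono[OF s]) (use u in simp_all)
  qed simp_all
  have ex: "exact_at X n" for n
    unfolding exact_at_def
  proof (intro allI impI, elim conjE)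
    fix z assume z: "z \<in> Arr E" "Cod E z = ob X n" "z \<cdot> diff X n = Zero E (Dom E z) (ob X (n + 1))"
    obtain y where y: "y \<in> Arr E" "Dom E y = Dom E z" "Cod E y = Dom E (k n)" "y \<cdot> k n = z"
      using kernel_lift[OF ker, of z n] z by auto
    have ce: "Cod E (e (n - 1)) = Dom E (k n)" "e (n - 1) \<cdot> k n = diff X (n - 1)"
      using a(5)[of "n - 1"] ek[of "n - 1"] by simp_all
    \<comment> \<open>The object of cycles in degree \<open>n\<close> is covered by
      \<open>ob X (n - 1)\<close> through the pure epimorphism \<open>e (n - 1)\<close>; a lift of
      \<open>y\<close> along it is a bounding element for \<open>z\<close>.\<close>
    obtain q w where q: "pure_epi E q" "q \<in> Arr E" "Cod E q = Dom E y" "w \<in> Arr E" "Dom E w = Dom E q" "Cod E w = Dom E (e (n - 1))"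
      "q \<cdot> y = w \<cdot> e (n - 1)"
      by (rule local_lift[OF seq_pure(1)[OF s[of "n - 1"]], of y]) (use y ce in simp_all)
    have "q \<cdot> z = w \<cdot> diff X (n - 1)"
      using comp_reduce[OF q(7), of "k n"] q y(1-3) ce by (simp add: y(4))
    then show "\<exists>q w. pure_epi E q \<and> Cod E q = Dom E z \<and> w \<in> Arr E \<and> Dom E w = Dom E q \<and> Cod E w = ob X (n - 1) \<and>
       q \<cdot> z = w \<cdot> diff X (n - 1)"
      using q y by (intro exI[of _ q] exI[of _ w]) simp
  qed
  show thesis by (rule that[OF X s a(1,2,3,4,5) ek ker ex])
qed

section \<open>Two out of three for acyclic complexes in a pure short exact sequence\<close>

context
  fixes i p
  assumes s: "(i, p) \<in> Pure_Seq CE"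
begin

abbreviation (input) "X1 \<equiv> src i"
abbreviation (input) "X2 \<equiv> tgt i"
abbreviation (input) "X3 \<equiv> tgt p"

lemma sn: "(cmp i n, cmp p n) \<in> Pure_Seq E" and ch: "is_chain_map E i" "is_chain_map E p" and sp: "src p = X2"
  using s by simp_all

lemma comm_i: "cmp i n \<cdot> diff X2 n = diff X1 n \<cdot> cmp i (n + 1)" and comm_p: "cmp p n \<cdot> diff X3 n = diff X2 n \<cdot> cmp p (n + 1)"
  using is_chain_mapD(6)[OF ch(1), of n] is_chain_mapD(6)[OF ch(2), of n] by (simp_all add: sp)

lemma ip: "cmp i n \<cdot> cmp p n = Zero E (ob X1 n) (ob X3 n)"
  using seq_arr(4)[OF sn, of n] ch by simp

lemma cxs: "is_complex E X1" "is_complex E X2" "is_complex E X3"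
  using ch by simp_all

lemma cms: "cmp i n \<in> Arr E" "Dom E (cmp i n) = ob X1 n" "Cod E (cmp i n) = ob X2 n"
  "cmp p n \<in> Arr E" "Dom E (cmp p n) = ob X2 n" "Cod E (cmp p n) = ob X3 n"
  using ch sp by simp_all

lemma comm_p_r: "k \<in> Arr E \<Longrightarrow> Dom E k = ob X3 (n + 1) \<Longrightarrow> cmp p n \<cdot> (diff X3 n \<cdot> k) = diff X2 n \<cdot> (cmp p (n + 1) \<cdot> k)"
  using comp_reduce[OF comm_p[of n], of k] by (simp add: cxs cms)

text \<open>The cycles of \<open>X2\<close> are found inside the preimage \<open>m\<close> of the
  cycles of \<open>X3\<close>. There the differential takes values in the cycles of
  \<open>X1\<close>, which defines \<open>q\<close>, and the kernel of \<open>q\<close> is the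
  required one. Exactness is the usual chase.\<close>

lemma acyclic_extension:
  assumes A1: "purely_acyclic E X1" and A3: "purely_acyclic E X3"
  shows "purely_acyclic E X2"
proof -
  obtain e' k' where X': "\<And>n. (k' n, e' n) \<in> Pure_Seq E" "\<And>n. e' n \<in> Arr E" "\<And>n. k' n \<in> Arr E"
    "\<And>n. Dom E (e' n) = ob X1 n" "\<And>n. Cod E (k' n) = ob X1 n" "\<And>n. Cod E (e' n) = Dom E (k' (n + 1))"
    "\<And>n. e' n \<cdot> k' (n + 1) = diff X1 n" "\<And>n. is_kernel E (diff X1 n) (k' n)" "\<And>n. exact_at X1 n"
    by (rule acyclicE[OF A1]) blast
  obtain e'' k'' where X'': "\<And>n. (k'' n, e'' n) \<in> Pure_Seq E" "\<And>n. e'' n \<in> Arr E" "\<And>n. k'' n \<in> Arr E"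
    "\<And>n. Dom E (e'' n) = ob X3 n" "\<And>n. Cod E (k'' n) = ob X3 n" "\<And>n. Cod E (e'' n) = Dom E (k'' (n + 1))"
    "\<And>n. e'' n \<cdot> k'' (n + 1) = diff X3 n" "\<And>n. is_kernel E (diff X3 n) (k'' n)" "\<And>n. exact_at X3 n"
    by (rule acyclicE[OF A3]) blast
  note [simp] = cxs cms X'(2-6) X''(2-6)
  show ?thesis
  proof (rule acyclicI)
    fix n
    have kd: "k'' n \<cdot> diff X3 n = Zero E (Dom E (k'' n)) (ob X3 (n + 1))" using is_kernelD(4)[OF X''(8), of n] by simp
    have kd': "k' n \<cdot> diff X1 n = Zero E (Dom E (k' n)) (ob X1 (n + 1))" for n using is_kernelD(4)[OF X'(8), of n] by simp
    obtain m v where P: "pullback E (k'' n) (cmp p n) m v" "pure_epi E v" "m \<in> Arr E" "v \<in> Arr E" "Cod E m = Dom E (cmp p n)"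
      "Cod E v = Dom E (k'' n)" "Dom E m = Dom E v" "m \<cdot> cmp p n = v \<cdot> k'' n"
      by (rule pure_pullback[OF seq_pure(1)[OF sn[of n]], of "k'' n"]) simp_all
    have [simp]: "m \<in> Arr E" "v \<in> Arr E" "Cod E m = ob X2 n" "Cod E v = Dom E (k'' n)" "Dom E m = Dom E v" using P by simp_all
    have "(m \<cdot> diff X2 n) \<cdot> cmp p (n + 1) = (m \<cdot> cmp p n) \<cdot> diff X3 n" by (simp add: comm_p)
    also have "\<dots> = Zero E (Dom E v) (ob X3 (n + 1))" unfolding P(8) by (simp add: kd)
    finally obtain r where r: "r \<in> Arr E" "Dom E r = Dom E v" "Cod E r = ob X1 (n + 1)" "r \<cdot> cmp i (n + 1) = m \<cdot> diff X2 n"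
      using seq_lift[OF sn, of "m \<cdot> diff X2 n" "n + 1"] by auto
    note [simp] = r(1-3)
    have "(r \<cdot> diff X1 (n + 1)) \<cdot> cmp i (n + 2) = (r \<cdot> cmp i (n + 1)) \<cdot> diff X2 (n + 1)"
      using comm_i[of "n + 1"] by (simp add: add.assoc)
    also have "\<dots> = Zero E (Dom E v) (ob X1 (n + 2)) \<cdot> cmp i (n + 2)" unfolding r(4) by (simp add: add.assoc)
    finally have "r \<cdot> diff X1 (n + 1) = Zero E (Dom E v) (ob X1 (n + 2))"
      by (rule seq_mono[OF sn]) (simp_all add: add.assoc)
    then obtain q where q: "q \<in> Arr E" "Dom E q = Dom E v" "Cod E q = Dom E (k' (n + 1))" "q \<cdot> k' (n + 1) = r"
      using kernel_lift[OF X'(8), of r "n + 1"] by (auto simp: add.assoc)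
    note [simp] = q(1-3)
    obtain j where j: "j \<in> Arr E" "Dom E j = Dom E (cmp i n)" "Cod E j = Dom E m" "j \<cdot> m = cmp i n" "j \<cdot> v = Zero E (ob X1 n) (Dom E (k'' n))"
      by (rule pullback_lift[OF P(1), of "cmp i n" "Zero E (ob X1 n) (Dom E (k'' n))"]) (simp_all add: ip)
    have [simp]: "j \<in> Arr E" "Dom E j = ob X1 n" "Cod E j = Dom E v" using j by simp_all
    have "((j \<cdot> q) \<cdot> k' (n + 1)) \<cdot> cmp i (n + 1) = j \<cdot> (r \<cdot> cmp i (n + 1))" by (simp add: q(4))
    also have "\<dots> = (e' n \<cdot> k' (n + 1)) \<cdot> cmp i (n + 1)"
      unfolding r(4) X'(7) using comp_reduce[OF j(4), of "diff X2 n"] by (simp add: comm_i)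
    finally have "(j \<cdot> q) \<cdot> k' (n + 1) = e' n \<cdot> k' (n + 1)" by (rule seq_mono[OF sn]) simp_all
    \<comment> \<open>Restricted to \<open>X1\<close>, the arrow \<open>q\<close> is the pure
      epimorphism \<open>e' n\<close> onto the cycles. Hence \<open>q\<close> is a pure epimorphism
      and has a kernel.\<close>
    then have "j \<cdot> q = e' n" by (rule seq_mono[OF X'(1)]) simp_all
    then have "pure_epi E (j \<cdot> q)" using seq_pure(1)[OF X'(1)] by simp
    then have qe: "pure_epi E q" by (rule pure_epi_right) simp_all
    then obtain \<kappa> where \<kappa>: "(\<kappa>, q) \<in> Pure_Seq E" using pure_epi_seq by blast
    have [simp]: "\<kappa> \<in> Arr E" "Cod E \<kappa> = Dom E v" using seq_arr(1,3)[OF \<kappa>] by simp_all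
    have mdq: "u \<cdot> (m \<cdot> diff X2 n) = (u \<cdot> q) \<cdot> (k' (n + 1) \<cdot> cmp i (n + 1))" if "u \<in> Arr E" "Cod E u = Dom E v" for u
      using that comp_reduce[OF q(4), of "cmp i (n + 1)"] by (simp add: r(4))
    have "is_kernel E (diff X2 n) (\<kappa> \<cdot> m)"
    proof (rule is_kernelI)
      show "(\<kappa> \<cdot> m) \<cdot> diff X2 n = Zero E (Dom E (\<kappa> \<cdot> m)) (Cod E (diff X2 n))"
        using mdq[of \<kappa>] seq_arr(4)[OF \<kappa>] by simp
    next
      fix g assume g: "g \<in> Arr E" "Cod E g = Dom E (diff X2 n)" "g \<cdot> diff X2 n = Zero E (Dom E g) (Cod E (diff X2 n))"
      have [simp]: "g \<in> Arr E" "Cod E g = ob X2 n" using g by simp_all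
      have "(g \<cdot> cmp p n) \<cdot> diff X3 n = Zero E (Dom E g) (ob X3 (n + 1))"
        using comp_reduce[OF g(3), of "cmp p (n + 1)"] by (simp add: comm_p)
      then obtain y where y: "y \<in> Arr E" "Dom E y = Dom E g" "Cod E y = Dom E (k'' n)" "y \<cdot> k'' n = g \<cdot> cmp p n"
        using kernel_lift[OF X''(8), of "g \<cdot> cmp p n" n] by auto
      obtain u where u: "u \<in> Arr E" "Dom E u = Dom E g" "Cod E u = Dom E m" "u \<cdot> m = g" "u \<cdot> v = y"
        by (rule pullback_lift[OF P(1), of g y]) (use y in simp_all)
      have [simp]: "u \<in> Arr E" "Dom E u = Dom E g" "Cod E u = Dom E v" using u by simp_all
      have "((u \<cdot> q) \<cdot> k' (n + 1)) \<cdot> cmp i (n + 1) = (u \<cdot> m) \<cdot> diff X2 n" using mdq[of u] by simp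
      also have "\<dots> = Zero E (Dom E g) (ob X1 (n + 1)) \<cdot> cmp i (n + 1)" unfolding u(4) using g(3) by simp
      finally have "(u \<cdot> q) \<cdot> k' (n + 1) = Zero E (Dom E g) (ob X1 (n + 1))" by (rule seq_mono[OF sn]) simp_all
      then have "(u \<cdot> q) \<cdot> k' (n + 1) = Zero E (Dom E g) (Dom E (k' (n + 1))) \<cdot> k' (n + 1)" by simp
      then have "u \<cdot> q = Zero E (Dom E g) (Dom E (k' (n + 1)))" by (rule seq_mono[OF X'(1)]) simp_all
      then obtain w where w: "w \<in> Arr E" "Dom E w = Dom E g" "Cod E w = Dom E \<kappa>" "w \<cdot> \<kappa> = u"
        using seq_lift[OF \<kappa>, of u] by auto
      then show "\<exists>u\<in>Arr E. Dom E u = Dom E g \<and> Cod E u = Dom E (\<kappa> \<cdot> m) \<and> u \<cdot> (\<kappa> \<cdot> m) = g"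
        using comp_reduce[OF w(4), of m] u(4) by (intro bexI[of _ w]) simp_all
    next
      fix w Y assume w: "w \<in> Arr E" "Dom E w = Y" "Cod E w = Dom E (\<kappa> \<cdot> m)" "w \<cdot> (\<kappa> \<cdot> m) = Zero E Y (Cod E (\<kappa> \<cdot> m))"
      have [simp]: "w \<in> Arr E" "Dom E w = Y" "Cod E w = Dom E \<kappa>" "Y \<in> Obj E" using w dom_obj[OF w(1)] by simp_all
      have 1: "(w \<cdot> \<kappa>) \<cdot> m = Zero E Y (Dom E v) \<cdot> m" using w(4) by simp
      have "((w \<cdot> \<kappa>) \<cdot> v) \<cdot> k'' n = ((w \<cdot> \<kappa>) \<cdot> m) \<cdot> cmp p n" by (simp add: P(8))
      also have "\<dots> = (Zero E Y (Dom E v) \<cdot> v) \<cdot> k'' n" unfolding 1 by simp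
      finally have 2: "(w \<cdot> \<kappa>) \<cdot> v = Zero E Y (Dom E v) \<cdot> v" by (rule seq_mono[OF X''(1)]) simp_all
      have "w \<cdot> \<kappa> = Zero E Y (Dom E v)" by (rule pullback_eqI[OF P(1) _ _ _ _ _ 1 2]) simp_all
      then have "w \<cdot> \<kappa> = Zero E Y (Dom E \<kappa>) \<cdot> \<kappa>" by simp
      then have "w = Zero E Y (Dom E \<kappa>)" by (rule seq_mono[OF \<kappa>]) simp_all
      then show "w = Zero E Y (Dom E (\<kappa> \<cdot> m))" by simp
    qed simp_all
    then show "\<exists>k. is_kernel E (diff X2 n) k" ..
  next
    fix n
    show "exact_at X2 n"
      unfolding exact_at_def
    proof (intro allI impI, elim conjE)
      fix z assume z: "z \<in> Arr E" "Cod E z = ob X2 n" "z \<cdot> diff X2 n = Zero E (Dom E z) (ob X2 (n + 1))"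
      note [simp] = z(1,2)
      have 1: "(z \<cdot> cmp p n) \<cdot> diff X3 n = Zero E (Dom E z) (ob X3 (n + 1))"
        using comp_reduce[OF z(3), of "cmp p (n + 1)"] by (simp add: comm_p)
      obtain q1 w where q1: "pure_epi E q1" "q1 \<in> Arr E" "Cod E q1 = Dom E (z \<cdot> cmp p n)" "w \<in> Arr E" "Dom E w = Dom E q1"
        "Cod E w = ob X3 (n - 1)" "q1 \<cdot> (z \<cdot> cmp p n) = w \<cdot> diff X3 (n - 1)"
        by (rule exact_atE[OF X''(9), of "z \<cdot> cmp p n" n]) (use 1 in simp_all)
      obtain q2 w2 where q2: "pure_epi E q2" "q2 \<in> Arr E" "Cod E q2 = Dom E w" "w2 \<in> Arr E" "Dom E w2 = Dom E q2"
        "Cod E w2 = Dom E (cmp p (n - 1))" "q2 \<cdot> w = w2 \<cdot> cmp p (n - 1)"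
        by (rule local_lift[OF seq_pure(1)[OF sn[of "n - 1"]], of w]) (use q1 in simp_all)
      have [simp]: "q1 \<in> Arr E" "Cod E q1 = Dom E z" "w \<in> Arr E" "Dom E w = Dom E q1" "Cod E w = ob X3 (n - 1)"
        "q2 \<in> Arr E" "Cod E q2 = Dom E q1" "w2 \<in> Arr E" "Dom E w2 = Dom E q2" "Cod E w2 = ob X2 (n - 1)"
        using q1 q2 by simp_all
      \<comment> \<open>Locally the image of \<open>z\<close> in \<open>X3\<close> is the boundary
        of an element lifted to \<open>w2\<close>. Subtracting the boundary of \<open>w2\<close>
        moves \<open>z\<close> into \<open>X1\<close>.\<close>
      let ?t = "q2 \<cdot> q1 \<cdot> z \<boxplus> Neg E (w2 \<cdot> diff X2 (n - 1))"
      have "w2 \<cdot> (diff X2 (n - 1) \<cdot> cmp p n) = (w2 \<cdot> cmp p (n - 1)) \<cdot> diff X3 (n - 1)"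
        using comm_p[of "n - 1"] by simp
      also have "\<dots> = q2 \<cdot> (q1 \<cdot> (z \<cdot> cmp p n))" unfolding q2(7)[symmetric] q1(7) by simp
      finally have "?t \<cdot> cmp p n = Zero E (Dom E q2) (ob X3 n)" by simp
      then obtain y where y: "y \<in> Arr E" "Dom E y = Dom E q2" "Cod E y = ob X1 n" "y \<cdot> cmp i n = ?t"
        using seq_lift[OF sn, of ?t n] by auto
      note [simp] = y(1-3)
      have "(y \<cdot> diff X1 n) \<cdot> cmp i (n + 1) = ?t \<cdot> diff X2 n"
        unfolding y(4)[symmetric] by (simp add: comm_i)
      also have "\<dots> = Zero E (Dom E q2) (ob X1 (n + 1)) \<cdot> cmp i (n + 1)"
        by (simp add: z(3))
      finally have yd: "y \<cdot> diff X1 n = Zero E (Dom E q2) (ob X1 (n + 1))" by (rule seq_mono[OF sn]) simp_all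
      obtain q3 w3 where q3: "pure_epi E q3" "q3 \<in> Arr E" "Cod E q3 = Dom E y" "w3 \<in> Arr E" "Dom E w3 = Dom E q3"
        "Cod E w3 = ob X1 (n - 1)" "q3 \<cdot> y = w3 \<cdot> diff X1 (n - 1)"
        by (rule exact_atE[OF X'(9), of y n]) (use yd in simp_all)
      have [simp]: "q3 \<in> Arr E" "Cod E q3 = Dom E q2" "w3 \<in> Arr E" "Dom E w3 = Dom E q3" "Cod E w3 = ob X1 (n - 1)"
        using q3 by simp_all
      have "q3 \<cdot> ?t = (w3 \<cdot> cmp i (n - 1)) \<cdot> diff X2 (n - 1)"
        unfolding y(4)[symmetric] using comp_reduce[OF q3(7), of "cmp i n"] comm_i[of "n - 1"] by simp
      then have e: "q3 \<cdot> (q2 \<cdot> (q1 \<cdot> z)) \<boxplus> Neg E (q3 \<cdot> (w2 \<cdot> diff X2 (n - 1))) = w3 \<cdot> (cmp i (n - 1) \<cdot> diff X2 (n - 1))" by simp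
      have "q3 \<cdot> (q2 \<cdot> (q1 \<cdot> z)) = (q3 \<cdot> (q2 \<cdot> (q1 \<cdot> z)) \<boxplus> Neg E (q3 \<cdot> (w2 \<cdot> diff X2 (n - 1)))) \<boxplus> q3 \<cdot> (w2 \<cdot> diff X2 (n - 1))" by simp
      also have "\<dots> = (w3 \<cdot> cmp i (n - 1) \<boxplus> q3 \<cdot> w2) \<cdot> diff X2 (n - 1)" unfolding e by simp
      finally have "(q3 \<cdot> q2 \<cdot> q1) \<cdot> z = (w3 \<cdot> cmp i (n - 1) \<boxplus> q3 \<cdot> w2) \<cdot> diff X2 (n - 1)" by simp
      moreover have "pure_epi E (q3 \<cdot> q2 \<cdot> q1)" using q1(1) q2(1) q3(1) by (auto intro!: pure_epi_comp)
      ultimately show "\<exists>q w. pure_epi E q \<and> Cod E q = Dom E z \<and> w \<in> Arr E \<and> Dom E w = Dom E q \<and> Cod E w = ob X2 (n - 1) \<and>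
         q \<cdot> z = w \<cdot> diff X2 (n - 1)"
        by (intro exI[of _ "q3 \<cdot> q2 \<cdot> q1"] exI[of _ "w3 \<cdot> cmp i (n - 1) \<boxplus> q3 \<cdot> w2"]) simp
    qed
  qed simp
qed

text \<open>The arrow \<open>\<zeta>\<close> induced by \<open>p\<close> on cycles is a pure
  epimorphism, because preceded by \<open>e (n - 1)\<close> it becomes \<open>cmp p (n - 1)\<close>
  followed by \<open>e'' (n - 1)\<close>. Its kernel provides the cycles of
  \<open>X1\<close>.\<close>

lemma acyclic_sub:
  assumes A2: "purely_acyclic E X2" and A3: "purely_acyclic E X3"
  shows "purely_acyclic E X1"
proof -
  obtain e k where X: "\<And>n. (k n, e n) \<in> Pure_Seq E" "\<And>n. e n \<in> Arr E" "\<And>n. k n \<in> Arr E"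
    "\<And>n. Dom E (e n) = ob X2 n" "\<And>n. Cod E (k n) = ob X2 n" "\<And>n. Cod E (e n) = Dom E (k (n + 1))"
    "\<And>n. e n \<cdot> k (n + 1) = diff X2 n" "\<And>n. is_kernel E (diff X2 n) (k n)" "\<And>n. exact_at X2 n"
    by (rule acyclicE[OF A2]) blast
  obtain e'' k'' where X'': "\<And>n. (k'' n, e'' n) \<in> Pure_Seq E" "\<And>n. e'' n \<in> Arr E" "\<And>n. k'' n \<in> Arr E"
    "\<And>n. Dom E (e'' n) = ob X3 n" "\<And>n. Cod E (k'' n) = ob X3 n" "\<And>n. Cod E (e'' n) = Dom E (k'' (n + 1))"
    "\<And>n. e'' n \<cdot> k'' (n + 1) = diff X3 n" "\<And>n. is_kernel E (diff X3 n) (k'' n)" "\<And>n. exact_at X3 n"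
    by (rule acyclicE[OF A3]) blast
  note [simp] = cxs cms X(2-6) X''(2-6)
  have kd: "k n \<cdot> diff X2 n = Zero E (Dom E (k n)) (ob X2 (n + 1))" for n using is_kernelD(4)[OF X(8), of n] by simp
  show ?thesis
  proof (rule acyclicI)
    fix n
    have "(k n \<cdot> cmp p n) \<cdot> diff X3 n = Zero E (Dom E (k n)) (ob X3 (n + 1))"
      using comp_reduce[OF kd[of n], of "cmp p (n + 1)"] by (simp add: comm_p)
    then obtain \<zeta> where z: "\<zeta> \<in> Arr E" "Dom E \<zeta> = Dom E (k n)" "Cod E \<zeta> = Dom E (k'' n)" "\<zeta> \<cdot> k'' n = k n \<cdot> cmp p n"
      using kernel_lift[OF X''(8), of "k n \<cdot> cmp p n" n] by auto
    note [simp] = z(1-3)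
    have c: "Cod E (e (n - 1)) = Dom E (k n)" "e (n - 1) \<cdot> k n = diff X2 (n - 1)"
      "Cod E (e'' (n - 1)) = Dom E (k'' n)" "e'' (n - 1) \<cdot> k'' n = diff X3 (n - 1)"
      using X(6,7)[of "n - 1"] X''(6,7)[of "n - 1"] by simp_all
    have "(e (n - 1) \<cdot> \<zeta>) \<cdot> k'' n = (cmp p (n - 1) \<cdot> e'' (n - 1)) \<cdot> k'' n"
      using comp_reduce[OF c(2), of "cmp p n"] comm_p[of "n - 1"] c(1,3) by (simp add: z(4) c(4))
    then have "e (n - 1) \<cdot> \<zeta> = cmp p (n - 1) \<cdot> e'' (n - 1)" by (rule seq_mono[OF X''(1)]) (simp_all add: c(1,3))
    moreover have "pure_epi E (cmp p (n - 1) \<cdot> e'' (n - 1))"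
      using seq_pure(1)[OF sn[of "n - 1"]] seq_pure(1)[OF X''(1)[of "n - 1"]] by (intro pure_epi_comp) simp_all
    ultimately have "pure_epi E \<zeta>" using pure_epi_right[of "e (n - 1)" \<zeta>] c(1) by simp
    then obtain \<kappa> where K: "(\<kappa>, \<zeta>) \<in> Pure_Seq E" using pure_epi_seq by blast
    have [simp]: "\<kappa> \<in> Arr E" "Cod E \<kappa> = Dom E (k n)" using seq_arr(1,3)[OF K] by simp_all
    have "(\<kappa> \<cdot> k n) \<cdot> cmp p n = Zero E (Dom E \<kappa>) (ob X3 n)"
      using seq_reduce[OF K, of "k'' n"] by (simp add: z(4))
    then obtain k' where k': "k' \<in> Arr E" "Dom E k' = Dom E \<kappa>" "Cod E k' = ob X1 n" "k' \<cdot> cmp i n = \<kappa> \<cdot> k n"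
      using seq_lift[OF sn, of "\<kappa> \<cdot> k n" n] by auto
    note [simp] = k'(1-3)
    have "is_kernel E (diff X1 n) k'"
    proof (rule is_kernelI)
      have "(k' \<cdot> diff X1 n) \<cdot> cmp i (n + 1) = (k' \<cdot> cmp i n) \<cdot> diff X2 n" by (simp add: comm_i)
      also have "\<dots> = Zero E (Dom E \<kappa>) (ob X1 (n + 1)) \<cdot> cmp i (n + 1)" unfolding k'(4) by (simp add: kd)
      finally have "k' \<cdot> diff X1 n = Zero E (Dom E \<kappa>) (ob X1 (n + 1))" by (rule seq_mono[OF sn]) simp_all
      then show "k' \<cdot> diff X1 n = Zero E (Dom E k') (Cod E (diff X1 n))" by simp
    next
      fix g assume g: "g \<in> Arr E" "Cod E g = Dom E (diff X1 n)" "g \<cdot> diff X1 n = Zero E (Dom E g) (Cod E (diff X1 n))"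
      have [simp]: "g \<in> Arr E" "Cod E g = ob X1 n" using g by simp_all
      have "(g \<cdot> cmp i n) \<cdot> diff X2 n = Zero E (Dom E g) (ob X2 (n + 1))"
        using comp_reduce[OF g(3), of "cmp i (n + 1)"] by (simp add: comm_i)
      then obtain u where u: "u \<in> Arr E" "Dom E u = Dom E g" "Cod E u = Dom E (k n)" "u \<cdot> k n = g \<cdot> cmp i n"
        using kernel_lift[OF X(8), of "g \<cdot> cmp i n" n] by auto
      note [simp] = u(1-3)
      have "(u \<cdot> \<zeta>) \<cdot> k'' n = (u \<cdot> k n) \<cdot> cmp p n" by (simp add: z(4))
      also have "\<dots> = Zero E (Dom E g) (Dom E (k'' n)) \<cdot> k'' n" unfolding u(4) by (simp add: ip)
      finally have "u \<cdot> \<zeta> = Zero E (Dom E g) (Dom E (k'' n))" by (rule seq_mono[OF X''(1)]) simp_all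
      then obtain v where v: "v \<in> Arr E" "Dom E v = Dom E g" "Cod E v = Dom E \<kappa>" "v \<cdot> \<kappa> = u"
        using seq_lift[OF K, of u] by auto
      note [simp] = v(1-3)
      have "(v \<cdot> k') \<cdot> cmp i n = (v \<cdot> \<kappa>) \<cdot> k n" by (simp add: k'(4))
      also have "\<dots> = g \<cdot> cmp i n" unfolding v(4) u(4) ..
      finally have "v \<cdot> k' = g" by (rule seq_mono[OF sn]) simp_all
      then show "\<exists>u\<in>Arr E. Dom E u = Dom E g \<and> Cod E u = Dom E k' \<and> u \<cdot> k' = g"
        by (intro bexI[of _ v]) simp_all
    next
      fix u Y assume u: "u \<in> Arr E" "Dom E u = Y" "Cod E u = Dom E k'" "u \<cdot> k' = Zero E Y (Cod E k')"
      have [simp]: "u \<in> Arr E" "Dom E u = Y" "Cod E u = Dom E \<kappa>" "Y \<in> Obj E" using u dom_obj[OF u(1)] by simp_all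
      have "(u \<cdot> \<kappa>) \<cdot> k n = (u \<cdot> k') \<cdot> cmp i n" by (simp add: k'(4))
      also have "\<dots> = (Zero E Y (Dom E \<kappa>) \<cdot> \<kappa>) \<cdot> k n" unfolding u(4) by simp
      finally have "u \<cdot> \<kappa> = Zero E Y (Dom E \<kappa>) \<cdot> \<kappa>" by (rule seq_mono[OF X(1)]) simp_all
      then have "u = Zero E Y (Dom E \<kappa>)" by (rule seq_mono[OF K]) simp_all
      then show "u = Zero E Y (Dom E k')" by simp
    qed simp_all
    then show "\<exists>k. is_kernel E (diff X1 n) k" ..
  next
    fix n
    show "exact_at X1 n"
      unfolding exact_at_def
    proof (intro allI impI, elim conjE)
      fix z assume z: "z \<in> Arr E" "Cod E z = ob X1 n" "z \<cdot> diff X1 n = Zero E (Dom E z) (ob X1 (n + 1))"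
      note [simp] = z(1,2)
      have 1: "(z \<cdot> cmp i n) \<cdot> diff X2 n = Zero E (Dom E z) (ob X2 (n + 1))"
        using comp_reduce[OF z(3), of "cmp i (n + 1)"] by (simp add: comm_i)
      obtain q1 w where q1: "pure_epi E q1" "q1 \<in> Arr E" "Cod E q1 = Dom E (z \<cdot> cmp i n)" "w \<in> Arr E" "Dom E w = Dom E q1"
        "Cod E w = ob X2 (n - 1)" "q1 \<cdot> (z \<cdot> cmp i n) = w \<cdot> diff X2 (n - 1)"
        by (rule exact_atE[OF X(9), of "z \<cdot> cmp i n" n]) (use 1 in simp_all)
      have [simp]: "q1 \<in> Arr E" "Cod E q1 = Dom E z" "w \<in> Arr E" "Dom E w = Dom E q1" "Cod E w = ob X2 (n - 1)"
        using q1 by simp_all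
      \<comment> \<open>The element \<open>w\<close> bounding the image of \<open>z\<close> need not
        come from \<open>X1\<close>. Its image in \<open>X3\<close> is a cycle, hence locally a
        boundary; subtracting the boundary of a lift moves \<open>w\<close> into \<open>X1\<close>
        without changing its own boundary.\<close>
      have "(w \<cdot> cmp p (n - 1)) \<cdot> diff X3 (n - 1) = (w \<cdot> diff X2 (n - 1)) \<cdot> cmp p n"
        using comm_p[of "n - 1"] by simp
      also have "\<dots> = Zero E (Dom E q1) (ob X3 n)" unfolding q1(7)[symmetric] by (simp add: ip)
      finally have 2: "(w \<cdot> cmp p (n - 1)) \<cdot> diff X3 (n - 1) = Zero E (Dom E q1) (ob X3 n)" .
      obtain q2 y where q2: "pure_epi E q2" "q2 \<in> Arr E" "Cod E q2 = Dom E (w \<cdot> cmp p (n - 1))" "y \<in> Arr E" "Dom E y = Dom E q2"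
        "Cod E y = ob X3 (n - 1 - 1)" "q2 \<cdot> (w \<cdot> cmp p (n - 1)) = y \<cdot> diff X3 (n - 1 - 1)"
        by (rule exact_atE[OF X''(9), of "w \<cdot> cmp p (n - 1)" "n - 1"]) (use 2 in simp_all)
      \<comment> \<open>The degree two below \<open>n\<close>, named to avoid nested differences:
        exactness of \<open>X3\<close> is used at \<open>n - 1\<close>, one degree below that of
        \<open>X2\<close>.\<close>
      define l where "l = n - 1 - 1"
      have l: "l + 1 = n - 1" by (simp add: l_def)
      obtain q3 x where q3: "pure_epi E q3" "q3 \<in> Arr E" "Cod E q3 = Dom E y" "x \<in> Arr E" "Dom E x = Dom E q3"
        "Cod E x = Dom E (cmp p l)" "q3 \<cdot> y = x \<cdot> cmp p l"
        by (rule local_lift[OF seq_pure(1)[OF sn[of l]], of y]) (use q2 in \<open>simp_all add: l_def\<close>)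
      have [simp]: "q2 \<in> Arr E" "Cod E q2 = Dom E q1" "y \<in> Arr E" "Dom E y = Dom E q2" "Cod E y = ob X3 l"
        "q3 \<in> Arr E" "Cod E q3 = Dom E q2" "x \<in> Arr E" "Dom E x = Dom E q3" "Cod E x = ob X2 l"
        using q2 q3 by (simp_all add: l_def)
      have [simp]: "Cod E (diff X2 l) = ob X2 (n - 1)" "Cod E (diff X3 l) = ob X3 (n - 1)"
        using is_complexD(4)[of X2 l] is_complexD(4)[of X3 l] by (simp_all only: l cxs)
      have pl: "cmp p l \<cdot> diff X3 l = diff X2 l \<cdot> cmp p (n - 1)" using comm_p[of l] by (simp only: l)
      have dl: "diff X2 l \<cdot> diff X2 (n - 1) = Zero E (ob X2 l) (ob X2 n)"
        using diff_diff_pred[of X2 "n - 1"] by (simp add: l_def)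
      let ?t = "q3 \<cdot> q2 \<cdot> w \<boxplus> Neg E (x \<cdot> diff X2 l)"
      have "x \<cdot> (diff X2 l \<cdot> cmp p (n - 1)) = (x \<cdot> cmp p l) \<cdot> diff X3 l" by (simp add: pl)
      also have "\<dots> = q3 \<cdot> (q2 \<cdot> (w \<cdot> cmp p (n - 1)))"
        unfolding q3(7)[symmetric] q2(7) by (simp add: l_def[symmetric])
      finally have "?t \<cdot> cmp p (n - 1) = Zero E (Dom E q3) (ob X3 (n - 1))" by simp
      then obtain v where v: "v \<in> Arr E" "Dom E v = Dom E q3" "Cod E v = ob X1 (n - 1)" "v \<cdot> cmp i (n - 1) = ?t"
        using seq_lift[OF sn, of ?t "n - 1"] by auto
      note [simp] = v(1-3)
      have "(v \<cdot> diff X1 (n - 1)) \<cdot> cmp i n = (v \<cdot> cmp i (n - 1)) \<cdot> diff X2 (n - 1)"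
        using comm_i[of "n - 1"] by simp
      also have "\<dots> = q3 \<cdot> (q2 \<cdot> (w \<cdot> diff X2 (n - 1)))" unfolding v(4) by (simp add: dl)
      also have "\<dots> = (q3 \<cdot> q2 \<cdot> q1 \<cdot> z) \<cdot> cmp i n" unfolding q1(7)[symmetric] by simp
      finally have "v \<cdot> diff X1 (n - 1) = q3 \<cdot> q2 \<cdot> q1 \<cdot> z" by (rule seq_mono[OF sn]) simp_all
      moreover have "pure_epi E (q3 \<cdot> q2 \<cdot> q1)" using q1(1) q2(1) q3(1) by (auto intro!: pure_epi_comp)
      ultimately show "\<exists>q w. pure_epi E q \<and> Cod E q = Dom E z \<and> w \<in> Arr E \<and> Dom E w = Dom E q \<and> Cod E w = ob X1 (n - 1) \<and>
         q \<cdot> z = w \<cdot> diff X1 (n - 1)"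
        by (intro exI[of _ "q3 \<cdot> q2 \<cdot> q1"] exI[of _ v]) simp
    qed
  qed simp
qed

text \<open>The cycles of \<open>X3\<close> are the kernel of \<open>e''\<close>, which is
  \<open>e n\<close> taken modulo the cycles of \<open>X1\<close> in degree \<open>n + 1\<close>.
  That \<open>e''\<close> annihilates every cycle is seen locally, where the cycle is a boundary;
  for this reason exactness is established before the kernels.\<close>

lemma acyclic_quotient:
  assumes A1: "purely_acyclic E X1" and A2: "purely_acyclic E X2"
  shows "purely_acyclic E X3"
proof -
  obtain e' k' where X': "\<And>n. (k' n, e' n) \<in> Pure_Seq E" "\<And>n. e' n \<in> Arr E" "\<And>n. k' n \<in> Arr E"
    "\<And>n. Dom E (e' n) = ob X1 n" "\<And>n. Cod E (k' n) = ob X1 n" "\<And>n. Cod E (e' n) = Dom E (k' (n + 1))"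
    "\<And>n. e' n \<cdot> k' (n + 1) = diff X1 n" "\<And>n. is_kernel E (diff X1 n) (k' n)" "\<And>n. exact_at X1 n"
    by (rule acyclicE[OF A1]) blast
  obtain e k where X: "\<And>n. (k n, e n) \<in> Pure_Seq E" "\<And>n. e n \<in> Arr E" "\<And>n. k n \<in> Arr E"
    "\<And>n. Dom E (e n) = ob X2 n" "\<And>n. Cod E (k n) = ob X2 n" "\<And>n. Cod E (e n) = Dom E (k (n + 1))"
    "\<And>n. e n \<cdot> k (n + 1) = diff X2 n" "\<And>n. is_kernel E (diff X2 n) (k n)" "\<And>n. exact_at X2 n"
    by (rule acyclicE[OF A2]) blast
  note [simp] = cxs cms X(2-6) X'(2-6)
  have kd': "k' n \<cdot> diff X1 n = Zero E (Dom E (k' n)) (ob X1 (n + 1))" for n using is_kernelD(4)[OF X'(8), of n] by simp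
  have ex: "exact_at X3 n" for n
    unfolding exact_at_def
  proof (intro allI impI, elim conjE)
    fix z assume z: "z \<in> Arr E" "Cod E z = ob X3 n" "z \<cdot> diff X3 n = Zero E (Dom E z) (ob X3 (n + 1))"
    note [simp] = z(1,2)
    obtain q1 t where q1: "pure_epi E q1" "q1 \<in> Arr E" "Cod E q1 = Dom E z" "t \<in> Arr E" "Dom E t = Dom E q1"
      "Cod E t = Dom E (cmp p n)" "q1 \<cdot> z = t \<cdot> cmp p n"
      by (rule local_lift[OF seq_pure(1)[OF sn[of n]], of z]) simp_all
    have [simp]: "q1 \<in> Arr E" "Cod E q1 = Dom E z" "t \<in> Arr E" "Dom E t = Dom E q1" "Cod E t = ob X2 n" using q1 by simp_all
    have "(t \<cdot> diff X2 n) \<cdot> cmp p (n + 1) = (t \<cdot> cmp p n) \<cdot> diff X3 n" by (simp add: comm_p)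
    also have "\<dots> = Zero E (Dom E q1) (ob X3 (n + 1))" unfolding q1(7)[symmetric] by (simp add: z(3))
    finally obtain y where y: "y \<in> Arr E" "Dom E y = Dom E q1" "Cod E y = ob X1 (n + 1)" "y \<cdot> cmp i (n + 1) = t \<cdot> diff X2 n"
      using seq_lift[OF sn, of "t \<cdot> diff X2 n" "n + 1"] by auto
    note [simp] = y(1-3)
    have "(y \<cdot> diff X1 (n + 1)) \<cdot> cmp i (n + 2) = (y \<cdot> cmp i (n + 1)) \<cdot> diff X2 (n + 1)"
      using comm_i[of "n + 1"] by (simp add: add.assoc)
    also have "\<dots> = Zero E (Dom E q1) (ob X1 (n + 2)) \<cdot> cmp i (n + 2)" unfolding y(4) by (simp add: add.assoc)
    finally have yd: "y \<cdot> diff X1 (n + 1) = Zero E (Dom E q1) (ob X1 (n + 2))"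
      by (rule seq_mono[OF sn]) (simp_all add: add.assoc)
    obtain q2 w where q2: "pure_epi E q2" "q2 \<in> Arr E" "Cod E q2 = Dom E y" "w \<in> Arr E" "Dom E w = Dom E q2"
      "Cod E w = ob X1 n" "q2 \<cdot> y = w \<cdot> diff X1 n"
      by (rule exact_atE[OF X'(9), of y "n + 1"]) (use yd in \<open>simp_all add: add.assoc\<close>)
    have [simp]: "q2 \<in> Arr E" "Cod E q2 = Dom E q1" "w \<in> Arr E" "Dom E w = Dom E q2" "Cod E w = ob X1 n" using q2 by simp_all
    let ?t = "q2 \<cdot> t \<boxplus> Neg E (w \<cdot> cmp i n)"
    have "q2 \<cdot> (t \<cdot> diff X2 n) = (w \<cdot> diff X1 n) \<cdot> cmp i (n + 1)" unfolding y(4)[symmetric] q2(7)[symmetric] by simp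
    then have td: "?t \<cdot> diff X2 n = Zero E (Dom E q2) (ob X2 (n + 1))" by (simp add: comm_i)
    obtain q3 v where q3: "pure_epi E q3" "q3 \<in> Arr E" "Cod E q3 = Dom E ?t" "v \<in> Arr E" "Dom E v = Dom E q3"
      "Cod E v = ob X2 (n - 1)" "q3 \<cdot> ?t = v \<cdot> diff X2 (n - 1)"
      by (rule exact_atE[OF X(9), of ?t n]) (use td in simp_all)
    have [simp]: "q3 \<in> Arr E" "Cod E q3 = Dom E q2" "v \<in> Arr E" "Dom E v = Dom E q3" "Cod E v = ob X2 (n - 1)" using q3 by simp_all
    have "(v \<cdot> cmp p (n - 1)) \<cdot> diff X3 (n - 1) = (v \<cdot> diff X2 (n - 1)) \<cdot> cmp p n" using comm_p[of "n - 1"] by simp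
    also have "\<dots> = q3 \<cdot> (q2 \<cdot> (t \<cdot> cmp p n))" unfolding q3(7)[symmetric] by (simp add: ip)
    also have "\<dots> = (q3 \<cdot> q2 \<cdot> q1) \<cdot> z" unfolding q1(7)[symmetric] by simp
    finally have "(q3 \<cdot> q2 \<cdot> q1) \<cdot> z = (v \<cdot> cmp p (n - 1)) \<cdot> diff X3 (n - 1)" by (rule HOL.sym)
    moreover have "pure_epi E (q3 \<cdot> q2 \<cdot> q1)" using q1(1) q2(1) q3(1) by (auto intro!: pure_epi_comp)
    ultimately show "\<exists>q w. pure_epi E q \<and> Cod E q = Dom E z \<and> w \<in> Arr E \<and> Dom E w = Dom E q \<and> Cod E w = ob X3 (n - 1) \<and>
       q \<cdot> z = w \<cdot> diff X3 (n - 1)"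
      by (intro exI[of _ "q3 \<cdot> q2 \<cdot> q1"] exI[of _ "v \<cdot> cmp p (n - 1)"]) simp
  qed
  show ?thesis
  proof (rule acyclicI)
    fix n
    have "(k' (n + 1) \<cdot> cmp i (n + 1)) \<cdot> diff X2 (n + 1) = Zero E (Dom E (k' (n + 1))) (ob X2 (n + 2))"
      using comp_reduce[OF kd'[of "n + 1"], of "cmp i (n + 2)"] comm_i[of "n + 1"] by (simp add: add.assoc)
    then obtain \<zeta> where z: "\<zeta> \<in> Arr E" "Dom E \<zeta> = Dom E (k' (n + 1))" "Cod E \<zeta> = Dom E (k (n + 1))"
      "\<zeta> \<cdot> k (n + 1) = k' (n + 1) \<cdot> cmp i (n + 1)"
      using kernel_lift[OF X(8), of "k' (n + 1) \<cdot> cmp i (n + 1)" "n + 1"] by (auto simp: add.assoc)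
    note [simp] = z(1-3)
    have "pure_mono E (\<zeta> \<cdot> k (n + 1))" unfolding z(4)
      using seq_pure(2)[OF sn[of "n + 1"]] seq_pure(2)[OF X'(1)[of "n + 1"]] by (intro pure_mono_comp) simp_all
    then have "pure_mono E \<zeta>" by (rule pure_mono_left) simp_all
    then obtain \<gamma> where G: "(\<zeta>, \<gamma>) \<in> Pure_Seq E" using pure_mono_seq by blast
    have [simp]: "\<gamma> \<in> Arr E" "Dom E \<gamma> = Dom E (k (n + 1))" using seq_arr(2,3)[OF G] by simp_all
    have "(cmp i n \<cdot> e n) \<cdot> k (n + 1) = (e' n \<cdot> \<zeta>) \<cdot> k (n + 1)"
      using comp_reduce[OF X'(7)[of n], of "cmp i (n + 1)"] by (simp add: X(7) z(4) comm_i)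
    then have "cmp i n \<cdot> e n = e' n \<cdot> \<zeta>" by (rule seq_mono[OF X(1)]) simp_all
    then have "cmp i n \<cdot> (e n \<cdot> \<gamma>) = Zero E (ob X1 n) (Cod E \<gamma>)"
      using comp_reduce[of "cmp i n" "e n" "e' n \<cdot> \<zeta>" \<gamma>] seq_arr(4)[OF G] by simp
    then obtain e'' where e'': "e'' \<in> Arr E" "Dom E e'' = ob X3 n" "Cod E e'' = Cod E \<gamma>" "cmp p n \<cdot> e'' = e n \<cdot> \<gamma>"
      using seq_desc[OF sn, of "e n \<cdot> \<gamma>" n] by auto
    note [simp] = e''(1-3)
    have "pure_epi E (cmp p n \<cdot> e'')" unfolding e''(4)
      using seq_pure(1)[OF X(1)[of n]] seq_pure(1)[OF G] by (intro pure_epi_comp) simp_all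
    then have "pure_epi E e''" by (rule pure_epi_right) simp_all
    then obtain k'' where K: "(k'', e'') \<in> Pure_Seq E" using pure_epi_seq by blast
    have [simp]: "k'' \<in> Arr E" "Cod E k'' = ob X3 n" using seq_arr(1,3)[OF K] by simp_all
    have "\<zeta> \<cdot> (k (n + 1) \<cdot> cmp p (n + 1)) = Zero E (Dom E \<zeta>) (ob X3 (n + 1))"
      using comp_reduce[OF z(4), of "cmp p (n + 1)"] by (simp add: ip)
    then obtain m where m: "m \<in> Arr E" "Dom E m = Cod E \<gamma>" "Cod E m = ob X3 (n + 1)" "\<gamma> \<cdot> m = k (n + 1) \<cdot> cmp p (n + 1)"
      using seq_desc[OF G, of "k (n + 1) \<cdot> cmp p (n + 1)"] by auto
    note [simp] = m(1-3)
    have "cmp p n \<cdot> (e'' \<cdot> m) = e n \<cdot> (k (n + 1) \<cdot> cmp p (n + 1))"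
      using comp_reduce[OF e''(4), of m] by (simp add: m(4))
    also have "\<dots> = cmp p n \<cdot> diff X3 n" using comp_reduce[OF X(7)[of n], of "cmp p (n + 1)"] by (simp add: comm_p)
    finally have em: "e'' \<cdot> m = diff X3 n" by (rule seq_epi[OF sn]) simp_all
    have c: "Cod E (diff X3 (n - 1)) = ob X3 n" "Cod E (diff X2 (n - 1)) = ob X2 n"
      using is_complexD(4)[of X3 "n - 1"] is_complexD(4)[of X2 "n - 1"] by simp_all
    have "(diff X2 (n - 1) \<cdot> e n) \<cdot> k (n + 1) = Zero E (ob X2 (n - 1)) (Dom E (k (n + 1))) \<cdot> k (n + 1)"
      using c by (simp add: X(7))
    then have de: "diff X2 (n - 1) \<cdot> e n = Zero E (ob X2 (n - 1)) (Dom E (k (n + 1)))" by (rule seq_mono[OF X(1)]) (simp_all add: c)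
    have "cmp p (n - 1) \<cdot> (diff X3 (n - 1) \<cdot> e'') = diff X2 (n - 1) \<cdot> (cmp p n \<cdot> e'')"
      using comm_p_r[of e'' "n - 1"] by simp
    also have "\<dots> = cmp p (n - 1) \<cdot> Zero E (ob X3 (n - 1)) (Cod E \<gamma>)"
      unfolding e''(4) using comp_reduce[OF de, of \<gamma>] c by simp
    finally have de'': "diff X3 (n - 1) \<cdot> e'' = Zero E (ob X3 (n - 1)) (Cod E \<gamma>)"
      by (rule seq_epi[OF sn]) (simp_all add: c)
    have "is_kernel E (diff X3 n) k''"
    proof (rule is_kernelI)
      show "k'' \<cdot> diff X3 n = Zero E (Dom E k'') (Cod E (diff X3 n))"
        unfolding em[symmetric] using seq_reduce[OF K, of m] by simp
    next
      fix g assume g: "g \<in> Arr E" "Cod E g = Dom E (diff X3 n)" "g \<cdot> diff X3 n = Zero E (Dom E g) (Cod E (diff X3 n))"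
      have [simp]: "g \<in> Arr E" "Cod E g = ob X3 n" using g by simp_all
      obtain q w where q: "pure_epi E q" "q \<in> Arr E" "Cod E q = Dom E g" "w \<in> Arr E" "Dom E w = Dom E q" "Cod E w = ob X3 (n - 1)"
        "q \<cdot> g = w \<cdot> diff X3 (n - 1)"
        by (rule exact_atE[OF ex, of g n]) (use g in simp_all)
      \<comment> \<open>After \<open>q\<close> the cycle \<open>g\<close> is a boundary, and
        boundaries are annihilated by \<open>e''\<close>. Cancelling \<open>q\<close> gives the
        claim for \<open>g\<close>.\<close>
      have "q \<cdot> (g \<cdot> e'') = w \<cdot> (diff X3 (n - 1) \<cdot> e'')" using comp_reduce[OF q(7), of e''] q(2-6) c by simp
      also have "\<dots> = q \<cdot> Zero E (Dom E g) (Cod E \<gamma>)" unfolding de'' using q(2-6) by simp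
      finally have "g \<cdot> e'' = Zero E (Dom E g) (Cod E e'')" using pure_epi_cancel[OF q(1)] q(3) by simp
      then obtain u where "u \<in> Arr E" "Dom E u = Dom E g" "Cod E u = Dom E k''" "u \<cdot> k'' = g"
        using seq_lift[OF K, of g] by auto
      then show "\<exists>u\<in>Arr E. Dom E u = Dom E g \<and> Cod E u = Dom E k'' \<and> u \<cdot> k'' = g" by blast
    next
      fix u Y assume u: "u \<in> Arr E" "Dom E u = Y" "Cod E u = Dom E k''" "u \<cdot> k'' = Zero E Y (Cod E k'')"
      have [simp]: "u \<in> Arr E" "Dom E u = Y" "Cod E u = Dom E k''" "Y \<in> Obj E" using u dom_obj[OF u(1)] by simp_all
      have "u \<cdot> k'' = Zero E Y (Dom E k'') \<cdot> k''" using u(4) by simp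
      then show "u = Zero E Y (Dom E k'')" by (rule seq_mono[OF K]) simp_all
    qed simp_all
    then show "\<exists>k. is_kernel E (diff X3 n) k" ..
  qed (simp_all add: ex)
qed

end

text \<open>Exactness passes to homotopy retracts, and the contracting homotopy together with the kernels
  of the acyclic complex yields the factorisations needed to split off the kernels.\<close>

lemma acyclic_homotopy_retract:
  assumes spl: "idempotent_splitting E" and X: "is_complex E X" and A: "purely_acyclic E A"
    and s: "is_chain_map E s" "src s = X" "tgt s = A" and r: "is_chain_map E r" "src r = A" "tgt r = X"
    and h: "\<And>n. h n \<in> Arr E" "\<And>n. Dom E (h n) = ob X n" "\<And>n. Cod E (h n) = ob X (n - 1)"
    and e: "\<And>n. Ident E (ob X n) = cmp s n \<cdot> cmp r n \<boxplus> (diff X n \<cdot> h (n + 1) \<boxplus> h n \<cdot> diff X (n - 1))"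
  shows "purely_acyclic E X"
proof -
  obtain e' k where Ac: "is_complex E A" "\<And>n. k n \<in> Arr E" "\<And>n. Cod E (k n) = ob A n" "\<And>n. is_kernel E (diff A n) (k n)"
    "\<And>n. exact_at A n"
    by (rule acyclicE[OF A]) blast
  note [simp] = X Ac(1-3) s r h
  have cs: "Dom E (cmp s n) = ob X n" "Cod E (cmp s n) = ob A n" "Dom E (cmp r n) = ob A n" "Cod E (cmp r n) = ob X n" for n
    using chain_map_simps(4,5)[OF s(1)] chain_map_simps(4,5)[OF r(1)] by simp_all
  have ca: "cmp s n \<in> Arr E" "cmp r n \<in> Arr E" for n by simp_all
  note [simp] = cs ca
  have c: "Cod E (diff X (n - 1)) = ob X n" "Cod E (diff A (n - 1)) = ob A n" for n
    using is_complexD(4)[of X "n - 1"] is_complexD(4)[of A "n - 1"] by simp_all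
  note [simp] = c
  have sd: "cmp s n \<cdot> diff A n = diff X n \<cdot> cmp s (n + 1)" for n using is_chain_mapD(6)[OF s(1), of n] by simp
  have rd: "cmp r n \<cdot> diff X n = diff A n \<cdot> cmp r (n + 1)" for n using is_chain_mapD(6)[OF r(1), of n] by simp
  have kd: "k n \<cdot> diff A n = Zero E (Dom E (k n)) (ob A (n + 1))" for n using is_kernelD(4)[OF Ac(4), of n] by simp
  have cyc: "(z \<cdot> cmp s n) \<cdot> diff A n = Zero E (Dom E z) (ob A (n + 1))"
      "z \<cdot> (cmp s n \<cdot> cmp r n) \<boxplus> z \<cdot> (h n \<cdot> diff X (n - 1)) = z"
    if z: "z \<in> Arr E" "Cod E z = ob X n" "z \<cdot> diff X n = Zero E (Dom E z) (ob X (n + 1))" for z n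
  proof -
    note [simp] = z(1,2)
    show "(z \<cdot> cmp s n) \<cdot> diff A n = Zero E (Dom E z) (ob A (n + 1))"
      using comp_reduce[OF z(3), of "cmp s (n + 1)"] by (simp add: sd)
    have "z = z \<cdot> (cmp s n \<cdot> cmp r n \<boxplus> (diff X n \<cdot> h (n + 1) \<boxplus> h n \<cdot> diff X (n - 1)))"
      using comp_id[OF z(1,2)] unfolding e by (rule HOL.sym)
    also have "\<dots> = z \<cdot> (cmp s n \<cdot> cmp r n) \<boxplus> z \<cdot> (h n \<cdot> diff X (n - 1))"
      using comp_reduce[OF z(3), of "h (n + 1)"] by simp
    finally show "z \<cdot> (cmp s n \<cdot> cmp r n) \<boxplus> z \<cdot> (h n \<cdot> diff X (n - 1)) = z" by (rule HOL.sym)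
  qed
  show ?thesis
  proof (rule acyclicI)
    fix n
    obtain W i1 i2 p1 p2 where b: "biproduct E (Dom E (k n)) (ob X (n - 1)) W i1 i2 p1 p2"
      by (rule biproduct_exists[of "Dom E (k n)" "ob X (n - 1)"]) simp_all
    note [simp] = biproduct_simps[OF b]
    have "\<forall>z. \<exists>u. z \<in> Arr E \<and> Cod E z = ob X n \<and> z \<cdot> diff X n = Zero E (Dom E z) (ob X (n + 1)) \<longrightarrow>
      u \<in> Arr E \<and> Dom E u = Dom E z \<and> Cod E u = Dom E (k n) \<and> u \<cdot> k n = z \<cdot> cmp s n"
    proof (intro allI)
      fix z
      show "\<exists>u. z \<in> Arr E \<and> Cod E z = ob X n \<and> z \<cdot> diff X n = Zero E (Dom E z) (ob X (n + 1)) \<longrightarrow>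
        u \<in> Arr E \<and> Dom E u = Dom E z \<and> Cod E u = Dom E (k n) \<and> u \<cdot> k n = z \<cdot> cmp s n"
      proof (cases "z \<in> Arr E \<and> Cod E z = ob X n \<and> z \<cdot> diff X n = Zero E (Dom E z) (ob X (n + 1))")
        case True
        then obtain u where "u \<in> Arr E" "Dom E u = Dom E (z \<cdot> cmp s n)" "Cod E u = Dom E (k n)" "u \<cdot> k n = z \<cdot> cmp s n"
          using kernel_lift[OF Ac(4), of "z \<cdot> cmp s n" n] cyc(1)[of z n] by auto
        then show ?thesis using True by auto
      qed auto
    qed
    then obtain L where L: "\<And>z. z \<in> Arr E \<Longrightarrow> Cod E z = ob X n \<Longrightarrow> z \<cdot> diff X n = Zero E (Dom E z) (ob X (n + 1)) \<Longrightarrow>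
      L z \<in> Arr E \<and> Dom E (L z) = Dom E z \<and> Cod E (L z) = Dom E (k n) \<and> L z \<cdot> k n = z \<cdot> cmp s n"
      by metis
    \<comment> \<open>The homotopy decomposes a cycle \<open>z\<close> into
      \<open>z \<cdot> (cmp s n \<cdot> cmp r n)\<close> and
      \<open>z \<cdot> (h n \<cdot> diff X (n - 1))\<close>. The first part passes through the
      kernel \<open>k n\<close> by the lift \<open>L z\<close>, the second through
      \<open>ob X (n - 1)\<close>, so the direct sum \<open>W\<close> carries a factorisation of
      every cycle.\<close>
    let ?w = "p1 \<cdot> (k n \<cdot> cmp r n) \<boxplus> p2 \<cdot> diff X (n - 1)" and ?\<phi> = "\<lambda>z. L z \<cdot> i1 \<boxplus> (z \<cdot> h n) \<cdot> i2"
    show "\<exists>k. is_kernel E (diff X n) k"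
    proof (rule kernel_as_retract[of ?w "diff X n" ?\<phi>, OF spl])
      show "?w \<cdot> diff X n = Zero E (Dom E ?w) (Cod E (diff X n))"
        using comp_reduce[OF kd[of n], of "cmp r (n + 1)"] by (simp add: rd)
    next
      fix z assume z: "z \<in> Arr E" "Cod E z = Dom E (diff X n)" "z \<cdot> diff X n = Zero E (Dom E z) (Cod E (diff X n))"
      then have z': "Cod E z = ob X n" "z \<cdot> diff X n = Zero E (Dom E z) (ob X (n + 1))" by simp_all
      note Lz = L[OF z(1) z']
      have [simp]: "z \<in> Arr E" "Cod E z = ob X n" "L z \<in> Arr E" "Dom E (L z) = Dom E z" "Cod E (L z) = Dom E (k n)"
        using z z' Lz by simp_all
      have "?\<phi> z \<cdot> ?w = z \<cdot> (cmp s n \<cdot> cmp r n) \<boxplus> z \<cdot> (h n \<cdot> diff X (n - 1))"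
        using comp_reduce[of "L z" "k n" "z \<cdot> cmp s n" "cmp r n"] Lz by simp
      then show "?\<phi> z \<in> Arr E \<and> Dom E (?\<phi> z) = Dom E z \<and> Cod E (?\<phi> z) = Dom E ?w \<and> ?\<phi> z \<cdot> ?w = z"
        unfolding cyc(2)[OF z(1) z'] by simp
    next
      fix u z assume z: "u \<in> Arr E" "z \<in> Arr E" "Cod E u = Dom E z" "Cod E z = Dom E (diff X n)"
        "z \<cdot> diff X n = Zero E (Dom E z) (Cod E (diff X n))"
      then have z': "Cod E z = ob X n" "z \<cdot> diff X n = Zero E (Dom E z) (ob X (n + 1))" by simp_all
      note [simp] = z(1-3) z'(1)
      note Lz = L[OF z(2) z']
      have [simp]: "L z \<in> Arr E" "Dom E (L z) = Dom E z" "Cod E (L z) = Dom E (k n)" using Lz by simp_all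
      have Lu: "L (u \<cdot> z) \<in> Arr E \<and> Dom E (L (u \<cdot> z)) = Dom E (u \<cdot> z) \<and> Cod E (L (u \<cdot> z)) = Dom E (k n) \<and>
        L (u \<cdot> z) \<cdot> k n = (u \<cdot> z) \<cdot> cmp s n"
        by (rule L) (simp_all add: z'(2))
      \<comment> \<open>Lifts through the kernel \<open>k n\<close> are unique, which makes the
        chosen ones natural.\<close>
      have "L (u \<cdot> z) = u \<cdot> L z"
        by (rule kernel_mono[OF Ac(4)[of n]]) (use Lu Lz in simp_all)
      then show "?\<phi> (u \<cdot> z) = u \<cdot> ?\<phi> z" by simp
    qed simp_all
  next
    fix n
    show "exact_at X n"
      unfolding exact_at_def
    proof (intro allI impI, elim conjE)
      fix z assume z: "z \<in> Arr E" "Cod E z = ob X n" "z \<cdot> diff X n = Zero E (Dom E z) (ob X (n + 1))"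
      note [simp] = z(1,2)
      obtain q w where q: "pure_epi E q" "q \<in> Arr E" "Cod E q = Dom E (z \<cdot> cmp s n)" "w \<in> Arr E" "Dom E w = Dom E q"
        "Cod E w = ob A (n - 1)" "q \<cdot> (z \<cdot> cmp s n) = w \<cdot> diff A (n - 1)"
        by (rule exact_atE[OF Ac(5), of "z \<cdot> cmp s n" n]) (use cyc(1)[OF z] in simp_all)
      have [simp]: "q \<in> Arr E" "Cod E q = Dom E z" "w \<in> Arr E" "Dom E w = Dom E q" "Cod E w = ob A (n - 1)" using q by simp_all
      have rd': "cmp r (n - 1) \<cdot> diff X (n - 1) = diff A (n - 1) \<cdot> cmp r n" using rd[of "n - 1"] by simp
      have "q \<cdot> z = q \<cdot> (z \<cdot> (cmp s n \<cdot> cmp r n) \<boxplus> z \<cdot> (h n \<cdot> diff X (n - 1)))" unfolding cyc(2)[OF z] ..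
      also have "\<dots> = (q \<cdot> (z \<cdot> cmp s n)) \<cdot> cmp r n \<boxplus> q \<cdot> (z \<cdot> (h n \<cdot> diff X (n - 1)))" by simp
      also have "\<dots> = (w \<cdot> cmp r (n - 1) \<boxplus> q \<cdot> (z \<cdot> h n)) \<cdot> diff X (n - 1)" unfolding q(7) by (simp add: rd')
      finally show "\<exists>q w. pure_epi E q \<and> Cod E q = Dom E z \<and> w \<in> Arr E \<and> Dom E w = Dom E q \<and> Cod E w = ob X (n - 1) \<and>
         q \<cdot> z = w \<cdot> diff X (n - 1)"
        using q(1) by (intro exI[of _ q] exI[of _ "w \<cdot> cmp r (n - 1) \<boxplus> q \<cdot> (z \<cdot> h n)"]) simp
    qed
  qed simp
qed

lemma acyclic_zero_complex:
  assumes Z: "zero_object E Z"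
  shows "purely_acyclic E (Cx (\<lambda>n. Z) (\<lambda>n. Zero E Z Z))"
proof -
  have [simp]: "Z \<in> Obj E" by (rule zero_object_simps(1)[OF Z])
  show ?thesis unfolding purely_acyclic_def
    by (intro conjI exI[of _ "\<lambda>n. Z"] exI[of _ "\<lambda>n. Zero E Z Z"] exI[of _ "\<lambda>n. Ident E Z"] is_complexI)
      (simp_all add: Hom_iff Ident_seq(1)[OF Z])
qed

text \<open>A contraction exhibits \<open>X\<close> as a homotopy retract of a zero complex.\<close>

lemma acyclic_contractible:
  assumes spl: "idempotent_splitting E" and X [simp]: "is_complex E X"
    and h: "\<And>n. h n \<in> Arr E" "\<And>n. Dom E (h n) = ob X n" "\<And>n. Cod E (h n) = ob X (n - 1)"
    and e: "\<And>n. Ident E (ob X n) = diff X n \<cdot> h (n + 1) \<boxplus> h n \<cdot> diff X (n - 1)"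
  shows "purely_acyclic E X"
proof -
  obtain Z where Z: "zero_object E Z" by (rule zero_object_exists)
  let ?Z = "Cx (\<lambda>n::int. Z) (\<lambda>n. Zero E Z Z)"
  have [simp]: "Z \<in> Obj E" by (rule zero_object_simps(1)[OF Z])
  have Zc: "is_complex E ?Z" by (rule is_complexI) simp_all
  have c: "Cod E (diff X (n - 1)) = ob X n" for n using is_complexD(4)[of X "n - 1"] by simp
  show ?thesis
    by (rule acyclic_homotopy_retract[OF spl X acyclic_zero_complex[OF Z] chain_map_zero[OF X Zc] _ _ chain_map_zero[OF Zc X] _ _ h])
      (simp_all add: e h c)
qed

section \<open>Mapping cones and shifts\<close>

context
  fixes f K i1 i2 p1 p2
  assumes f [simp]: "is_chain_map E f"
    and b: "\<And>n. biproduct E (ob (src f) (n + 1)) (ob (tgt f) n) (ob K n) (i1 n) (i2 n) (p1 n) (p2 n)"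
    and d: "\<And>n. diff K n = p1 n \<cdot> Neg E (diff (src f) (n + 1)) \<cdot> i1 (n + 1)
          \<boxplus> p1 n \<cdot> cmp f (n + 1) \<cdot> i2 (n + 1) \<boxplus> p2 n \<cdot> diff (tgt f) n \<cdot> i2 (n + 1)"
begin

lemmas cone_simps = biproduct_simps[OF b] d add.assoc

lemma cone_chain: "cmp f n \<cdot> diff (tgt f) n = diff (src f) n \<cdot> cmp f (n + 1)"
    "k \<in> Arr E \<Longrightarrow> Dom E k = ob (tgt f) (n + 1) \<Longrightarrow> cmp f n \<cdot> (diff (tgt f) n \<cdot> k) = diff (src f) n \<cdot> (cmp f (n + 1) \<cdot> k)"
  using is_chain_mapD(6)[OF f, of n] chain_map_reduce[OF f, of k n] by simp_all

lemma cone_complex: "is_complex E K"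
proof (rule is_complexI)
  fix n
  have dd: "diff (src f) (n + 1) \<cdot> (diff (src f) (n + 2) \<cdot> i1 (n + 2)) = Zero E (ob (src f) (n + 1)) (ob K (n + 2))"
    using diff_diff_reduce[of "src f" "i1 (n + 2)" "n + 1"] biproduct_simps[OF b[of "n + 2"]] by (simp add: add.assoc)
  note [simp] = cone_simps cone_chain(1)[of "n + 1", simplified add.assoc] cone_chain(2)[of _ "n + 1", simplified add.assoc] dd
  show "diff K n \<cdot> diff K (n + 1) = Zero E (ob K n) (ob K (n + 2))" by (simp add: cone_chain)
qed (simp_all add: cone_simps)

lemma cone_inclusion: "is_chain_map E (Chain_Map (tgt f) K i2)"
  by (rule is_chain_mapI) (simp_all add: cone_complex cone_simps)

text \<open>The cone one degree lower, with the index \<open>n - 1 + 1\<close> normalised to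
  \<open>n\<close>; homotopies involve the differential in this degree.\<close>

lemma cone_pred: "diff K (n - 1) = p1 (n - 1) \<cdot> (Neg E (diff (src f) n) \<cdot> i1 n)
          \<boxplus> (p1 (n - 1) \<cdot> (cmp f n \<cdot> i2 n) \<boxplus> p2 (n - 1) \<cdot> (diff (tgt f) (n - 1) \<cdot> i2 n))"
  "Dom E (i1 (n - 1)) = ob (src f) n" "Cod E (p1 (n - 1)) = ob (src f) n" 
  "i1 (n - 1) \<cdot> p1 (n - 1) = Ident E (ob (src f) n)"
  "i2 (n - 1) \<cdot> p1 (n - 1) = Zero E (ob (tgt f) (n - 1)) (ob (src f) n)"
  "Cod E (diff (tgt f) (n - 1)) = ob (tgt f) n"
  "k \<in> Arr E \<Longrightarrow> Dom E k = ob (src f) n \<Longrightarrow> i1 (n - 1) \<cdot> (p1 (n - 1) \<cdot> k) = k"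
  "k \<in> Arr E \<Longrightarrow> Dom E k = ob (src f) n \<Longrightarrow> i2 (n - 1) \<cdot> (p1 (n - 1) \<cdot> k) = Zero E (ob (tgt f) (n - 1)) (Cod E k)"
proof -
  have [simp]: "Cod E (diff (tgt f) (n - 1)) = ob (tgt f) n" using is_complexD(4)[of "tgt f" "n - 1"] by simp
  note [simp] = biproduct_simps[OF b[of "n - 1"], simplified] biproduct_simps[OF b[of n]]
  show "diff K (n - 1) = p1 (n - 1) \<cdot> (Neg E (diff (src f) n) \<cdot> i1 n)
          \<boxplus> (p1 (n - 1) \<cdot> (cmp f n \<cdot> i2 n) \<boxplus> p2 (n - 1) \<cdot> (diff (tgt f) (n - 1) \<cdot> i2 n))"
    using d[of "n - 1"] by simp
  show "Cod E (diff (tgt f) (n - 1)) = ob (tgt f) n" by simp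
qed (use biproduct_simps[OF b[of "n - 1"]] in simp_all)

end

lemma mapping_cone_exists:
  assumes f: "is_chain_map E f"
  obtains K i1 i2 p1 p2 where
    "\<And>n. biproduct E (ob (src f) (n + 1)) (ob (tgt f) n) (ob K n) (i1 n) (i2 n) (p1 n) (p2 n)"
    "\<And>n. diff K n = p1 n \<cdot> Neg E (diff (src f) (n + 1)) \<cdot> i1 (n + 1)
          \<boxplus> p1 n \<cdot> cmp f (n + 1) \<cdot> i2 (n + 1) \<boxplus> p2 n \<cdot> diff (tgt f) n \<cdot> i2 (n + 1)"
proof -
  have "\<exists>t. case t of (S, i1, i2, p1, p2) \<Rightarrow> biproduct E (ob (src f) (n + 1)) (ob (tgt f) n) S i1 i2 p1 p2" for n
  proof -
    obtain S i1 i2 p1 p2 where "biproduct E (ob (src f) (n + 1)) (ob (tgt f) n) S i1 i2 p1 p2"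
      by (rule biproduct_exists[of "ob (src f) (n + 1)" "ob (tgt f) n"]) (use f in simp_all)
    then show ?thesis by (intro exI[of _ "(S, i1, i2, p1, p2)"]) simp
  qed
  then obtain t where t: "\<And>n. case t n of (S, i1, i2, p1, p2) \<Rightarrow> biproduct E (ob (src f) (n + 1)) (ob (tgt f) n) S i1 i2 p1 p2"
    by metis
  define i1 i2 p1 p2 where "i1 n = fst (snd (t n))" and "i2 n = fst (snd (snd (t n)))"
    and "p1 n = fst (snd (snd (snd (t n))))" and "p2 n = snd (snd (snd (snd (t n))))" for n
  have b: "biproduct E (ob (src f) (n + 1)) (ob (tgt f) n) (fst (t n)) (i1 n) (i2 n) (p1 n) (p2 n)" for n
    using t[of n] by (simp add: case_prod_beta i1_def i2_def p1_def p2_def)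
  show thesis
    by (rule that[of "Cx (\<lambda>n. fst (t n)) (\<lambda>n. p1 n \<cdot> Neg E (diff (src f) (n + 1)) \<cdot> i1 (n + 1)
          \<boxplus> p1 n \<cdot> cmp f (n + 1) \<cdot> i2 (n + 1) \<boxplus> p2 n \<cdot> diff (tgt f) n \<cdot> i2 (n + 1))" i1 i2 p1 p2]) (simp_all add: b)
qed

text \<open>The contraction \<open>p2 n \<cdot> i1 (n - 1)\<close> carries the unshifted copy of
  \<open>X\<close> identically onto the shifted copy one degree lower.\<close>

lemma acyclic_cone_of_identity:
  assumes spl: "idempotent_splitting E" and X: "is_complex E X"
    and b: "\<And>n. biproduct E (ob X (n + 1)) (ob X n) (ob K n) (i1 n) (i2 n) (p1 n) (p2 n)"
    and d: "\<And>n. diff K n = p1 n \<cdot> Neg E (diff X (n + 1)) \<cdot> i1 (n + 1)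
          \<boxplus> p1 n \<cdot> i2 (n + 1) \<boxplus> p2 n \<cdot> diff X n \<cdot> i2 (n + 1)"
  shows "purely_acyclic E K" "is_chain_map E (Chain_Map X K i2)" "is_complex E K"
proof -
  note [simp] = X
  let ?f = "Chain_Map X X (\<lambda>n. Ident E (ob X n))"
  have f: "is_chain_map E ?f" by (rule is_chain_mapI) simp_all
  have b': "biproduct E (ob (src ?f) (n + 1)) (ob (tgt ?f) n) (ob K n) (i1 n) (i2 n) (p1 n) (p2 n)" for n using b by simp
  note bs = biproduct_simps[OF b]
  have d': "diff K n = p1 n \<cdot> Neg E (diff (src ?f) (n + 1)) \<cdot> i1 (n + 1)
          \<boxplus> p1 n \<cdot> cmp ?f (n + 1) \<cdot> i2 (n + 1) \<boxplus> p2 n \<cdot> diff (tgt ?f) n \<cdot> i2 (n + 1)" for n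
    using d[of n] bs by simp
  show K: "is_complex E K" by (rule cone_complex[OF f b' d'])
  show "is_chain_map E (Chain_Map X K i2)" using cone_inclusion[OF f b' d'] by simp
  note cp = cone_pred[OF f b' d', simplified]
  show "purely_acyclic E K"
  proof (rule acyclic_contractible[OF spl K, of "\<lambda>n. p2 n \<cdot> i1 (n - 1)"])
    fix n
    note [simp] = bs cp
    show "p2 n \<cdot> i1 (n - 1) \<in> Arr E" "Dom E (p2 n \<cdot> i1 (n - 1)) = ob K n" "Cod E (p2 n \<cdot> i1 (n - 1)) = ob K (n - 1)"
      by (simp_all del: cp(1))
    have 1: "diff K n \<cdot> (p2 (n + 1) \<cdot> i1 (n + 1 - 1)) = p1 n \<cdot> i1 n \<boxplus> p2 n \<cdot> (diff X n \<cdot> i1 n)"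
      by (simp add: d)
    have 2: "(p2 n \<cdot> i1 (n - 1)) \<cdot> diff K (n - 1) = Neg E (p2 n \<cdot> (diff X n \<cdot> i1 n)) \<boxplus> p2 n \<cdot> i2 n"
      by simp
    have "p1 n \<cdot> i1 n \<boxplus> p2 n \<cdot> i2 n = Ident E (ob K n)" by (rule biproduct_sum[OF b])
    then show "Ident E (ob K n) = diff K n \<cdot> (p2 (n + 1) \<cdot> i1 (n + 1 - 1)) \<boxplus> (p2 n \<cdot> i1 (n - 1)) \<cdot> diff K (n - 1)"
      unfolding 1 2 by simp
  qed
qed

lemma cone_of_identity:
  assumes spl: "idempotent_splitting E" and X: "is_complex E X"
  obtains I I1 I2 P1 P2 where
    "\<And>n. biproduct E (ob X (n + 1)) (ob X n) (ob I n) (I1 n) (I2 n) (P1 n) (P2 n)"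
    "\<And>n. diff I n = P1 n \<cdot> Neg E (diff X (n + 1)) \<cdot> I1 (n + 1) \<boxplus> P1 n \<cdot> I2 (n + 1) \<boxplus> P2 n \<cdot> diff X n \<cdot> I2 (n + 1)"
    "purely_acyclic E I" "is_complex E I" "is_chain_map E (Chain_Map X I I2)"
proof -
  note [simp] = X
  let ?f = "Chain_Map X X (\<lambda>n. Ident E (ob X n))"
  have f: "is_chain_map E ?f" by (rule is_chain_mapI) simp_all
  obtain K i1 i2 p1 p2 where K:
    "\<And>n. biproduct E (ob (src ?f) (n + 1)) (ob (tgt ?f) n) (ob K n) (i1 n) (i2 n) (p1 n) (p2 n)"
    "\<And>n. diff K n = p1 n \<cdot> Neg E (diff (src ?f) (n + 1)) \<cdot> i1 (n + 1)
          \<boxplus> p1 n \<cdot> cmp ?f (n + 1) \<cdot> i2 (n + 1) \<boxplus> p2 n \<cdot> diff (tgt ?f) n \<cdot> i2 (n + 1)"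
    using mapping_cone_exists[OF f] by blast
  have b: "biproduct E (ob X (n + 1)) (ob X n) (ob K n) (i1 n) (i2 n) (p1 n) (p2 n)" for n
    using K(1)[of n] by simp
  have d: "diff K n = p1 n \<cdot> Neg E (diff X (n + 1)) \<cdot> i1 (n + 1) \<boxplus> p1 n \<cdot> i2 (n + 1) \<boxplus> p2 n \<cdot> diff X n \<cdot> i2 (n + 1)" for n
    using K(2)[of n] biproduct_simps[OF b] by simp
  show thesis by (rule that[OF b d acyclic_cone_of_identity(1)[OF spl X b d]
    acyclic_cone_of_identity(3)[OF spl X b d] acyclic_cone_of_identity(2)[OF spl X b d]])
qed

text \<open>The sign makes the projection of a mapping cone onto the shifted source a chain
  map.\<close>

definition shift_complex :: "('o, 'm) cx \<Rightarrow> ('o, 'm) cx" where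
  "shift_complex X = Cx (\<lambda>n. ob X (n + 1)) (\<lambda>n. Neg E (diff X (n + 1)))"

definition shift_map :: "('o, 'm) chain_map \<Rightarrow> ('o, 'm) chain_map" where
  "shift_map f = Chain_Map (shift_complex (src f)) (shift_complex (tgt f)) (\<lambda>n. cmp f (n + 1))"

lemma shift_complex_simps [simp]: "ob (shift_complex X) n = ob X (n + 1)" "diff (shift_complex X) n = Neg E (diff X (n + 1))"
  by (simp_all add: shift_complex_def)

lemma shift_map_simps [simp]: "src (shift_map f) = shift_complex (src f)" "tgt (shift_map f) = shift_complex (tgt f)"
  "cmp (shift_map f) n = cmp f (n + 1)"
  by (simp_all add: shift_map_def)

lemma shift_is_complex: "is_complex E X \<Longrightarrow> is_complex E (shift_complex X)"
  using is_complexD(5)[of X "n + 1" for n] by (intro is_complexI) (simp_all add: add.assoc)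

lemma shift_is_chain_map: "is_chain_map E f \<Longrightarrow> is_chain_map E (shift_map f)"
  unfolding shift_map_def using is_chain_mapD(6)[of f "n + 1" for n]
  by (intro is_chain_mapI shift_is_complex) (simp_all add: add.assoc)

text \<open>The sign is absorbed by the automorphism minus one of the objects of cycles.\<close>

lemma acyclic_shift:
  assumes "purely_acyclic E X"
  shows "purely_acyclic E (shift_complex X)"
proof -
  obtain e k where X: "is_complex E X" "\<And>n. (k n, e n) \<in> Pure_Seq E" "\<And>n. e n \<in> Arr E" "\<And>n. k n \<in> Arr E"
    "\<And>n. Dom E (e n) = ob X n" "\<And>n. Cod E (k n) = ob X n" "\<And>n. Cod E (e n) = Dom E (k (n + 1))"
    "\<And>n. e n \<cdot> k (n + 1) = diff X n"
    by (rule acyclicE[OF assms]) blast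
  note [simp] = X(1,3-7)
  have "(k n, Neg E (e n)) \<in> Pure_Seq E" for n
  proof (rule seq_iso[OF X(2)[of n], of "Ident E (Dom E (k n))" "Ident E (ob X n)" "Neg E (Ident E (Dom E (k (n + 1))))"])
    show "is_iso E (Neg E (Ident E (Dom E (k (n + 1)))))"
      by (rule is_isoI[of _ "Neg E (Ident E (Dom E (k (n + 1))))"]) simp_all
  qed (simp_all add: is_iso_Ident commutes_def composable_def)
  then show ?thesis
    using X(8)[of "n + 1" for n] unfolding purely_acyclic_def
    by (intro conjI shift_is_complex X exI[of _ "\<lambda>n. Dom E (k (n + 1))"] exI[of _ "\<lambda>n. Neg E (e (n + 1))"] exI[of _ "\<lambda>n. k (n + 1)"])
      (simp add: Hom_iff)
qed

end

locale acyclic_complexes_loc = complexes_loc E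
  for E :: "('o, 'm, 'z) exact_cat_scheme" (structure) +
  assumes spl: "idempotent_splitting E"
begin

sublocale CE: acyclic_loc CE "{X. purely_acyclic E X}"
proof (unfold_locales, goal_cases)
  case (1 X) then show ?case by (auto simp: purely_acyclic_def)
next
  case (2 Z)
  have Zc: "is_complex E Z" using 2 by (simp add: zero_object_def)
  note [simp] = Zc
  have "Ident CE Z = Zero CE Z Z" using CE.zero_object_simps(2)[OF 2, of "Ident CE Z"] CE.id_arr[of Z] by simp
  then have e: "Ident E (ob Z n) = Zero E (ob Z n) (ob Z n)" for n by (auto dest: fun_cong)
  \<comment> \<open>An arbitrary zero object need not be a constant complex, but its identities
    vanish, so the zero homotopy contracts it.\<close>
  have "purely_acyclic E Z"
    by (rule acyclic_contractible[OF spl Zc, of "\<lambda>n. Zero E (ob Z n) (ob Z (n - 1))"])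
      (use is_complexD(4)[OF Zc, of "n - 1" for n] in \<open>simp_all add: e\<close>)
  then show ?case by simp
next
  case (3 i p) then show ?case using acyclic_extension[OF 3(1)] by simp
next
  case (4 i p) then show ?case using acyclic_quotient[OF 4(1)] by simp
next
  case (5 i p) then show ?case using acyclic_sub[OF 5(1)] by simp
next
  case (6 s r)
  then have s: "is_chain_map E s" "is_chain_map E r" "tgt s = src r" "purely_acyclic E (tgt s)" by simp_all
  note [simp] = s(1,2)
  have "tgt r = src s" using 6(4) by simp
  moreover have "cmp s n \<cdot> cmp r n = Ident E (ob (src s) n)" for n using 6(4) by (auto dest: fun_cong)
  \<comment> \<open>A retract is a homotopy retract with zero homotopy.\<close>
  ultimately have "purely_acyclic E (src s)"
    using s(3) is_complexD(4)[OF chain_map_simps(1)[OF s(1)], of "n - 1" for n]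
    by (intro acyclic_homotopy_retract[OF spl _ s(4) s(1) _ _ s(2), of _ "\<lambda>n. Zero E (ob (src s) n) (ob (src s) (n - 1))"]) simp_all
  then show ?case by simp
next
  case (7 X)
  then have X: "is_complex E X" by simp
  obtain I I1 I2 P1 P2 where I:
    "\<And>n. biproduct E (ob X (n + 1)) (ob X n) (ob I n) (I1 n) (I2 n) (P1 n) (P2 n)"
    "purely_acyclic E I" "is_chain_map E (Chain_Map X I I2)"
    using cone_of_identity[OF spl X] by metis
  \<comment> \<open>The inclusion of a complex into the cone of its identity splits in each degree,
    so it is a pure embedding into an acyclic complex.\<close>
  have "pure_mono E (I2 n)" for n by (rule seq_pure(2)[OF biproduct_seq'[OF I(1)]])
  then show ?case using I(2,3) by (intro exI[of _ "Chain_Map X I I2"]) (simp add: pure_mono_CE)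
qed

text \<open>A null homotopy is an extension of \<open>g\<close> over the cone of the identity of its
  source, given by \<open>h\<close> on the shifted copy and by \<open>g\<close> on the
  other.\<close>

lemma null_if_null_homotopic:
  assumes g: "is_chain_map E g" and h: "\<And>n. h n \<in> Arr E" "\<And>n. Dom E (h n) = ob (src g) n" "\<And>n. Cod E (h n) = ob (tgt g) (n - 1)"
    and e: "\<And>n. cmp g n = diff (src g) n \<cdot> h (n + 1) \<boxplus> h n \<cdot> diff (tgt g) (n - 1)"
  shows "CE.null g"
proof -
  have h1: "Cod E (h (n + 1)) = ob (tgt g) n" for n using h(3)[of "n + 1"] by simp
  note [simp] = g h(1,2) h1
  have X: "is_complex E (src g)" and Y: "is_complex E (tgt g)" by simp_all
  obtain I I1 I2 P1 P2 where
    b: "\<And>n. biproduct E (ob (src g) (n + 1)) (ob (src g) n) (ob I n) (I1 n) (I2 n) (P1 n) (P2 n)" and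
    d: "\<And>n. diff I n = P1 n \<cdot> Neg E (diff (src g) (n + 1)) \<cdot> I1 (n + 1) \<boxplus> P1 n \<cdot> I2 (n + 1) \<boxplus> P2 n \<cdot> diff (src g) n \<cdot> I2 (n + 1)"
    and I: "purely_acyclic E I" "is_complex E I" "is_chain_map E (Chain_Map (src g) I I2)"
    by (rule cone_of_identity[OF spl X]) blast
  note [simp] = biproduct_simps[OF b] X Y
  let ?k = "\<lambda>n. P1 n \<cdot> h (n + 1) \<boxplus> P2 n \<cdot> cmp g n"
  have "is_chain_map E (Chain_Map I (tgt g) ?k)"
  proof (rule is_chain_mapI[OF I(2) Y])
    fix n
    have [simp]: "Cod E (h (n + 2)) = ob (tgt g) (n + 1)" using h1[of "n + 1"] by (simp add: add.assoc)
    \<comment> \<open>The homotopy equation in degree \<open>n + 1\<close>, in the form needed for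
      the shifted summand.\<close>
    have "Neg E (diff (src g) (n + 1) \<cdot> h (n + 2)) \<boxplus> cmp g (n + 1) = h (n + 1) \<cdot> diff (tgt g) n"
      unfolding e[of "n + 1"] by (simp add: add.assoc)
    then have 1: "P1 n \<cdot> (Neg E (diff (src g) (n + 1) \<cdot> h (n + 2)) \<boxplus> cmp g (n + 1)) = P1 n \<cdot> (h (n + 1) \<cdot> diff (tgt g) n)" by simp
    have "diff I n \<cdot> ?k (n + 1) = P1 n \<cdot> (Neg E (diff (src g) (n + 1) \<cdot> h (n + 2)) \<boxplus> cmp g (n + 1)) \<boxplus> P2 n \<cdot> (diff (src g) n \<cdot> cmp g (n + 1))"
      by (simp add: d add.assoc)
    also have "\<dots> = ?k n \<cdot> diff (tgt g) n" unfolding 1 by (simp add: is_chain_mapD(6)[OF g])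
    finally show "diff I n \<cdot> ?k (n + 1) = ?k n \<cdot> diff (tgt g) n" .
  qed simp_all
  then have "CE.null (Chain_Map (src g) I I2 \<cdot>\<^bsub>CE\<^esub> Chain_Map I (tgt g) ?k)"
    by (intro CE.nullI) (simp_all add: I)
  moreover have "Chain_Map (src g) I I2 \<cdot>\<^bsub>CE\<^esub> Chain_Map I (tgt g) ?k = g" by (auto intro!: chain_map_eqI)
  ultimately show ?thesis by simp
qed

section \<open>Quasi-isomorphisms and cones\<close>

context
  fixes f K i1 i2 p1 p2
  assumes f [simp]: "is_chain_map E f"
    and b: "\<And>n. biproduct E (ob (src f) (n + 1)) (ob (tgt f) n) (ob K n) (i1 n) (i2 n) (p1 n) (p2 n)"
    and d: "\<And>n. diff K n = p1 n \<cdot> Neg E (diff (src f) (n + 1)) \<cdot> i1 (n + 1)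
          \<boxplus> p1 n \<cdot> cmp f (n + 1) \<cdot> i2 (n + 1) \<boxplus> p2 n \<cdot> diff (tgt f) n \<cdot> i2 (n + 1)"
begin

lemma DA_iff_cone: "f \<in> CE.DA \<longleftrightarrow> purely_acyclic E K"
proof -
  have X: "is_complex E (src f)" and Y: "is_complex E (tgt f)" and K: "is_complex E K"
    using cone_complex[OF f b d] by simp_all
  obtain I I1 I2 P1 P2 where
    bI: "\<And>n. biproduct E (ob (src f) (n + 1)) (ob (src f) n) (ob I n) (I1 n) (I2 n) (P1 n) (P2 n)" and
    dI: "\<And>n. diff I n = P1 n \<cdot> Neg E (diff (src f) (n + 1)) \<cdot> I1 (n + 1) \<boxplus> P1 n \<cdot> I2 (n + 1) \<boxplus> P2 n \<cdot> diff (src f) n \<cdot> I2 (n + 1)"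
    and I: "purely_acyclic E I" "is_complex E I" "is_chain_map E (Chain_Map (src f) I I2)"
    by (rule cone_of_identity[OF spl X]) blast
  obtain S j1 j2 q1 q2 where S: "biproduct CE (tgt f) I S j1 j2 q1 q2" using biproduct_CE_exists[OF Y I(2)] by blast
  note Sn = biproduct_CE_imp[OF S]
  note bs = biproduct_simps[OF b] biproduct_simps[OF bI] biproduct_simps[OF Sn]
  have ch: "is_chain_map E j1" "is_chain_map E j2" "is_chain_map E q1" "is_chain_map E q2"
    "src j1 = tgt f" "src j2 = I" "tgt j1 = S" "tgt j2 = S" "src q1 = S" "src q2 = S" "tgt q1 = tgt f" "tgt q2 = I"
    using CE.biproduct_simps[OF S] by simp_all
  note [simp] = X Y K I(2)
  \<comment> \<open>The map from the cone of the identity to the cone of \<open>f\<close> that is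
    the identity on the shifted source and \<open>f\<close> on the other copy.\<close>
  let ?g = "Chain_Map I K (\<lambda>n. P1 n \<cdot> i1 n \<boxplus> P2 n \<cdot> (cmp f n \<cdot> i2 n))"
  have g: "is_chain_map E ?g"
    by (rule is_chain_mapI) (simp_all add: bs d dI cone_chain[OF f b d])
  have j: "is_chain_map E (Chain_Map (tgt f) K i2)" by (rule cone_inclusion[OF f b d])
  let ?s = "Chain_Map (src f) S (\<lambda>n. cmp f n \<cdot> cmp j1 n \<boxplus> I2 n \<cdot> cmp j2 n)"
  \<comment> \<open>The cokernel of \<open>?s\<close> glues the inclusion of the target into the
    cone with minus \<open>?g\<close>: the two agree on the image of the source, where both are
    \<open>f\<close> followed by that inclusion.\<close>
  let ?c = "Chain_Map S K (\<lambda>n. cmp q1 n \<cdot> i2 n \<boxplus> Neg E (cmp q2 n \<cdot> (P1 n \<cdot> i1 n \<boxplus> P2 n \<cdot> (cmp f n \<cdot> i2 n))))"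
  have s: "is_chain_map E ?s"
    using chain_map_add[OF chain_map_comp[OF f ch(1)] chain_map_comp[OF I(3) ch(2)]] ch by simp
  have c: "is_chain_map E ?c"
    using chain_map_add[OF chain_map_comp[OF ch(3) j] chain_map_neg[OF chain_map_comp[OF ch(4) g]]] ch by simp
  have "(cmp ?s n, cmp ?c n) \<in> Pure_Seq E" for n
  proof (rule pure_seq_kernel)
    note [simp] = bs
    \<comment> \<open>A section of \<open>?c\<close> in degree \<open>n\<close>: the shifted source
      enters through \<open>I\<close>, with the sign that compensates the one in
      \<open>?c\<close>.\<close>
    let ?t = "p1 n \<cdot> (Neg E (I1 n) \<cdot> cmp j2 n) \<boxplus> p2 n \<cdot> cmp j1 n"
    have "p2 n \<cdot> i2 n \<boxplus> p1 n \<cdot> i1 n = Ident E (ob K n)"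
      using biproduct_sum[OF b[of n]] add_comm[of "p2 n \<cdot> i2 n" "p1 n \<cdot> i1 n"] by simp
    then have "?t \<cdot> cmp ?c n = Ident E (ob K n)" by simp
    then have "pure_epi E (?t \<cdot> cmp ?c n)" by (simp add: pure_epi_Ident)
    then show "pure_epi E (cmp ?c n)" by (rule pure_epi_right) simp_all
    show "is_kernel E (cmp ?c n) (cmp ?s n)"
    proof (rule is_kernelI)
      fix u assume u: "u \<in> Arr E" "Cod E u = Dom E (cmp ?c n)" "u \<cdot> cmp ?c n = Zero E (Dom E u) (Cod E (cmp ?c n))"
      have [simp]: "u \<in> Arr E" "Cod E u = ob S n" using u by simp_all
      have u3: "u \<cdot> cmp ?c n = Zero E (Dom E u) (ob K n)" using u by simp
      \<comment> \<open>An element annihilated by \<open>?c\<close> has no component on the shifted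
        copy, and its component in the target is the image under \<open>f\<close> of its remaining
        component. That remaining component is the preimage under \<open>?s\<close>.\<close>
      have "Neg E (u \<cdot> (cmp q2 n \<cdot> P1 n)) = Zero E (Dom E u) (ob (src f) (n + 1))"
        using comp_reduce[OF u3, of "p1 n"] by simp
      then have "Neg E (Neg E (u \<cdot> (cmp q2 n \<cdot> P1 n))) = Neg E (Zero E (Dom E u) (ob (src f) (n + 1)))" by (rule arg_cong)
      then have a1: "u \<cdot> (cmp q2 n \<cdot> P1 n) = Zero E (Dom E u) (ob (src f) (n + 1))" by simp
      have a2: "u \<cdot> (cmp q2 n \<cdot> (P2 n \<cdot> cmp f n)) = u \<cdot> cmp q1 n"
        using comp_reduce[OF u3, of "p2 n"] sub_eq_zero[of "u \<cdot> cmp q1 n" "u \<cdot> (cmp q2 n \<cdot> (P2 n \<cdot> cmp f n))"] by simp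
      have a3: "u \<cdot> (cmp q2 n \<cdot> (P2 n \<cdot> I2 n)) = u \<cdot> cmp q2 n"
        by (rule biproduct_eqI[OF bI[of n]]) (simp_all add: a1)
      have "(u \<cdot> (cmp q2 n \<cdot> P2 n)) \<cdot> cmp ?s n = u"
        by (rule biproduct_eqI[OF Sn[of n]]) (simp_all add: a2 a3)
      then show "\<exists>v\<in>Arr E. Dom E v = Dom E u \<and> Cod E v = Dom E (cmp ?s n) \<and> v \<cdot> cmp ?s n = u"
        by (intro bexI[of _ "u \<cdot> (cmp q2 n \<cdot> P2 n)"]) simp_all
    next
      fix u W assume u: "u \<in> Arr E" "Dom E u = W" "Cod E u = Dom E (cmp ?s n)" "u \<cdot> cmp ?s n = Zero E W (Cod E (cmp ?s n))"
      have [simp]: "u \<in> Arr E" "Dom E u = W" "Cod E u = ob (src f) n" "W \<in> Obj E" using u dom_obj[OF u(1)] by simp_all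
      have "u \<cdot> cmp ?s n = Zero E W (ob S n)" using u by simp
      from comp_reduce[OF this, of "cmp q2 n \<cdot> P2 n"] show "u = Zero E W (Dom E (cmp ?s n))" by simp
    qed simp_all
  qed
  then have sc: "(?s, ?c) \<in> Pure_Seq CE" using s c by simp
  have sq: "?s \<cdot>\<^bsub>CE\<^esub> q1 = f" by (rule chain_map_eqI) (simp_all add: bs ch)
  have "q1 \<in> CE.TD" by (rule CE.biproduct_TD[OF S]) (simp add: I)
  then show ?thesis using CE.DA_iff[OF sc, of q1] unfolding sq by (simp add: ch)
qed

end

text \<open>With split idempotents acyclicity passes along homotopy equivalences, so a cone
  equivalent to an acyclic complex is acyclic itself, and \<open>DA_iff_cone\<close>
  applies.\<close>

lemma quasi_iso_iff: "quasi_iso E f \<longleftrightarrow> f \<in> CE.DA"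
proof
  assume q: "quasi_iso E f"
  then have f: "is_chain_map E f" by (simp add: quasi_iso_def)
  obtain K A where K: "mapping_cone E f K" "purely_acyclic E A" "homotopy_equivalent E K A"
    using q by (auto simp: quasi_iso_def)
  obtain i1 i2 p1 p2 where
    b: "\<And>n. biproduct E (ob (src f) (n + 1)) (ob (tgt f) n) (ob K n) (i1 n) (i2 n) (p1 n) (p2 n)" and
    d: "\<And>n. diff K n = p1 n \<cdot> Neg E (diff (src f) (n + 1)) \<cdot> i1 (n + 1)
          \<boxplus> p1 n \<cdot> cmp f (n + 1) \<cdot> i2 (n + 1) \<boxplus> p2 n \<cdot> diff (tgt f) n \<cdot> i2 (n + 1)"
    using K(1) unfolding mapping_cone_def by blast
  note [simp] = cone_complex[OF f b d]
  obtain u v where u: "is_chain_map E u" "src u = K" "tgt u = A" and v: "is_chain_map E v" "src v = A" "tgt v = K"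
    and uv: "(u \<cdot>\<^bsub>CE\<^esub> v, Ident CE K) \<in> homotopic E"
    using K(3) by (auto simp: homotopy_equivalent_def Hom_def)
  obtain h where h: "\<And>n. h n \<in> Arr E" "\<And>n. Dom E (h n) = ob K n" "\<And>n. Cod E (h n) = ob K (n - 1)"
    and e: "\<And>n. cmp u n \<cdot> cmp v n = Ident E (ob K n) \<boxplus> (diff K n \<cdot> h (n + 1) \<boxplus> h n \<cdot> diff K (n - 1))"
    using uv u v by (auto simp: homotopic_def Hom_iff)
  have c: "Cod E (diff K (n - 1)) = ob K n" for n using is_complexD(4)[of K "n - 1"] by simp
  \<comment> \<open>The homotopy expresses the composite through the identity, while the criterion
    asks for the identity in terms of the composite; hence the change of sign.\<close>
  have "purely_acyclic E K"
  proof (rule acyclic_homotopy_retract[OF spl _ K(2) u v, of "\<lambda>n. Neg E (h n)"])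
    fix n
    show "Ident E (ob K n) = cmp u n \<cdot> cmp v n \<boxplus> (diff K n \<cdot> Neg E (h (n + 1)) \<boxplus> Neg E (h n) \<cdot> diff K (n - 1))"
      unfolding e by (simp add: h c add_ac)
  qed (simp_all add: h)
  then show "f \<in> CE.DA" using DA_iff_cone[OF f b d] by simp
next
  assume fD: "f \<in> CE.DA"
  then have f: "is_chain_map E f" using CE.DA_arr by simp
  obtain K i1 i2 p1 p2 where
    b: "\<And>n. biproduct E (ob (src f) (n + 1)) (ob (tgt f) n) (ob K n) (i1 n) (i2 n) (p1 n) (p2 n)" and
    d: "\<And>n. diff K n = p1 n \<cdot> Neg E (diff (src f) (n + 1)) \<cdot> i1 (n + 1)
          \<boxplus> p1 n \<cdot> cmp f (n + 1) \<cdot> i2 (n + 1) \<boxplus> p2 n \<cdot> diff (tgt f) n \<cdot> i2 (n + 1)"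
    by (rule mapping_cone_exists[OF f]) blast
  have K: "purely_acyclic E K" using DA_iff_cone[OF f b d] fD by simp
  have [simp]: "is_complex E K" by (rule cone_complex[OF f b d])
  have c: "Cod E (diff K (n - 1)) = ob K n" for n using is_complexD(4)[of K "n - 1"] by simp
  let ?I = "Ident CE K"
  have I: "is_chain_map E ?I" using CE.id_arr[of K] by simp
  then have "(?I \<cdot>\<^bsub>CE\<^esub> ?I, ?I) \<in> homotopic E"
    unfolding homotopic_def
    by (auto simp: Hom_iff c intro!: exI[of _ "\<lambda>n. Zero E (ob K n) (ob K (n - 1))"])
  then have "homotopy_equivalent E K K" unfolding homotopy_equivalent_def
    using I by (intro bexI[of _ ?I]) (simp_all add: Hom_def)
  moreover have "mapping_cone E f K" unfolding mapping_cone_def using b d by blast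
  ultimately show "quasi_iso E f" using f K unfolding quasi_iso_def by blast
qed

section \<open>Shifts and saturation\<close>

lemma shift_DA:
  assumes "f \<in> CE.DA"
  shows "shift_map f \<in> CE.DA"
proof -
  have seq: "(shift_map i, shift_map p) \<in> Pure_Seq CE" if "(i, p) \<in> Pure_Seq CE" for i p
    using that shift_is_chain_map by simp
  obtain s p where f: "f = s \<cdot>\<^bsub>CE\<^esub> p" "s \<in> CE.SA" "p \<in> CE.TD" "Cod CE s = Dom CE p" using assms unfolding CE.DA_def by blast
  obtain c k where c: "(s, c) \<in> Pure_Seq CE" "purely_acyclic E (tgt c)" and k: "(k, p) \<in> Pure_Seq CE" "purely_acyclic E (src k)"
    using f(2,3) unfolding CE.SA_def CE.TD_def by auto
  have "shift_map s \<in> CE.SA" "shift_map p \<in> CE.TD"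
    unfolding CE.SA_def CE.TD_def using seq[OF c(1)] seq[OF k(1)] acyclic_shift[OF c(2)] acyclic_shift[OF k(2)]
    by (auto simp del: CE_simps(9))
  moreover have "shift_map f = shift_map s \<cdot>\<^bsub>CE\<^esub> shift_map p" unfolding f(1) by (auto intro!: chain_map_eqI)
  moreover have "Cod CE (shift_map s) = Dom CE (shift_map p)" using f(4) by simp
  ultimately show ?thesis unfolding CE.DA_def by blast
qed

text \<open>Shifting preserves pure sequences and acyclicity, hence denominators and null arrows. It
  is needed because the projection of a cone ends in the shifted source, whereas composition with
  \<open>f\<close> requires the unshifted one.\<close>

lemma shift_null_in_Frac:
  assumes "CE.null_in_Frac f"
  shows "CE.null_in_Frac (shift_map f)"
proof -
  obtain d where f: "is_chain_map E f" and d: "d \<in> CE.DA" "src d = tgt f" "CE.null (f \<cdot>\<^bsub>CE\<^esub> d)"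
    using assms by (auto simp: CE.null_in_Frac_def simp del: CE_simps(6))
  obtain u v where uv: "is_chain_map E u" "is_chain_map E v" "tgt u = src v" "purely_acyclic E (tgt u)" "f \<cdot>\<^bsub>CE\<^esub> d = u \<cdot>\<^bsub>CE\<^esub> v"
    using d(3) unfolding CE.null_def by auto
  have "CE.null (shift_map u \<cdot>\<^bsub>CE\<^esub> shift_map v)"
    using uv(1-4) shift_is_chain_map acyclic_shift by (intro CE.nullI) simp_all
  moreover have "shift_map (f \<cdot>\<^bsub>CE\<^esub> d) = shift_map f \<cdot>\<^bsub>CE\<^esub> shift_map d" "shift_map (u \<cdot>\<^bsub>CE\<^esub> v) = shift_map u \<cdot>\<^bsub>CE\<^esub> shift_map v"
    by (auto intro!: chain_map_eqI)
  ultimately have "CE.null (shift_map f \<cdot>\<^bsub>CE\<^esub> shift_map d)" using uv(5) by simp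
  then show ?thesis unfolding CE.null_in_Frac_def
    using shift_DA[OF d(1)] d(2) f shift_is_chain_map by (intro conjI bexI[of _ "shift_map d"]) simp_all
qed

text \<open>If \<open>f: X \<rightarrow> Y\<close> becomes invertible, then the inclusion of \<open>Y\<close> into the cone of \<open>f\<close> and the
  projection of the cone onto the shift of \<open>X\<close> vanish in the fraction category, because their
  composites with \<open>f\<close> are null-homotopic.  This forces the cone to be acyclic.\<close>

lemma DA_if_LF_iso:
  assumes f: "is_chain_map E f" and iso: "is_iso CE.Loc (CE.LF f)"
  shows "f \<in> CE.DA"
proof -
  obtain K i1 i2 p1 p2 where
    b: "\<And>n. biproduct E (ob (src f) (n + 1)) (ob (tgt f) n) (ob K n) (i1 n) (i2 n) (p1 n) (p2 n)" and
    d: "\<And>n. diff K n = p1 n \<cdot> Neg E (diff (src f) (n + 1)) \<cdot> i1 (n + 1)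
          \<boxplus> p1 n \<cdot> cmp f (n + 1) \<cdot> i2 (n + 1) \<boxplus> p2 n \<cdot> diff (tgt f) n \<cdot> i2 (n + 1)"
    by (rule mapping_cone_exists[OF f]) blast
  note bs = biproduct_simps[OF b] and cp = cone_pred[OF f b d]
  have K: "is_complex E K" and j: "is_chain_map E (Chain_Map (tgt f) K i2)"
    using cone_complex[OF f b d] cone_inclusion[OF f b d] by simp_all
  note [simp] = f K bs(1-15)
  \<comment> \<open>The cone shifted back by one degree, so that its projection ends in the source
    of \<open>f\<close>; \<open>shift_map\<close> undoes this afterwards.\<close>
  define L where "L = Cx (\<lambda>n. ob K (n - 1)) (\<lambda>n. Neg E (diff K (n - 1)))"
  have KL: "shift_complex L = K" by (rule cx.expand) (simp add: L_def shift_complex_def)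
  have cK: "Cod E (diff K (n - 1)) = ob K n" for n using is_complexD(4)[OF K, of "n - 1"] by simp
  have L: "is_complex E L" by (rule is_complexI) (simp_all add: L_def cK add.commute)
  let ?\<phi> = "Chain_Map L (src f) (\<lambda>n. p1 (n - 1))"
  let ?j = "Chain_Map (tgt f) K i2"
  have phi: "is_chain_map E ?\<phi>"
  proof (rule is_chain_mapI[OF L])
    fix n
    have "diff K (n - 1) \<cdot> p1 n = Neg E (p1 (n - 1) \<cdot> diff (src f) n)" by (simp add: bs cp)
    then show "diff L n \<cdot> p1 (n + 1 - 1) = p1 (n - 1) \<cdot> diff (src f) n" by (simp add: L_def cK cp(3))
  qed (simp_all add: L_def cp(3))
  \<comment> \<open>The homotopy includes the source as the first summand of the cone one degree
    lower.\<close>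
  have "CE.null (f \<cdot>\<^bsub>CE\<^esub> ?j)"
  proof (rule null_if_null_homotopic[of _ "\<lambda>n. i1 (n - 1)"])
    show "is_chain_map E (f \<cdot>\<^bsub>CE\<^esub> ?j)" using chain_map_comp[OF f j] by simp
    fix n
    show "cmp (f \<cdot>\<^bsub>CE\<^esub> ?j) n = diff (src (f \<cdot>\<^bsub>CE\<^esub> ?j)) n \<cdot> i1 (n + 1 - 1) \<boxplus> i1 (n - 1) \<cdot> diff (tgt (f \<cdot>\<^bsub>CE\<^esub> ?j)) (n - 1)"
      by (simp add: bs cp)
  qed (simp_all add: cp(2))
  then have nj: "CE.null_in_Frac ?j" by (intro CE.null_in_Frac_if_LF_iso(2)[of f, OF _ iso]) (simp_all add: j)
  \<comment> \<open>The homotopy is minus the projection onto the target; its sign matches that of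
    the differential of \<open>L\<close>.\<close>
  have "CE.null (?\<phi> \<cdot>\<^bsub>CE\<^esub> f)"
  proof (rule null_if_null_homotopic[of _ "\<lambda>n. Neg E (p2 (n - 1))"])
    show "is_chain_map E (?\<phi> \<cdot>\<^bsub>CE\<^esub> f)" using chain_map_comp[OF phi f] by simp
    fix n
    show "cmp (?\<phi> \<cdot>\<^bsub>CE\<^esub> f) n = diff (src (?\<phi> \<cdot>\<^bsub>CE\<^esub> f)) n \<cdot> Neg E (p2 (n + 1 - 1)) \<boxplus> Neg E (p2 (n - 1)) \<cdot> diff (tgt (?\<phi> \<cdot>\<^bsub>CE\<^esub> f)) (n - 1)"
      by (simp add: L_def bs cp)
  qed (simp_all add: L_def)
  then have "CE.null_in_Frac ?\<phi>" by (intro CE.null_in_Frac_if_LF_iso(1)[of f, OF _ iso]) (simp_all add: phi)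
  then have "CE.null_in_Frac (shift_map ?\<phi>)" by (rule shift_null_in_Frac)
  moreover have "shift_map ?\<phi> = Chain_Map K (shift_complex (src f)) p1" by (rule chain_map_eqI) (simp_all add: KL)
  moreover have "is_chain_map E (shift_map ?\<phi>)" by (rule shift_is_chain_map[OF phi])
  ultimately have nd: "CE.null_in_Frac (Chain_Map K (shift_complex (src f)) p1)"
    and dc: "is_chain_map E (Chain_Map K (shift_complex (src f)) p1)" by simp_all
  \<comment> \<open>Target, cone and shifted source form a pure sequence, split in each degree. Both
    of its arrows vanish in the fraction category.\<close>
  have "(?j, Chain_Map K (shift_complex (src f)) p1) \<in> Pure_Seq CE"
    using j dc biproduct_seq'[OF b] by simp
  then have "purely_acyclic E K" using CE.acyclic_if_null_in_Frac[OF _ nj nd] by simp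
  then show ?thesis using DA_iff_cone[OF f b d] by simp
qed

end

section \<open>The derived category\<close>

context acyclic_complexes_loc
begin

lemma homotopicI:
  assumes "is_chain_map E f" "is_chain_map E g" "src f = src g" "tgt f = tgt g"
    and "\<And>n. h n \<in> Arr E" "\<And>n. Dom E (h n) = ob (src f) n" "\<And>n. Cod E (h n) = ob (tgt f) (n - 1)"
    and "\<And>n. cmp f n = cmp g n \<boxplus> (diff (src f) n \<cdot> h (n + 1) \<boxplus> h n \<cdot> diff (tgt f) (n - 1))"
  shows "(f, g) \<in> homotopic E"
  unfolding homotopic_def using assms by (auto simp: Hom_iff intro!: exI[of _ h])

lemma homotopicE:
  assumes "(f, g) \<in> homotopic E"
  obtains h where "is_chain_map E f" "is_chain_map E g" "src f = src g" "tgt f = tgt g"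
    "\<And>n. h n \<in> Arr E" "\<And>n. Dom E (h n) = ob (src g) n" "\<And>n. Cod E (h n) = ob (tgt g) (n - 1)"
    "\<And>n. cmp f n = cmp g n \<boxplus> (diff (src g) n \<cdot> h (n + 1) \<boxplus> h n \<cdot> diff (tgt g) (n - 1))"
    "\<And>n. Cod E (h (n + 1)) = ob (tgt g) n" "\<And>n. Cod E (diff (tgt g) (n - 1)) = ob (tgt g) n"
    "\<And>n. diff (src g) (n - 1) \<in> Arr E"
proof -
  obtain h where h: "is_chain_map E f" "is_chain_map E g" "src f = src g" "tgt f = tgt g"
    "\<And>n. h n \<in> Arr E" "\<And>n. Dom E (h n) = ob (src g) n" "\<And>n. Cod E (h n) = ob (tgt g) (n - 1)"
    "\<And>n. cmp f n = cmp g n \<boxplus> (diff (src g) n \<cdot> h (n + 1) \<boxplus> h n \<cdot> diff (tgt g) (n - 1))"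
  proof -
    assume *: "\<And>h. \<lbrakk>is_chain_map E f; is_chain_map E g; src f = src g; tgt f = tgt g;
      \<And>n. h n \<in> Arr E; \<And>n. Dom E (h n) = ob (src g) n; \<And>n. Cod E (h n) = ob (tgt g) (n - 1);
      \<And>n. cmp f n = cmp g n \<boxplus> (diff (src g) n \<cdot> h (n + 1) \<boxplus> h n \<cdot> diff (tgt g) (n - 1))\<rbrakk> \<Longrightarrow> thesis"
    show thesis using assms unfolding homotopic_def Hom_iff by clarify (rule *, simp_all)
  qed
  show thesis
    by (rule that[OF h]) (use h(2) h(7)[of "n + 1" for n] is_complexD(4)[of "tgt g" "n - 1" for n] in simp_all)
qed

lemma homotopic_refl: "is_chain_map E f \<Longrightarrow> (f, f) \<in> homotopic E"
  by (rule homotopicI[of f f "\<lambda>n. Zero E (ob (src f) n) (ob (tgt f) (n - 1))"])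
    (use is_complexD(4)[of "tgt f" "n - 1" for n] in simp_all)

lemma homotopic_sym:
  assumes "(f, g) \<in> homotopic E"
  shows "(g, f) \<in> homotopic E"
proof -
  obtain h where h: "is_chain_map E f" "is_chain_map E g" "src f = src g" "tgt f = tgt g"
    "\<And>n. h n \<in> Arr E" "\<And>n. Dom E (h n) = ob (src g) n" "\<And>n. Cod E (h n) = ob (tgt g) (n - 1)"
    "\<And>n. cmp f n = cmp g n \<boxplus> (diff (src g) n \<cdot> h (n + 1) \<boxplus> h n \<cdot> diff (tgt g) (n - 1))"
    "\<And>n. Cod E (h (n + 1)) = ob (tgt g) n" "\<And>n. Cod E (diff (tgt g) (n - 1)) = ob (tgt g) n"
    by (rule homotopicE[OF assms]) blast
  note [simp] = h(1-7,9,10)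
  show ?thesis
  proof (rule homotopicI[of g f "\<lambda>n. Neg E (h n)"])
    fix n
    let ?x = "diff (src g) n \<cdot> h (n + 1) \<boxplus> h n \<cdot> diff (tgt g) (n - 1)"
    have "cmp f n \<boxplus> Neg E ?x = cmp g n \<boxplus> (?x \<boxplus> Neg E ?x)"
      unfolding h(8)[of n] by (rule add_assoc) simp_all
    also have "?x \<boxplus> Neg E ?x = Zero E (ob (src g) n) (ob (tgt g) n)" by (subst add_neg) simp_all
    finally show "cmp g n = cmp f n \<boxplus> (diff (src g) n \<cdot> Neg E (h (n + 1)) \<boxplus> Neg E (h n) \<cdot> diff (tgt g) (n - 1))" by simp
  qed simp_all
qed

lemma homotopic_trans:
  assumes "(f, g) \<in> homotopic E" "(g, k) \<in> homotopic E"
  shows "(f, k) \<in> homotopic E"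
proof -
  obtain h where h: "is_chain_map E f" "is_chain_map E g" "src f = src g" "tgt f = tgt g"
    "\<And>n. h n \<in> Arr E" "\<And>n. Dom E (h n) = ob (src g) n" "\<And>n. Cod E (h n) = ob (tgt g) (n - 1)"
    "\<And>n. cmp f n = cmp g n \<boxplus> (diff (src g) n \<cdot> h (n + 1) \<boxplus> h n \<cdot> diff (tgt g) (n - 1))"
    "\<And>n. Cod E (h (n + 1)) = ob (tgt g) n" "\<And>n. Cod E (diff (tgt g) (n - 1)) = ob (tgt g) n"
    by (rule homotopicE[OF assms(1)]) blast
  obtain l where l: "is_chain_map E k" "src g = src k" "tgt g = tgt k"
    "\<And>n. l n \<in> Arr E" "\<And>n. Dom E (l n) = ob (src k) n" "\<And>n. Cod E (l n) = ob (tgt k) (n - 1)"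
    "\<And>n. cmp g n = cmp k n \<boxplus> (diff (src k) n \<cdot> l (n + 1) \<boxplus> l n \<cdot> diff (tgt k) (n - 1))"
    "\<And>n. Cod E (l (n + 1)) = ob (tgt k) n"
    by (rule homotopicE[OF assms(2)]) blast
  note [simp] = h(1-7,9) l(1-6,8) h(10)[unfolded l]
  show ?thesis
  proof (rule homotopicI[of f k "\<lambda>n. l n \<boxplus> h n"])
    fix n
    show "cmp f n = cmp k n \<boxplus> (diff (src f) n \<cdot> (l (n + 1) \<boxplus> h (n + 1)) \<boxplus> (l n \<boxplus> h n) \<cdot> diff (tgt f) (n - 1))"
      unfolding h(8)[of n] l(7)[of n]
      by (simp add: add_lcomm[of "l n \<cdot> diff (tgt k) (n - 1)" "diff (src k) n \<cdot> h (n + 1)"])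
  qed simp_all
qed

lemma homotopic_comp_right:
  assumes "(f, f') \<in> homotopic E" and g: "is_chain_map E g" "src g = tgt f"
  shows "(f \<cdot>\<^bsub>CE\<^esub> g, f' \<cdot>\<^bsub>CE\<^esub> g) \<in> homotopic E"
proof -
  obtain h where h: "is_chain_map E f" "is_chain_map E f'" "src f = src f'" "tgt f = tgt f'"
    "\<And>n. h n \<in> Arr E" "\<And>n. Dom E (h n) = ob (src f') n" "\<And>n. Cod E (h n) = ob (tgt f') (n - 1)"
    "\<And>n. cmp f n = cmp f' n \<boxplus> (diff (src f') n \<cdot> h (n + 1) \<boxplus> h n \<cdot> diff (tgt f') (n - 1))"
    "\<And>n. Cod E (h (n + 1)) = ob (tgt f') n" "\<And>n. Cod E (diff (tgt f') (n - 1)) = ob (tgt f') n"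
    by (rule homotopicE[OF assms(1)]) blast
  note [simp] = h(1-7,9,10) g
  have gd: "diff (tgt f') (n - 1) \<cdot> cmp g n = cmp g (n - 1) \<cdot> diff (tgt g) (n - 1)" for n
    using is_chain_mapD(6)[OF g(1), of "n - 1"] by simp
  show ?thesis
  proof (rule homotopicI[of _ _ "\<lambda>n. h n \<cdot> cmp g (n - 1)"])
    show "is_chain_map E (f \<cdot>\<^bsub>CE\<^esub> g)" "is_chain_map E (f' \<cdot>\<^bsub>CE\<^esub> g)"
      using chain_map_comp[OF h(1) g(1)] chain_map_comp[OF h(2) g(1)] by simp_all
    fix n
    show "cmp (f \<cdot>\<^bsub>CE\<^esub> g) n = cmp (f' \<cdot>\<^bsub>CE\<^esub> g) n \<boxplus> (diff (src (f \<cdot>\<^bsub>CE\<^esub> g)) n \<cdot> (h (n + 1) \<cdot> cmp g (n + 1 - 1))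
      \<boxplus> (h n \<cdot> cmp g (n - 1)) \<cdot> diff (tgt (f \<cdot>\<^bsub>CE\<^esub> g)) (n - 1))"
      by (simp add: h(8)[of n] gd)
  qed simp_all
qed

lemma homotopic_comp_left:
  assumes "(g, g') \<in> homotopic E" and f: "is_chain_map E f" "tgt f = src g"
  shows "(f \<cdot>\<^bsub>CE\<^esub> g, f \<cdot>\<^bsub>CE\<^esub> g') \<in> homotopic E"
proof -
  obtain h where h: "is_chain_map E g" "is_chain_map E g'" "src g = src g'" "tgt g = tgt g'"
    "\<And>n. h n \<in> Arr E" "\<And>n. Dom E (h n) = ob (src g') n" "\<And>n. Cod E (h n) = ob (tgt g') (n - 1)"
    "\<And>n. cmp g n = cmp g' n \<boxplus> (diff (src g') n \<cdot> h (n + 1) \<boxplus> h n \<cdot> diff (tgt g') (n - 1))"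
    "\<And>n. Cod E (h (n + 1)) = ob (tgt g') n" "\<And>n. Cod E (diff (tgt g') (n - 1)) = ob (tgt g') n"
    by (rule homotopicE[OF assms(1)]) blast
  note [simp] = h(1-7,9,10) f
  have fd: "cmp f n \<cdot> (diff (src g') n \<cdot> h (n + 1)) = diff (src f) n \<cdot> (cmp f (n + 1) \<cdot> h (n + 1))" for n
    using chain_map_reduce[OF f(1), of "h (n + 1)" n] by simp
  show ?thesis
  proof (rule homotopicI[of _ _ "\<lambda>n. cmp f n \<cdot> h n"])
    show "is_chain_map E (f \<cdot>\<^bsub>CE\<^esub> g)" "is_chain_map E (f \<cdot>\<^bsub>CE\<^esub> g')"
      using chain_map_comp[OF f(1) h(1)] chain_map_comp[OF f(1) h(2)] by simp_all
    fix n
    show "cmp (f \<cdot>\<^bsub>CE\<^esub> g) n = cmp (f \<cdot>\<^bsub>CE\<^esub> g') n \<boxplus> (diff (src (f \<cdot>\<^bsub>CE\<^esub> g)) n \<cdot> (cmp f (n + 1) \<cdot> h (n + 1))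
      \<boxplus> (cmp f n \<cdot> h n) \<cdot> diff (tgt (f \<cdot>\<^bsub>CE\<^esub> g)) (n - 1))"
      by (simp add: h(8)[of n] fd)
  qed simp_all
qed

lemma homotopic_congruence: "cat_congruence CE (homotopic E)"
proof -
  have par: "is_chain_map E f" "is_chain_map E g" "src f = src g" "tgt f = tgt g" if "(f, g) \<in> homotopic E" for f g
    using that by (auto simp: homotopic_def)
  have "equiv (Arr CE) (homotopic E)"
  proof (rule equivI)
    show "homotopic E \<subseteq> Arr CE \<times> Arr CE" using par by auto
    show "refl_on (Arr CE) (homotopic E)" by (rule refl_onI) (simp add: homotopic_refl)
    show "Relation.sym (homotopic E)" using homotopic_sym by (simp add: sym_def)
    show "Relation.trans (homotopic E)" using homotopic_trans by (auto intro: transI)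
  qed
  moreover have "(f \<cdot>\<^bsub>CE\<^esub> g, f' \<cdot>\<^bsub>CE\<^esub> g') \<in> homotopic E"
    if "(f, f') \<in> homotopic E" "(g, g') \<in> homotopic E" "tgt f = src g" for f f' g g'
    by (rule homotopic_trans[OF homotopic_comp_right[OF that(1)] homotopic_comp_left[OF that(2)]])
      (use that par[OF that(1)] par[OF that(2)] in simp_all)
  ultimately show ?thesis unfolding cat_congruence_def using par by (auto simp del: CE_simps(6))
qed

lemma null_if_homotopic:
  assumes "(f, g) \<in> homotopic E"
  shows "CE.null (f \<boxplus>\<^bsub>CE\<^esub> Neg CE g)"
proof -
  obtain h where h: "is_chain_map E f" "is_chain_map E g" "src f = src g" "tgt f = tgt g"
    "\<And>n. h n \<in> Arr E" "\<And>n. Dom E (h n) = ob (src g) n" "\<And>n. Cod E (h n) = ob (tgt g) (n - 1)"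
    "\<And>n. cmp f n = cmp g n \<boxplus> (diff (src g) n \<cdot> h (n + 1) \<boxplus> h n \<cdot> diff (tgt g) (n - 1))"
    "\<And>n. Cod E (h (n + 1)) = ob (tgt g) n" "\<And>n. Cod E (diff (tgt g) (n - 1)) = ob (tgt g) n"
    by (rule homotopicE[OF assms(1)]) blast
  note [simp] = h(1-7,9,10)
  show ?thesis
  proof (rule null_if_null_homotopic[of _ h])
    show "is_chain_map E (f \<boxplus>\<^bsub>CE\<^esub> Neg CE g)"
      using chain_map_add[OF h(1) chain_map_neg[OF h(2)]] by simp
    fix n
    have "cmp f n \<boxplus> Neg E (cmp g n) = Neg E (cmp g n) \<boxplus> cmp f n" by (rule add_comm) simp_all
    also have "\<dots> = diff (src g) n \<cdot> h (n + 1) \<boxplus> h n \<cdot> diff (tgt g) (n - 1)" unfolding h(8)[of n] by simp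
    finally show "cmp (f \<boxplus>\<^bsub>CE\<^esub> Neg CE g) n = diff (src (f \<boxplus>\<^bsub>CE\<^esub> Neg CE g)) n \<cdot> h (n + 1)
      \<boxplus> h n \<cdot> diff (tgt (f \<boxplus>\<^bsub>CE\<^esub> Neg CE g)) (n - 1)" by simp
  qed simp_all
qed

text \<open>A homotopy makes the difference of two maps null, so \<open>null_difference\<close>
  yields both requirements on the congruence: homotopic maps agree in the localisation, and
  quasi-isomorphisms form a union of homotopy classes.\<close>

lemma derived_cat_isomorphic: "isomorphic_categories (derived_cat E) (Frac CE CE.DA CE.SA CE.TD)"
proof -
  interpret homotopy: quotient_localisation CE "homotopic E" CE.DA
  proof (unfold_locales, goal_cases)
    case 1 show ?case by (rule homotopic_congruence)
  next
    case (2 f g)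
    then have "is_chain_map E f" "is_chain_map E g" "src f = src g" "tgt f = tgt g" by (auto simp: homotopic_def)
    then show ?case using CE.null_difference(2)[OF _ _ _ _ null_if_homotopic[OF 2(1)] 2(2)] by simp
  next
    case (3 f g)
    then have h: "is_chain_map E f" "is_chain_map E g" "src f = src g" "tgt f = tgt g" by (auto simp: homotopic_def)
    then have "CE.LF f = CE.LF g" using CE.null_difference(1)[OF _ _ _ _ null_if_homotopic[OF 3(1)]] by simp
    then show ?case using h by (subst CE.zcl_eq_iff[symmetric]) (auto simp: CE.LF_def)
  qed
  have "derived_cat E = localisation (quot_cat CE (homotopic E)) {homotopic E `` {f} |f. f \<in> CE.DA}"
    by (simp add: derived_cat_def homotopy_cat_def quasi_iso_iff)
  then show ?thesis
    using isomorphic_categories_sym[OF isomorphic_categories_trans[OF CE.Frac_transport(3) homotopy.Loc_isomorphic]] by simp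
qed

lemma Den_eq: "Den E = CE.DA"
  using CE.DA_arr unfolding Den_def quasi_iso_iff by auto

lemma SDen_eq: "SDen E = CE.SA" and TDen_eq: "TDen E = CE.TD"
  by (simp_all add: SDen_def TDen_def Den_eq CE.SA_eq CE.TD_eq)

lemma SA_iff_cokernel: "i \<in> CE.SA \<longleftrightarrow> pure_mono CE i \<and> (\<exists>c. is_cokernel CE i c \<and> purely_acyclic E (Cod CE c))"
  and TD_iff_kernel: "p \<in> CE.TD \<longleftrightarrow> pure_epi CE p \<and> (\<exists>k. is_kernel CE p k \<and> purely_acyclic E (Dom CE k))"
proof -
  have "(i, c) \<in> Pure_Seq CE \<longleftrightarrow> pure_mono CE i \<and> is_cokernel CE i c" for i c
    using seq_CE_cokernel CE.seq_pure(2) CE.pure_seq_cokernel by blast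
  then show "i \<in> CE.SA \<longleftrightarrow> pure_mono CE i \<and> (\<exists>c. is_cokernel CE i c \<and> purely_acyclic E (Cod CE c))"
    unfolding CE.SA_def by blast
  have "(k, p) \<in> Pure_Seq CE \<longleftrightarrow> pure_epi CE p \<and> is_kernel CE p k" for k p
    using seq_CE_kernel CE.seq_pure(1) CE.pure_seq_kernel by blast
  then show "p \<in> CE.TD \<longleftrightarrow> pure_epi CE p \<and> (\<exists>k. is_kernel CE p k \<and> purely_acyclic E (Dom CE k))"
    unfolding CE.TD_def by blast
qed

lemma saturated_CE: "saturated CE CE.DA CE.SA CE.TD"
  unfolding saturated_def
proof (intro ballI impI)
  fix f assume f: "f \<in> Arr CE" "is_iso (Frac CE CE.DA CE.SA CE.TD) (loc CE CE.DA f)"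
  show "f \<in> CE.DA" using DA_if_LF_iso[OF _ CE.Frac_iso_imp_LF_iso[OF f]] f(1) by simp
qed

end

theorem mainTheorem5:
  fixes E :: "('o, 'm) exact_cat"
  assumes "exact_category E"
    and "idempotent_splitting E"
  shows "additive_uni_fractionable (complexes E) (Den E) (SDen E) (TDen E) \<and>
    saturated (complexes E) (Den E) (SDen E) (TDen E) \<and>
    SDen E = {i \<in> Arr (complexes E). pure_mono (complexes E) i \<and>
           (\<exists>c. is_cokernel (complexes E) i c \<and> purely_acyclic E (Cod (complexes E) c))} \<and>
    TDen E = {p \<in> Arr (complexes E). pure_epi (complexes E) p \<and>
           (\<exists>k. is_kernel (complexes E) p k \<and> purely_acyclic E (Dom (complexes E) k))} \<and>
    isomorphic_categories (derived_cat E) (Frac (complexes E) (Den E) (SDen E) (TDen E))"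
proof -
  \<comment> \<open>Idempotent splitting strengthens axiom c for \<open>E\<close> here, and it is
    retained as an assumption for the acyclicity of homotopy retracts.\<close>
  interpret acyclic_complexes_loc E
    using exact_loc.pure_category_if_idempotent_splitting[OF exact_loc.intro[OF assms(1)] assms(2)] assms(2)
    by unfold_locales
  show ?thesis
    unfolding Den_eq SDen_eq TDen_eq additive_uni_fractionable_def
  proof (intro conjI)
    show "CE.SA = {i \<in> Arr CE. pure_mono CE i \<and> (\<exists>c. is_cokernel CE i c \<and> purely_acyclic E (Cod CE c))}"
      using SA_iff_cokernel CE.pure_mono_arr by blast
    show "CE.TD = {p \<in> Arr CE. pure_epi CE p \<and> (\<exists>k. is_kernel CE p k \<and> purely_acyclic E (Dom CE k))}"
      using TD_iff_kernel CE.pure_epi_arr by blast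
  qed (rule CE.uni_fractionable additive_CE CE.sums_DA saturated_CE derived_cat_isomorphic)+
qed

end
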